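(* Let $\xi^1,\xi^2\in L^2(\Omega,\mathcal{F}_T,\mathbb{P},\mathbb{R})$, let $S^1,S^2\in\mathcal{S}^2([0,T],\mathbb{R})$ with $S^i_T\le\xi^i$ a.s. for $i=1,2$, and let $g$ satisfy $g(\cdot,0,0)\equiv 0$ and, for some constants $C>0$ and $0<\alpha<1$, $\|g(t,y_1,z_1)-g(t,y_2,z_2)\|^2\le C|y_1-y_2|^2+\alpha\|z_1-z_2\|^2$ for all $t\in[0,T]$ and $(y_1,z_1),(y_2,z_2)\in\mathbb{R}\times\mathbb{R}^d$. Assume that the RBDSDEs $(f^1,g,\xi^1,S^1)$ and $(f^2,g,\xi^2,S^2)$ have solutions $(Y^1,Z^1,K^1)$ and $(Y^2,Z^2,K^2)$, respectively. Assume moreover that: (i) $\xi^1\le\xi^2$ a.s.; (ii) $S^1_t\le S^2_t$ a.s., for all $t\in[0,T]$; (iii) either $f^1$ satisfies the Lipschitz condition (L) and $f^1(t,Y^2_t,Z^2_t)\le f^2(t,Y^2_t,Z^2_t)$ a.s. for a.e. $t\in[0,T]$, or $f^2$ satisfies the Lipschitz condition (L) and $f^1(t,Y^1_t,Z^1_t)\le f^2(t,Y^1_t,Z^1_t)$ a.s. for a.e. $t\in[0,T]$. Here a generator $f$ satisfies (L) if it is jointly measurable, $f(\cdot,0,0)\in\mathcal{M}^2(0,T,\mathbb{R})$, and there is a constant $C>0$ such that $|f(t,y_1,z_1)-f(t,y_2,z_2)|\le C(|y_1-y_2|+\|z_1-z_2\|)$ for all $t\in[0,T]$ and $(y_1,z_1),(y_2,z_2)\in\mathbb{R}\times\mathbb{R}^d$.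 Then $Y^1_t\le Y^2_t$ a.s., for all $t\in[0,T]$.
   Context: Fix $T>0$ and a probability space $(\Omega,\mathcal{F},\mathbb{P})$ carrying two mutually independent standard Brownian motions $W$ (with values in $\mathbb{R}^d$) and $B$ (with values in $\mathbb{R}^l$). Let $\mathcal{N}$ be the class of $\mathbb{P}$-null sets of $\mathcal{F}$. For a process $\eta$ and $0\le s\le t\le T$ put $\mathcal{F}^{\eta}_{s,t}=\sigma\{\eta_r-\eta_s;\ s\le r\le t\}\vee\mathcal{N}$, $\mathcal{F}^\eta_t=\mathcal{F}^\eta_{0,t}$, and let $\mathcal{F}_t=\mathcal{F}^W_t\vee\mathcal{F}^B_{t,T}$ for $t\in[0,T]$ (this family is not a filtration). $\mathcal{M}^2(0,T,\mathbb{R}^n)$ is the set of (classes of $d\mathbb{P}\otimes dt$-a.e. equal) $n$-dimensional jointly measurable processes $\varphi$ with $\mathbb{E}\int_0^T|\varphi_t|^2dt<\infty$ and $\varphi_t$ $\mathcal{F}_t$-measurable for a.e. $t\in[0,T]$. $\mathcal{S}^2([0,T],\mathbb{R}^n)$ is the set of continuous $n$-dimensional processes $\varphi$ with $\mathbb{E}(\sup_{0\le t\le T}|\varphi_t|^2)<\infty$ and $\varphi_t$ $\mathcal{F}_t$-measurable for every $t\in[0,T]$. The coefficients $f^1,f^2:\Omega\times[0,T]\times\mathbb{R}\times\mathbb{R}^d\to\mathbb{R}$ and $g:\Omega\times[0,T]\times\mathbb{R}\times\mathbb{R}^d\to\mathbb{R}^l$ are jointly measurable, with $g(t,y,z)$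 $\mathcal{F}_t$-measurable for each $(t,y,z)$ (the dependence on $\omega$ is suppressed). The reflected backward doubly stochastic differential equation RBDSDE $(f,g,\xi,S)$ is $$Y_t=\xi+\int_t^T f(s,Y_s,Z_s)\,ds+\int_t^T g(s,Y_s,Z_s)\,\overleftarrow{dB}_s+K_T-K_t-\int_t^T Z_s\,dW_s,\qquad 0\le t\le T,$$ where $dW$ is a standard forward Itô integral and $\overleftarrow{dB}$ a backward Itô integral. A solution is a triple of processes $(Y,Z,K)$ satisfying this equation such that: (i) $Y\in\mathcal{S}^2([0,T],\mathbb{R})$, $Z\in\mathcal{M}^2(0,T,\mathbb{R}^d)$, and $K$ is $\mathbb{R}_+$-valued and square integrable ($K_t\in L^2(\Omega,\mathbb{P},\mathbb{R}_+)$ for all $t$); (ii) $Y_t\ge S_t$ for all $t\in[0,T]$; (iii) $K$ is continuous and increasing (i.e. non-decreasing), $K_0=0$ and $\int_0^T(Y_t-S_t)\,dK_t=0$. *)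

theory Defs
  imports "HOL-Probability.Probability"
begin

text \<open>Processes are functions of time first and outcome second (\<open>X t \<omega>\<close>), random fields take the
  outcome first (\<open>f \<omega> t y z\<close>). Only times in \<open>{0..T}\<close> are ever constrained.\<close>

definition standard_BM :: "'w measure \<Rightarrow> real \<Rightarrow> (real \<Rightarrow> 'w \<Rightarrow> real ^ 'n) \<Rightarrow> bool" where
  "standard_BM M T W \<longleftrightarrow>
     (\<forall>t\<in>{0..T}. W t \<in> borel_measurable M) \<and>
     (AE \<omega> in M. W 0 \<omega> = 0) \<and>
     (AE \<omega> in M. continuous_on {0..T} (\<lambda>t. W t \<omega>)) \<and>
     (\<forall>s t i. 0 \<le> s \<and> s < t \<and> t \<le> T \<longrightarrow>
        distributed M lborel (\<lambda>\<omega>. W t \<omega> $ i - W s \<omega> $ i) (normal_density 0 (sqrt (t - s)))) \<and>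
     (\<forall>(n::nat) p. (\<forall>k\<le>n. p k \<in> {0..T}) \<and> (\<forall>k<n. p k \<le> p (Suc k)) \<longrightarrow>
        prob_space.indep_vars M (\<lambda>_. borel)
          (\<lambda>(k, i) \<omega>. W (p (Suc k)) \<omega> $ i - W (p k) \<omega> $ i) ({..<n} \<times> (UNIV :: 'n set)))"

text \<open>Sigma-algebras on \<open>space M\<close> are represented by measures, of which only \<open>space\<close> and \<open>sets\<close>
  matter. \<open>sigma_incr M X s t\<close> is \<open>\<sigma>{X\<^sub>r - X\<^sub>s; s \<le> r \<le> t} \<or> N\<close>.\<close>

definition sigma_incr ::
  "'w measure \<Rightarrow> (real \<Rightarrow> 'w \<Rightarrow> 'a::euclidean_space) \<Rightarrow> real \<Rightarrow> real \<Rightarrow> 'w measure" where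
  "sigma_incr M X s t = sigma (space M)
     ({(\<lambda>\<omega>. X r \<omega> - X s \<omega>) -` A \<inter> space M | r A. s \<le> r \<and> r \<le> t \<and> A \<in> sets borel} \<union> null_sets M)"

definition sigma_join :: "'w measure \<Rightarrow> 'w measure \<Rightarrow> 'w measure" where
  "sigma_join F G = sigma (space F) (sets F \<union> sets G)"

definition BM_pair ::
  "'w measure \<Rightarrow> real \<Rightarrow> (real \<Rightarrow> 'w \<Rightarrow> real ^ 'd) \<Rightarrow> (real \<Rightarrow> 'w \<Rightarrow> real ^ 'l) \<Rightarrow> bool" where
  "BM_pair M T W B \<longleftrightarrow> standard_BM M T W \<and> standard_BM M T B \<and>
     prob_space.indep_set M (sets (sigma_incr M W 0 T)) (sets (sigma_incr M B 0 T))"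

definition Ft ::
  "'w measure \<Rightarrow> real \<Rightarrow> (real \<Rightarrow> 'w \<Rightarrow> real ^ 'd) \<Rightarrow> (real \<Rightarrow> 'w \<Rightarrow> real ^ 'l) \<Rightarrow> real \<Rightarrow> 'w measure" where
  "Ft M T W B t = sigma_join (sigma_incr M W 0 t) (sigma_incr M B t T)"

text \<open>\<open>Ft\<close> is not monotone in \<open>t\<close>. It is contained in the increasing family \<open>Gt\<close>, for which \<open>W\<close>
  is still a Brownian motion, and in the decreasing family \<open>Ht\<close>, for which \<open>B\<close> is a
  Brownian motion run backward from \<open>T\<close>. The two stochastic integrals are taken with respect to
  these families.\<close>

definition Gt ::
  "'w measure \<Rightarrow> real \<Rightarrow> (real \<Rightarrow> 'w \<Rightarrow> real ^ 'd) \<Rightarrow> (real \<Rightarrow> 'w \<Rightarrow> real ^ 'l) \<Rightarrow> real \<Rightarrow> 'w measure" where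
  "Gt M T W B t = sigma_join (sigma_incr M W 0 t) (sigma_incr M B 0 T)"

definition Ht ::
  "'w measure \<Rightarrow> real \<Rightarrow> (real \<Rightarrow> 'w \<Rightarrow> real ^ 'd) \<Rightarrow> (real \<Rightarrow> 'w \<Rightarrow> real ^ 'l) \<Rightarrow> real \<Rightarrow> 'w measure" where
  "Ht M T W B t = sigma_join (sigma_incr M W 0 T) (sigma_incr M B t T)"

definition M2_space ::
  "'w measure \<Rightarrow> real \<Rightarrow> (real \<Rightarrow> 'w \<Rightarrow> real ^ 'd) \<Rightarrow> (real \<Rightarrow> 'w \<Rightarrow> real ^ 'l)
     \<Rightarrow> (real \<Rightarrow> 'w \<Rightarrow> 'a::euclidean_space) set" where
  "M2_space M T W B = {\<phi>.
     (\<lambda>(\<omega>, t). \<phi> t \<omega>) \<in> borel_measurable (M \<Otimes>\<^sub>M restrict_space borel {0..T}) \<and>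
     (\<integral>\<^sup>+\<omega>. (\<integral>\<^sup>+t\<in>{0..T}. ennreal ((norm (\<phi> t \<omega>))\<^sup>2) \<partial>lborel) \<partial>M) < \<infinity> \<and>
     (AE t in lborel. t \<in> {0..T} \<longrightarrow> \<phi> t \<in> borel_measurable (Ft M T W B t))}"

definition S2_space ::
  "'w measure \<Rightarrow> real \<Rightarrow> (real \<Rightarrow> 'w \<Rightarrow> real ^ 'd) \<Rightarrow> (real \<Rightarrow> 'w \<Rightarrow> real ^ 'l)
     \<Rightarrow> (real \<Rightarrow> 'w \<Rightarrow> 'a::euclidean_space) set" where
  "S2_space M T W B = {\<phi>.
     (AE \<omega> in M. continuous_on {0..T} (\<lambda>t. \<phi> t \<omega>)) \<and>
     (\<integral>\<^sup>+\<omega>. (SUP t\<in>{0..T}. ennreal ((norm (\<phi> t \<omega>))\<^sup>2)) \<partial>M) < \<infinity> \<and>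
     (\<forall>t\<in>{0..T}. \<phi> t \<in> borel_measurable (Ft M T W B t))}"

definition partition_of :: "real \<Rightarrow> real \<Rightarrow> nat \<Rightarrow> (nat \<Rightarrow> real) \<Rightarrow> bool" where
  "partition_of a b n p \<longleftrightarrow> p 0 = a \<and> p n = b \<and> (\<forall>i<n. p i \<le> p (Suc i))"

text \<open>Both Ito integrals over \<open>{a..b}\<close> are the \<open>L\<^sup>2(P)\<close>-limits of the elementary integrals of
  bounded step processes converging to \<open>\<phi>\<close> in \<open>L\<^sup>2(P \<otimes> dt)\<close>; they are determined up to
  a null set, hence the relational form. On the \<open>i\<close>-th interval \<open>{p i..p (Suc i)}\<close> the step
  process takes the value \<open>h i\<close>, which has to be measurable at the left end point for the forward
  and at the right end point for the backward integral. Measurability of \<open>\<phi>\<close> with respect to the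
  completion admits processes with almost surely continuous paths.\<close>

definition step_process ::
  "nat \<Rightarrow> (nat \<Rightarrow> real) \<Rightarrow> (nat \<Rightarrow> 'w \<Rightarrow> 'a::euclidean_space) \<Rightarrow> real \<Rightarrow> 'w \<Rightarrow> 'a" where
  "step_process n p h s \<omega> = (\<Sum>i<n. indicator {p i<..p (Suc i)} s *\<^sub>R h i \<omega>)"

definition elementary_integral ::
  "(real \<Rightarrow> 'w \<Rightarrow> 'a::euclidean_space) \<Rightarrow> nat \<Rightarrow> (nat \<Rightarrow> real) \<Rightarrow> (nat \<Rightarrow> 'w \<Rightarrow> 'a) \<Rightarrow> 'w \<Rightarrow> real" where
  "elementary_integral X n p h \<omega> = (\<Sum>i<n. h i \<omega> \<bullet> (X (p (Suc i)) \<omega> - X (p i) \<omega>))"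

definition L2_limit_of_elementary ::
  "'w measure \<Rightarrow> (nat \<Rightarrow> (nat \<Rightarrow> real) \<Rightarrow> (nat \<Rightarrow> 'w \<Rightarrow> 'a::euclidean_space) \<Rightarrow> bool)
     \<Rightarrow> (real \<Rightarrow> 'w \<Rightarrow> 'a) \<Rightarrow> real \<Rightarrow> real \<Rightarrow> (real \<Rightarrow> 'w \<Rightarrow> 'a) \<Rightarrow> ('w \<Rightarrow> real) \<Rightarrow> bool" where
  "L2_limit_of_elementary M adm X a b \<phi> I \<longleftrightarrow>
     (\<lambda>(\<omega>, s). \<phi> s \<omega>) \<in> borel_measurable (completion (M \<Otimes>\<^sub>M restrict_space lborel {a..b})) \<and>
     I \<in> borel_measurable M \<and>
     (\<exists>n p h. (\<forall>k. partition_of a b (n k) (p k) \<and>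
                   (\<forall>i<n k. \<exists>c. \<forall>\<omega>\<in>space M. norm (h k i \<omega>) \<le> c) \<and>
                   adm (n k) (p k) (h k)) \<and>
        (\<lambda>k. \<integral>\<^sup>+(\<omega>, s). ennreal ((norm (step_process (n k) (p k) (h k) s \<omega> - \<phi> s \<omega>))\<^sup>2)
               \<partial>(M \<Otimes>\<^sub>M restrict_space lborel {a..b})) \<longlonglongrightarrow> 0 \<and>
        (\<lambda>k. \<integral>\<^sup>+\<omega>. ennreal ((elementary_integral X (n k) (p k) (h k) \<omega> - I \<omega>)\<^sup>2) \<partial>M)
          \<longlonglongrightarrow> 0)"

definition has_forward_ito_integral ::
  "'w measure \<Rightarrow> (real \<Rightarrow> 'w measure) \<Rightarrow> (real \<Rightarrow> 'w \<Rightarrow> 'a::euclidean_space) \<Rightarrow> real \<Rightarrow> real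
     \<Rightarrow> (real \<Rightarrow> 'w \<Rightarrow> 'a) \<Rightarrow> ('w \<Rightarrow> real) \<Rightarrow> bool" where
  "has_forward_ito_integral M G X a b \<phi> I \<longleftrightarrow>
     L2_limit_of_elementary M (\<lambda>n p h. \<forall>i<n. h i \<in> borel_measurable (G (p i))) X a b \<phi> I"

definition has_backward_ito_integral ::
  "'w measure \<Rightarrow> (real \<Rightarrow> 'w measure) \<Rightarrow> (real \<Rightarrow> 'w \<Rightarrow> 'a::euclidean_space) \<Rightarrow> real \<Rightarrow> real
     \<Rightarrow> (real \<Rightarrow> 'w \<Rightarrow> 'a) \<Rightarrow> ('w \<Rightarrow> real) \<Rightarrow> bool" where
  "has_backward_ito_integral M H X a b \<phi> I \<longleftrightarrow>
     L2_limit_of_elementary M (\<lambda>n p h. \<forall>i<n. h i \<in> borel_measurable (H (p (Suc i)))) X a b \<phi> I"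

definition jointly_measurable ::
  "'w measure \<Rightarrow> real \<Rightarrow> ('w \<Rightarrow> real \<Rightarrow> real \<Rightarrow> real ^ 'd \<Rightarrow> 'a::euclidean_space) \<Rightarrow> bool" where
  "jointly_measurable M T f \<longleftrightarrow> (\<lambda>(\<omega>, t, y, z). f \<omega> t y z)
     \<in> borel_measurable (M \<Otimes>\<^sub>M restrict_space borel {0..T} \<Otimes>\<^sub>M borel \<Otimes>\<^sub>M borel)"

definition lipschitz_L ::
  "'w measure \<Rightarrow> real \<Rightarrow> (real \<Rightarrow> 'w \<Rightarrow> real ^ 'd) \<Rightarrow> (real \<Rightarrow> 'w \<Rightarrow> real ^ 'l)
     \<Rightarrow> ('w \<Rightarrow> real \<Rightarrow> real \<Rightarrow> real ^ 'd \<Rightarrow> real) \<Rightarrow> bool" where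
  "lipschitz_L M T W B f \<longleftrightarrow> jointly_measurable M T f \<and>
     (\<lambda>t \<omega>. f \<omega> t 0 0) \<in> M2_space M T W B \<and>
     (\<exists>C>0. AE \<omega> in M. \<forall>t\<in>{0..T}. \<forall>y1 y2 z1 z2.
        \<bar>f \<omega> t y1 z1 - f \<omega> t y2 z2\<bar> \<le> C * (\<bar>y1 - y2\<bar> + norm (z1 - z2)))"

text \<open>The pathwise measure \<open>dK\<close>: the path is frozen outside \<open>{0..T}\<close>, so that nothing is charged
  there. It is meaningful for paths that are non-decreasing and continuous on \<open>{0..T}\<close>.\<close>

definition dpath :: "real \<Rightarrow> (real \<Rightarrow> 'w \<Rightarrow> real) \<Rightarrow> 'w \<Rightarrow> real measure" where
  "dpath T K \<omega> = interval_measure (\<lambda>t. K (max 0 (min T t)) \<omega>)"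

text \<open>That the equation makes sense includes the pathwise integrability of the drift, which must be
  required explicitly because the Lebesgue integral is a total function.\<close>

definition rbdsde_solution ::
  "'w measure \<Rightarrow> real \<Rightarrow> (real \<Rightarrow> 'w \<Rightarrow> real ^ 'd) \<Rightarrow> (real \<Rightarrow> 'w \<Rightarrow> real ^ 'l)
     \<Rightarrow> ('w \<Rightarrow> real \<Rightarrow> real \<Rightarrow> real ^ 'd \<Rightarrow> real) \<Rightarrow> ('w \<Rightarrow> real \<Rightarrow> real \<Rightarrow> real ^ 'd \<Rightarrow> real ^ 'l)
     \<Rightarrow> ('w \<Rightarrow> real) \<Rightarrow> (real \<Rightarrow> 'w \<Rightarrow> real)
     \<Rightarrow> (real \<Rightarrow> 'w \<Rightarrow> real) \<Rightarrow> (real \<Rightarrow> 'w \<Rightarrow> real ^ 'd) \<Rightarrow> (real \<Rightarrow> 'w \<Rightarrow> real) \<Rightarrow> bool" where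
  "rbdsde_solution M T W B f g \<xi> S Y Z K \<longleftrightarrow>
     Y \<in> S2_space M T W B \<and> Z \<in> M2_space M T W B \<and>
     (\<forall>t\<in>{0..T}. K t \<in> borel_measurable M \<and> integrable M (\<lambda>\<omega>. (K t \<omega>)\<^sup>2)) \<and>
     (AE \<omega> in M. \<forall>t\<in>{0..T}. 0 \<le> K t \<omega>) \<and>
     (AE \<omega> in M. set_integrable lborel {0..T} (\<lambda>s. f \<omega> s (Y s \<omega>) (Z s \<omega>))) \<and>
     (\<forall>t\<in>{0..T}. \<exists>I J.
        has_backward_ito_integral M (Ht M T W B) B t T (\<lambda>s \<omega>. g \<omega> s (Y s \<omega>) (Z s \<omega>)) I \<and>
        has_forward_ito_integral M (Gt M T W B) W t T Z J \<and>
        (AE \<omega> in M. Y t \<omega> = \<xi> \<omega> + (LINT s:{t..T}|lborel. f \<omega> s (Y s \<omega>) (Z s \<omega>)) + I \<omega>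
                             + K T \<omega> - K t \<omega> - J \<omega>)) \<and>
     (AE \<omega> in M. \<forall>t\<in>{0..T}. S t \<omega> \<le> Y t \<omega>) \<and>
     (AE \<omega> in M. continuous_on {0..T} (\<lambda>t. K t \<omega>) \<and> mono_on {0..T} (\<lambda>t. K t \<omega>) \<and> K 0 \<omega> = 0 \<and>
        (LINT t:{0..T}|dpath T K \<omega>. Y t \<omega> - S t \<omega>) = 0)"

end

theory Submission
  imports Defs
begin

text \<open>Let \<open>X = Y1 - Y2\<close> and let \<open>\<psi>\<close> be a \<open>C\<^sup>2\<close> function that is positive exactly on \<open>(0, \<infinity>)\<close>, with
  \<open>\<psi>'' x = 2 min (max x 0) 1\<close>. The Ito formula for \<open>E (\<psi> (X t))\<close> is replaced by a discrete computation
  along uniform partitions: on each interval the increment of the backward integral is paired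
  with the right end point and that of the forward integral with the left end point, where they are
  centred and where the conditional Ito isometry holds, and the mixed products of the two increments
  cancel. The measure \<open>dK1\<close> contributes nothing in the limit because it only charges times with
  \<open>Y1 = S1 \<le> S2 \<le> Y2\<close>, and \<open>K2\<close> has the good sign. What remains is controlled by the Lipschitz
  conditions, \<open>\<alpha> < 1\<close> and the inequality between \<open>\<psi>'\<close>, \<open>\<psi>\<close> and \<open>\<psi>''\<close>; it gives a Gronwall inequality
  for \<open>E (\<psi> (X t))\<close>, which therefore vanishes.\<close>

section \<open>Independence of the increments of a Brownian motion\<close>

text \<open>Three obstacles shape the argument. \<open>Ft\<close> is not monotone, so no single end
  point of an interval serves both integrals; the expansion of the test function is therefore taken
  in trapezoidal form, which treats both ends alike and lets each increment be moved to its own end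
  at the cost of half a difference of first derivatives. The usual test function, the square of the
  positive part, has a jump in its second derivative, so its remainder is not controlled by the
  oscillation of the paths. Letting the second derivative rise linearly on [0, 1] makes it
  Lipschitz; freezing it beyond 1 keeps quadratic growth, which is what the integrability of the
  solutions pays for. Finally, the remainder carries the oscillation of X over the whole partition
  as a weight on the squared increments. This weight anticipates, so no isometry applies; it is
  removed by comparison with one fixed step process, whose increments have fourth moments of the
  order of the squared interval length. The drift outside the Lipschitz generator has no L^2 bound
  of its own: its integrability is recovered from the equation.\<close>

lemma borel_measurable_vec_lambda:
  fixes f :: "'i::finite \<Rightarrow> 'a \<Rightarrow> real"
  assumes "\<And>i. f i \<in> borel_measurable N"
  shows "(\<lambda>x. \<chi> i. f i x) \<in> borel_measurable N"
proof -
  have "(\<lambda>x. \<chi> i. f i x) = (\<lambda>x. \<Sum>i\<in>UNIV. f i x *\<^sub>R axis i (1::real))"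
    by (auto simp: fun_eq_iff vec_eq_iff axis_def if_distrib cong: if_cong)
  then show ?thesis
    using assms by simp
qed

section \<open>Sigma-algebras generated by increments, and their joins\<close>

lemma subalgebraI': "space F = space M \<Longrightarrow> sets F \<subseteq> sets M \<Longrightarrow> subalgebra M F"
  by (simp add: subalgebra_def)

lemma space_sigma_incr [simp]: "space (sigma_incr M X s t) = space M"
  by (simp add: sigma_incr_def space_measure_of_conv)

lemma sigma_incr_generators_subset:
  "{(\<lambda>\<omega>. X r \<omega> - X s \<omega>) -` A \<inter> space M | r A. s \<le> r \<and> r \<le> t \<and> A \<in> sets borel} \<union> null_sets M
     \<subseteq> Pow (space M)"
  using sets.sets_into_space[of _ M] by (auto simp: null_sets_def)

lemma sets_sigma_incr:
  "sets (sigma_incr M X s t) = sigma_sets (space M)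
     ({(\<lambda>\<omega>. X r \<omega> - X s \<omega>) -` A \<inter> space M | r A. s \<le> r \<and> r \<le> t \<and> A \<in> sets borel} \<union> null_sets M)"
  unfolding sigma_incr_def by (rule sets_measure_of) (rule sigma_incr_generators_subset)

lemma null_sets_subset_sigma_incr: "null_sets M \<subseteq> sets (sigma_incr M X s t)"
  unfolding sets_sigma_incr by (auto intro: sigma_sets.Basic)

lemma measurable_increment:
  assumes "s \<le> r" "r \<le> t"
  shows "(\<lambda>\<omega>. X r \<omega> - X s \<omega>) \<in> borel_measurable (sigma_incr M X s t)"
  by (rule measurableI) (use assms in \<open>auto simp: sets_sigma_incr intro!: sigma_sets.Basic\<close>)

lemma measurable_increment2:
  fixes X :: "real \<Rightarrow> 'w \<Rightarrow> 'a::euclidean_space"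
  assumes "s \<le> r" "r \<le> t" "s \<le> q" "q \<le> t"
  shows "(\<lambda>\<omega>. X r \<omega> - X q \<omega>) \<in> borel_measurable (sigma_incr M X s t)"
proof -
  have "(\<lambda>\<omega>. (X r \<omega> - X s \<omega>) - (X q \<omega> - X s \<omega>)) \<in> borel_measurable (sigma_incr M X s t)"
    by (intro borel_measurable_diff measurable_increment assms)
  then show ?thesis by simp
qed

lemma sets_sigma_incr_least:
  assumes "space F = space M" "null_sets M \<subseteq> sets F"
    and "\<And>r. s \<le> r \<Longrightarrow> r \<le> t \<Longrightarrow> (\<lambda>\<omega>. X r \<omega> - X s \<omega>) \<in> borel_measurable F"
  shows "sets (sigma_incr M X s t) \<subseteq> sets F"
  unfolding sets_sigma_incr
  by (subst assms(1)[symmetric], rule sets.sigma_sets_subset)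
     (use assms(2,3) in \<open>auto dest: measurable_sets simp: assms(1)[symmetric]\<close>)

lemma subalgebra_sigma_incr:
  fixes X :: "real \<Rightarrow> 'w \<Rightarrow> 'a::euclidean_space"
  assumes "\<And>r. s \<le> r \<Longrightarrow> r \<le> t \<Longrightarrow> X r \<in> borel_measurable M"
  shows "subalgebra M (sigma_incr M X s t)"
  by (rule subalgebraI', simp, rule sets_sigma_incr_least)
     (use assms in \<open>auto simp: null_sets_def intro!: borel_measurable_diff\<close>)

lemma sigma_incr_mono:
  fixes X :: "real \<Rightarrow> 'w \<Rightarrow> 'a::euclidean_space"
  assumes "s' \<le> s" "t \<le> t'"
  shows "sets (sigma_incr M X s t) \<subseteq> sets (sigma_incr M X s' t')"
  by (rule sets_sigma_incr_least)
     (use assms null_sets_subset_sigma_incr[of M X s' t'] in \<open>auto intro!: measurable_increment2\<close>)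

lemma space_sigma_join [simp]: "space (sigma_join F G) = space F"
  by (simp add: sigma_join_def space_measure_of_conv)

lemma sets_sigma_join:
  assumes "space F = space G"
  shows "sets (sigma_join F G) = sigma_sets (space F) (sets F \<union> sets G)"
  unfolding sigma_join_def
  by (rule sets_measure_of) (use assms sets.sets_into_space in blast)

lemma sets_sigma_join_least:
  assumes "space F = space N" "space G = space N" "sets F \<subseteq> sets N" "sets G \<subseteq> sets N"
  shows "sets (sigma_join F G) \<subseteq> sets N"
  using assms by (simp add: sets_sigma_join sets.sigma_sets_subset)

lemma sets_subset_sigma_join:
  assumes "space F = space G"
  shows "sets F \<subseteq> sets (sigma_join F G)" "sets G \<subseteq> sets (sigma_join F G)"
  using assms by (auto simp: sets_sigma_join intro: sigma_sets.Basic)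

lemma sigma_join_mono:
  assumes "space F = space G" "space F' = space F" "space G' = space F"
    and "sets F \<subseteq> sets F'" "sets G \<subseteq> sets G'"
  shows "sets (sigma_join F G) \<subseteq> sets (sigma_join F' G')"
  by (rule sets_sigma_join_least) (use assms sets_subset_sigma_join[of F' G'] in auto)

section \<open>Independence from joined sigma-algebras and of disjoint increments\<close>

lemma (in prob_space) indep_set_mono:
  assumes "indep_set A B" "A' \<subseteq> A" "B' \<subseteq> B"
  shows "indep_set A' B'"
  using indep_setD[OF assms(1)] indep_setD_ev1[OF assms(1)] indep_setD_ev2[OF assms(1)] assms(2,3)
  by (intro indep_setI) blast+

text \<open>The intersections of a set of \<open>F\<close> with a set of \<open>G\<close> form a
  pi-system generating the join, so the product formula has to be checked only there. Independence
  of the third family from \<open>F\<close> and from \<open>G\<close> separately would not give it,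
  which is why the hypothesis speaks of triple intersections.\<close>

lemma (in prob_space) indep_set_sigma_join:
  assumes FG: "subalgebra M F" "subalgebra M G"
    and indep: "\<And>A B D. A \<in> sets F \<Longrightarrow> B \<in> sets G \<Longrightarrow> D \<in> \<D> \<Longrightarrow> prob (A \<inter> B \<inter> D) = prob (A \<inter> B) * prob D"
    and D: "\<D> \<subseteq> events" "Int_stable \<D>"
  shows "indep_set (sets (sigma_join F G)) (sigma_sets (space M) \<D>)"
proof -
  have sp: "space F = space M" "space G = space M" "sets F \<subseteq> events" "sets G \<subseteq> events"
    using FG by (auto simp: subalgebra_def)
  let ?G = "{A \<inter> B | A B. A \<in> sets F \<and> B \<in> sets G}"
  have "indep_set (sigma_sets (space M) ?G) (sigma_sets (space M) \<D>)"
  proof (rule indep_set_sigma_sets)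
    show "indep_set ?G \<D>"
      by (rule indep_setI) (use sp D indep in auto)
    show "Int_stable ?G"
    proof (rule Int_stableI)
      fix a b assume "a \<in> ?G" "b \<in> ?G"
      then obtain A B A' B' where "a = A \<inter> B" "b = A' \<inter> B'" "A \<in> sets F" "A' \<in> sets F"
        "B \<in> sets G" "B' \<in> sets G" by auto
      then have "a \<inter> b = (A \<inter> A') \<inter> (B \<inter> B')" "A \<inter> A' \<in> sets F" "B \<inter> B' \<in> sets G" by auto
      then show "a \<inter> b \<in> ?G" by blast
    qed
  qed fact
  moreover have "sets (sigma_join F G) \<subseteq> sigma_sets (space M) ?G"
  proof -
    have "sets F \<union> sets G \<subseteq> ?G"
    proof
      fix x assume "x \<in> sets F \<union> sets G"
      then show "x \<in> ?G"
      proof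
        assume "x \<in> sets F"
        then have "x = x \<inter> space M" "space M \<in> sets G" using sp sets.sets_into_space by (metis inf.orderE) (metis sp(2) sets.top)
        then show ?thesis using \<open>x \<in> sets F\<close> by blast
      next
        assume "x \<in> sets G"
        then have "x = space M \<inter> x" "space M \<in> sets F" using sp sets.sets_into_space by (metis inf.absorb2) (metis sp(1) sets.top)
        then show ?thesis using \<open>x \<in> sets G\<close> by blast
      qed
    qed
    then show ?thesis
      using sp by (simp add: sets_sigma_join sigma_sets_mono')
  qed
  ultimately show ?thesis
    by (rule indep_set_mono) simp
qed

text \<open>The grid points are enumerated so that both increments are sums over disjoint index sets of
  the independent family in the definition of a Brownian motion.\<close>

lemma (in prob_space) standard_BM_indep_increments:
  fixes X :: "real \<Rightarrow> 'a \<Rightarrow> real ^ 'n"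
  assumes BM: "standard_BM M T X" and R: "finite R" "R \<subseteq> {a..b}"
    and ab: "0 \<le> a" "a \<le> b" "b \<le> T" and st: "0 \<le> s" "s \<le> t" "t \<le> T" and disj: "b \<le> s \<or> t \<le> a"
    and A: "\<And>r. r \<in> R \<Longrightarrow> A r \<in> sets borel" and D: "D \<in> sets borel"
  shows "prob ({\<omega>\<in>space M. \<forall>r\<in>R. X r \<omega> - X a \<omega> \<in> A r} \<inter> ((\<lambda>\<omega>. X t \<omega> - X s \<omega>) -` D \<inter> space M))
     = prob {\<omega>\<in>space M. \<forall>r\<in>R. X r \<omega> - X a \<omega> \<in> A r} * prob ((\<lambda>\<omega>. X t \<omega> - X s \<omega>) -` D \<inter> space M)"
proof -
  define P where "P = R \<union> {a, s, t}"
  define l where "l = sorted_list_of_set P"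
  define n where "n = length l - 1"
  define p where "p k = l ! k" for k
  have finP: "finite P" and Psub: "P \<subseteq> {0..T}" using R ab st by (auto simp: P_def)
  have "card P \<noteq> 0" using finP by (auto simp: P_def)
  moreover have "length l = card P" by (simp add: l_def)
  ultimately have len: "length l = Suc n" unfolding n_def by linarith
  have setl: "set l = P" and strict: "sorted_wrt (<) l"
    using finP by (simp_all add: l_def)
  have pmono: "p i < p j \<longleftrightarrow> i < j" "p i \<le> p j \<longleftrightarrow> i \<le> j" if "i \<le> n" "j \<le> n" for i j
  proof -
    have lt: "p i < p j" if "i < j" "j \<le> n" for i j
      using that strict len by (auto simp: p_def sorted_wrt_iff_nth_less)
    show "p i < p j \<longleftrightarrow> i < j" "p i \<le> p j \<longleftrightarrow> i \<le> j"
      using lt[of i j] lt[of j i] that by (cases i j rule: linorder_cases; auto)+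
  qed
  define Y where "Y = (\<lambda>(k::nat, i) \<omega>. X (p (Suc k)) \<omega> $ i - X (p k) \<omega> $ i)"
  have "p k \<in> {0..T}" if "k \<le> n" for k
  proof -
    have "p k \<in> set l" using that len by (simp add: p_def)
    then show ?thesis using Psub setl by blast
  qed
  moreover have "p k \<le> p (Suc k)" if "k < n" for k
    using pmono(2)[of k "Suc k"] that by simp
  ultimately have ind: "indep_vars (\<lambda>_. borel) Y ({..<n} \<times> UNIV)"
    using BM unfolding standard_BM_def Y_def by simp
  have tele: "X d \<omega> $ i - X c \<omega> $ i = (\<Sum>k\<in>{k\<in>{..<n}. c \<le> p k \<and> p (Suc k) \<le> d}. Y (k, i) \<omega>)"
    if cd: "c \<in> P" "d \<in> P" "c \<le> d" for c d \<omega> i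
  proof -
    have "\<exists>j\<le>n. x = p j" if "x \<in> P" for x
    proof -
      have "x \<in> set l" using that setl by simp
      then obtain j where "j < length l" "x = l ! j" by (auto simp: in_set_conv_nth)
      then show ?thesis using len by (auto simp: p_def intro!: exI[of _ j])
    qed
    from this[OF cd(1)] this[OF cd(2)] obtain j k where jk: "c = p j" "d = p k" "j \<le> n" "k \<le> n"
      by blast
    have "j \<le> k" using jk that pmono by auto
    have "{k\<in>{..<n}. c \<le> p k \<and> p (Suc k) \<le> d} = {j..<k}"
      using jk pmono by (auto simp: Suc_le_eq)
    moreover have "(\<Sum>k\<in>{j..<k}. Y (k, i) \<omega>) = X d \<omega> $ i - X c \<omega> $ i"
      using \<open>j \<le> k\<close> by (simp add: Y_def jk sum_Suc_diff'[of j k "\<lambda>m. X (p m) \<omega> $ i"])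
    ultimately show ?thesis by simp
  qed
  define U where "U = {k\<in>{..<n}. a \<le> p k \<and> p (Suc k) \<le> b}"
  define V where "V = {k\<in>{..<n}. s \<le> p k \<and> p (Suc k) \<le> t}"
  \<comment> \<open>An index in both sets would give a grid interval inside {a..b} and inside
    {s..t}; these meet in at most one point, whereas consecutive grid points are distinct.\<close>
  have "U \<inter> V = {}"
  proof -
    have False if "k < n" "a \<le> p k" "p (Suc k) \<le> b" "s \<le> p k" "p (Suc k) \<le> t" for k
      using disj that pmono(1)[of k "Suc k"] by auto
    then show ?thesis by (auto simp: U_def V_def)
  qed
  then have iv: "indep_var (PiM (U \<times> UNIV) (\<lambda>_. borel)) (\<lambda>\<omega>. restrict (\<lambda>i. Y i \<omega>) (U \<times> UNIV))
      (PiM (V \<times> UNIV) (\<lambda>_. borel)) (\<lambda>\<omega>. restrict (\<lambda>i. Y i \<omega>) (V \<times> UNIV))"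
    by (intro indep_var_restrict[OF ind]) (auto simp: U_def V_def)
  define gr where "gr r x = (\<chi> i. \<Sum>k\<in>{k\<in>U. p (Suc k) \<le> r}. x (k, i))" for r :: real and x :: "nat \<times> 'n \<Rightarrow> real"
  define gt where "gt x = (\<chi> i. \<Sum>k\<in>V. x (k, i))" for x :: "nat \<times> 'n \<Rightarrow> real"
  have gr_m: "gr r \<in> borel_measurable (PiM (U \<times> UNIV) (\<lambda>_. borel))" for r
    unfolding gr_def by (intro borel_measurable_vec_lambda borel_measurable_sum measurable_component_singleton) auto
  have gt_m: "gt \<in> borel_measurable (PiM (V \<times> UNIV) (\<lambda>_. borel))"
    unfolding gt_def by (intro borel_measurable_vec_lambda borel_measurable_sum measurable_component_singleton) auto
  have gr_eq: "gr r (restrict (\<lambda>i. Y i \<omega>) (U \<times> UNIV)) = X r \<omega> - X a \<omega>" if "r \<in> R" for r \<omega>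
  proof -
    have *: "{k\<in>U. p (Suc k) \<le> r} = {k\<in>{..<n}. a \<le> p k \<and> p (Suc k) \<le> r}"
      using that R by (auto simp: U_def)
    have cd: "a \<in> P" "r \<in> P" "a \<le> r" using that R by (auto simp: P_def)
    have "(\<Sum>k\<in>{k\<in>U. p (Suc k) \<le> r}. restrict (\<lambda>i. Y i \<omega>) (U \<times> UNIV) (k, i)) = X r \<omega> $ i - X a \<omega> $ i" for i
      unfolding tele[OF cd] *[symmetric] by (rule sum.cong) auto
    then show ?thesis by (simp add: gr_def vec_eq_iff)
  qed
  have gt_eq: "gt (restrict (\<lambda>i. Y i \<omega>) (V \<times> UNIV)) = X t \<omega> - X s \<omega>" for \<omega>
  proof -
    have cd: "s \<in> P" "t \<in> P" "s \<le> t" using st by (auto simp: P_def)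
    have "(\<Sum>k\<in>V. restrict (\<lambda>i. Y i \<omega>) (V \<times> UNIV) (k, i)) = X t \<omega> $ i - X s \<omega> $ i" for i
      unfolding tele[OF cd] V_def[symmetric] by (rule sum.cong) auto
    then show ?thesis by (simp add: gt_def vec_eq_iff)
  qed
  let ?EA = "{x\<in>space (PiM (U \<times> UNIV) (\<lambda>_. borel)). \<forall>r\<in>R. gr r x \<in> A r}"
  let ?EB = "gt -` D \<inter> space (PiM (V \<times> UNIV) (\<lambda>_. borel))"
  have EA: "?EA \<in> sets (PiM (U \<times> UNIV) (\<lambda>_. borel))"
  proof (rule sets.sets_Collect_finite_All[OF _ R(1)])
    fix r assume "r \<in> R"
    then show "{x \<in> space (PiM (U \<times> UNIV) (\<lambda>_. borel)). gr r x \<in> A r} \<in> sets (PiM (U \<times> UNIV) (\<lambda>_. borel))"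
      using measurable_sets[OF gr_m A] by (simp add: vimage_def Int_def conj_commute)
  qed
  have EB: "?EB \<in> sets (PiM (V \<times> UNIV) (\<lambda>_. borel))"
    using measurable_sets[OF gt_m D] .
  have 1: "(\<lambda>\<omega>. restrict (\<lambda>i. Y i \<omega>) (U \<times> UNIV)) -` ?EA \<inter> space M
      = {\<omega>\<in>space M. \<forall>r\<in>R. X r \<omega> - X a \<omega> \<in> A r}"
    by (auto simp: gr_eq space_PiM)
  have 2: "(\<lambda>\<omega>. restrict (\<lambda>i. Y i \<omega>) (V \<times> UNIV)) -` ?EB \<inter> space M
      = (\<lambda>\<omega>. X t \<omega> - X s \<omega>) -` D \<inter> space M"
    by (auto simp: gt_eq space_PiM)
  have 3: "(\<lambda>x. (restrict (\<lambda>i. Y i x) (U \<times> UNIV), restrict (\<lambda>i. Y i x) (V \<times> UNIV))) -` (?EA \<times> ?EB) \<inter> space M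
     = {\<omega>\<in>space M. \<forall>r\<in>R. X r \<omega> - X a \<omega> \<in> A r} \<inter> ((\<lambda>\<omega>. X t \<omega> - X s \<omega>) -` D \<inter> space M)"
    using 1 2 by blast
  show ?thesis
    using indep_varD[OF iv EA EB] unfolding 1 2 3 .
qed

text \<open>The preimages are kept as a family instead of being closed to a sigma-algebra, because
  the pi-system argument for independence works with this intersection-stable generator.\<close>

definition vimages :: "'w measure \<Rightarrow> ('w \<Rightarrow> 'a::topological_space) \<Rightarrow> 'w set set" where
  "vimages M f = {f -` D \<inter> space M | D. D \<in> sets borel}"

lemma Int_stable_vimages: "Int_stable (vimages M f)"
proof (rule Int_stableI)
  fix a b assume "a \<in> vimages M f" "b \<in> vimages M f"
  then obtain D E where "a = f -` D \<inter> space M" "b = f -` E \<inter> space M" "D \<in> sets borel" "E \<in> sets borel"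
    by (auto simp: vimages_def)
  then show "a \<inter> b \<in> vimages M f"
    by (auto simp: vimages_def intro!: exI[of _ "D \<inter> E"])
qed

lemma vimages_subset: "f \<in> borel_measurable M \<Longrightarrow> vimages M f \<subseteq> sets M"
  by (auto simp: vimages_def)

text \<open>The finite-dimensional events of the increments from \<open>a\<close>, together with the
  null sets, form a pi-system generating the completed sigma-algebra. On the former the product
  formula is \<open>standard_BM_indep_increments\<close>; on the latter both sides vanish.\<close>

lemma (in prob_space) standard_BM_indep_set:
  fixes X :: "real \<Rightarrow> 'a \<Rightarrow> real ^ 'n"
  assumes BM: "standard_BM M T X" 
    and ab: "0 \<le> a" "a \<le> b" "b \<le> T" and st: "0 \<le> s" "s \<le> t" "t \<le> T" and disj: "b \<le> s \<or> t \<le> a"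
  shows "indep_set (sets (sigma_incr M X a b)) (sigma_sets (space M) (vimages M (\<lambda>\<omega>. X t \<omega> - X s \<omega>)))"
proof -
  have Xm: "X r \<in> borel_measurable M" if "0 \<le> r" "r \<le> T" for r
    using BM that by (auto simp: standard_BM_def)
  define \<P> where "\<P> = {{\<omega>\<in>space M. \<forall>r\<in>R. X r \<omega> - X a \<omega> \<in> A r} | R A. finite R \<and> R \<subseteq> {a..b} \<and> (\<forall>r\<in>R. A r \<in> sets borel)}"
  have Pev: "\<P> \<subseteq> events"
  proof (clarsimp simp: \<P>_def)
    fix R :: "real set" and A :: "real \<Rightarrow> (real^'n) set"
    assume R: "finite R" "R \<subseteq> {a..b}" "\<forall>r\<in>R. A r \<in> sets borel"
    show "{\<omega> \<in> space M. \<forall>r\<in>R. X r \<omega> - X a \<omega> \<in> A r} \<in> events"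
    proof (rule sets.sets_Collect_finite_All[OF _ R(1)])
      fix r assume "r \<in> R"
      then have "(\<lambda>\<omega>. X r \<omega> - X a \<omega>) \<in> borel_measurable M"
        using R ab by (auto intro!: borel_measurable_diff Xm)
      from measurable_sets[OF this, of "A r"] show "{\<omega> \<in> space M. X r \<omega> - X a \<omega> \<in> A r} \<in> events"
        using R \<open>r \<in> R\<close> by (simp add: vimage_def Int_def conj_commute)
    qed
  qed
  have "indep_set (sigma_sets (space M) (\<P> \<union> null_sets M)) (sigma_sets (space M) (vimages M (\<lambda>\<omega>. X t \<omega> - X s \<omega>)))"
  proof (rule indep_set_sigma_sets)
    show "indep_set (\<P> \<union> null_sets M) (vimages M (\<lambda>\<omega>. X t \<omega> - X s \<omega>))"
    proof (rule indep_setI)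
      show "\<P> \<union> null_sets M \<subseteq> events" using Pev by auto
      show V: "vimages M (\<lambda>\<omega>. X t \<omega> - X s \<omega>) \<subseteq> events"
        using st by (intro vimages_subset borel_measurable_diff Xm) auto
      fix x y assume x: "x \<in> \<P> \<union> null_sets M" and y: "y \<in> vimages M (\<lambda>\<omega>. X t \<omega> - X s \<omega>)"
      from x show "prob (x \<inter> y) = prob x * prob y"
      proof
        assume "x \<in> \<P>"
        then show ?thesis
          using y standard_BM_indep_increments[OF BM _ _ ab st disj]
          by (auto simp: \<P>_def vimages_def)
      next
        assume "x \<in> null_sets M"
        moreover from this have "x \<inter> y \<in> null_sets M" using y V by (intro null_set_Int2) auto
        ultimately show ?thesis by (simp add: measure_eq_0_null_sets)
      qed
    qed
    show "Int_stable (\<P> \<union> null_sets M)"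
    proof (rule Int_stableI)
      fix x y assume xy: "x \<in> \<P> \<union> null_sets M" "y \<in> \<P> \<union> null_sets M"
      show "x \<inter> y \<in> \<P> \<union> null_sets M"
      proof (cases "x \<in> null_sets M \<or> y \<in> null_sets M")
        case True
        then show ?thesis
          using xy Pev null_set_Int1[of x M y] null_set_Int1[of y M x] by (auto simp: Int_commute)
      next
        case False
        with xy obtain R A R' A' where *: "x = {\<omega>\<in>space M. \<forall>r\<in>R. X r \<omega> - X a \<omega> \<in> A r}"
          "finite R" "R \<subseteq> {a..b}" "\<forall>r\<in>R. A r \<in> sets borel"
          "y = {\<omega>\<in>space M. \<forall>r\<in>R'. X r \<omega> - X a \<omega> \<in> A' r}"
          "finite R'" "R' \<subseteq> {a..b}" "\<forall>r\<in>R'. A' r \<in> sets borel" by (auto simp: \<P>_def)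
        \<comment> \<open>A time constrained by only one of the two events receives the trivial
          constraint \<open>UNIV\<close> from the other, so both events become one family of
          constraints over R \<union> R'.\<close>
        let ?A = "\<lambda>r. (if r \<in> R then A r else UNIV) \<inter> (if r \<in> R' then A' r else UNIV)"
        have "x \<inter> y = {\<omega>\<in>space M. \<forall>r\<in>R\<union>R'. X r \<omega> - X a \<omega> \<in> ?A r}"
          using * by (auto split: if_splits)
        moreover have "finite (R \<union> R')" "R \<union> R' \<subseteq> {a..b}" "\<forall>r\<in>R \<union> R'. ?A r \<in> sets borel"
          using * by auto
        ultimately have "x \<inter> y \<in> \<P>"
          unfolding \<P>_def by (intro CollectI exI[of _ "R \<union> R'"] exI[of _ ?A] conjI)
        then show ?thesis by simp
      qed
    qed
  qed (rule Int_stable_vimages)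
  moreover have "sets (sigma_incr M X a b) \<subseteq> sigma_sets (space M) (\<P> \<union> null_sets M)"
    unfolding sets_sigma_incr
  proof (rule sigma_sets_mono', clarsimp)
    fix r A assume "a \<le> r" "r \<le> b" "A \<in> sets (borel :: (real^'n) measure)"
      "(\<lambda>\<omega>. X r \<omega> - X a \<omega>) -` A \<inter> space M \<notin> null_sets M"
    then show "(\<lambda>\<omega>. X r \<omega> - X a \<omega>) -` A \<inter> space M \<in> \<P>"
      unfolding \<P>_def by (intro CollectI exI[of _ "{r}"] exI[of _ "\<lambda>_. A"]) auto
  qed
  ultimately show ?thesis
    by (rule indep_set_mono) simp
qed

section \<open>Moments of the increments\<close>

text \<open>Mere integrability is asked of u, so that it may later be the product of an L^2 variable
  with a bounded coordinate of an integrand.\<close>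

lemma (in prob_space) indep_lebesgue_integral:
  fixes u :: "'a \<Rightarrow> real" and \<Delta> :: "'a \<Rightarrow> 'b::euclidean_space" and f :: "'b \<Rightarrow> real"
  assumes F: "subalgebra M F" and \<Delta>: "\<Delta> \<in> borel_measurable M"
    and indep: "indep_set (sets F) (sigma_sets (space M) (vimages M \<Delta>))"
    and u: "u \<in> borel_measurable F" "integrable M u"
    and f: "f \<in> borel_measurable borel" "integrable M (\<lambda>\<omega>. f (\<Delta> \<omega>))"
  shows "integrable M (\<lambda>\<omega>. u \<omega> * f (\<Delta> \<omega>))"
    and "(\<integral>\<omega>. u \<omega> * f (\<Delta> \<omega>) \<partial>M) = (\<integral>\<omega>. u \<omega> \<partial>M) * (\<integral>\<omega>. f (\<Delta> \<omega>) \<partial>M)"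
proof -
  have sp: "space F = space M" using F by (simp add: subalgebra_def)
  have "indep_var borel u borel (\<lambda>\<omega>. f (\<Delta> \<omega>))"
    unfolding indep_var_eq
  proof (intro conjI)
    show "random_variable borel u" "random_variable borel (\<lambda>\<omega>. f (\<Delta> \<omega>))"
      using measurable_from_subalg[OF F u(1)] f(1) \<Delta> by auto
    show "indep_set (sigma_sets (space M) {u -` A \<inter> space M |A. A \<in> sets borel})
     (sigma_sets (space M) {(\<lambda>\<omega>. f (\<Delta> \<omega>)) -` A \<inter> space M |A. A \<in> sets borel})"
    proof (rule indep_set_mono[OF indep])
      show "sigma_sets (space M) {u -` A \<inter> space M |A. A \<in> sets borel} \<subseteq> sets F"
        unfolding sp[symmetric] by (rule sets.sigma_sets_subset) (use measurable_sets[OF u(1)] in auto)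
      have "(\<lambda>\<omega>. f (\<Delta> \<omega>)) -` A \<inter> space M \<in> vimages M \<Delta>" if "A \<in> sets borel" for A
        using measurable_sets[OF f(1) that] by (auto simp: vimages_def intro!: exI[of _ "f -` A"])
      then show "sigma_sets (space M) {(\<lambda>\<omega>. f (\<Delta> \<omega>)) -` A \<inter> space M |A. A \<in> sets borel}
        \<subseteq> sigma_sets (space M) (vimages M \<Delta>)"
        by (intro sigma_sets_mono') auto
    qed
  qed
  then show "integrable M (\<lambda>\<omega>. u \<omega> * f (\<Delta> \<omega>))"
     "(\<integral>\<omega>. u \<omega> * f (\<Delta> \<omega>) \<partial>M) = (\<integral>\<omega>. u \<omega> \<partial>M) * (\<integral>\<omega>. f (\<Delta> \<omega>) \<partial>M)"
    using u f by (auto intro: indep_var_lebesgue_integral indep_var_integrable)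
qed

lemma integrable_mult_square:
  fixes u v :: "'a \<Rightarrow> real"
  assumes "u \<in> borel_measurable M" "v \<in> borel_measurable M"
    and "integrable M (\<lambda>x. (u x)\<^sup>2)" "integrable M (\<lambda>x. (v x)\<^sup>2)"
  shows "integrable M (\<lambda>x. u x * v x)"
proof (rule Bochner_Integration.integrable_bound[where f="\<lambda>x. (u x)\<^sup>2 + (v x)\<^sup>2"])
  show "AE x in M. norm (u x * v x) \<le> norm ((u x)\<^sup>2 + (v x)\<^sup>2)"
  proof (rule AE_I2)
    fix x
    have "2 * \<bar>u x * v x\<bar> \<le> (u x)\<^sup>2 + (v x)\<^sup>2"
      using sum_squares_bound[of "\<bar>u x\<bar>" "\<bar>v x\<bar>"] by (simp add: abs_mult)
    then show "norm (u x * v x) \<le> norm ((u x)\<^sup>2 + (v x)\<^sup>2)" by simp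
  qed
qed (use assms in auto)

lemma (in prob_space) integrable_of_square:
  fixes u :: "'a \<Rightarrow> real"
  assumes "u \<in> borel_measurable M" "integrable M (\<lambda>x. (u x)\<^sup>2)"
  shows "integrable M u"
  using integrable_mult_square[of u M "\<lambda>_. 1"] assms by simp

lemma integrable_mult_bounded:
  fixes u v :: "'a \<Rightarrow> real"
  assumes "integrable M u" "v \<in> borel_measurable M" "\<And>x. x \<in> space M \<Longrightarrow> \<bar>v x\<bar> \<le> c"
  shows "integrable M (\<lambda>x. u x * v x)"
proof (rule Bochner_Integration.integrable_bound[where f="\<lambda>x. c * u x"])
  show "AE x in M. norm (u x * v x) \<le> norm (c * u x)"
  proof (rule AE_I2)
    fix x assume "x \<in> space M"
    then have "\<bar>v x\<bar> \<le> \<bar>c\<bar>" using assms(3)[of x] by linarith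
    then have "\<bar>u x\<bar> * \<bar>v x\<bar> \<le> \<bar>u x\<bar> * \<bar>c\<bar>" by (intro mult_left_mono) auto
    then show "norm (u x * v x) \<le> norm (c * u x)" by (simp add: abs_mult mult.commute)
  qed
qed (use assms in auto)

definition bounded_measurable :: "'w measure \<Rightarrow> ('w \<Rightarrow> 'a::euclidean_space) \<Rightarrow> bool" where
  "bounded_measurable F h \<longleftrightarrow> h \<in> borel_measurable F \<and> (\<exists>c. \<forall>\<omega>\<in>space F. norm (h \<omega>) \<le> c)"

text \<open>Expanding the inner products in the basis reduces everything to coordinates, where the
  moments of the increment factor out. This is the conditional form of centring and of the Ito
  isometry on one interval; the second claim is polarised because overlapping steps will carry
  different integrands.\<close>

lemma (in prob_space) indep_increment_moments:
  fixes \<Delta> :: "'a \<Rightarrow> 'b::euclidean_space" and \<eta> :: "'a \<Rightarrow> real"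
  assumes F: "subalgebra M F" and \<Delta>: "\<Delta> \<in> borel_measurable M"
    and indep: "indep_set (sets F) (sigma_sets (space M) (vimages M \<Delta>))"
    and sq: "\<And>i. i \<in> Basis \<Longrightarrow> integrable M (\<lambda>\<omega>. (\<Delta> \<omega> \<bullet> i)\<^sup>2)"
    and mean: "\<And>i. i \<in> Basis \<Longrightarrow> (\<integral>\<omega>. \<Delta> \<omega> \<bullet> i \<partial>M) = 0"
    and cov: "\<And>i j. i \<in> Basis \<Longrightarrow> j \<in> Basis \<Longrightarrow> (\<integral>\<omega>. (\<Delta> \<omega> \<bullet> i) * (\<Delta> \<omega> \<bullet> j) \<partial>M) = (if i = j then v else 0)"
    and h: "bounded_measurable F h" and k: "bounded_measurable F k"
    and \<eta>: "\<eta> \<in> borel_measurable F" "integrable M (\<lambda>\<omega>. (\<eta> \<omega>)\<^sup>2)"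
  shows "(\<integral>\<omega>. \<eta> \<omega> * (h \<omega> \<bullet> \<Delta> \<omega>) \<partial>M) = 0"
    and "(\<integral>\<omega>. (h \<omega> \<bullet> \<Delta> \<omega>) * (k \<omega> \<bullet> \<Delta> \<omega>) \<partial>M) = v * (\<integral>\<omega>. h \<omega> \<bullet> k \<omega> \<partial>M)"
proof -
  have sp: "space F = space M" using F by (simp add: subalgebra_def)
  obtain c where c: "\<And>\<omega>. \<omega> \<in> space M \<Longrightarrow> norm (h \<omega>) \<le> c"
    using h by (auto simp: bounded_measurable_def sp)
  obtain c' where c': "\<And>\<omega>. \<omega> \<in> space M \<Longrightarrow> norm (k \<omega>) \<le> c'"
    using k by (auto simp: bounded_measurable_def sp)
  have hF: "h \<in> borel_measurable F" "k \<in> borel_measurable F"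
    using h k by (auto simp: bounded_measurable_def)
  note toM = measurable_from_subalg[OF F]
  have [measurable]: "h \<in> borel_measurable M" "k \<in> borel_measurable M" "\<eta> \<in> borel_measurable M"
    using hF \<eta> toM by auto
  note [measurable] = \<Delta>
  have int1: "integrable M (\<lambda>\<omega>. \<Delta> \<omega> \<bullet> i)" if "i \<in> Basis" for i
    by (rule integrable_of_square) (use sq that in auto)
  have int2: "integrable M (\<lambda>\<omega>. (\<Delta> \<omega> \<bullet> i) * (\<Delta> \<omega> \<bullet> j))" if "i \<in> Basis" "j \<in> Basis" for i j
    by (rule integrable_mult_square) (use sq that in auto)
  have \<eta>int: "integrable M \<eta>"
    by (rule integrable_of_square) (use \<eta> toM in auto)
  have bnd: "\<bar>h \<omega> \<bullet> i\<bar> \<le> c" "\<bar>k \<omega> \<bullet> i\<bar> \<le> c'" if "i \<in> Basis" "\<omega> \<in> space M" for i \<omega>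
    using c[of \<omega>] c'[of \<omega>] that Basis_le_norm order_trans by blast+
  have A: "integrable M (\<lambda>\<omega>. \<eta> \<omega> * (h \<omega> \<bullet> i))" if "i \<in> Basis" for i
    by (rule integrable_mult_bounded[OF \<eta>int, of _ c]) (use bnd that in auto)
  have B: "integrable M (\<lambda>\<omega>. \<eta> \<omega> * (h \<omega> \<bullet> i) * (\<Delta> \<omega> \<bullet> i))"
     "(\<integral>\<omega>. \<eta> \<omega> * (h \<omega> \<bullet> i) * (\<Delta> \<omega> \<bullet> i) \<partial>M) = 0" if "i \<in> Basis" for i
    using indep_lebesgue_integral[OF F \<Delta> indep _ A[OF that], of "\<lambda>x. x \<bullet> i"] \<eta>(1) hF(1) int1[OF that] mean[OF that]
    by auto
  have "(\<integral>\<omega>. \<eta> \<omega> * (h \<omega> \<bullet> \<Delta> \<omega>) \<partial>M) = (\<integral>\<omega>. (\<Sum>i\<in>Basis. \<eta> \<omega> * (h \<omega> \<bullet> i) * (\<Delta> \<omega> \<bullet> i)) \<partial>M)"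
    by (subst euclidean_inner) (simp add: sum_distrib_left mult.assoc)
  also have "\<dots> = (\<Sum>i\<in>Basis. (\<integral>\<omega>. \<eta> \<omega> * (h \<omega> \<bullet> i) * (\<Delta> \<omega> \<bullet> i) \<partial>M))"
    by (rule Bochner_Integration.integral_sum) (rule B)
  also have "\<dots> = 0" by (simp add: B)
  finally show "(\<integral>\<omega>. \<eta> \<omega> * (h \<omega> \<bullet> \<Delta> \<omega>) \<partial>M) = 0" .
  have C: "integrable M (\<lambda>\<omega>. (h \<omega> \<bullet> i) * (k \<omega> \<bullet> j))" if "i \<in> Basis" "j \<in> Basis" for i j
  proof -
    have "integrable M (\<lambda>\<omega>. h \<omega> \<bullet> i)"
      by (rule integrable_const_bound[where B=c]) (use bnd that in auto)
    then show ?thesis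
      by (rule integrable_mult_bounded[of _ _ _ c']) (use bnd that in auto)
  qed
  have D: "integrable M (\<lambda>\<omega>. ((h \<omega> \<bullet> i) * (k \<omega> \<bullet> j)) * ((\<Delta> \<omega> \<bullet> i) * (\<Delta> \<omega> \<bullet> j)))"
     "(\<integral>\<omega>. ((h \<omega> \<bullet> i) * (k \<omega> \<bullet> j)) * ((\<Delta> \<omega> \<bullet> i) * (\<Delta> \<omega> \<bullet> j)) \<partial>M)
        = (if i = j then v * (\<integral>\<omega>. (h \<omega> \<bullet> i) * (k \<omega> \<bullet> j) \<partial>M) else 0)" if "i \<in> Basis" "j \<in> Basis" for i j
    using indep_lebesgue_integral[OF F \<Delta> indep _ C[OF that], of "\<lambda>x. (x \<bullet> i) * (x \<bullet> j)"] hF int2[OF that] cov[OF that]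
    by (auto simp: mult.commute)
  have "(\<integral>\<omega>. (h \<omega> \<bullet> \<Delta> \<omega>) * (k \<omega> \<bullet> \<Delta> \<omega>) \<partial>M)
     = (\<integral>\<omega>. (\<Sum>i\<in>Basis. \<Sum>j\<in>Basis. ((h \<omega> \<bullet> i) * (k \<omega> \<bullet> j)) * ((\<Delta> \<omega> \<bullet> i) * (\<Delta> \<omega> \<bullet> j))) \<partial>M)"
    by (subst euclidean_inner, subst (2) euclidean_inner) (simp add: sum_product mult_ac)
  also have "\<dots> = (\<Sum>i\<in>Basis. \<Sum>j\<in>Basis. (if i = j then v * (\<integral>\<omega>. (h \<omega> \<bullet> i) * (k \<omega> \<bullet> j) \<partial>M) else 0))"
    by (subst Bochner_Integration.integral_sum, intro Bochner_Integration.integrable_sum D, assumption+)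
       (intro sum.cong refl, subst Bochner_Integration.integral_sum, auto intro!: D(1) sum.cong simp: D)
  also have "\<dots> = v * (\<Sum>i\<in>Basis. (\<integral>\<omega>. (h \<omega> \<bullet> i) * (k \<omega> \<bullet> i) \<partial>M))"
    by (simp add: sum.delta' sum_distrib_left)
  also have "(\<Sum>i\<in>Basis. (\<integral>\<omega>. (h \<omega> \<bullet> i) * (k \<omega> \<bullet> i) \<partial>M)) = (\<integral>\<omega>. h \<omega> \<bullet> k \<omega> \<partial>M)"
    by (subst Bochner_Integration.integral_sum[symmetric]) (auto intro!: C Bochner_Integration.integral_cong simp: euclidean_inner[of "h _" "k _"])
  finally show "(\<integral>\<omega>. (h \<omega> \<bullet> \<Delta> \<omega>) * (k \<omega> \<bullet> \<Delta> \<omega>) \<partial>M) = v * (\<integral>\<omega>. h \<omega> \<bullet> k \<omega> \<partial>M)" .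
qed

lemma (in prob_space) normal_moments:
  fixes f :: "'a \<Rightarrow> real"
  assumes D: "distributed M lborel f (normal_density 0 \<sigma>)" and \<sigma>: "0 < \<sigma>"
  shows "integrable M (\<lambda>\<omega>. f \<omega> ^ k)" "(\<integral>\<omega>. f \<omega> \<partial>M) = 0" "(\<integral>\<omega>. (f \<omega>)\<^sup>2 \<partial>M) = \<sigma>\<^sup>2"
    "(\<integral>\<omega>. (f \<omega>)^4 \<partial>M) = 3 * \<sigma>^4"
proof -
  have nn: "AE x in lborel. 0 \<le> normal_density 0 \<sigma> x" by simp
  have I: "(\<integral>\<omega>. f \<omega> ^ k \<partial>M) = (\<integral>x. normal_density 0 \<sigma> x * (x - 0) ^ k \<partial>lborel)" for k
    using distributed_integral[OF D, of "\<lambda>x. x ^ k"] by simp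
  show "integrable M (\<lambda>\<omega>. f \<omega> ^ k)"
    using distributed_integrable[OF D, of "\<lambda>x. x ^ k"] integrable_normal_moment[OF \<sigma>, of 0 k] by simp
  show "(\<integral>\<omega>. f \<omega> \<partial>M) = 0"
    using I[of 1] integral_normal_moment_odd[OF \<sigma>, of 0 0] by simp
  show "(\<integral>\<omega>. (f \<omega>)\<^sup>2 \<partial>M) = \<sigma>\<^sup>2"
    using I[of 2] integral_normal_moment_even[OF \<sigma>, of 0 1] by (simp add: fact_numeral)
  show "(\<integral>\<omega>. (f \<omega>)^4 \<partial>M) = 3 * \<sigma>^4"
    using I[of 4] integral_normal_moment_even[OF \<sigma>, of 0 2] \<sigma>
    by (simp add: fact_numeral field_simps power2_eq_square power4_eq_xxxx)
qed

text \<open>The second moments feed the isometry. The fourth moment, of order (t - s)^2, is what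
  later allows a weight that is not adapted to be split off by Cauchy-Schwarz.\<close>

lemma (in prob_space) standard_BM_increment_moments:
  fixes X :: "real \<Rightarrow> 'a \<Rightarrow> real ^ 'n"
  assumes BM: "standard_BM M T X" and st: "0 \<le> s" "s \<le> t" "t \<le> T"
  defines "\<Delta> \<equiv> \<lambda>\<omega>. X t \<omega> - X s \<omega>"
  shows "\<And>i. i \<in> Basis \<Longrightarrow> integrable M (\<lambda>\<omega>. (\<Delta> \<omega> \<bullet> i)\<^sup>2)"
    and "\<And>i. i \<in> Basis \<Longrightarrow> (\<integral>\<omega>. \<Delta> \<omega> \<bullet> i \<partial>M) = 0"
    and "\<And>i j. i \<in> Basis \<Longrightarrow> j \<in> Basis \<Longrightarrow> (\<integral>\<omega>. (\<Delta> \<omega> \<bullet> i) * (\<Delta> \<omega> \<bullet> j) \<partial>M) = (if i = j then t - s else 0)"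
    and "integrable M (\<lambda>\<omega>. norm (\<Delta> \<omega>) ^ 4)"
    and "(\<integral>\<omega>. norm (\<Delta> \<omega>) ^ 4 \<partial>M) \<le> 3 * (real CARD('n))\<^sup>2 * (t - s)\<^sup>2"
proof -
  define f where "f i \<omega> = X t \<omega> $ i - X s \<omega> $ i" for i \<omega>
  have Basis: "\<exists>j. i = axis j 1" if "i \<in> Basis" for i :: "real^'n" using that by (auto simp: Basis_vec_def)
  have ip: "\<Delta> \<omega> \<bullet> axis j 1 = f j \<omega>" for \<omega> j by (simp add: \<Delta>_def f_def inner_axis)
  have mom: "integrable M (\<lambda>\<omega>. f i \<omega> ^ k)" "(\<integral>\<omega>. f i \<omega> \<partial>M) = 0" "(\<integral>\<omega>. (f i \<omega>)\<^sup>2 \<partial>M) = t - s"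
    "(\<integral>\<omega>. (f i \<omega>)^4 \<partial>M) = 3 * (t - s)\<^sup>2" for i k
  proof -
    have "integrable M (\<lambda>\<omega>. f i \<omega> ^ k) \<and> (\<integral>\<omega>. f i \<omega> \<partial>M) = 0 \<and> (\<integral>\<omega>. (f i \<omega>)\<^sup>2 \<partial>M) = t - s
      \<and> (\<integral>\<omega>. (f i \<omega>)^4 \<partial>M) = 3 * (t - s)\<^sup>2"
    proof (cases "s = t")
      \<comment> \<open>The definition of a Brownian motion provides a density only for s < t; a
        degenerate increment is identically 0 and obeys the same formulas.\<close>
      case True
      then show ?thesis by (simp add: f_def)
    next
      case False
      then have "s < t" using st by simp
      then have "distributed M lborel (f i) (normal_density 0 (sqrt (t - s)))"
        using BM st by (simp add: standard_BM_def f_def[abs_def])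
      from normal_moments[OF this] \<open>s < t\<close> show ?thesis
        by (auto simp: real_sqrt_power[symmetric] power4_eq_xxxx power2_eq_square)
    qed
    then show "integrable M (\<lambda>\<omega>. f i \<omega> ^ k)" "(\<integral>\<omega>. f i \<omega> \<partial>M) = 0" "(\<integral>\<omega>. (f i \<omega>)\<^sup>2 \<partial>M) = t - s"
    "(\<integral>\<omega>. (f i \<omega>)^4 \<partial>M) = 3 * (t - s)\<^sup>2" by auto
  qed
  show "integrable M (\<lambda>\<omega>. (\<Delta> \<omega> \<bullet> i)\<^sup>2)" "(\<integral>\<omega>. \<Delta> \<omega> \<bullet> i \<partial>M) = 0" if "i \<in> Basis" for i
    using Basis[OF that] mom ip by auto
  show "(\<integral>\<omega>. (\<Delta> \<omega> \<bullet> i) * (\<Delta> \<omega> \<bullet> j) \<partial>M) = (if i = j then t - s else 0)" if ijB: "i \<in> Basis" "j \<in> Basis" for i j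
  proof -
    obtain i' j' where ij: "i = axis i' 1" "j = axis j' 1" using Basis[OF ijB(1)] Basis[OF ijB(2)] by blast
    show ?thesis
    proof (cases "i' = j'")
      case True
      then show ?thesis using mom(3)[of i'] ij ip by (simp add: power2_eq_square)
    next
      case False
      \<comment> \<open>A partition whose only interval is {s..t}: the independent family of the
        definition then consists of the coordinates of a single increment.\<close>
      define p where "p k = (if k = (0::nat) then s else t)" for k
      have "indep_vars (\<lambda>_. borel) (\<lambda>(k, i) \<omega>. X (p (Suc k)) \<omega> $ i - X (p k) \<omega> $ i) ({..<1} \<times> UNIV)"
      proof -
        have "(\<forall>k\<le>1::nat. p k \<in> {0..T}) \<and> (\<forall>k<1::nat. p k \<le> p (Suc k))"
          using st by (auto simp: p_def)
        then show ?thesis using BM unfolding standard_BM_def by blast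
      qed
      then have "indep_vars (\<lambda>_. borel) (\<lambda>(k, i) \<omega>. X (p (Suc k)) \<omega> $ i - X (p k) \<omega> $ i) ({(0, i'), (0, j')})"
        by (rule indep_vars_subset) auto
      then have "(\<integral>\<omega>. (\<Prod>m\<in>{(0, i'), (0, j')}. (\<lambda>(k, i) \<omega>. X (p (Suc k)) \<omega> $ i - X (p k) \<omega> $ i) m \<omega>) \<partial>M)
        = (\<Prod>m\<in>{(0, i'), (0, j')}. (\<integral>\<omega>. (\<lambda>(k, i) \<omega>. X (p (Suc k)) \<omega> $ i - X (p k) \<omega> $ i) m \<omega> \<partial>M))"
        using mom(1)[of _ 1] by (intro indep_vars_lebesgue_integral) (auto simp: p_def f_def)
      then have "(\<integral>\<omega>. f i' \<omega> * f j' \<omega> \<partial>M) = (\<integral>\<omega>. f i' \<omega> \<partial>M) * (\<integral>\<omega>. f j' \<omega> \<partial>M)"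
        using False by (simp add: p_def f_def)
      then show ?thesis using False mom(2) ij ip by (simp add: axis_eq_axis)
    qed
  qed
  \<comment> \<open>One factor CARD('n) comes from Cauchy-Schwarz here, the other from summing the
    coordinate moments 3 (t - s)^2.\<close>
  have le: "norm (\<Delta> \<omega>) ^ 4 \<le> real CARD('n) * (\<Sum>i\<in>UNIV. f i \<omega> ^ 4)" for \<omega>
  proof -
    have "norm (\<Delta> \<omega>) ^ 4 = ((norm (\<Delta> \<omega>))\<^sup>2)\<^sup>2" by simp
    also have "(norm (\<Delta> \<omega>))\<^sup>2 = (\<Sum>i\<in>UNIV. (f i \<omega>)\<^sup>2)"
      unfolding power2_norm_eq_inner inner_vec_def by (simp add: \<Delta>_def f_def power2_eq_square)
    also have "(\<Sum>i\<in>UNIV. (f i \<omega>)\<^sup>2)\<^sup>2 \<le> (\<Sum>i\<in>UNIV. ((f i \<omega>)\<^sup>2)\<^sup>2) * card (UNIV :: 'n set)"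
      by (rule sum_squared_le_sum_of_squares)
    finally show ?thesis by (simp add: mult.commute)
  qed
  have \<Delta>m[measurable]: "\<Delta> \<in> borel_measurable M"
    using BM st by (auto simp: standard_BM_def \<Delta>_def intro!: borel_measurable_diff)
  have i4: "integrable M (\<lambda>\<omega>. real CARD('n) * (\<Sum>i\<in>UNIV. f i \<omega> ^ 4))" using mom(1) by auto
  show int: "integrable M (\<lambda>\<omega>. norm (\<Delta> \<omega>) ^ 4)"
    by (rule Bochner_Integration.integrable_bound[OF i4]) (use le in \<open>auto intro!: AE_I2 order_trans[OF _ abs_ge_self]\<close>)
  have "(\<integral>\<omega>. norm (\<Delta> \<omega>) ^ 4 \<partial>M) \<le> (\<integral>\<omega>. real CARD('n) * (\<Sum>i\<in>UNIV. f i \<omega> ^ 4) \<partial>M)"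
    by (rule integral_mono[OF int i4 le])
  also have "\<dots> = 3 * (real CARD('n))\<^sup>2 * (t - s)\<^sup>2"
    using mom(1,4) by (simp add: power2_eq_square)
  finally show "(\<integral>\<omega>. norm (\<Delta> \<omega>) ^ 4 \<partial>M) \<le> 3 * (real CARD('n))\<^sup>2 * (t - s)\<^sup>2" .
qed

section \<open>Elementary stochastic integrals and their isometry\<close>

text \<open>Splitting a squared norm into (1 + d) times one part and (1 + 1/d) times the error loses
  only the factor (1 + d)^2 in the limit, and d then tends to 0. Extended non-negative integrals
  spare the question whether the limits are finite. The two sides may live on different spaces, as
  outcomes and outcomes with time do in the isometry.\<close>

lemma L2_limit_le:
  fixes u :: "'a \<Rightarrow> 'c::euclidean_space" and v :: "'b \<Rightarrow> 'd::euclidean_space"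
  assumes [measurable]: "u \<in> borel_measurable M" "\<And>k. uk k \<in> borel_measurable M"
      "v \<in> borel_measurable N" "\<And>k. vk k \<in> borel_measurable N"
    and eq: "\<And>k::nat. (\<integral>\<^sup>+x. ennreal ((norm (uk k x))\<^sup>2) \<partial>M) \<le> (\<integral>\<^sup>+x. ennreal ((norm (vk k x))\<^sup>2) \<partial>N)"
    and u: "(\<lambda>k. \<integral>\<^sup>+x. ennreal ((norm (uk k x - u x))\<^sup>2) \<partial>M) \<longlonglongrightarrow> 0"
    and v: "(\<lambda>k. \<integral>\<^sup>+x. ennreal ((norm (vk k x - v x))\<^sup>2) \<partial>N) \<longlonglongrightarrow> 0"
  shows "(\<integral>\<^sup>+x. ennreal ((norm (u x))\<^sup>2) \<partial>M) \<le> (\<integral>\<^sup>+x. ennreal ((norm (v x))\<^sup>2) \<partial>N)"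
proof -
  have pt: "(norm a)\<^sup>2 \<le> (1 + d) * (norm b)\<^sup>2 + (1 + 1/d) * (norm (a - b))\<^sup>2" if "d > 0"
    for d :: real and a b :: "'z::real_normed_vector"
  proof -
    have "norm a \<le> norm b + norm (a - b)" using norm_triangle_ineq[of b "a - b"] by simp
    then have "(norm a)\<^sup>2 \<le> (norm b + norm (a - b))\<^sup>2" by (intro power_mono) auto
    also have "\<dots> = (norm b)\<^sup>2 + (norm (a - b))\<^sup>2 + 2 * norm b * norm (a - b)"
      by (simp add: power2_sum)
    also have "2 * norm b * norm (a - b) \<le> d * (norm b)\<^sup>2 + (1/d) * (norm (a - b))\<^sup>2"
    proof -
      have "0 \<le> (d * norm b - norm (a - b))\<^sup>2 / d" using that by simp
      also have "\<dots> = d * (norm b)\<^sup>2 + (1/d) * (norm (a - b))\<^sup>2 - 2 * norm b * norm (a - b)"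
        using that by (simp add: power2_diff field_simps power2_eq_square)
      finally show ?thesis by simp
    qed
    finally show ?thesis by (simp add: algebra_simps)
  qed
  let ?A = "\<integral>\<^sup>+x. ennreal ((norm (u x))\<^sup>2) \<partial>M" and ?B = "\<integral>\<^sup>+x. ennreal ((norm (v x))\<^sup>2) \<partial>N"
  have le: "?A \<le> ennreal ((1 + d)\<^sup>2) * ?B" if d: "d > 0" for d :: real
  proof -
    have 1: "(\<integral>\<^sup>+x. ennreal ((norm (f x))\<^sup>2) \<partial>L)
        \<le> ennreal (1 + d) * (\<integral>\<^sup>+x. ennreal ((norm (g x))\<^sup>2) \<partial>L) + ennreal (1 + 1/d) * (\<integral>\<^sup>+x. ennreal ((norm (f x - g x))\<^sup>2) \<partial>L)"
      if [measurable]: "f \<in> borel_measurable L" "g \<in> borel_measurable L"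
      for L :: "'y measure" and f g :: "'y \<Rightarrow> 'z::euclidean_space"
    proof -
      have "(\<integral>\<^sup>+x. ennreal ((norm (f x))\<^sup>2) \<partial>L)
        \<le> (\<integral>\<^sup>+x. ennreal (1 + d) * ennreal ((norm (g x))\<^sup>2) + ennreal (1 + 1/d) * ennreal ((norm (f x - g x))\<^sup>2) \<partial>L)"
        using d pt[of d "f _" "g _"]
        by (intro nn_integral_mono) (simp add: ennreal_mult[symmetric] ennreal_plus[symmetric] del: ennreal_plus)
      also have "\<dots> = ennreal (1 + d) * (\<integral>\<^sup>+x. ennreal ((norm (g x))\<^sup>2) \<partial>L) + ennreal (1 + 1/d) * (\<integral>\<^sup>+x. ennreal ((norm (f x - g x))\<^sup>2) \<partial>L)"
        by (subst nn_integral_add) (auto simp: nn_integral_cmult)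
      finally show ?thesis .
    qed
    have "?A \<le> ennreal (1 + d) * (ennreal (1 + d) * ?B + ennreal (1 + 1/d) * (\<integral>\<^sup>+x. ennreal ((norm (vk k x - v x))\<^sup>2) \<partial>N))
        + ennreal (1 + 1/d) * (\<integral>\<^sup>+x. ennreal ((norm (uk k x - u x))\<^sup>2) \<partial>M)" for k
    proof -
      have "?A \<le> ennreal (1 + d) * (\<integral>\<^sup>+x. ennreal ((norm (uk k x))\<^sup>2) \<partial>M) + ennreal (1 + 1/d) * (\<integral>\<^sup>+x. ennreal ((norm (uk k x - u x))\<^sup>2) \<partial>M)"
        using 1[of u M "uk k"] by (simp add: norm_minus_commute)
      also have "(\<integral>\<^sup>+x. ennreal ((norm (uk k x))\<^sup>2) \<partial>M) \<le> ennreal (1 + d) * ?B + ennreal (1 + 1/d) * (\<integral>\<^sup>+x. ennreal ((norm (vk k x - v x))\<^sup>2) \<partial>N)"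
        using order_trans[OF eq 1[of "vk k" N v]] by simp
      finally show ?thesis by (simp add: mult_left_mono add_right_mono)
    qed
    moreover have "(\<lambda>k. ennreal (1 + d) * (ennreal (1 + d) * ?B + ennreal (1 + 1/d) * (\<integral>\<^sup>+x. ennreal ((norm (vk k x - v x))\<^sup>2) \<partial>N))
        + ennreal (1 + 1/d) * (\<integral>\<^sup>+x. ennreal ((norm (uk k x - u x))\<^sup>2) \<partial>M))
      \<longlonglongrightarrow> ennreal (1 + d) * (ennreal (1 + d) * ?B + ennreal (1 + 1/d) * 0) + ennreal (1 + 1/d) * 0"
      by (intro tendsto_add ennreal_tendsto_cmult tendsto_const u v) auto
    ultimately have "?A \<le> ennreal (1 + d) * (ennreal (1 + d) * ?B + ennreal (1 + 1/d) * 0) + ennreal (1 + 1/d) * 0"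
      by (intro LIMSEQ_le_const) auto
    then show ?thesis using d by (simp add: power2_eq_square ennreal_mult mult.assoc)
  qed
  show ?thesis
  proof (cases "?B = \<infinity>")
    case False
    have "((\<lambda>d. ?B * ennreal ((1 + d)\<^sup>2)) \<longlongrightarrow> ?B * ennreal ((1 + 0)\<^sup>2)) (at_right 0)"
      using False by (intro ennreal_tendsto_cmult tendsto_ennrealI tendsto_intros) (auto simp: less_top)
    moreover have "\<forall>\<^sub>F d in at_right 0. ?A \<le> ?B * ennreal ((1 + d)\<^sup>2)"
      using le by (auto simp: eventually_at_right_field mult.commute intro!: exI[of _ 1])
    ultimately have "?A \<le> ?B * ennreal ((1 + 0)\<^sup>2)"
      by (rule tendsto_lowerbound) simp
    then show ?thesis by simp
  qed simp
qed

text \<open>One interface for both integrals. \<open>\<Phi> s t\<close> is the sigma-algebra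
  admissible for an integrand on {s..t}: it will be \<open>Gt\<close> at s in the forward case and
  \<open>Ht\<close> at t in the backward case, and in both it grows when the interval shrinks. The
  direction of time could be seen only in \<open>orth\<close>, which does not say on which of the
  two factors one conditions.\<close>

locale simple_integration = prob_space M for M :: "'w measure" +
  fixes T \<kappa> :: real and \<Phi> :: "real \<Rightarrow> real \<Rightarrow> 'w measure" and X :: "real \<Rightarrow> 'w \<Rightarrow> 'b::euclidean_space"
  assumes sub: "0 \<le> s \<Longrightarrow> s \<le> t \<Longrightarrow> t \<le> T \<Longrightarrow> subalgebra M (\<Phi> s t)"
    and mono_\<Phi>: "0 \<le> s \<Longrightarrow> s \<le> s' \<Longrightarrow> s' \<le> t' \<Longrightarrow> t' \<le> t \<Longrightarrow> t \<le> T \<Longrightarrow> sets (\<Phi> s t) \<subseteq> sets (\<Phi> s' t')"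
    and X_meas: "0 \<le> t \<Longrightarrow> t \<le> T \<Longrightarrow> X t \<in> borel_measurable M"
    and mean: "0 \<le> s \<Longrightarrow> s \<le> t \<Longrightarrow> t \<le> T \<Longrightarrow> bounded_measurable (\<Phi> s t) h \<Longrightarrow>
       \<eta> \<in> borel_measurable (\<Phi> s t) \<Longrightarrow> integrable M (\<lambda>\<omega>. (\<eta> \<omega>)\<^sup>2) \<Longrightarrow>
       (\<integral>\<omega>. \<eta> \<omega> * (h \<omega> \<bullet> (X t \<omega> - X s \<omega>)) \<partial>M) = 0"
    and orth: "0 \<le> a \<Longrightarrow> a \<le> b \<Longrightarrow> b \<le> c \<Longrightarrow> c \<le> d \<Longrightarrow> d \<le> T \<Longrightarrow>
       bounded_measurable (\<Phi> a b) h \<Longrightarrow> bounded_measurable (\<Phi> c d) k \<Longrightarrow>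
       (\<integral>\<omega>. (h \<omega> \<bullet> (X b \<omega> - X a \<omega>)) * (k \<omega> \<bullet> (X d \<omega> - X c \<omega>)) \<partial>M) = 0"
    and cov: "0 \<le> s \<Longrightarrow> s \<le> t \<Longrightarrow> t \<le> T \<Longrightarrow>
       bounded_measurable (\<Phi> s t) h \<Longrightarrow> bounded_measurable (\<Phi> s t) k \<Longrightarrow>
       (\<integral>\<omega>. (h \<omega> \<bullet> (X t \<omega> - X s \<omega>)) * (k \<omega> \<bullet> (X t \<omega> - X s \<omega>)) \<partial>M) = (t - s) * (\<integral>\<omega>. h \<omega> \<bullet> k \<omega> \<partial>M)"
    and mom4: "0 \<le> s \<Longrightarrow> s \<le> t \<Longrightarrow> t \<le> T \<Longrightarrow> integrable M (\<lambda>\<omega>. norm (X t \<omega> - X s \<omega>) ^ 4)"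
    and mom4_le: "0 \<le> s \<Longrightarrow> s \<le> t \<Longrightarrow> t \<le> T \<Longrightarrow> (\<integral>\<omega>. norm (X t \<omega> - X s \<omega>) ^ 4 \<partial>M) \<le> \<kappa> * (t - s)\<^sup>2"
    and \<kappa>_nonneg: "0 \<le> \<kappa>"
begin

lemma space_\<Phi>: "0 \<le> s \<Longrightarrow> s \<le> t \<Longrightarrow> t \<le> T \<Longrightarrow> space (\<Phi> s t) = space M"
  using sub by (simp add: subalgebra_def)

lemma bm_\<Phi>_mono:
  assumes "0 \<le> s" "s \<le> s'" "s' \<le> t'" "t' \<le> t" "t \<le> T" "bounded_measurable (\<Phi> s t) h"
  shows "bounded_measurable (\<Phi> s' t') h"
proof -
  have "subalgebra (\<Phi> s' t') (\<Phi> s t)"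
    using mono_\<Phi>[OF assms(1-5)] space_\<Phi>[of s t] space_\<Phi>[of s' t'] assms by (simp add: subalgebra_def)
  from measurable_from_subalg[OF this] show ?thesis
    using assms space_\<Phi>[of s t] space_\<Phi>[of s' t'] by (auto simp: bounded_measurable_def)
qed

lemma bm_imp_meas:
  "0 \<le> s \<Longrightarrow> s \<le> t \<Longrightarrow> t \<le> T \<Longrightarrow> bounded_measurable (\<Phi> s t) h \<Longrightarrow> h \<in> borel_measurable M"
  using measurable_from_subalg[OF sub] by (auto simp: bounded_measurable_def)

lemma increment_sq_integrable:
  assumes "0 \<le> s" "s \<le> t" "t \<le> T"
  shows "integrable M (\<lambda>\<omega>. (norm (X t \<omega> - X s \<omega>))\<^sup>2)"
proof (rule Bochner_Integration.integrable_bound[where f="\<lambda>\<omega>. 1 + norm (X t \<omega> - X s \<omega>) ^ 4"])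
  show "(\<lambda>\<omega>. (norm (X t \<omega> - X s \<omega>))\<^sup>2) \<in> borel_measurable M"
    using assms X_meas[of s] X_meas[of t] by auto
  have "z\<^sup>2 \<le> 1 + z ^ 4" for z :: real
    using sum_squares_bound[of "z\<^sup>2" 1] by (simp add: power2_eq_square power4_eq_xxxx mult.assoc) (smt (verit) zero_le_square mult.assoc)
  then show "AE \<omega> in M. norm ((norm (X t \<omega> - X s \<omega>))\<^sup>2) \<le> norm (1 + norm (X t \<omega> - X s \<omega>) ^ 4)"
    by (simp add: abs_of_nonneg)
qed (use mom4[OF assms] in auto)

lemma simple_sq_integrable:
  assumes st: "0 \<le> s" "s \<le> t" "t \<le> T" and h: "h \<in> borel_measurable M" "\<And>\<omega>. \<omega> \<in> space M \<Longrightarrow> norm (h \<omega>) \<le> c"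
  shows "integrable M (\<lambda>\<omega>. (h \<omega> \<bullet> (X t \<omega> - X s \<omega>))\<^sup>2)"
proof (rule Bochner_Integration.integrable_bound[where f="\<lambda>\<omega>. c\<^sup>2 * (norm (X t \<omega> - X s \<omega>))\<^sup>2"])
  show "(\<lambda>\<omega>. (h \<omega> \<bullet> (X t \<omega> - X s \<omega>))\<^sup>2) \<in> borel_measurable M"
    using st X_meas[of s] X_meas[of t] h by auto
  show "AE \<omega> in M. norm ((h \<omega> \<bullet> (X t \<omega> - X s \<omega>))\<^sup>2) \<le> norm (c\<^sup>2 * (norm (X t \<omega> - X s \<omega>))\<^sup>2)"
  proof (rule AE_I2)
    fix \<omega> assume "\<omega> \<in> space M"
    have "\<bar>h \<omega> \<bullet> (X t \<omega> - X s \<omega>)\<bar> \<le> norm (h \<omega>) * norm (X t \<omega> - X s \<omega>)" by (rule Cauchy_Schwarz_ineq2)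
    also have "\<dots> \<le> c * norm (X t \<omega> - X s \<omega>)" using h(2)[OF \<open>\<omega> \<in> space M\<close>] by (intro mult_right_mono) auto
    finally have "\<bar>h \<omega> \<bullet> (X t \<omega> - X s \<omega>)\<bar>\<^sup>2 \<le> (c * norm (X t \<omega> - X s \<omega>))\<^sup>2" by (intro power_mono) auto
    then show "norm ((h \<omega> \<bullet> (X t \<omega> - X s \<omega>))\<^sup>2) \<le> norm (c\<^sup>2 * (norm (X t \<omega> - X s \<omega>))\<^sup>2)"
      by (simp add: power_mult_distrib)
  qed
qed (use increment_sq_integrable[OF st] in auto)

lemma bm_sq_integrable:
  assumes st: "0 \<le> s" "s \<le> t" "t \<le> T" and h: "bounded_measurable (\<Phi> s t) h"
    and st': "0 \<le> s'" "s' \<le> t'" "t' \<le> T"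
  shows "integrable M (\<lambda>\<omega>. (h \<omega> \<bullet> (X t' \<omega> - X s' \<omega>))\<^sup>2)" "(\<lambda>\<omega>. h \<omega> \<bullet> (X t' \<omega> - X s' \<omega>)) \<in> borel_measurable M"
proof -
  obtain c where "\<And>\<omega>. \<omega> \<in> space M \<Longrightarrow> norm (h \<omega>) \<le> c"
    using h space_\<Phi>[OF st] by (auto simp: bounded_measurable_def)
  then show "integrable M (\<lambda>\<omega>. (h \<omega> \<bullet> (X t' \<omega> - X s' \<omega>))\<^sup>2)"
    using simple_sq_integrable[OF st', of h c] bm_imp_meas[OF st h] by blast
  show "(\<lambda>\<omega>. h \<omega> \<bullet> (X t' \<omega> - X s' \<omega>)) \<in> borel_measurable M"
    using X_meas[of s'] X_meas[of t'] st' bm_imp_meas[OF st h] by auto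
qed

text \<open>Cutting both intervals at the ends of their overlap produces nine products. All vanish,
  by \<open>orth\<close> or because a piece is degenerate, except the one over the overlap, where
  \<open>cov\<close> applies.\<close>

lemma simple_covariance:
  assumes st: "0 \<le> s" "s \<le> t" "t \<le> T" and st': "0 \<le> s'" "s' \<le> t'" "t' \<le> T"
    and h: "bounded_measurable (\<Phi> s t) h" and k: "bounded_measurable (\<Phi> s' t') k"
  shows "(\<integral>\<omega>. (h \<omega> \<bullet> (X t \<omega> - X s \<omega>)) * (k \<omega> \<bullet> (X t' \<omega> - X s' \<omega>)) \<partial>M)
     = max 0 (min t t' - max s s') * (\<integral>\<omega>. h \<omega> \<bullet> k \<omega> \<partial>M)"
proof (cases "min t t' \<le> max s s'")
  case True
  then have "t = s \<or> t' = s' \<or> t \<le> s' \<or> t' \<le> s" using st st' by linarith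
  then have "(\<integral>\<omega>. (h \<omega> \<bullet> (X t \<omega> - X s \<omega>)) * (k \<omega> \<bullet> (X t' \<omega> - X s' \<omega>)) \<partial>M) = 0"
    using orth[of s t s' t' h k] orth[of s' t' s t k h] st st' h k by (auto simp: mult.commute)
  then show ?thesis using True by simp
next
  case False
  define m where "m = max s s'"
  define m' where "m' = min t t'"
  have ord: "s \<le> m" "s' \<le> m" "m \<le> m'" "m' \<le> t" "m' \<le> t'" "0 \<le> m" "m' \<le> T" "m = s \<or> m = s'" "m' = t \<or> m' = t'"
    using False st st' by (auto simp: m_def m'_def)
  define a where "a = (\<lambda>p q \<omega>. h \<omega> \<bullet> (X q \<omega> - X p \<omega>))"
  define b where "b = (\<lambda>p q \<omega>. k \<omega> \<bullet> (X q \<omega> - X p \<omega>))"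
  have hb: "bounded_measurable (\<Phi> p q) h" if "s \<le> p" "p \<le> q" "q \<le> t" for p q
    using bm_\<Phi>_mono[of s p q t h] that st h by auto
  have kb: "bounded_measurable (\<Phi> p q) k" if "s' \<le> p" "p \<le> q" "q \<le> t'" for p q
    using bm_\<Phi>_mono[of s' p q t' k] that st' k by auto
  have int: "integrable M (\<lambda>\<omega>. a p q \<omega> * b p' q' \<omega>)"
    if "0 \<le> p" "p \<le> q" "q \<le> T" "0 \<le> p'" "p' \<le> q'" "q' \<le> T" for p q p' q'
    unfolding a_def b_def
    by (intro integrable_mult_square bm_sq_integrable[OF st h] bm_sq_integrable[OF st' k] that)
  have z1: "(\<integral>\<omega>. a p q \<omega> * b p' q' \<omega> \<partial>M) = 0" if "s \<le> p" "p \<le> q" "q \<le> p'" "p' \<le> q'" "q' \<le> t'" "q \<le> t" "s' \<le> p'" for p q p' q'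
    unfolding a_def b_def by (rule orth) (use that st st' hb kb in auto)
  have z2: "(\<integral>\<omega>. a p q \<omega> * b p' q' \<omega> \<partial>M) = 0" if "s' \<le> p'" "p' \<le> q'" "q' \<le> p" "p \<le> q" "q \<le> t" "q' \<le> t'" "s \<le> p" for p q p' q'
    unfolding a_def b_def by (subst mult.commute, rule orth) (use that st st' hb kb in auto)
  \<comment> \<open>One of the two pieces before the overlap is empty, since the overlap starts at
    the left end of one of the intervals; the next line is the same at the right end.\<close>
  have z3: "(\<integral>\<omega>. a s m \<omega> * b s' m \<omega> \<partial>M) = 0" using ord(8) by (auto simp: a_def b_def)
  have z4: "(\<integral>\<omega>. a m' t \<omega> * b m' t' \<omega> \<partial>M) = 0" using ord(9) by (auto simp: a_def b_def)
  have c: "(\<integral>\<omega>. a m m' \<omega> * b m m' \<omega> \<partial>M) = (m' - m) * (\<integral>\<omega>. h \<omega> \<bullet> k \<omega> \<partial>M)"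
    unfolding a_def b_def by (rule cov) (use ord hb kb in auto)
  have "(\<integral>\<omega>. (h \<omega> \<bullet> (X t \<omega> - X s \<omega>)) * (k \<omega> \<bullet> (X t' \<omega> - X s' \<omega>)) \<partial>M)
    = (\<integral>\<omega>. ((a s m \<omega> * b s' m \<omega> + a s m \<omega> * b m m' \<omega> + a s m \<omega> * b m' t' \<omega>)
        + (a m m' \<omega> * b s' m \<omega> + a m m' \<omega> * b m m' \<omega> + a m m' \<omega> * b m' t' \<omega>)
        + (a m' t \<omega> * b s' m \<omega> + a m' t \<omega> * b m m' \<omega> + a m' t \<omega> * b m' t' \<omega>)) \<partial>M)"
    by (rule Bochner_Integration.integral_cong) (simp_all add: a_def b_def algebra_simps inner_diff_right)
  also have "\<dots> = (\<integral>\<omega>. a m m' \<omega> * b m m' \<omega> \<partial>M)"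
    using st st' ord
    by (simp add: Bochner_Integration.integral_add int Bochner_Integration.integrable_add z1 z2 z3 z4)
  moreover have "max 0 (min t t' - max s s') = m' - m" using False by (simp add: m_def m'_def max_absorb2)
  ultimately show ?thesis using c by simp
qed

text \<open>Integrand and integral are generated together, and the steps may overlap. Sums,
  differences and multiples thus stay in the class without passing to a common refinement; the price
  is that the isometry has to cope with overlapping steps, which is the role of
  \<open>simple_covariance\<close>.\<close>

inductive ito_simple :: "real \<Rightarrow> real \<Rightarrow> (real \<Rightarrow> 'w \<Rightarrow> 'b) \<Rightarrow> ('w \<Rightarrow> real) \<Rightarrow> bool" for s r where
  zero: "ito_simple s r (\<lambda>_ _. 0) (\<lambda>_. 0)"
| step: "ito_simple s r \<phi> I \<Longrightarrow> s \<le> a \<Longrightarrow> a \<le> b \<Longrightarrow> b \<le> r \<Longrightarrow> bounded_measurable (\<Phi> a b) h \<Longrightarrow>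
    ito_simple s r (\<lambda>u \<omega>. \<phi> u \<omega> + indicator {a<..b} u *\<^sub>R h \<omega>) (\<lambda>\<omega>. I \<omega> + h \<omega> \<bullet> (X b \<omega> - X a \<omega>))"

lemma ito_simple_cong:
  "ito_simple s r \<phi> I \<Longrightarrow> (\<And>u \<omega>. \<phi>' u \<omega> = \<phi> u \<omega>) \<Longrightarrow> (\<And>\<omega>. I' \<omega> = I \<omega>) \<Longrightarrow> ito_simple s r \<phi>' I'"
proof -
  assume *: "ito_simple s r \<phi> I" "\<And>u \<omega>. \<phi>' u \<omega> = \<phi> u \<omega>" "\<And>\<omega>. I' \<omega> = I \<omega>"
  then have "\<phi>' = \<phi>" "I' = I" by (simp_all add: fun_eq_iff)
  then show ?thesis using *(1) by simp
qed

lemma ito_simple_diff: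
  assumes "ito_simple s r \<phi>' I'" "ito_simple s r \<phi> I"
  shows "ito_simple s r (\<lambda>u \<omega>. \<phi> u \<omega> - \<phi>' u \<omega>) (\<lambda>\<omega>. I \<omega> - I' \<omega>)"
  using assms(1)
proof induction
  case zero
  then show ?case using assms(2) by simp
next
  case (step \<phi>' I' a b h)
  have "bounded_measurable (\<Phi> a b) (\<lambda>\<omega>. - h \<omega>)"
    using step by (auto simp: bounded_measurable_def)
  from ito_simple.step[OF step.IH step(2-4) this] show ?case
    by (rule ito_simple_cong) (auto simp: algebra_simps)
qed

text \<open>A factor admissible on the whole interval is admissible on each step by
  \<open>mono_\<Phi>\<close>. Multiplying by it is the device that turns the plain isometry into a
  conditional one.\<close>

lemma ito_simple_scale:
  assumes "ito_simple s r \<phi> I" and sr: "0 \<le> s" "s \<le> r" "r \<le> T"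
    and \<theta>: "bounded_measurable (\<Phi> s r) (\<theta> :: 'w \<Rightarrow> real)"
  shows "ito_simple s r (\<lambda>u \<omega>. \<theta> \<omega> *\<^sub>R \<phi> u \<omega>) (\<lambda>\<omega>. \<theta> \<omega> * I \<omega>)"
  using assms(1)
proof induction
  case zero
  then show ?case by (simp add: ito_simple.zero)
next
  case (step \<phi> I a b h)
  have ab: "0 \<le> a" "a \<le> b" "b \<le> T" using step sr by auto
  obtain c where c: "\<And>\<omega>. \<omega> \<in> space M \<Longrightarrow> norm (h \<omega>) \<le> c"
    using step(5) space_\<Phi>[OF ab] by (auto simp: bounded_measurable_def)
  obtain d where d: "\<And>\<omega>. \<omega> \<in> space M \<Longrightarrow> \<bar>\<theta> \<omega>\<bar> \<le> d"
    using \<theta> space_\<Phi>[OF sr] by (auto simp: bounded_measurable_def)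
  have "bounded_measurable (\<Phi> a b) \<theta>" using bm_\<Phi>_mono[of s a b r \<theta>] step sr \<theta> by auto
  then have "(\<lambda>\<omega>. \<theta> \<omega> *\<^sub>R h \<omega>) \<in> borel_measurable (\<Phi> a b)"
    using step(5) by (auto simp: bounded_measurable_def)
  moreover have "norm (\<theta> \<omega> *\<^sub>R h \<omega>) \<le> d * c" if "\<omega> \<in> space M" for \<omega>
    using mult_mono[OF d[OF that] c[OF that] order_trans[OF abs_ge_zero d[OF that]] norm_ge_zero] by simp
  ultimately have "bounded_measurable (\<Phi> a b) (\<lambda>\<omega>. \<theta> \<omega> *\<^sub>R h \<omega>)"
    using space_\<Phi>[OF ab] by (auto simp: bounded_measurable_def)
  from ito_simple.step[OF step.IH step(2-4) this] show ?case
    by (rule ito_simple_cong) (auto simp: algebra_simps)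
qed

lemma ito_simple_props:
  assumes "ito_simple s r \<phi> I" and sr: "0 \<le> s" "s \<le> r" "r \<le> T"
  shows "case_prod (\<lambda>\<omega> u. \<phi> u \<omega>) \<in> borel_measurable (M \<Otimes>\<^sub>M lborel)" (is ?a)
    and "I \<in> borel_measurable M" "integrable M (\<lambda>\<omega>. (I \<omega>)\<^sup>2)"
    and "\<exists>c. \<forall>u. \<forall>\<omega>\<in>space M. norm (\<phi> u \<omega>) \<le> c * indicator {s<..r} u"
    and "\<eta> \<in> borel_measurable (\<Phi> s r) \<Longrightarrow> integrable M (\<lambda>\<omega>. (\<eta> \<omega>)\<^sup>2) \<Longrightarrow> (\<integral>\<omega>. \<eta> \<omega> * I \<omega> \<partial>M) = 0"
proof -
  have "?a \<and> I \<in> borel_measurable M \<and> integrable M (\<lambda>\<omega>. (I \<omega>)\<^sup>2)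
      \<and> (\<exists>c. \<forall>u. \<forall>\<omega>\<in>space M. norm (\<phi> u \<omega>) \<le> c * indicator {s<..r} u)
      \<and> (\<eta> \<in> borel_measurable (\<Phi> s r) \<longrightarrow> integrable M (\<lambda>\<omega>. (\<eta> \<omega>)\<^sup>2) \<longrightarrow> (\<integral>\<omega>. \<eta> \<omega> * I \<omega> \<partial>M) = 0)"
    using assms(1)
  proof induction
    case zero
    show ?case by (auto intro!: exI[of _ 0])
  next
    case (step \<phi> I a b h)
    have ab: "0 \<le> a" "a \<le> b" "b \<le> T" using step sr by auto
    have [measurable]: "h \<in> borel_measurable M" using bm_imp_meas[OF ab step(5)] .
    have [measurable]: "case_prod (\<lambda>\<omega> u. \<phi> u \<omega>) \<in> borel_measurable (M \<Otimes>\<^sub>M lborel)" and IM[measurable]: "I \<in> borel_measurable M"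
      and I2: "integrable M (\<lambda>\<omega>. (I \<omega>)\<^sup>2)" using step.IH by auto
    obtain c where c: "\<And>u \<omega>. \<omega> \<in> space M \<Longrightarrow> norm (\<phi> u \<omega>) \<le> c * indicator {s<..r} u" using step.IH by auto
    obtain d where d: "\<And>\<omega>. \<omega> \<in> space M \<Longrightarrow> norm (h \<omega>) \<le> d"
      using step(5) space_\<Phi>[OF ab] by (auto simp: bounded_measurable_def)
    have 1: "case_prod (\<lambda>\<omega> u. \<phi> u \<omega> + indicator {a<..b} u *\<^sub>R h \<omega>) \<in> borel_measurable (M \<Otimes>\<^sub>M lborel)" by measurable
    note J = bm_sq_integrable[OF ab step(5) ab]
    note [measurable] = J(2)
    have 2: "(\<lambda>\<omega>. I \<omega> + h \<omega> \<bullet> (X b \<omega> - X a \<omega>)) \<in> borel_measurable M" by measurable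
    have 3: "integrable M (\<lambda>\<omega>. (I \<omega> + h \<omega> \<bullet> (X b \<omega> - X a \<omega>))\<^sup>2)"
      unfolding power2_sum using I2 J integrable_mult_square[OF IM J(2) I2 J(1)]
      by (intro Bochner_Integration.integrable_add) (auto simp: mult.assoc)
    have 4: "norm (\<phi> u \<omega> + indicator {a<..b} u *\<^sub>R h \<omega>) \<le> (c + d) * indicator {s<..r} u" if "\<omega> \<in> space M" for u \<omega>
    proof -
      have "0 \<le> d" using d[OF that] norm_ge_zero order_trans by blast
      have "norm (\<phi> u \<omega> + indicator {a<..b} u *\<^sub>R h \<omega>) \<le> c * indicator {s<..r} u + indicator {a<..b} u * d"
        using c[OF that, of u] d[OF that] by (intro norm_triangle_le add_mono) (auto simp: indicator_def)
      also have "indicator {a<..b} u * d \<le> d * indicator {s<..r} u"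
        using step(2-4) \<open>0 \<le> d\<close> by (auto simp: indicator_def)
      finally show ?thesis by (simp add: algebra_simps)
    qed
    have 5: "(\<integral>\<omega>. \<eta> \<omega> * (I \<omega> + h \<omega> \<bullet> (X b \<omega> - X a \<omega>)) \<partial>M) = 0"
      if \<eta>: "\<eta> \<in> borel_measurable (\<Phi> s r)" "integrable M (\<lambda>\<omega>. (\<eta> \<omega>)\<^sup>2)"
    proof -
      have \<eta>M: "\<eta> \<in> borel_measurable M" using measurable_from_subalg[OF sub[OF sr] \<eta>(1)] .
      have "subalgebra (\<Phi> a b) (\<Phi> s r)"
        using mono_\<Phi>[of s a b r] step sr space_\<Phi>[OF ab] space_\<Phi>[OF sr] by (simp add: subalgebra_def)
      from measurable_from_subalg[OF this \<eta>(1)] have "(\<integral>\<omega>. \<eta> \<omega> * (h \<omega> \<bullet> (X b \<omega> - X a \<omega>)) \<partial>M) = 0"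
        by (intro mean ab step \<eta>(2))
      then show ?thesis
        using step.IH \<eta> integrable_mult_square[OF \<eta>M IM \<eta>(2) I2] integrable_mult_square[OF \<eta>M J(2) \<eta>(2) J(1)]
        by (simp add: distrib_left)
    qed
    show ?case using 1 2 3 4 5 by blast
  qed
  then show ?a "I \<in> borel_measurable M" "integrable M (\<lambda>\<omega>. (I \<omega>)\<^sup>2)"
    "\<exists>c. \<forall>u. \<forall>\<omega>\<in>space M. norm (\<phi> u \<omega>) \<le> c * indicator {s<..r} u"
    "\<eta> \<in> borel_measurable (\<Phi> s r) \<Longrightarrow> integrable M (\<lambda>\<omega>. (\<eta> \<omega>)\<^sup>2) \<Longrightarrow> (\<integral>\<omega>. \<eta> \<omega> * I \<omega> \<partial>M) = 0"
    by auto
qed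

end

section \<open>Cauchy-Schwarz, and integration over outcomes and time\<close>

lemma integral_Cauchy_Schwarz:
  fixes u v :: "'a \<Rightarrow> real"
  assumes u: "u \<in> borel_measurable M" "integrable M (\<lambda>x. (u x)\<^sup>2)"
    and v: "v \<in> borel_measurable M" "integrable M (\<lambda>x. (v x)\<^sup>2)"
  shows "(\<integral>x. \<bar>u x * v x\<bar> \<partial>M) \<le> sqrt (\<integral>x. (u x)\<^sup>2 \<partial>M) * sqrt (\<integral>x. (v x)\<^sup>2 \<partial>M)"
proof -
  define A where "A = (\<integral>x. (u x)\<^sup>2 \<partial>M)"
  define B where "B = (\<integral>x. (v x)\<^sup>2 \<partial>M)"
  have AB: "0 \<le> A" "0 \<le> B" by (simp_all add: A_def B_def)
  have int: "integrable M (\<lambda>x. u x * v x)" by (rule integrable_mult_square[OF u(1) v(1) u(2) v(2)])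
  have z: "(\<integral>x. \<bar>u x * v x\<bar> \<partial>M) = 0" if "A = 0 \<or> B = 0"
  proof -
    have "(AE x in M. (u x)\<^sup>2 = 0) \<or> (AE x in M. (v x)\<^sup>2 = 0)"
      using that integral_nonneg_eq_0_iff_AE[OF u(2)] integral_nonneg_eq_0_iff_AE[OF v(2)] by (auto simp: A_def B_def)
    then have "AE x in M. \<bar>u x * v x\<bar> = 0" by (auto elim!: AE_mp)
    then have "(\<integral>x. \<bar>u x * v x\<bar> \<partial>M) = (\<integral>x. 0 \<partial>M)" using u v by (intro integral_cong_AE) auto
    then show ?thesis by simp
  qed
  show ?thesis
  proof (cases "A = 0 \<or> B = 0")
    case True
    then show ?thesis using z AB by (auto simp: A_def[symmetric] B_def[symmetric])
  next
    case False
    define a where "a = sqrt A"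
    define b where "b = sqrt B"
    have ab: "0 < a" "0 < b" "a\<^sup>2 = A" "b\<^sup>2 = B" using False AB by (auto simp: a_def b_def)
    \<comment> \<open>These weights balance the two squares: each of them integrates to half of a *
      b.\<close>
    have "(\<integral>x. \<bar>u x * v x\<bar> \<partial>M) \<le> (\<integral>x. (b / (2 * a)) * (u x)\<^sup>2 + (a / (2 * b)) * (v x)\<^sup>2 \<partial>M)"
    proof (rule integral_mono)
      fix x
      have "0 \<le> (b * \<bar>u x\<bar> - a * \<bar>v x\<bar>)\<^sup>2 / (2 * a * b)" using ab by simp
      also have "\<dots> = (b / (2 * a)) * (u x)\<^sup>2 + (a / (2 * b)) * (v x)\<^sup>2 - \<bar>u x * v x\<bar>"
        using ab(1,2) by (simp add: power2_diff power_mult_distrib abs_mult field_simps) (simp add: power2_eq_square)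
      finally show "\<bar>u x * v x\<bar> \<le> (b / (2 * a)) * (u x)\<^sup>2 + (a / (2 * b)) * (v x)\<^sup>2" by simp
    qed (use int u v in auto)
    also have "\<dots> = (b / (2 * a)) * A + (a / (2 * b)) * B" using u v by (simp add: A_def B_def)
    also have "\<dots> = a * b" using ab(1,2) unfolding ab(3,4)[symmetric] by (simp add: field_simps power2_eq_square)
    finally show ?thesis by (simp add: a_def b_def A_def B_def)
  qed
qed

lemma nn_integral_square_finite_iff:
  fixes u :: "'a \<Rightarrow> real"
  assumes "u \<in> borel_measurable M"
  shows "integrable M (\<lambda>x. (u x)\<^sup>2) \<longleftrightarrow> (\<integral>\<^sup>+x. ennreal ((u x)\<^sup>2) \<partial>M) < \<infinity>"
  using assms by (subst integrable_iff_bounded) auto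

context prob_space
begin

lemma pair_sigma_finite_lborel: "pair_sigma_finite M lborel"
  by unfold_locales

lemma integrable_product_bounded:
  fixes F :: "'a \<times> real \<Rightarrow> real"
  assumes F: "F \<in> borel_measurable (M \<Otimes>\<^sub>M lborel)"
    and bnd: "\<And>\<omega> u. \<omega> \<in> space M \<Longrightarrow> \<bar>F (\<omega>, u)\<bar> \<le> c * indicator {s<..r} u"
  shows "integrable (M \<Otimes>\<^sub>M lborel) F"
proof (rule integrableI_bounded_set[where A="space M \<times> {s<..r}" and B=c])
  show "space M \<times> {s<..r} \<in> sets (M \<Otimes>\<^sub>M lborel)" by auto
  have "emeasure (M \<Otimes>\<^sub>M lborel) (space M \<times> {s<..r}) = emeasure M (space M) * emeasure lborel {s<..r}"
    by (rule lborel.emeasure_pair_measure_Times) auto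
  then show "emeasure (M \<Otimes>\<^sub>M lborel) (space M \<times> {s<..r}) < \<infinity>"
    by (cases "s \<le> r") (auto simp: emeasure_space_1)
  show "AE x in M \<Otimes>\<^sub>M lborel. x \<in> space M \<times> {s<..r} \<longrightarrow> norm (F x) \<le> c"
  proof (intro AE_I2 impI)
    fix x assume "x \<in> space M \<times> {s<..r}"
    then show "norm (F x) \<le> c" using bnd[of "fst x" "snd x"] by auto
  qed
  show "AE x in M \<Otimes>\<^sub>M lborel. x \<notin> space M \<times> {s<..r} \<longrightarrow> F x = 0"
  proof (intro AE_I2 impI)
    fix x assume "x \<in> space (M \<Otimes>\<^sub>M lborel)" "x \<notin> space M \<times> {s<..r}"
    then show "F x = 0"
      using bnd[of "fst x" "snd x"] by (auto simp: space_pair_measure split: split_indicator_asm)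
  qed
qed fact

lemma integral_product_indicator:
  fixes h :: "'a \<Rightarrow> real"
  assumes h: "integrable M h" "h \<in> borel_measurable M" "\<And>\<omega>. \<omega> \<in> space M \<Longrightarrow> \<bar>h \<omega>\<bar> \<le> c"
  shows "(\<integral>x. indicator {s<..r} (snd x) * h (fst x) \<partial>(M \<Otimes>\<^sub>M lborel)) = max 0 (r - s) * (\<integral>\<omega>. h \<omega> \<partial>M)"
proof -
  interpret pair_sigma_finite M lborel by (rule pair_sigma_finite_lborel)
  note [measurable] = h(2)
  have "integrable (M \<Otimes>\<^sub>M lborel) (\<lambda>x. indicator {s<..r} (snd x) * h (fst x))"
    by (rule integrable_product_bounded[where c=c and s=s and r=r]) (use h(3) in \<open>auto simp: indicator_def\<close>)
  from integral_fst'[OF this, symmetric]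
  have "(\<integral>x. indicator {s<..r} (snd x) * h (fst x) \<partial>(M \<Otimes>\<^sub>M lborel)) = (\<integral>\<omega>. (\<integral>u. indicator {s<..r} u * h \<omega> \<partial>lborel) \<partial>M)"
    by simp
  also have "\<dots> = (\<integral>\<omega>. max 0 (r - s) * h \<omega> \<partial>M)"
    by (intro Bochner_Integration.integral_cong) (auto simp: max_def)
  finally show ?thesis by simp
qed

end

context simple_integration
begin

lemma ito_simple_bounded:
  assumes "ito_simple s r \<phi> I" "0 \<le> s" "s \<le> r" "r \<le> T"
  obtains c where "0 \<le> c" "\<And>u \<omega>. \<omega> \<in> space M \<Longrightarrow> norm (\<phi> u \<omega>) \<le> c * indicator {s<..r} u"
proof -
  obtain c where c: "\<And>u \<omega>. \<omega> \<in> space M \<Longrightarrow> norm (\<phi> u \<omega>) \<le> c * indicator {s<..r} u"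
    using ito_simple_props(4)[OF assms] by blast
  have "norm (\<phi> u \<omega>) \<le> \<bar>c\<bar> * indicator {s<..r} u" if "\<omega> \<in> space M" for u \<omega>
    using c[OF that, of u] by (auto simp: indicator_def split: if_splits)
  then show thesis using that[of "\<bar>c\<bar>"] by auto
qed

text \<open>Induction adds the steps of the first integrand one at a time against the fixed step on
  {a<..b}. Each contributes the length of its overlap times the mean of k \<bullet> h, which is the
  same overlap written as an integral over outcomes and time.\<close>

lemma ito_simple_cross:
  assumes "ito_simple s r \<phi> I" and sr: "0 \<le> s" "s \<le> r" "r \<le> T"
    and ab: "s \<le> a" "a \<le> b" "b \<le> r" and h: "bounded_measurable (\<Phi> a b) h"
  shows "(\<integral>\<omega>. I \<omega> * (h \<omega> \<bullet> (X b \<omega> - X a \<omega>)) \<partial>M)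
    = (\<integral>x. \<phi> (snd x) (fst x) \<bullet> (indicator {a<..b} (snd x) *\<^sub>R h (fst x)) \<partial>(M \<Otimes>\<^sub>M lborel))"
  using assms(1)
proof induction
  case zero
  then show ?case by simp
next
  case (step \<phi> I a' b' k)
  have ab0: "0 \<le> a" "a \<le> b" "b \<le> T" using ab sr by auto
  have ab': "0 \<le> a'" "a' \<le> b'" "b' \<le> T" using step sr by auto
  note P = ito_simple_props[OF step(1) sr]
  note J = bm_sq_integrable[OF ab0 h ab0]
  note K = bm_sq_integrable[OF ab' step(5) ab']
  have [measurable]: "h \<in> borel_measurable M" "k \<in> borel_measurable M"
    using bm_imp_meas[OF ab0 h] bm_imp_meas[OF ab' step(5)] .
  note [measurable] = P(1)
  obtain c where c: "0 \<le> c" "\<And>u \<omega>. \<omega> \<in> space M \<Longrightarrow> norm (\<phi> u \<omega>) \<le> c * indicator {s<..r} u"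
    using ito_simple_bounded[OF step(1) sr] by blast
  obtain d where d: "\<And>\<omega>. \<omega> \<in> space M \<Longrightarrow> norm (h \<omega>) \<le> d"
    using h space_\<Phi>[OF ab0] by (auto simp: bounded_measurable_def)
  obtain e where e: "\<And>\<omega>. \<omega> \<in> space M \<Longrightarrow> norm (k \<omega>) \<le> e"
    using step(5) space_\<Phi>[OF ab'] by (auto simp: bounded_measurable_def)
  have kh: "\<bar>k \<omega> \<bullet> h \<omega>\<bar> \<le> e * d" if "\<omega> \<in> space M" for \<omega>
    using Cauchy_Schwarz_ineq2[of "k \<omega>" "h \<omega>"] mult_mono[OF e[OF that] d[OF that] order_trans[OF norm_ge_zero e[OF that]] norm_ge_zero]
    by linarith
  have khi: "integrable M (\<lambda>\<omega>. k \<omega> \<bullet> h \<omega>)"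
    by (rule integrable_const_bound[where B="e * d"]) (use kh in auto)
  have i1: "integrable (M \<Otimes>\<^sub>M lborel) (\<lambda>x. \<phi> (snd x) (fst x) \<bullet> (indicator {a<..b} (snd x) *\<^sub>R h (fst x)))"
  proof (rule integrable_product_bounded[where c="c * d" and s=s and r=r])
    show "(\<lambda>x. \<phi> (snd x) (fst x) \<bullet> (indicator {a<..b} (snd x) *\<^sub>R h (fst x))) \<in> borel_measurable (M \<Otimes>\<^sub>M lborel)"
      using P(1) by (auto simp: split_beta')
    fix \<omega> u assume \<omega>: "\<omega> \<in> space M"
    have "\<bar>\<phi> u \<omega> \<bullet> h \<omega>\<bar> \<le> (c * indicator {s<..r} u) * d"
      using Cauchy_Schwarz_ineq2[of "\<phi> u \<omega>" "h \<omega>"] mult_mono[OF c(2)[OF \<omega>, of u] d[OF \<omega>] _ norm_ge_zero] c(1) by fastforce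
    moreover have "0 \<le> d" using d[OF \<omega>] norm_ge_zero order_trans by blast
    ultimately show "\<bar>\<phi> (snd (\<omega>, u)) (fst (\<omega>, u)) \<bullet> (indicator {a<..b} (snd (\<omega>, u)) *\<^sub>R h (fst (\<omega>, u)))\<bar> \<le> c * d * indicator {s<..r} u"
      using c(1) by (auto simp: indicator_def split: if_splits)
  qed
  have eq: "(\<lambda>x. (indicator {a'<..b'} (snd x) *\<^sub>R k (fst x)) \<bullet> (indicator {a<..b} (snd x) *\<^sub>R h (fst x)))
     = (\<lambda>x. indicator {max a' a<..min b' b} (snd x) * (k (fst x) \<bullet> h (fst x)))"
    by (auto simp: fun_eq_iff indicator_def)
  have i2: "integrable (M \<Otimes>\<^sub>M lborel) (\<lambda>x. (indicator {a'<..b'} (snd x) *\<^sub>R k (fst x)) \<bullet> (indicator {a<..b} (snd x) *\<^sub>R h (fst x)))"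
    unfolding eq by (rule integrable_product_bounded[where c="e * d" and s="max a' a" and r="min b' b"])
       (use kh in \<open>auto simp: indicator_def\<close>)
  have "(\<integral>\<omega>. (I \<omega> + k \<omega> \<bullet> (X b' \<omega> - X a' \<omega>)) * (h \<omega> \<bullet> (X b \<omega> - X a \<omega>)) \<partial>M)
    = (\<integral>\<omega>. I \<omega> * (h \<omega> \<bullet> (X b \<omega> - X a \<omega>)) \<partial>M) + (\<integral>\<omega>. (k \<omega> \<bullet> (X b' \<omega> - X a' \<omega>)) * (h \<omega> \<bullet> (X b \<omega> - X a \<omega>)) \<partial>M)"
    unfolding distrib_right
    by (rule Bochner_Integration.integral_add)
       (intro integrable_mult_square[OF P(2) J(2) P(3) J(1)] integrable_mult_square[OF K(2) J(2) K(1) J(1)])+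
  also have "\<dots> = (\<integral>x. \<phi> (snd x) (fst x) \<bullet> (indicator {a<..b} (snd x) *\<^sub>R h (fst x)) \<partial>(M \<Otimes>\<^sub>M lborel))
     + max 0 (min b' b - max a' a) * (\<integral>\<omega>. k \<omega> \<bullet> h \<omega> \<partial>M)"
    by (simp only: step.IH simple_covariance[OF ab' ab0 step(5) h])
  also have "max 0 (min b' b - max a' a) * (\<integral>\<omega>. k \<omega> \<bullet> h \<omega> \<partial>M)
     = (\<integral>x. (indicator {a'<..b'} (snd x) *\<^sub>R k (fst x)) \<bullet> (indicator {a<..b} (snd x) *\<^sub>R h (fst x)) \<partial>(M \<Otimes>\<^sub>M lborel))"
    unfolding eq using integral_product_indicator[OF khi _ kh] by simp
  finally show ?case
    unfolding inner_add_left by (subst Bochner_Integration.integral_add[OF i1 i2])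
qed

text \<open>Adding a step changes the square by a cross term and by the square of the new step; both
  are instances of \<open>ito_simple_cross\<close>, the new step being a simple process
  itself.\<close>

lemma ito_simple_isometry:
  assumes "ito_simple s r \<phi> I" and sr: "0 \<le> s" "s \<le> r" "r \<le> T"
  shows "(\<integral>\<^sup>+\<omega>. ennreal ((I \<omega>)\<^sup>2) \<partial>M) = (\<integral>\<^sup>+x. ennreal ((norm (\<phi> (snd x) (fst x)))\<^sup>2) \<partial>(M \<Otimes>\<^sub>M lborel))"
proof -
  have int: "integrable (M \<Otimes>\<^sub>M lborel) (\<lambda>x. \<phi> (snd x) (fst x) \<bullet> \<psi> (snd x) (fst x))"
    if 1: "ito_simple s r \<phi> I" and 2: "ito_simple s r \<psi> J" for \<phi> \<psi> I J
  proof -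
    obtain c where c: "0 \<le> c" "\<And>u \<omega>. \<omega> \<in> space M \<Longrightarrow> norm (\<phi> u \<omega>) \<le> c * indicator {s<..r} u"
      using ito_simple_bounded[OF 1 sr] by blast
    obtain d where d: "0 \<le> d" "\<And>u \<omega>. \<omega> \<in> space M \<Longrightarrow> norm (\<psi> u \<omega>) \<le> d * indicator {s<..r} u"
      using ito_simple_bounded[OF 2 sr] by blast
    show ?thesis
    proof (rule integrable_product_bounded[where c="c * d" and s=s and r=r])
      show "(\<lambda>x. \<phi> (snd x) (fst x) \<bullet> \<psi> (snd x) (fst x)) \<in> borel_measurable (M \<Otimes>\<^sub>M lborel)"
        using ito_simple_props(1)[OF 1 sr] ito_simple_props(1)[OF 2 sr] by (auto simp: split_beta')
      fix \<omega> u assume \<omega>: "\<omega> \<in> space M"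
      have "\<bar>\<phi> u \<omega> \<bullet> \<psi> u \<omega>\<bar> \<le> (c * indicator {s<..r} u) * (d * indicator {s<..r} u)"
        using Cauchy_Schwarz_ineq2[of "\<phi> u \<omega>" "\<psi> u \<omega>"] mult_mono[OF c(2)[OF \<omega>, of u] d(2)[OF \<omega>, of u] _ norm_ge_zero] c(1) by fastforce
      then show "\<bar>\<phi> (snd (\<omega>, u)) (fst (\<omega>, u)) \<bullet> \<psi> (snd (\<omega>, u)) (fst (\<omega>, u))\<bar> \<le> c * d * indicator {s<..r} u"
        by (auto simp: indicator_def split: if_splits)
    qed
  qed
  have "(\<integral>\<omega>. (I \<omega>)\<^sup>2 \<partial>M) = (\<integral>x. \<phi> (snd x) (fst x) \<bullet> \<phi> (snd x) (fst x) \<partial>(M \<Otimes>\<^sub>M lborel))"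
    using assms(1)
  proof induction
    case zero
    then show ?case by simp
  next
    case (step \<phi> I a b h)
    have ab0: "0 \<le> a" "a \<le> b" "b \<le> T" using step sr by auto
    note P = ito_simple_props[OF step(1) sr]
    note J = bm_sq_integrable[OF ab0 step(5) ab0]
    have sing: "ito_simple s r (\<lambda>u \<omega>. indicator {a<..b} u *\<^sub>R h \<omega>) (\<lambda>\<omega>. h \<omega> \<bullet> (X b \<omega> - X a \<omega>))"
      using ito_simple.step[OF ito_simple.zero step(2-5)] by simp
    have "(\<integral>\<omega>. (I \<omega> + h \<omega> \<bullet> (X b \<omega> - X a \<omega>))\<^sup>2 \<partial>M)
      = (\<integral>\<omega>. (I \<omega>)\<^sup>2 + (2 * (I \<omega> * (h \<omega> \<bullet> (X b \<omega> - X a \<omega>))) + (h \<omega> \<bullet> (X b \<omega> - X a \<omega>)) * (h \<omega> \<bullet> (X b \<omega> - X a \<omega>))) \<partial>M)"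
      by (rule Bochner_Integration.integral_cong) (simp_all add: power2_eq_square algebra_simps)
    also have "\<dots> = (\<integral>\<omega>. (I \<omega>)\<^sup>2 \<partial>M) + (2 * (\<integral>\<omega>. I \<omega> * (h \<omega> \<bullet> (X b \<omega> - X a \<omega>)) \<partial>M)
          + (\<integral>\<omega>. (h \<omega> \<bullet> (X b \<omega> - X a \<omega>)) * (h \<omega> \<bullet> (X b \<omega> - X a \<omega>)) \<partial>M))"
      using P(3) J integrable_mult_square[OF P(2) J(2) P(3) J(1)] integrable_mult_square[OF J(2) J(2) J(1) J(1)]
      by (subst Bochner_Integration.integral_add, simp, simp, subst Bochner_Integration.integral_add, simp_all)
    also have "\<dots> = (\<integral>x. \<phi> (snd x) (fst x) \<bullet> \<phi> (snd x) (fst x) \<partial>(M \<Otimes>\<^sub>M lborel))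
      + (2 * (\<integral>x. \<phi> (snd x) (fst x) \<bullet> (indicator {a<..b} (snd x) *\<^sub>R h (fst x)) \<partial>(M \<Otimes>\<^sub>M lborel))
        + (\<integral>x. (indicator {a<..b} (snd x) *\<^sub>R h (fst x)) \<bullet> (indicator {a<..b} (snd x) *\<^sub>R h (fst x)) \<partial>(M \<Otimes>\<^sub>M lborel)))"
      by (simp only: step.IH ito_simple_cross[OF step(1) sr step(2-5)] ito_simple_cross[OF sing sr step(2-5)])
    also have "\<dots> = (\<integral>x. \<phi> (snd x) (fst x) \<bullet> \<phi> (snd x) (fst x)
       + (2 * (\<phi> (snd x) (fst x) \<bullet> (indicator {a<..b} (snd x) *\<^sub>R h (fst x)))
         + (indicator {a<..b} (snd x) *\<^sub>R h (fst x)) \<bullet> (indicator {a<..b} (snd x) *\<^sub>R h (fst x))) \<partial>(M \<Otimes>\<^sub>M lborel))"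
      using int[OF step(1) step(1)] int[OF step(1) sing] int[OF sing sing]
      by (subst Bochner_Integration.integral_add, simp, simp, subst Bochner_Integration.integral_add, simp_all)
    also have "\<dots> = (\<integral>x. (\<phi> (snd x) (fst x) + indicator {a<..b} (snd x) *\<^sub>R h (fst x)) \<bullet>
       (\<phi> (snd x) (fst x) + indicator {a<..b} (snd x) *\<^sub>R h (fst x)) \<partial>(M \<Otimes>\<^sub>M lborel))"
      by (rule Bochner_Integration.integral_cong) (auto simp: inner_add_left inner_add_right inner_commute)
    finally show ?case .
  qed
  then show ?thesis
    using ito_simple_props(3)[OF assms] int[OF assms(1) assms(1)]
    by (simp add: nn_integral_eq_integral power2_norm_eq_inner)
qed

end

section \<open>Limits of elementary integrals\<close>

context simple_integration
begin

text \<open>The approximants are arbitrary simple processes on {s..r} rather than those of a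
  partition, and the integrand is cut off to {s<..r} so that all intervals share one product
  space.\<close>

definition ito_limit :: "real \<Rightarrow> real \<Rightarrow> (real \<Rightarrow> 'w \<Rightarrow> 'b) \<Rightarrow> ('w \<Rightarrow> real) \<Rightarrow> bool" where
  "ito_limit s r \<phi> w \<longleftrightarrow> w \<in> borel_measurable M \<and> (\<exists>\<phi>k Ik. (\<forall>k::nat. ito_simple s r (\<phi>k k) (Ik k)) \<and>
     (\<lambda>k. \<integral>\<^sup>+x. ennreal ((norm (\<phi>k k (snd x) (fst x) - indicator {s<..r} (snd x) *\<^sub>R \<phi> (snd x) (fst x)))\<^sup>2) \<partial>(M \<Otimes>\<^sub>M lborel)) \<longlonglongrightarrow> 0 \<and>
     (\<lambda>k. \<integral>\<^sup>+\<omega>. ennreal ((Ik k \<omega> - w \<omega>)\<^sup>2) \<partial>M) \<longlonglongrightarrow> 0)"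

text \<open>Two freedoms are built in: the weight \<theta> makes this a conditional isometry, and
  the subtracted simple process measures how far w is from an elementary integral. Both are
  inherited from the approximants, and equality follows by using \<open>L2_limit_le\<close> in both
  directions.\<close>

lemma ito_limit_isometry:
  assumes lim: "ito_limit s r \<phi> w" and sr: "0 \<le> s" "s \<le> r" "r \<le> T"
    and \<phi>: "(\<lambda>x. \<phi> (snd x) (fst x)) \<in> borel_measurable (M \<Otimes>\<^sub>M lborel)"
    and e: "ito_simple s r \<psi> e" and \<theta>: "bounded_measurable (\<Phi> s r) (\<theta> :: 'w \<Rightarrow> real)"
  shows "(\<integral>\<^sup>+\<omega>. ennreal ((\<theta> \<omega> * (w \<omega> - e \<omega>))\<^sup>2) \<partial>M)
    = (\<integral>\<^sup>+x. ennreal ((norm (\<theta> (fst x) *\<^sub>R (indicator {s<..r} (snd x) *\<^sub>R \<phi> (snd x) (fst x) - \<psi> (snd x) (fst x))))\<^sup>2) \<partial>(M \<Otimes>\<^sub>M lborel))"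
proof -
  obtain \<phi>k Ik where w: "w \<in> borel_measurable M" and k: "\<And>k::nat. ito_simple s r (\<phi>k k) (Ik k)"
    and l1: "(\<lambda>k. \<integral>\<^sup>+x. ennreal ((norm (\<phi>k k (snd x) (fst x) - indicator {s<..r} (snd x) *\<^sub>R \<phi> (snd x) (fst x)))\<^sup>2) \<partial>(M \<Otimes>\<^sub>M lborel)) \<longlonglongrightarrow> 0"
    and l2: "(\<lambda>k. \<integral>\<^sup>+\<omega>. ennreal ((Ik k \<omega> - w \<omega>)\<^sup>2) \<partial>M) \<longlonglongrightarrow> 0"
    using lim unfolding ito_limit_def by auto
  note [measurable] = w \<phi> ito_simple_props(2)[OF k sr] ito_simple_props(2)[OF e sr]
  have [measurable]: "(\<lambda>x. \<phi>k k (snd x) (fst x)) \<in> borel_measurable (M \<Otimes>\<^sub>M lborel)" for k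
    using ito_simple_props(1)[OF k sr] by (simp add: split_beta')
  have [measurable]: "(\<lambda>x. \<psi> (snd x) (fst x)) \<in> borel_measurable (M \<Otimes>\<^sub>M lborel)"
    using ito_simple_props(1)[OF e sr] by (simp add: split_beta')
  have [measurable]: "\<theta> \<in> borel_measurable M"
    using measurable_from_subalg[OF sub[OF sr]] \<theta> by (auto simp: bounded_measurable_def)
  obtain c where c: "\<And>\<omega>. \<omega> \<in> space M \<Longrightarrow> \<bar>\<theta> \<omega>\<bar> \<le> c"
    using \<theta> space_\<Phi>[OF sr] by (auto simp: bounded_measurable_def)
  have c2: "(\<theta> \<omega>)\<^sup>2 \<le> c\<^sup>2" if "\<omega> \<in> space M" for \<omega>
    using c[OF that] power_mono[of "\<bar>\<theta> \<omega>\<bar>" c 2] by simp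
  have eq: "(\<integral>\<^sup>+\<omega>. ennreal ((norm (\<theta> \<omega> * (Ik k \<omega> - e \<omega>)))\<^sup>2) \<partial>M)
    = (\<integral>\<^sup>+x. ennreal ((norm (\<theta> (fst x) *\<^sub>R (\<phi>k k (snd x) (fst x) - \<psi> (snd x) (fst x))))\<^sup>2) \<partial>(M \<Otimes>\<^sub>M lborel))" for k
    using ito_simple_isometry[OF ito_simple_scale[OF ito_simple_diff[OF e k] sr \<theta>] sr] by simp
  have L1: "(\<lambda>k. \<integral>\<^sup>+x. ennreal ((norm (\<theta> (fst x) *\<^sub>R (\<phi>k k (snd x) (fst x) - \<psi> (snd x) (fst x))
        - \<theta> (fst x) *\<^sub>R (indicator {s<..r} (snd x) *\<^sub>R \<phi> (snd x) (fst x) - \<psi> (snd x) (fst x))))\<^sup>2) \<partial>(M \<Otimes>\<^sub>M lborel)) \<longlonglongrightarrow> 0"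
  proof (rule tendsto_sandwich[OF _ _ tendsto_const])
    have "(\<lambda>k. ennreal (c\<^sup>2) * (\<integral>\<^sup>+x. ennreal ((norm (\<phi>k k (snd x) (fst x) - indicator {s<..r} (snd x) *\<^sub>R \<phi> (snd x) (fst x)))\<^sup>2) \<partial>(M \<Otimes>\<^sub>M lborel)))
      \<longlonglongrightarrow> ennreal (c\<^sup>2) * 0"
      by (rule ennreal_tendsto_cmult[OF _ l1]) simp
    then show "(\<lambda>k. ennreal (c\<^sup>2) * (\<integral>\<^sup>+x. ennreal ((norm (\<phi>k k (snd x) (fst x) - indicator {s<..r} (snd x) *\<^sub>R \<phi> (snd x) (fst x)))\<^sup>2) \<partial>(M \<Otimes>\<^sub>M lborel))) \<longlonglongrightarrow> 0"
      by simp
    show "\<forall>\<^sub>F k in sequentially. (\<integral>\<^sup>+x. ennreal ((norm (\<theta> (fst x) *\<^sub>R (\<phi>k k (snd x) (fst x) - \<psi> (snd x) (fst x))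
        - \<theta> (fst x) *\<^sub>R (indicator {s<..r} (snd x) *\<^sub>R \<phi> (snd x) (fst x) - \<psi> (snd x) (fst x))))\<^sup>2) \<partial>(M \<Otimes>\<^sub>M lborel))
       \<le> ennreal (c\<^sup>2) * (\<integral>\<^sup>+x. ennreal ((norm (\<phi>k k (snd x) (fst x) - indicator {s<..r} (snd x) *\<^sub>R \<phi> (snd x) (fst x)))\<^sup>2) \<partial>(M \<Otimes>\<^sub>M lborel))"
    proof (intro always_eventually allI)
      fix k
      show "(\<integral>\<^sup>+x. ennreal ((norm (\<theta> (fst x) *\<^sub>R (\<phi>k k (snd x) (fst x) - \<psi> (snd x) (fst x))
        - \<theta> (fst x) *\<^sub>R (indicator {s<..r} (snd x) *\<^sub>R \<phi> (snd x) (fst x) - \<psi> (snd x) (fst x))))\<^sup>2) \<partial>(M \<Otimes>\<^sub>M lborel))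
       \<le> ennreal (c\<^sup>2) * (\<integral>\<^sup>+x. ennreal ((norm (\<phi>k k (snd x) (fst x) - indicator {s<..r} (snd x) *\<^sub>R \<phi> (snd x) (fst x)))\<^sup>2) \<partial>(M \<Otimes>\<^sub>M lborel))"
        by (subst nn_integral_cmult[symmetric], simp, intro nn_integral_mono,
            simp add: ennreal_mult[symmetric] scaleR_diff_right[symmetric] power_mult_distrib)
           (auto simp: space_pair_measure intro!: mult_right_mono ennreal_leI c2)
    qed
  qed simp
  have L2: "(\<lambda>k. \<integral>\<^sup>+\<omega>. ennreal ((norm (\<theta> \<omega> * (Ik k \<omega> - e \<omega>) - \<theta> \<omega> * (w \<omega> - e \<omega>)))\<^sup>2) \<partial>M) \<longlonglongrightarrow> 0"
  proof (rule tendsto_sandwich[OF _ _ tendsto_const])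
    have "(\<lambda>k. ennreal (c\<^sup>2) * (\<integral>\<^sup>+\<omega>. ennreal ((Ik k \<omega> - w \<omega>)\<^sup>2) \<partial>M)) \<longlonglongrightarrow> ennreal (c\<^sup>2) * 0"
      by (rule ennreal_tendsto_cmult[OF _ l2]) simp
    then show "(\<lambda>k. ennreal (c\<^sup>2) * (\<integral>\<^sup>+\<omega>. ennreal ((Ik k \<omega> - w \<omega>)\<^sup>2) \<partial>M)) \<longlonglongrightarrow> 0"
      by simp
    show "\<forall>\<^sub>F k in sequentially. (\<integral>\<^sup>+\<omega>. ennreal ((norm (\<theta> \<omega> * (Ik k \<omega> - e \<omega>) - \<theta> \<omega> * (w \<omega> - e \<omega>)))\<^sup>2) \<partial>M)
        \<le> ennreal (c\<^sup>2) * (\<integral>\<^sup>+\<omega>. ennreal ((Ik k \<omega> - w \<omega>)\<^sup>2) \<partial>M)"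
      by (intro always_eventually allI, subst nn_integral_cmult[symmetric], simp, intro nn_integral_mono,
          simp add: ennreal_mult[symmetric] right_diff_distrib[symmetric] power_mult_distrib)
         (auto intro!: mult_right_mono ennreal_leI c2)
  qed simp
  have "(\<integral>\<^sup>+\<omega>. ennreal ((norm (\<theta> \<omega> * (w \<omega> - e \<omega>)))\<^sup>2) \<partial>M)
    = (\<integral>\<^sup>+x. ennreal ((norm (\<theta> (fst x) *\<^sub>R (indicator {s<..r} (snd x) *\<^sub>R \<phi> (snd x) (fst x) - \<psi> (snd x) (fst x))))\<^sup>2) \<partial>(M \<Otimes>\<^sub>M lborel))"
    by (intro antisym L2_limit_le[OF _ _ _ _ _ L2 L1] L2_limit_le[OF _ _ _ _ _ L1 L2]) (auto simp only: eq, measurable)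
  then show ?thesis by simp
qed

lemma ito_limit_sq_integrable:
  assumes lim: "ito_limit s r \<phi> w" and sr: "0 \<le> s" "s \<le> r" "r \<le> T"
  shows "w \<in> borel_measurable M" "integrable M (\<lambda>\<omega>. (w \<omega>)\<^sup>2)"
proof -
  obtain \<phi>k Ik where w: "w \<in> borel_measurable M" and k: "\<And>k::nat. ito_simple s r (\<phi>k k) (Ik k)"
    and l2: "(\<lambda>k. \<integral>\<^sup>+\<omega>. ennreal ((Ik k \<omega> - w \<omega>)\<^sup>2) \<partial>M) \<longlonglongrightarrow> 0"
    using lim unfolding ito_limit_def by auto
  show "w \<in> borel_measurable M" by fact
  note [measurable] = w ito_simple_props(2)[OF k sr]
  obtain k where "(\<integral>\<^sup>+\<omega>. ennreal ((Ik k \<omega> - w \<omega>)\<^sup>2) \<partial>M) < 1"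
    using order_tendstoD(2)[OF l2, of 1] by (auto simp: eventually_sequentially)
  then have i: "integrable M (\<lambda>\<omega>. (Ik k \<omega> - w \<omega>)\<^sup>2)"
    by (subst nn_integral_square_finite_iff) (auto intro: less_trans)
  show "integrable M (\<lambda>\<omega>. (w \<omega>)\<^sup>2)"
  proof (rule Bochner_Integration.integrable_bound[where f="\<lambda>\<omega>. 2 * (Ik k \<omega>)\<^sup>2 + 2 * (Ik k \<omega> - w \<omega>)\<^sup>2"])
    have "y\<^sup>2 \<le> 2 * x\<^sup>2 + 2 * (x - y)\<^sup>2" for x y :: real
    proof -
      have "0 \<le> (2 * x - y)\<^sup>2" by simp
      then show ?thesis by (simp add: power2_eq_square algebra_simps)
    qed
    then show "AE \<omega> in M. norm ((w \<omega>)\<^sup>2) \<le> norm (2 * (Ik k \<omega>)\<^sup>2 + 2 * (Ik k \<omega> - w \<omega>)\<^sup>2)"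
      by (simp add: abs_of_nonneg)
  qed (use i ito_simple_props(3)[OF k sr] in auto)
qed

text \<open>Simple integrals are centred by construction and Cauchy-Schwarz carries this to the
  limit. The factor \<eta> is allowed to be any L^2 variable because it will be the first derivative
  of the test function, which is unbounded.\<close>

lemma ito_limit_mean:
  assumes lim: "ito_limit s r \<phi> w" and sr: "0 \<le> s" "s \<le> r" "r \<le> T"
    and \<eta>: "\<eta> \<in> borel_measurable (\<Phi> s r)" "integrable M (\<lambda>\<omega>. (\<eta> \<omega>)\<^sup>2)"
  shows "(\<integral>\<omega>. \<eta> \<omega> * w \<omega> \<partial>M) = 0"
proof -
  obtain \<phi>k Ik where k: "\<And>k::nat. ito_simple s r (\<phi>k k) (Ik k)"
    and l2: "(\<lambda>k. \<integral>\<^sup>+\<omega>. ennreal ((Ik k \<omega> - w \<omega>)\<^sup>2) \<partial>M) \<longlonglongrightarrow> 0"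
    using lim unfolding ito_limit_def by auto
  note w = ito_limit_sq_integrable[OF lim sr]
  have \<eta>M[measurable]: "\<eta> \<in> borel_measurable M" using measurable_from_subalg[OF sub[OF sr] \<eta>(1)] .
  note K = ito_simple_props[OF k sr]
  have dm: "(\<lambda>\<omega>. Ik k \<omega> - w \<omega>) \<in> borel_measurable M" for k using w K by auto
  have d: "integrable M (\<lambda>\<omega>. (Ik k \<omega> - w \<omega>)\<^sup>2)" for k
    unfolding power2_diff using w K(3)[of k] integrable_mult_square[OF K(2)[of k] w(1) K(3)[of k] w(2)]
    by (auto simp: mult.assoc)
  have "(\<lambda>k. ennreal (\<integral>\<omega>. (Ik k \<omega> - w \<omega>)\<^sup>2 \<partial>M)) \<longlonglongrightarrow> ennreal 0"
    using l2 d by (simp add: nn_integral_eq_integral)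
  then have "(\<lambda>k. \<integral>\<omega>. (Ik k \<omega> - w \<omega>)\<^sup>2 \<partial>M) \<longlonglongrightarrow> 0"
    by (subst (asm) tendsto_ennreal_iff) auto
  then have l: "(\<lambda>k. sqrt (\<integral>\<omega>. (\<eta> \<omega>)\<^sup>2 \<partial>M) * sqrt (\<integral>\<omega>. (Ik k \<omega> - w \<omega>)\<^sup>2 \<partial>M)) \<longlonglongrightarrow> sqrt (\<integral>\<omega>. (\<eta> \<omega>)\<^sup>2 \<partial>M) * sqrt 0"
    by (intro tendsto_mult tendsto_const tendsto_real_sqrt)
  have "\<bar>\<integral>\<omega>. \<eta> \<omega> * w \<omega> \<partial>M\<bar> \<le> sqrt (\<integral>\<omega>. (\<eta> \<omega>)\<^sup>2 \<partial>M) * sqrt (\<integral>\<omega>. (Ik k \<omega> - w \<omega>)\<^sup>2 \<partial>M)" for k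
  proof -
    have "(\<integral>\<omega>. \<eta> \<omega> * (Ik k \<omega> - w \<omega>) \<partial>M) = (\<integral>\<omega>. \<eta> \<omega> * Ik k \<omega> \<partial>M) - (\<integral>\<omega>. \<eta> \<omega> * w \<omega> \<partial>M)"
      unfolding right_diff_distrib
      by (intro Bochner_Integration.integral_diff integrable_mult_square \<eta>M w K \<eta>(2))
    then have "\<bar>\<integral>\<omega>. \<eta> \<omega> * w \<omega> \<partial>M\<bar> = \<bar>\<integral>\<omega>. \<eta> \<omega> * (Ik k \<omega> - w \<omega>) \<partial>M\<bar>"
      using K(5)[OF \<eta>, of k] by simp
    also have "\<dots> \<le> (\<integral>\<omega>. \<bar>\<eta> \<omega> * (Ik k \<omega> - w \<omega>)\<bar> \<partial>M)" by (rule integral_abs_bound)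
    also have "\<dots> \<le> sqrt (\<integral>\<omega>. (\<eta> \<omega>)\<^sup>2 \<partial>M) * sqrt (\<integral>\<omega>. (Ik k \<omega> - w \<omega>)\<^sup>2 \<partial>M)"
      by (rule integral_Cauchy_Schwarz[OF \<eta>M \<eta>(2) dm d])
    finally show ?thesis .
  qed
  then have "\<bar>\<integral>\<omega>. \<eta> \<omega> * w \<omega> \<partial>M\<bar> \<le> sqrt (\<integral>\<omega>. (\<eta> \<omega>)\<^sup>2 \<partial>M) * sqrt 0"
    by (intro LIMSEQ_le_const[OF l]) auto
  then show ?thesis by simp
qed

end

text \<open>Clamping the points of a partition cuts each of its intervals down to the part inside
  {s..r} while keeping the index set; the intervals outside become degenerate.\<close>

definition clamp_time :: "real \<Rightarrow> real \<Rightarrow> real \<Rightarrow> real" where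
  "clamp_time s r u = max s (min r u)"

lemma indicator_clamp_time:
  "s \<le> r \<Longrightarrow> p \<le> q \<Longrightarrow>
    (indicator {clamp_time s r p<..clamp_time s r q} u :: real) = indicator {s<..r} u * indicator {p<..q} u"
  by (auto simp: indicator_def clamp_time_def)

lemma clamp_time_increment:
  assumes "a \<le> s" "s \<le> r"
  shows "X (clamp_time a r q) - X (clamp_time a r p) =
    (X (clamp_time a s q) - X (clamp_time a s p)) + (X (clamp_time s r q) - (X (clamp_time s r p) :: 'a::ab_group_add))"
proof -
  \<comment> \<open>One of the two clamped times on the right is s itself, so the surplus X s is the
    same for every q and cancels in increments.\<close>
  have "X (clamp_time a r q) = X (clamp_time a s q) + X (clamp_time s r q) - X s" for q
    using assms by (cases "q \<le> s") (auto simp: clamp_time_def max_def min_def)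
  then show ?thesis by simp
qed

lemma partition_of_range:
  assumes "partition_of a b n p" "i \<le> n"
  shows "a \<le> p i" "p i \<le> b"
proof -
  have mono: "p i \<le> p j" if "i \<le> j" "j \<le> n" for i j
    using that assms(1) by (induction rule: dec_induct) (auto simp: partition_of_def intro: order_trans)
  show "a \<le> p i" "p i \<le> b" using mono[of 0 i] mono[of i n] assms by (auto simp: partition_of_def)
qed

lemma elementary_integral_split:
  assumes p: "partition_of a b n p" and s: "a \<le> s" "s \<le> b"
  shows "elementary_integral X n p h \<omega> =
    elementary_integral X n (\<lambda>i. clamp_time a s (p i)) h \<omega> + elementary_integral X n (\<lambda>i. clamp_time s b (p i)) h \<omega>"
  unfolding elementary_integral_def sum.distrib[symmetric]
proof (rule sum.cong[OF refl])
  fix i assume "i \<in> {..<n}"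
  then have "a \<le> p i" "p i \<le> b" "a \<le> p (Suc i)" "p (Suc i) \<le> b"
    using partition_of_range[OF p, of i] partition_of_range[OF p, of "Suc i"] by auto
  then have "clamp_time a b (p i) = p i" "clamp_time a b (p (Suc i)) = p (Suc i)" by (auto simp: clamp_time_def)
  then show "h i \<omega> \<bullet> (X (p (Suc i)) \<omega> - X (p i) \<omega>) = h i \<omega> \<bullet> (X (clamp_time a s (p (Suc i))) \<omega> - X (clamp_time a s (p i)) \<omega>)
     + h i \<omega> \<bullet> (X (clamp_time s b (p (Suc i))) \<omega> - X (clamp_time s b (p i)) \<omega>)"
    using clamp_time_increment[OF s, of "\<lambda>u. X u \<omega>" "p (Suc i)" "p i"]
    by (simp add: inner_add_right[symmetric])
qed

context simple_integration
begin

lemma ito_simple_step_process: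
  assumes p: "partition_of a b n p" and ab: "0 \<le> a" "b \<le> T" and sr: "a \<le> s" "s \<le> r" "r \<le> b"
    and h: "\<And>i. i < n \<Longrightarrow> bounded_measurable (\<Phi> (p i) (p (Suc i))) (h i)"
  shows "ito_simple s r (\<lambda>u \<omega>. indicator {s<..r} u *\<^sub>R step_process n p h u \<omega>)
    (elementary_integral X n (\<lambda>i. clamp_time s r (p i)) h)"
proof -
  let ?c = "clamp_time s r"
  have "ito_simple s r (\<lambda>u \<omega>. indicator {s<..r} u *\<^sub>R step_process m p h u \<omega>)
    (elementary_integral X m (\<lambda>i. ?c (p i)) h)" if "m \<le> n" for m
    using that
  proof (induction m)
    case 0
    show ?case by (rule ito_simple_cong[OF ito_simple.zero]) (auto simp: step_process_def elementary_integral_def)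
  next
    case (Suc m)
    have pm: "p m \<le> p (Suc m)" "0 \<le> p m" "p (Suc m) \<le> T"
      using p ab Suc partition_of_range[OF p, of m] partition_of_range[OF p, of "Suc m"] by (auto simp: partition_of_def)
    have cm: "s \<le> ?c (p m)" "?c (p m) \<le> ?c (p (Suc m))" "?c (p (Suc m)) \<le> r"
      using pm sr by (auto simp: clamp_time_def)
    have IH: "ito_simple s r (\<lambda>u \<omega>. indicator {s<..r} u *\<^sub>R step_process m p h u \<omega>)
      (elementary_integral X m (\<lambda>i. ?c (p i)) h)" using Suc by simp
    show ?case
    \<comment> \<open>An interval outside {s..r} collapses to an end point that may lie outside {p
      m..p (Suc m)}; \<open>h m\<close> need not be admissible there, but its step contributes
      nothing. A clamped interval that does not collapse lies inside the original one.\<close>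
    proof (cases "?c (p m) = ?c (p (Suc m))")
      case True
      have "(indicator {s<..r} u * indicator {p m<..p (Suc m)} u :: real) = 0" for u
        unfolding indicator_clamp_time[OF sr(2) pm(1), symmetric] True by simp
      then have "indicator {s<..r} u *\<^sub>R indicator {p m<..p (Suc m)} u *\<^sub>R h m \<omega> = 0" for u \<omega>
        by (simp add: scaleR_scaleR)
      then show ?thesis
        by (intro ito_simple_cong[OF IH]) (auto simp: step_process_def elementary_integral_def True scaleR_add_right)
    next
      case False
      then have "p m \<le> ?c (p m)" "?c (p (Suc m)) \<le> p (Suc m)"
        using pm sr by (auto simp: clamp_time_def max_def min_def split: if_splits)
      then have "bounded_measurable (\<Phi> (?c (p m)) (?c (p (Suc m)))) (h m)"
        using bm_\<Phi>_mono[OF pm(2) _ cm(2) _ pm(3) h[of m]] Suc.prems by auto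
      from ito_simple.step[OF IH cm this]
      show ?thesis
        by (rule ito_simple_cong)
           (auto simp: step_process_def elementary_integral_def scaleR_add_right indicator_clamp_time[OF sr(2) pm(1)])
    qed
  qed
  then show ?thesis by simp
qed

end

text \<open>A null set of the first factor times the whole second space is null by sigma-finiteness;
  going through this measurable cylinder avoids any measurability question about P.\<close>

lemma (in sigma_finite_measure) AE_pair_fst:
  assumes "AE \<omega> in N. P \<omega>"
  shows "AE x in N \<Otimes>\<^sub>M M. P (fst x)"
proof -
  obtain A where A: "{\<omega>\<in>space N. \<not> P \<omega>} \<subseteq> A" "A \<in> sets N" "emeasure N A = 0"
    using AE_E[OF assms] by blast
  have "emeasure (N \<Otimes>\<^sub>M M) (A \<times> space M) = emeasure N A * emeasure M (space M)"
    by (rule emeasure_pair_measure_Times) (use A in auto)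
  then have "A \<times> space M \<in> null_sets (N \<Otimes>\<^sub>M M)"
    using A by (auto simp: null_sets_def)
  moreover have "{x\<in>space (N \<Otimes>\<^sub>M M). \<not> P (fst x)} \<subseteq> A \<times> space M"
    using A(1) by (auto simp: space_pair_measure)
  ultimately show ?thesis by (rule AE_I')
qed

lemma sigma_finite_restrict_lborel: "sigma_finite_measure (restrict_space lborel {a..b::real})"
  by (rule sigma_finite_measure_restrict_space) (auto intro: lborel.sigma_finite_measure_axioms)

text \<open>Time passes from the restricted space to the line with an indicator. The left end point,
  being null, is dropped so as to match the half-open steps.\<close>

lemma nn_integral_restrict_lborel_pair:
  fixes a b :: real
  assumes F[measurable]: "F \<in> borel_measurable (M \<Otimes>\<^sub>M lborel)"
  shows "(\<integral>\<^sup>+x. F x \<partial>(M \<Otimes>\<^sub>M restrict_space lborel {a..b}))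
    = (\<integral>\<^sup>+x. F x * indicator {a<..b} (snd x) \<partial>(M \<Otimes>\<^sub>M lborel))"
proof -
  interpret R: sigma_finite_measure "restrict_space lborel {a..b}" by (rule sigma_finite_restrict_lborel)
  have id: "(\<lambda>x. (fst x, snd x)) \<in> M \<Otimes>\<^sub>M restrict_space lborel {a..b} \<rightarrow>\<^sub>M M \<Otimes>\<^sub>M lborel"
  proof (rule measurable_Pair)
    show "snd \<in> M \<Otimes>\<^sub>M restrict_space lborel {a..b} \<rightarrow>\<^sub>M lborel"
    proof -
      have "(\<lambda>x. x) \<in> restrict_space lborel {a..b} \<rightarrow>\<^sub>M lborel" by (rule measurable_restrict_space1) simp
      from measurable_compose[OF measurable_snd this] show ?thesis by simp
    qed
  qed simp
  have FR: "F \<in> borel_measurable (M \<Otimes>\<^sub>M restrict_space lborel {a..b})"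
    using measurable_compose[OF id F] by simp
  have "(\<integral>\<^sup>+x. F x \<partial>(M \<Otimes>\<^sub>M restrict_space lborel {a..b})) = (\<integral>\<^sup>+\<omega>. (\<integral>\<^sup>+u. F (\<omega>, u) \<partial>restrict_space lborel {a..b}) \<partial>M)"
    by (rule R.nn_integral_fst[symmetric]) (rule FR)
  also have "\<dots> = (\<integral>\<^sup>+\<omega>. (\<integral>\<^sup>+u. F (\<omega>, u) * indicator {a..b} u \<partial>lborel) \<partial>M)"
    by (simp add: nn_integral_restrict_space)
  also have "\<dots> = (\<integral>\<^sup>+\<omega>. (\<integral>\<^sup>+u. F (\<omega>, u) * indicator {a<..b} u \<partial>lborel) \<partial>M)"
  proof (rule nn_integral_cong, rule nn_integral_cong_AE)
    fix \<omega>
    show "AE u in lborel. F (\<omega>, u) * indicator {a..b} u = F (\<omega>, u) * indicator {a<..b} u"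
      using AE_lborel_singleton[of a] by eventually_elim (auto simp: indicator_def)
  qed
  also have "\<dots> = (\<integral>\<^sup>+x. F x * indicator {a<..b} (snd x) \<partial>(M \<Otimes>\<^sub>M lborel))"
    by (subst lborel.nn_integral_fst[symmetric]) auto
  finally show ?thesis .
qed

lemma tendsto_0_nn_integral_le:
  fixes f g :: "nat \<Rightarrow> ennreal"
  assumes "g \<longlonglongrightarrow> 0" "\<And>k. f k \<le> g k"
  shows "f \<longlonglongrightarrow> 0"
  by (rule tendsto_sandwich[OF _ _ tendsto_const assms(1)]) (use assms(2) in auto)

context simple_integration
begin

lemma step_process_measurable:
  assumes "\<And>i. i < n \<Longrightarrow> h i \<in> borel_measurable M"
  shows "(\<lambda>x. step_process n p h (snd x) (fst x)) \<in> borel_measurable (M \<Otimes>\<^sub>M lborel)"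
  unfolding step_process_def
proof (intro borel_measurable_sum)
  fix i assume "i \<in> {..<n}"
  then have [measurable]: "h i \<in> borel_measurable M" using assms by simp
  show "(\<lambda>x. indicat_real {p i<..p (Suc i)} (snd x) *\<^sub>R h i (fst x)) \<in> borel_measurable (M \<Otimes>\<^sub>M lborel)"
    by measurable
qed

definition elementary_approx where
  "elementary_approx a b (n::nat) p h \<longleftrightarrow> partition_of a b n p \<and> (\<forall>i<n. bounded_measurable (\<Phi> (p i) (p (Suc i))) (h i))"

lemma elementary_approx_measurable:
  assumes "elementary_approx a b n p h" "0 \<le> a" "b \<le> T"
  shows "(\<lambda>x. step_process n p h (snd x) (fst x)) \<in> borel_measurable (M \<Otimes>\<^sub>M lborel)"
proof (rule step_process_measurable)
  fix i assume "i < n"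
  then have "0 \<le> p i" "p i \<le> p (Suc i)" "p (Suc i) \<le> T"
    using assms partition_of_range[of a b n p i] partition_of_range[of a b n p "Suc i"]
    by (auto simp: elementary_approx_def partition_of_def)
  then show "h i \<in> borel_measurable M" using bm_imp_meas assms(1) \<open>i < n\<close> by (auto simp: elementary_approx_def)
qed

text \<open>The integrand in the definition is measurable only for a completion. It is exchanged for
  a version measurable on the product that agrees with it at all times on almost every path, which
  changes no integral against the product measure.\<close>

lemma L2_limit_of_elementaryE:
  assumes lim: "L2_limit_of_elementary M adm X a b \<phi>0 I" and ab: "0 \<le> a" "a \<le> b" "b \<le> T"
    and adm: "\<And>n p h. adm n p h \<Longrightarrow> \<forall>i<n. h i \<in> borel_measurable (\<Phi> (p i) (p (Suc i)))"
    and \<phi>[measurable]: "(\<lambda>x. \<phi> (snd x) (fst x)) \<in> borel_measurable (M \<Otimes>\<^sub>M lborel)"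
    and eq: "AE \<omega> in M. \<forall>u\<in>{a..b}. \<phi>0 u \<omega> = \<phi> u \<omega>"
  obtains n p h where "\<And>k::nat. elementary_approx a b (n k) (p k) (h k)"
    and "(\<lambda>k. \<integral>\<^sup>+x. ennreal ((norm (step_process (n k) (p k) (h k) (snd x) (fst x) - \<phi> (snd x) (fst x)))\<^sup>2)
            * indicator {a<..b} (snd x) \<partial>(M \<Otimes>\<^sub>M lborel)) \<longlonglongrightarrow> 0"
    and "(\<lambda>k. \<integral>\<^sup>+\<omega>. ennreal ((elementary_integral X (n k) (p k) (h k) \<omega> - I \<omega>)\<^sup>2) \<partial>M) \<longlonglongrightarrow> 0"
    and "I \<in> borel_measurable M"
proof -
  obtain n p h where A: "\<And>k. partition_of a b (n k) (p k)" "\<And>k i. i < n k \<Longrightarrow> \<exists>c. \<forall>\<omega>\<in>space M. norm (h k i \<omega>) \<le> c"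
      "\<And>k. adm (n k) (p k) (h k)"
    and B: "(\<lambda>k. \<integral>\<^sup>+(\<omega>, s). ennreal ((norm (step_process (n k) (p k) (h k) s \<omega> - \<phi>0 s \<omega>))\<^sup>2)
               \<partial>(M \<Otimes>\<^sub>M restrict_space lborel {a..b})) \<longlonglongrightarrow> 0"
    and C: "(\<lambda>k. \<integral>\<^sup>+\<omega>. ennreal ((elementary_integral X (n k) (p k) (h k) \<omega> - I \<omega>)\<^sup>2) \<partial>M) \<longlonglongrightarrow> 0"
    and D: "I \<in> borel_measurable M"
    using lim unfolding L2_limit_of_elementary_def by blast
  have E: "elementary_approx a b (n k) (p k) (h k)" for k
    unfolding elementary_approx_def
  proof (intro conjI allI impI A(1))
    fix i assume i: "i < n k"
    have "0 \<le> p k i" "p k i \<le> p k (Suc i)" "p k (Suc i) \<le> T"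
      using i ab A(1)[of k] partition_of_range[OF A(1), of i k] partition_of_range[OF A(1), of "Suc i" k]
      by (auto simp: partition_of_def)
    then show "bounded_measurable (\<Phi> (p k i) (p k (Suc i))) (h k i)"
      using adm[OF A(3)] A(2)[OF i] i space_\<Phi> by (auto simp: bounded_measurable_def)
  qed
  interpret R: sigma_finite_measure "restrict_space lborel {a..b}" by (rule sigma_finite_restrict_lborel)
  have "(\<integral>\<^sup>+(\<omega>, s). ennreal ((norm (step_process (n k) (p k) (h k) s \<omega> - \<phi>0 s \<omega>))\<^sup>2)
               \<partial>(M \<Otimes>\<^sub>M restrict_space lborel {a..b}))
     = (\<integral>\<^sup>+x. ennreal ((norm (step_process (n k) (p k) (h k) (snd x) (fst x) - \<phi> (snd x) (fst x)))\<^sup>2)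
            * indicator {a<..b} (snd x) \<partial>(M \<Otimes>\<^sub>M lborel))" for k
  proof -
    note [measurable] = elementary_approx_measurable[OF E ab(1,3)]
    have "(\<integral>\<^sup>+(\<omega>, s). ennreal ((norm (step_process (n k) (p k) (h k) s \<omega> - \<phi>0 s \<omega>))\<^sup>2)
               \<partial>(M \<Otimes>\<^sub>M restrict_space lborel {a..b}))
      = (\<integral>\<^sup>+x. ennreal ((norm (step_process (n k) (p k) (h k) (snd x) (fst x) - \<phi> (snd x) (fst x)))\<^sup>2)
               \<partial>(M \<Otimes>\<^sub>M restrict_space lborel {a..b}))"
    proof (rule nn_integral_cong_AE)
      show "AE x in M \<Otimes>\<^sub>M restrict_space lborel {a..b}.
         (case x of (\<omega>, s) \<Rightarrow> ennreal ((norm (step_process (n k) (p k) (h k) s \<omega> - \<phi>0 s \<omega>))\<^sup>2)) =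
         ennreal ((norm (step_process (n k) (p k) (h k) (snd x) (fst x) - \<phi> (snd x) (fst x)))\<^sup>2)"
        using R.AE_pair_fst[OF eq] AE_space
        by eventually_elim (auto simp: space_pair_measure space_restrict_space)
    qed
    also have "\<dots> = (\<integral>\<^sup>+x. ennreal ((norm (step_process (n k) (p k) (h k) (snd x) (fst x) - \<phi> (snd x) (fst x)))\<^sup>2)
            * indicator {a<..b} (snd x) \<partial>(M \<Otimes>\<^sub>M lborel))"
      by (rule nn_integral_restrict_lborel_pair) measurable
    finally show ?thesis .
  qed
  with B have "(\<lambda>k. \<integral>\<^sup>+x. ennreal ((norm (step_process (n k) (p k) (h k) (snd x) (fst x) - \<phi> (snd x) (fst x)))\<^sup>2)
            * indicator {a<..b} (snd x) \<partial>(M \<Otimes>\<^sub>M lborel)) \<longlonglongrightarrow> 0" by simp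
  then show thesis by (rule that[OF E _ C D])
qed

lemma elementary_approx_ito_simple:
  assumes "elementary_approx a b n p h" and ab: "0 \<le> a" "b \<le> T" and sr: "a \<le> s" "s \<le> r" "r \<le> b"
  shows "ito_simple s r (\<lambda>u \<omega>. indicator {s<..r} u *\<^sub>R step_process n p h u \<omega>)
    (elementary_integral X n (\<lambda>i. clamp_time s r (p i)) h)"
  by (rule ito_simple_step_process[OF _ ab sr]) (use assms(1) in \<open>auto simp: elementary_approx_def\<close>)

text \<open>The integrals over {a..b} and {r..b} come with unrelated approximating sequences, so
  additivity in the interval is not built in. The first sequence is split at r. Its part beyond r
  and the second sequence approximate the same integrand there, hence have close integrals by the
  isometry, and the part before r is left to approximate I - J.\<close>

lemma ito_limit_increment:
  assumes lim: "L2_limit_of_elementary M adm X a b \<phi>0 I" "L2_limit_of_elementary M adm X r b \<phi>0 J"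
    and arb: "0 \<le> a" "a \<le> r" "r \<le> b" "b \<le> T"
    and adm: "\<And>n p h. adm n p h \<Longrightarrow> \<forall>i<n. h i \<in> borel_measurable (\<Phi> (p i) (p (Suc i)))"
    and \<phi>[measurable]: "(\<lambda>x. \<phi> (snd x) (fst x)) \<in> borel_measurable (M \<Otimes>\<^sub>M lborel)"
    and eq: "AE \<omega> in M. \<forall>u\<in>{a..b}. \<phi>0 u \<omega> = \<phi> u \<omega>"
  shows "ito_limit a r \<phi> (\<lambda>\<omega>. I \<omega> - J \<omega>)"
proof -
  let ?L = "M \<Otimes>\<^sub>M lborel"
  have ab: "a \<le> b" using arb by simp
  have eq': "AE \<omega> in M. \<forall>u\<in>{r..b}. \<phi>0 u \<omega> = \<phi> u \<omega>" using eq by eventually_elim (use arb in auto)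
  obtain n p h where E: "\<And>k::nat. elementary_approx a b (n k) (p k) (h k)"
    and B: "(\<lambda>k. \<integral>\<^sup>+x. ennreal ((norm (step_process (n k) (p k) (h k) (snd x) (fst x) - \<phi> (snd x) (fst x)))\<^sup>2)
            * indicator {a<..b} (snd x) \<partial>?L) \<longlonglongrightarrow> 0"
    and C: "(\<lambda>k. \<integral>\<^sup>+\<omega>. ennreal ((elementary_integral X (n k) (p k) (h k) \<omega> - I \<omega>)\<^sup>2) \<partial>M) \<longlonglongrightarrow> 0"
    and D: "I \<in> borel_measurable M"
    using L2_limit_of_elementaryE[OF lim(1) arb(1) ab arb(4) adm \<phi> eq] by blast
  obtain n' p' h' where E': "\<And>k::nat. elementary_approx r b (n' k) (p' k) (h' k)"
    and B': "(\<lambda>k. \<integral>\<^sup>+x. ennreal ((norm (step_process (n' k) (p' k) (h' k) (snd x) (fst x) - \<phi> (snd x) (fst x)))\<^sup>2)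
            * indicator {r<..b} (snd x) \<partial>?L) \<longlonglongrightarrow> 0"
    and C': "(\<lambda>k. \<integral>\<^sup>+\<omega>. ennreal ((elementary_integral X (n' k) (p' k) (h' k) \<omega> - J \<omega>)\<^sup>2) \<partial>M) \<longlonglongrightarrow> 0"
    and D': "J \<in> borel_measurable M"
    using L2_limit_of_elementaryE[OF lim(2) _ arb(3,4) adm \<phi> eq'] arb by auto
  have r0: "0 \<le> r" using arb by simp
  let ?S = "\<lambda>k x. step_process (n k) (p k) (h k) (snd x) (fst x)"
  let ?S' = "\<lambda>k x. step_process (n' k) (p' k) (h' k) (snd x) (fst x)"
  define e1 where "e1 k = elementary_integral X (n k) (p k) (h k)" for k
  define c0 where "c0 k = elementary_integral X (n k) (\<lambda>i. clamp_time a r (p k i)) (h k)" for k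
  define c1 where "c1 k = elementary_integral X (n k) (\<lambda>i. clamp_time r b (p k i)) (h k)" for k
  define e2 where "e2 k = elementary_integral X (n' k) (p' k) (h' k)" for k
  have e1: "e1 k \<omega> = c0 k \<omega> + c1 k \<omega>" for k \<omega>
    unfolding e1_def c0_def c1_def
    by (rule elementary_integral_split) (use E arb in \<open>auto simp: elementary_approx_def\<close>)
  have e2: "e2 k = elementary_integral X (n' k) (\<lambda>i. clamp_time r b (p' k i)) (h' k)" for k
    unfolding e2_def elementary_integral_def
  proof (intro ext sum.cong refl)
    fix \<omega> i assume "i \<in> {..<n' k}"
    then have "r \<le> p' k i" "p' k i \<le> b" "r \<le> p' k (Suc i)" "p' k (Suc i) \<le> b"
      using E' partition_of_range[of r b "n' k" "p' k" i] partition_of_range[of r b "n' k" "p' k" "Suc i"]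
      by (auto simp: elementary_approx_def)
    then show "h' k i \<omega> \<bullet> (X (p' k (Suc i)) \<omega> - X (p' k i) \<omega>) =
      h' k i \<omega> \<bullet> (X (clamp_time r b (p' k (Suc i))) \<omega> - X (clamp_time r b (p' k i)) \<omega>)"
      by (simp add: clamp_time_def)
  qed
  have s0: "ito_simple a r (\<lambda>u \<omega>. indicator {a<..r} u *\<^sub>R step_process (n k) (p k) (h k) u \<omega>) (c0 k)" for k
    unfolding c0_def by (rule elementary_approx_ito_simple[OF E]) (use arb in auto)
  have s1: "ito_simple r b (\<lambda>u \<omega>. indicator {r<..b} u *\<^sub>R step_process (n k) (p k) (h k) u \<omega>) (c1 k)" for k
    unfolding c1_def by (rule elementary_approx_ito_simple[OF E]) (use arb in auto)
  have s2: "ito_simple r b (\<lambda>u \<omega>. indicator {r<..b} u *\<^sub>R step_process (n' k) (p' k) (h' k) u \<omega>) (e2 k)" for k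
    unfolding e2 by (rule elementary_approx_ito_simple[OF E']) (use arb in auto)
  note [measurable] = D D' elementary_approx_measurable[OF E arb(1,4)] elementary_approx_measurable[OF E' r0 arb(4)]
    ito_simple_props(2)[OF s0 arb(1,2) order_trans[OF arb(3,4)]] ito_simple_props(2)[OF s1 r0 arb(3,4)] ito_simple_props(2)[OF s2 r0 arb(3,4)]
  have [measurable]: "e1 k \<in> borel_measurable M" for k
    unfolding e1[abs_def] by measurable
  have lim1: "(\<lambda>k. \<integral>\<^sup>+x. ennreal ((norm (indicator {a<..r} (snd x) *\<^sub>R ?S k x - indicator {a<..r} (snd x) *\<^sub>R \<phi> (snd x) (fst x)))\<^sup>2) \<partial>?L) \<longlonglongrightarrow> 0"
    by (rule tendsto_0_nn_integral_le[OF B], intro nn_integral_mono) (use arb in \<open>auto simp: indicator_def\<close>)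
  have three: "(x + y + z)\<^sup>2 \<le> 3 * (x\<^sup>2 + y\<^sup>2 + z\<^sup>2)" for x y z :: real
  proof -
    have "0 \<le> (x - y)\<^sup>2 + (y - z)\<^sup>2 + (x - z)\<^sup>2" by simp
    then show ?thesis by (simp add: power2_eq_square algebra_simps)
  qed
  have mid: "(\<integral>\<^sup>+\<omega>. ennreal ((c1 k \<omega> - e2 k \<omega>)\<^sup>2) \<partial>M) \<le> 
     2 * (\<integral>\<^sup>+x. ennreal ((norm (?S k x - \<phi> (snd x) (fst x)))\<^sup>2) * indicator {a<..b} (snd x) \<partial>?L) +
     2 * (\<integral>\<^sup>+x. ennreal ((norm (?S' k x - \<phi> (snd x) (fst x)))\<^sup>2) * indicator {r<..b} (snd x) \<partial>?L)" for k
  proof -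
    have pt: "(norm (x - y))\<^sup>2 \<le> 2 * (norm (x - z))\<^sup>2 + 2 * (norm (y - z))\<^sup>2" for x y z :: 'b
    proof -
      have "norm (x - y) \<le> norm (x - z) + norm (y - z)"
        using norm_triangle_ineq4[of "x - z" "y - z"] by simp
      then have "(norm (x - y))\<^sup>2 \<le> (norm (x - z) + norm (y - z))\<^sup>2" by (intro power_mono) auto
      also have "\<dots> \<le> 2 * (norm (x - z))\<^sup>2 + 2 * (norm (y - z))\<^sup>2"
        using sum_squares_bound[of "norm (x - z)" "norm (y - z)"] by (simp add: power2_sum)
      finally show ?thesis .
    qed
    have "(\<integral>\<^sup>+\<omega>. ennreal ((c1 k \<omega> - e2 k \<omega>)\<^sup>2) \<partial>M)
      = (\<integral>\<^sup>+x. ennreal ((norm (indicator {r<..b} (snd x) *\<^sub>R ?S k x - indicator {r<..b} (snd x) *\<^sub>R ?S' k x))\<^sup>2) \<partial>?L)"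
      by (rule ito_simple_isometry[OF ito_simple_diff[OF s2 s1] r0 arb(3,4)])
    also have "\<dots> \<le> (\<integral>\<^sup>+x. 2 * (ennreal ((norm (?S k x - \<phi> (snd x) (fst x)))\<^sup>2) * indicator {a<..b} (snd x)) +
      2 * (ennreal ((norm (?S' k x - \<phi> (snd x) (fst x)))\<^sup>2) * indicator {r<..b} (snd x)) \<partial>?L)"
    proof (intro nn_integral_mono)
      fix x :: "'w \<times> real"
      have "ennreal ((norm (?S k x - ?S' k x))\<^sup>2) \<le> ennreal (2 * (norm (?S k x - \<phi> (snd x) (fst x)))\<^sup>2 + 2 * (norm (?S' k x - \<phi> (snd x) (fst x)))\<^sup>2)"
        by (rule ennreal_leI) (rule pt)
      then show "ennreal ((norm (indicator {r<..b} (snd x) *\<^sub>R ?S k x - indicator {r<..b} (snd x) *\<^sub>R ?S' k x))\<^sup>2)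
        \<le> 2 * (ennreal ((norm (?S k x - \<phi> (snd x) (fst x)))\<^sup>2) * indicator {a<..b} (snd x)) +
          2 * (ennreal ((norm (?S' k x - \<phi> (snd x) (fst x)))\<^sup>2) * indicator {r<..b} (snd x))"
        using arb by (auto simp: indicator_def ennreal_mult)
    qed
    also have "\<dots> = 2 * (\<integral>\<^sup>+x. ennreal ((norm (?S k x - \<phi> (snd x) (fst x)))\<^sup>2) * indicator {a<..b} (snd x) \<partial>?L) +
     2 * (\<integral>\<^sup>+x. ennreal ((norm (?S' k x - \<phi> (snd x) (fst x)))\<^sup>2) * indicator {r<..b} (snd x) \<partial>?L)"
      by (subst nn_integral_add, measurable, subst nn_integral_cmult, measurable, subst nn_integral_cmult, measurable)
    finally show ?thesis .
  qed
  have "(\<lambda>k. \<integral>\<^sup>+\<omega>. ennreal ((c0 k \<omega> - (I \<omega> - J \<omega>))\<^sup>2) \<partial>M) \<longlonglongrightarrow> 0"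
  proof (rule tendsto_0_nn_integral_le)
    let ?b = "\<lambda>k. 3 * ((\<integral>\<^sup>+\<omega>. ennreal ((e1 k \<omega> - I \<omega>)\<^sup>2) \<partial>M) + (2 * (\<integral>\<^sup>+x. ennreal ((norm (?S k x - \<phi> (snd x) (fst x)))\<^sup>2) * indicator {a<..b} (snd x) \<partial>?L) +
     2 * (\<integral>\<^sup>+x. ennreal ((norm (?S' k x - \<phi> (snd x) (fst x)))\<^sup>2) * indicator {r<..b} (snd x) \<partial>?L)) + (\<integral>\<^sup>+\<omega>. ennreal ((e2 k \<omega> - J \<omega>)\<^sup>2) \<partial>M))"
    have "?b \<longlonglongrightarrow> 3 * (0 + (2 * 0 + 2 * 0) + 0)"
      by (intro ennreal_tendsto_cmult tendsto_add C[folded e1_def] C'[folded e2_def] B B') auto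
    then show "?b \<longlonglongrightarrow> 0" by simp
    fix k
    have "(\<integral>\<^sup>+\<omega>. ennreal ((c0 k \<omega> - (I \<omega> - J \<omega>))\<^sup>2) \<partial>M)
      \<le> (\<integral>\<^sup>+\<omega>. 3 * ((ennreal ((e1 k \<omega> - I \<omega>)\<^sup>2) + ennreal ((c1 k \<omega> - e2 k \<omega>)\<^sup>2)) + ennreal ((e2 k \<omega> - J \<omega>)\<^sup>2)) \<partial>M)"
    proof (intro nn_integral_mono)
      fix \<omega>
      \<comment> \<open>The three parts are the error of the first sequence, the discrepancy of the
        two sequences beyond r, and the error of the second sequence.\<close>
      have d: "c0 k \<omega> - (I \<omega> - J \<omega>) = (e1 k \<omega> - I \<omega>) + - (c1 k \<omega> - e2 k \<omega>) + - (e2 k \<omega> - J \<omega>)" using e1 by simp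
      have "(c0 k \<omega> - (I \<omega> - J \<omega>))\<^sup>2 \<le> 3 * ((e1 k \<omega> - I \<omega>)\<^sup>2 + (c1 k \<omega> - e2 k \<omega>)\<^sup>2 + (e2 k \<omega> - J \<omega>)\<^sup>2)"
        using three[of "e1 k \<omega> - I \<omega>" "- (c1 k \<omega> - e2 k \<omega>)" "- (e2 k \<omega> - J \<omega>)"]
        unfolding d by (simp only: power2_minus)
      then show "ennreal ((c0 k \<omega> - (I \<omega> - J \<omega>))\<^sup>2) \<le> 3 * ((ennreal ((e1 k \<omega> - I \<omega>)\<^sup>2) + ennreal ((c1 k \<omega> - e2 k \<omega>)\<^sup>2)) + ennreal ((e2 k \<omega> - J \<omega>)\<^sup>2))"
        by (simp add: ennreal_plus[symmetric] ennreal_mult[symmetric] ennreal_leI del: ennreal_plus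
              flip: ennreal_numeral)
    qed
    also have "\<dots> = 3 * (((\<integral>\<^sup>+\<omega>. ennreal ((e1 k \<omega> - I \<omega>)\<^sup>2) \<partial>M) + (\<integral>\<^sup>+\<omega>. ennreal ((c1 k \<omega> - e2 k \<omega>)\<^sup>2) \<partial>M)) + (\<integral>\<^sup>+\<omega>. ennreal ((e2 k \<omega> - J \<omega>)\<^sup>2) \<partial>M))"
      by (subst nn_integral_cmult, measurable, subst nn_integral_add, measurable, subst nn_integral_add, measurable)
    also have "\<dots> \<le> ?b k"
      using mid[of k] by (intro mult_left_mono add_mono) auto
    finally show "(\<integral>\<^sup>+\<omega>. ennreal ((c0 k \<omega> - (I \<omega> - J \<omega>))\<^sup>2) \<partial>M) \<le> ?b k" .
  qed
  then show ?thesis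
    unfolding ito_limit_def
    by (intro conjI exI[of _ "\<lambda>k u \<omega>. indicator {a<..r} u *\<^sub>R step_process (n k) (p k) (h k) u \<omega>"] exI[of _ c0])
       (use D D' lim1 s0 in auto)
qed

end

text \<open>The ordering of the two extreme points is carried along because the induction step needs
  it to glue half-open intervals.\<close>

lemma sum_indicator_consecutive:
  fixes \<tau> :: "nat \<Rightarrow> real"
  assumes "\<And>i. i < k \<Longrightarrow> \<tau> i \<le> \<tau> (Suc i)"
  shows "(\<Sum>i<k. indicator {\<tau> i<..\<tau> (Suc i)} u :: real) = indicator {\<tau> 0<..\<tau> k} u \<and> \<tau> 0 \<le> \<tau> k"
  using assms
proof (induction k)
  case (Suc k)
  then have "(\<Sum>i<k. indicator {\<tau> i<..\<tau> (Suc i)} u :: real) = indicator {\<tau> 0<..\<tau> k} u \<and> \<tau> 0 \<le> \<tau> k" "\<tau> k \<le> \<tau> (Suc k)"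
    by auto
  then show ?case by (auto simp: indicator_def)
qed simp

section \<open>Weighted isometries and vanishing anticipating weights\<close>

context simple_integration
begin

text \<open>Fubini turns the space-time side of the conditional isometry into a pathwise time
  integral, the form in which it can meet pathwise bounds on the coefficients.\<close>

lemma ito_limit_weighted:
  assumes lim: "ito_limit s r \<phi> w" and sr: "0 \<le> s" "s \<le> r" "r \<le> T"
    and \<phi>[measurable]: "(\<lambda>x. \<phi> (snd x) (fst x)) \<in> borel_measurable (M \<Otimes>\<^sub>M lborel)"
    and int: "integrable (M \<Otimes>\<^sub>M lborel) (\<lambda>x. indicator {s<..r} (snd x) * (norm (\<phi> (snd x) (fst x)))\<^sup>2)"
    and \<theta>: "bounded_measurable (\<Phi> s r) (\<theta> :: 'w \<Rightarrow> real)"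
  shows "(\<integral>\<omega>. (\<theta> \<omega>)\<^sup>2 * (w \<omega>)\<^sup>2 \<partial>M) = (\<integral>\<omega>. (\<theta> \<omega>)\<^sup>2 * (\<integral>u. indicator {s<..r} u * (norm (\<phi> u \<omega>))\<^sup>2 \<partial>lborel) \<partial>M)"
    and "integrable M (\<lambda>\<omega>. (\<theta> \<omega>)\<^sup>2 * (w \<omega>)\<^sup>2)"
    and "integrable M (\<lambda>\<omega>. (\<theta> \<omega>)\<^sup>2 * (\<integral>u. indicator {s<..r} u * (norm (\<phi> u \<omega>))\<^sup>2 \<partial>lborel))"
proof -
  interpret pair_sigma_finite M lborel by (rule pair_sigma_finite_lborel)
  note W = ito_limit_sq_integrable[OF lim sr]
  note [measurable] = W(1)
  have [measurable]: "\<theta> \<in> borel_measurable M"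
    using measurable_from_subalg[OF sub[OF sr]] \<theta> by (auto simp: bounded_measurable_def)
  obtain c where c: "\<And>\<omega>. \<omega> \<in> space M \<Longrightarrow> \<bar>\<theta> \<omega>\<bar> \<le> c"
    using \<theta> space_\<Phi>[OF sr] by (auto simp: bounded_measurable_def)
  have c2: "\<bar>(\<theta> \<omega>)\<^sup>2\<bar> \<le> c\<^sup>2" if "\<omega> \<in> space M" for \<omega>
    using c[OF that] power_mono[of "\<bar>\<theta> \<omega>\<bar>" c 2] by simp
  let ?R = "\<lambda>x. (\<theta> (fst x))\<^sup>2 * (indicator {s<..r} (snd x) * (norm (\<phi> (snd x) (fst x)))\<^sup>2)"
  have R: "integrable (M \<Otimes>\<^sub>M lborel) ?R"
    using integrable_mult_bounded[OF int, of "\<lambda>x. (\<theta> (fst x))\<^sup>2" "c\<^sup>2"] c2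
    by (auto simp: space_pair_measure mult.commute)
  show w: "integrable M (\<lambda>\<omega>. (\<theta> \<omega>)\<^sup>2 * (w \<omega>)\<^sup>2)"
    using integrable_mult_bounded[OF W(2), of "\<lambda>\<omega>. (\<theta> \<omega>)\<^sup>2" "c\<^sup>2"] c2 by (simp add: mult.commute)
  have "ennreal (\<integral>\<omega>. (\<theta> \<omega>)\<^sup>2 * (w \<omega>)\<^sup>2 \<partial>M) = (\<integral>\<^sup>+\<omega>. ennreal ((\<theta> \<omega> * (w \<omega> - 0))\<^sup>2) \<partial>M)"
    using w by (simp add: nn_integral_eq_integral power_mult_distrib)
  also have "\<dots> = (\<integral>\<^sup>+x. ennreal ((norm (\<theta> (fst x) *\<^sub>R (indicator {s<..r} (snd x) *\<^sub>R \<phi> (snd x) (fst x) - 0)))\<^sup>2) \<partial>(M \<Otimes>\<^sub>M lborel))"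
    by (rule ito_limit_isometry[OF lim sr \<phi> ito_simple.zero \<theta>])
  also have "\<dots> = (\<integral>\<^sup>+x. ennreal (?R x) \<partial>(M \<Otimes>\<^sub>M lborel))"
    by (rule nn_integral_cong) (auto simp: power_mult_distrib indicator_def)
  also have "\<dots> = ennreal (\<integral>x. ?R x \<partial>(M \<Otimes>\<^sub>M lborel))"
    using R by (simp add: nn_integral_eq_integral)
  finally have "(\<integral>\<omega>. (\<theta> \<omega>)\<^sup>2 * (w \<omega>)\<^sup>2 \<partial>M) = (\<integral>x. ?R x \<partial>(M \<Otimes>\<^sub>M lborel))"
    by (subst (asm) ennreal_inj) auto
  also have "\<dots> = (\<integral>\<omega>. (\<integral>u. ?R (\<omega>, u) \<partial>lborel) \<partial>M)"
    by (rule integral_fst'[OF R, symmetric])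
  finally show "(\<integral>\<omega>. (\<theta> \<omega>)\<^sup>2 * (w \<omega>)\<^sup>2 \<partial>M) = (\<integral>\<omega>. (\<theta> \<omega>)\<^sup>2 * (\<integral>u. indicator {s<..r} u * (norm (\<phi> u \<omega>))\<^sup>2 \<partial>lborel) \<partial>M)"
    by simp
  show "integrable M (\<lambda>\<omega>. (\<theta> \<omega>)\<^sup>2 * (\<integral>u. indicator {s<..r} u * (norm (\<phi> u \<omega>))\<^sup>2 \<partial>lborel))"
    using integrable_fst'[OF R] by simp
qed

text \<open>The weight \<rho> may depend on the whole path, so no isometry holds with it inside. The
  integrand is replaced by one fixed step process. The error is small uniformly in n, since \<rho>
  is at most 1 and the unweighted isometry adds up over the intervals. For the step process
  Cauchy-Schwarz separates \<rho> from the squared increments, whose L^2 norms are of the order of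
  the interval length by \<open>mom4_le\<close>; what remains is a multiple of the L^2 norm of
  \<rho>, which tends to 0.\<close>

lemma ito_limit_sum_null:
  assumes ab: "0 \<le> a" "a \<le> b" "b \<le> T"
    and approx: "\<And>\<epsilon>. 0 < \<epsilon> \<Longrightarrow> \<exists>n p h. elementary_approx a b n p h \<and>
        (\<integral>\<^sup>+x. ennreal ((norm (step_process n p h (snd x) (fst x) - \<phi> (snd x) (fst x)))\<^sup>2)
            * indicator {a<..b} (snd x) \<partial>(M \<Otimes>\<^sub>M lborel)) < ennreal \<epsilon>"
    and \<phi>[measurable]: "(\<lambda>x. \<phi> (snd x) (fst x)) \<in> borel_measurable (M \<Otimes>\<^sub>M lborel)"
    and \<tau>: "\<And>n i. i \<le> N n \<Longrightarrow> a \<le> \<tau> n i \<and> \<tau> n i \<le> b" "\<And>n i. i < N n \<Longrightarrow> \<tau> n i \<le> \<tau> n (Suc i)"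
    and w: "\<And>n i. i < N n \<Longrightarrow> ito_limit (\<tau> n i) (\<tau> n (Suc i)) \<phi> (w n i)"
    and \<rho>[measurable]: "\<And>n. \<rho> n \<in> borel_measurable M" and \<rho>1: "\<And>n \<omega>. 0 \<le> \<rho> n \<omega>" "\<And>n \<omega>. \<rho> n \<omega> \<le> (1::real)"
    and \<rho>0: "AE \<omega> in M. (\<lambda>n. \<rho> n \<omega>) \<longlonglongrightarrow> 0"
  shows "(\<lambda>n. \<Sum>i<N n. \<integral>\<omega>. \<rho> n \<omega> * (w n i \<omega>)\<^sup>2 \<partial>M) \<longlonglongrightarrow> 0"
proof -
  have \<rho>int: "integrable M (\<lambda>\<omega>. (\<rho> n \<omega>)\<^sup>2)" for n
    by (rule integrable_const_bound[where B=1]) (use \<rho>1 in \<open>auto simp: power_le_one\<close>)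
  have "(\<lambda>n. \<integral>\<omega>. (\<rho> n \<omega>)\<^sup>2 \<partial>M) \<longlonglongrightarrow> (\<integral>\<omega>. 0 \<partial>M)"
  proof (rule integral_dominated_convergence[where w="\<lambda>_. 1"])
    show "AE \<omega> in M. (\<lambda>n. (\<rho> n \<omega>)\<^sup>2) \<longlonglongrightarrow> 0"
      using \<rho>0 by eventually_elim (auto intro!: tendsto_eq_intros)
    show "AE \<omega> in M. norm ((\<rho> n \<omega>)\<^sup>2) \<le> 1" for n using \<rho>1 by (auto simp: power_le_one)
  qed auto
  then have \<rho>lim: "(\<lambda>n. sqrt (\<integral>\<omega>. (\<rho> n \<omega>)\<^sup>2 \<partial>M)) \<longlonglongrightarrow> 0"
    using tendsto_real_sqrt by fastforce
  have T: "0 \<le> \<tau> n i" "\<tau> n i \<le> \<tau> n (Suc i)" "\<tau> n (Suc i) \<le> T" "a \<le> \<tau> n i" "\<tau> n (Suc i) \<le> b" if "i < N n" for n i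
    using \<tau>(1)[of i n] \<tau>(1)[of "Suc i" n] \<tau>(2)[OF that] that ab by auto
  note W = ito_limit_sq_integrable[OF w T(1-3)]
  have nonneg: "0 \<le> (\<Sum>i<N n. \<integral>\<omega>. \<rho> n \<omega> * (w n i \<omega>)\<^sup>2 \<partial>M)" for n
    using \<rho>1 by (intro sum_nonneg integral_nonneg_AE) auto
  show ?thesis
  proof (rule LIMSEQ_I)
    fix \<epsilon> :: real assume \<epsilon>: "0 < \<epsilon>"
    \<comment> \<open>The splitting of squares below doubles the approximation error; a quarter
      leaves strict room for the vanishing part.\<close>
    then have "0 < \<epsilon> / 4" by simp
    from approx[OF this] obtain m p h where E: "elementary_approx a b m p h"
      and small: "(\<integral>\<^sup>+x. ennreal ((norm (step_process m p h (snd x) (fst x) - \<phi> (snd x) (fst x)))\<^sup>2)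
            * indicator {a<..b} (snd x) \<partial>(M \<Otimes>\<^sub>M lborel)) < ennreal (\<epsilon> / 4)" by blast
    have P: "0 \<le> p j" "p j \<le> p (Suc j)" "p (Suc j) \<le> T" if "j < m" for j
      using that ab E partition_of_range[of a b m p j] partition_of_range[of a b m p "Suc j"]
      by (auto simp: elementary_approx_def partition_of_def)
    have "\<exists>c. \<forall>\<omega>\<in>space M. norm (h j \<omega>) \<le> c" if "j < m" for j
    proof -
      have "bounded_measurable (\<Phi> (p j) (p (Suc j))) (h j)" using E that by (simp add: elementary_approx_def)
      then show ?thesis unfolding bounded_measurable_def space_\<Phi>[OF P[OF that]] by simp
    qed
    then obtain c' where c': "\<And>j \<omega>. j < m \<Longrightarrow> \<omega> \<in> space M \<Longrightarrow> norm (h j \<omega>) \<le> c' j" by metis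
    define c where "c = (\<Sum>j<m. \<bar>c' j\<bar>)"
    have c: "norm (h j \<omega>) \<le> c" "0 \<le> c" if "j < m" "\<omega> \<in> space M" for j \<omega>
    proof -
      have "\<bar>c' j\<bar> \<le> c" unfolding c_def by (rule member_le_sum) (use that in auto)
      then show "norm (h j \<omega>) \<le> c" using c'[OF that] by simp
      show "0 \<le> c" by (simp add: c_def sum_nonneg)
    qed
    define e where "e n i = elementary_integral X m (\<lambda>j. clamp_time (\<tau> n i) (\<tau> n (Suc i)) (p j)) h" for n i
    have es: "ito_simple (\<tau> n i) (\<tau> n (Suc i)) (\<lambda>u \<omega>. indicator {\<tau> n i<..\<tau> n (Suc i)} u *\<^sub>R step_process m p h u \<omega>) (e n i)"
      if "i < N n" for n i
      unfolding e_def by (rule elementary_approx_ito_simple[OF E ab(1,3)]) (use T[OF that] in auto)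
    note EP = ito_simple_props[OF es T(1-3)]
    note [measurable] = elementary_approx_measurable[OF E ab(1,3)]
    have dint: "integrable M (\<lambda>\<omega>. (w n i \<omega> - e n i \<omega>)\<^sup>2)" if "i < N n" for n i
      unfolding power2_diff
      using W[OF that] EP(3)[OF that] integrable_mult_square[OF W(1)[OF that] EP(2)[OF that that] W(2)[OF that] EP(3)[OF that that]] that
      by (auto simp: mult.assoc)
    \<comment> \<open>The pieces over successive intervals are disjoint in time, so their squared
      errors add up to at most the total error over {a<..b}.\<close>
    have D: "(\<Sum>i<N n. \<integral>\<omega>. (w n i \<omega> - e n i \<omega>)\<^sup>2 \<partial>M) \<le> \<epsilon> / 4" for n
    proof -
      have "ennreal (\<Sum>i<N n. \<integral>\<omega>. (w n i \<omega> - e n i \<omega>)\<^sup>2 \<partial>M) = (\<Sum>i<N n. \<integral>\<^sup>+\<omega>. ennreal ((1 * (w n i \<omega> - e n i \<omega>))\<^sup>2) \<partial>M)"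
        using dint by (subst sum_ennreal[symmetric]) (auto simp: nn_integral_eq_integral)
      also have "\<dots> = (\<Sum>i<N n. \<integral>\<^sup>+x. ennreal ((norm (1 *\<^sub>R (indicator {\<tau> n i<..\<tau> n (Suc i)} (snd x) *\<^sub>R \<phi> (snd x) (fst x)
           - indicator {\<tau> n i<..\<tau> n (Suc i)} (snd x) *\<^sub>R step_process m p h (snd x) (fst x))))\<^sup>2) \<partial>(M \<Otimes>\<^sub>M lborel))"
      proof (intro sum.cong refl)
        fix i assume "i \<in> {..<N n}"
        then have i: "i < N n" by simp
        have "bounded_measurable (\<Phi> (\<tau> n i) (\<tau> n (Suc i))) (\<lambda>_. 1 :: real)" by (auto simp: bounded_measurable_def)
        from ito_limit_isometry[OF w[OF i] T(1-3)[OF i] \<phi> es[OF i] this]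
        show "(\<integral>\<^sup>+\<omega>. ennreal ((1 * (w n i \<omega> - e n i \<omega>))\<^sup>2) \<partial>M) = (\<integral>\<^sup>+x. ennreal ((norm (1 *\<^sub>R (indicator {\<tau> n i<..\<tau> n (Suc i)} (snd x) *\<^sub>R \<phi> (snd x) (fst x)
           - indicator {\<tau> n i<..\<tau> n (Suc i)} (snd x) *\<^sub>R step_process m p h (snd x) (fst x))))\<^sup>2) \<partial>(M \<Otimes>\<^sub>M lborel))" .
      qed
      also have "\<dots> = (\<integral>\<^sup>+x. (\<Sum>i<N n. ennreal ((norm (1 *\<^sub>R (indicator {\<tau> n i<..\<tau> n (Suc i)} (snd x) *\<^sub>R \<phi> (snd x) (fst x)
           - indicator {\<tau> n i<..\<tau> n (Suc i)} (snd x) *\<^sub>R step_process m p h (snd x) (fst x))))\<^sup>2)) \<partial>(M \<Otimes>\<^sub>M lborel))"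
        by (rule nn_integral_sum[symmetric]) measurable
      also have "\<dots> \<le> (\<integral>\<^sup>+x. ennreal ((norm (step_process m p h (snd x) (fst x) - \<phi> (snd x) (fst x)))\<^sup>2)
            * indicator {a<..b} (snd x) \<partial>(M \<Otimes>\<^sub>M lborel))"
      proof (rule nn_integral_mono)
        fix x :: "'w \<times> real"
        let ?z = "(norm (step_process m p h (snd x) (fst x) - \<phi> (snd x) (fst x)))\<^sup>2"
        have "(\<Sum>i<N n. ennreal ((norm (1 *\<^sub>R (indicator {\<tau> n i<..\<tau> n (Suc i)} (snd x) *\<^sub>R \<phi> (snd x) (fst x)
           - indicator {\<tau> n i<..\<tau> n (Suc i)} (snd x) *\<^sub>R step_process m p h (snd x) (fst x))))\<^sup>2))
          = (\<Sum>i<N n. ennreal (?z * indicator {\<tau> n i<..\<tau> n (Suc i)} (snd x)))"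
          by (intro sum.cong refl arg_cong[of _ _ ennreal]) (auto simp: indicator_def norm_minus_commute)
        also have "\<dots> = ennreal (\<Sum>i<N n. ?z * indicator {\<tau> n i<..\<tau> n (Suc i)} (snd x))"
          by (rule sum_ennreal) auto
        also have "(\<Sum>i<N n. ?z * indicator {\<tau> n i<..\<tau> n (Suc i)} (snd x)) = ?z * indicator {\<tau> n 0<..\<tau> n (N n)} (snd x)"
          unfolding sum_distrib_left[symmetric] using sum_indicator_consecutive[of "N n" "\<tau> n" "snd x"] \<tau>(2) by simp
        also have "ennreal \<dots> \<le> ennreal ?z * indicator {a<..b} (snd x)"
          using \<tau>(1)[of 0 n] \<tau>(1)[of "N n" n] by (auto simp: indicator_def)
        finally show "(\<Sum>i<N n. ennreal ((norm (1 *\<^sub>R (indicator {\<tau> n i<..\<tau> n (Suc i)} (snd x) *\<^sub>R \<phi> (snd x) (fst x)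
           - indicator {\<tau> n i<..\<tau> n (Suc i)} (snd x) *\<^sub>R step_process m p h (snd x) (fst x))))\<^sup>2))
          \<le> ennreal ?z * indicator {a<..b} (snd x)" .
      qed
      also have "\<dots> < ennreal (\<epsilon> / 4)" by (rule small)
      finally show ?thesis using \<epsilon> by (subst (asm) ennreal_less_iff) (auto intro!: sum_nonneg)
    qed
    \<comment> \<open>Cauchy-Schwarz over the m steps gives one factor m and the sum of their m
      equal bounds another; the values of the step process give c^2 and the fourth moments sqrt
      \<kappa>. None of these depends on n.\<close>
    define K where "K = (real m)\<^sup>2 * c\<^sup>2 * sqrt \<kappa> * (b - a)"
    have Ebound: "(\<Sum>i<N n. \<integral>\<omega>. \<rho> n \<omega> * (e n i \<omega>)\<^sup>2 \<partial>M) \<le> K * sqrt (\<integral>\<omega>. (\<rho> n \<omega>)\<^sup>2 \<partial>M)" for n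
    proof -
      have "(\<integral>\<omega>. \<rho> n \<omega> * (e n i \<omega>)\<^sup>2 \<partial>M) \<le> (real m)\<^sup>2 * c\<^sup>2 * sqrt \<kappa> * sqrt (\<integral>\<omega>. (\<rho> n \<omega>)\<^sup>2 \<partial>M) * (\<tau> n (Suc i) - \<tau> n i)"
        if i: "i < N n" for i
      proof -
        let ?c = "clamp_time (\<tau> n i) (\<tau> n (Suc i))"
        let ?D = "\<lambda>j \<omega>. norm (X (?c (p (Suc j))) \<omega> - X (?c (p j)) \<omega>)"
        have C: "0 \<le> ?c (p j)" "?c (p j) \<le> ?c (p (Suc j))" "?c (p (Suc j)) \<le> T"
           "?c (p (Suc j)) - ?c (p j) \<le> \<tau> n (Suc i) - \<tau> n i" if "j < m" for j
          using P[OF that] T[OF i] by (auto simp: clamp_time_def)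
        have Xm: "?D j \<in> borel_measurable M" if "j < m" for j
          using X_meas[of "?c (p j)"] X_meas[of "?c (p (Suc j))"] C[OF that] by auto
        have int4: "integrable M (\<lambda>\<omega>. ((?D j \<omega>)\<^sup>2)\<^sup>2)" if "j < m" for j
          using mom4[OF C(1-3)[OF that]] by simp
        have intD: "integrable M (\<lambda>\<omega>. \<rho> n \<omega> * (?D j \<omega>)\<^sup>2)" if "j < m" for j
          by (rule integrable_mult_square[OF _ _ \<rho>int int4[OF that]]) (use Xm[OF that] in auto)
        have bound: "(\<integral>\<omega>. \<rho> n \<omega> * (?D j \<omega>)\<^sup>2 \<partial>M) \<le> sqrt (\<integral>\<omega>. (\<rho> n \<omega>)\<^sup>2 \<partial>M) * (sqrt \<kappa> * (\<tau> n (Suc i) - \<tau> n i))" if "j < m" for j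
        proof -
          have "(\<integral>\<omega>. \<rho> n \<omega> * (?D j \<omega>)\<^sup>2 \<partial>M) \<le> (\<integral>\<omega>. \<bar>\<rho> n \<omega> * (?D j \<omega>)\<^sup>2\<bar> \<partial>M)"
            by (rule integral_mono) (use intD[OF that] in auto)
          also have "\<dots> \<le> sqrt (\<integral>\<omega>. (\<rho> n \<omega>)\<^sup>2 \<partial>M) * sqrt (\<integral>\<omega>. ((?D j \<omega>)\<^sup>2)\<^sup>2 \<partial>M)"
            by (rule integral_Cauchy_Schwarz[OF _ \<rho>int _ int4[OF that]]) (use Xm[OF that] in auto)
          also have "sqrt (\<integral>\<omega>. ((?D j \<omega>)\<^sup>2)\<^sup>2 \<partial>M) \<le> sqrt (\<kappa> * (?c (p (Suc j)) - ?c (p j))\<^sup>2)"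
            using mom4_le[OF C(1-3)[OF that]] by simp
          also have "\<dots> = sqrt \<kappa> * (?c (p (Suc j)) - ?c (p j))"
            using C[OF that] by (simp add: real_sqrt_mult)
          also have "\<dots> \<le> sqrt \<kappa> * (\<tau> n (Suc i) - \<tau> n i)"
            using C[OF that] \<kappa>_nonneg by (intro mult_left_mono) auto
          finally show ?thesis by (simp add: mult_left_mono)
        qed
        have pt: "(e n i \<omega>)\<^sup>2 \<le> real m * c\<^sup>2 * (\<Sum>j<m. (?D j \<omega>)\<^sup>2)" if \<omega>: "\<omega> \<in> space M" for \<omega>
        proof -
          have "(e n i \<omega>)\<^sup>2 \<le> (\<Sum>j<m. (h j \<omega> \<bullet> (X (?c (p (Suc j))) \<omega> - X (?c (p j)) \<omega>))\<^sup>2) * real (card {..<m})"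
            unfolding e_def elementary_integral_def by (rule sum_squared_le_sum_of_squares)
          also have "\<dots> \<le> (\<Sum>j<m. c\<^sup>2 * (?D j \<omega>)\<^sup>2) * real (card {..<m})"
          proof (intro mult_right_mono sum_mono)
            fix j assume "j \<in> {..<m}"
            then have "\<bar>h j \<omega> \<bullet> (X (?c (p (Suc j))) \<omega> - X (?c (p j)) \<omega>)\<bar> \<le> c * ?D j \<omega>"
              using Cauchy_Schwarz_ineq2[of "h j \<omega>" "X (?c (p (Suc j))) \<omega> - X (?c (p j)) \<omega>"]
                mult_right_mono[OF c(1)[of j \<omega>], of "?D j \<omega>"] \<omega> by auto
            then have "\<bar>h j \<omega> \<bullet> (X (?c (p (Suc j))) \<omega> - X (?c (p j)) \<omega>)\<bar>\<^sup>2 \<le> (c * ?D j \<omega>)\<^sup>2"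
              by (intro power_mono) auto
            then show "(h j \<omega> \<bullet> (X (?c (p (Suc j))) \<omega> - X (?c (p j)) \<omega>))\<^sup>2 \<le> c\<^sup>2 * (?D j \<omega>)\<^sup>2"
              by (simp add: power_mult_distrib)
          qed simp
          finally show ?thesis by (simp add: sum_distrib_left mult_ac)
        qed
        have ei: "integrable M (\<lambda>\<omega>. \<rho> n \<omega> * (e n i \<omega>)\<^sup>2)"
          using integrable_mult_bounded[OF EP(3)[OF i i], of "\<rho> n" 1] \<rho>1 i by (auto simp: mult.commute)
        have sint: "integrable M (\<lambda>\<omega>. \<Sum>j<m. real m * c\<^sup>2 * (\<rho> n \<omega> * (?D j \<omega>)\<^sup>2))"
          using intD by auto
        have "(\<integral>\<omega>. \<rho> n \<omega> * (e n i \<omega>)\<^sup>2 \<partial>M) \<le> (\<integral>\<omega>. (\<Sum>j<m. real m * c\<^sup>2 * (\<rho> n \<omega> * (?D j \<omega>)\<^sup>2)) \<partial>M)"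
        proof (rule integral_mono[OF ei sint])
          fix \<omega> assume "\<omega> \<in> space M"
          from mult_left_mono[OF pt[OF this] \<rho>1(1)[of n \<omega>]]
          show "\<rho> n \<omega> * (e n i \<omega>)\<^sup>2 \<le> (\<Sum>j<m. real m * c\<^sup>2 * (\<rho> n \<omega> * (?D j \<omega>)\<^sup>2))"
            by (simp add: sum_distrib_left mult_ac)
        qed
        also have "\<dots> = (\<Sum>j<m. real m * c\<^sup>2 * (\<integral>\<omega>. \<rho> n \<omega> * (?D j \<omega>)\<^sup>2 \<partial>M))"
          using intD by (subst Bochner_Integration.integral_sum) auto
        also have "\<dots> \<le> (\<Sum>j<m. real m * c\<^sup>2 * (sqrt (\<integral>\<omega>. (\<rho> n \<omega>)\<^sup>2 \<partial>M) * (sqrt \<kappa> * (\<tau> n (Suc i) - \<tau> n i))))"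
          by (intro sum_mono mult_left_mono bound) auto
        finally show ?thesis by (simp add: power2_eq_square mult_ac)
      qed
      then have "(\<Sum>i<N n. \<integral>\<omega>. \<rho> n \<omega> * (e n i \<omega>)\<^sup>2 \<partial>M)
        \<le> (\<Sum>i<N n. (real m)\<^sup>2 * c\<^sup>2 * sqrt \<kappa> * sqrt (\<integral>\<omega>. (\<rho> n \<omega>)\<^sup>2 \<partial>M) * (\<tau> n (Suc i) - \<tau> n i))"
        by (intro sum_mono) auto
      also have "\<dots> = (real m)\<^sup>2 * c\<^sup>2 * sqrt \<kappa> * sqrt (\<integral>\<omega>. (\<rho> n \<omega>)\<^sup>2 \<partial>M) * (\<tau> n (N n) - \<tau> n 0)"
        by (simp add: sum_distrib_left[symmetric] sum_lessThan_telescope)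
      also have "\<dots> \<le> (real m)\<^sup>2 * c\<^sup>2 * sqrt \<kappa> * sqrt (\<integral>\<omega>. (\<rho> n \<omega>)\<^sup>2 \<partial>M) * (b - a)"
        using \<tau>(1)[of 0 n] \<tau>(1)[of "N n" n] \<kappa>_nonneg by (intro mult_left_mono) auto
      finally show ?thesis by (simp add: K_def mult_ac)
    qed
    have bound: "(\<Sum>i<N n. \<integral>\<omega>. \<rho> n \<omega> * (w n i \<omega>)\<^sup>2 \<partial>M) \<le> 2 * (K * sqrt (\<integral>\<omega>. (\<rho> n \<omega>)\<^sup>2 \<partial>M)) + 2 * (\<epsilon> / 4)" for n
    proof -
      have "(\<integral>\<omega>. \<rho> n \<omega> * (w n i \<omega>)\<^sup>2 \<partial>M) \<le> 2 * (\<integral>\<omega>. \<rho> n \<omega> * (e n i \<omega>)\<^sup>2 \<partial>M) + 2 * (\<integral>\<omega>. (w n i \<omega> - e n i \<omega>)\<^sup>2 \<partial>M)"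
        if i: "i < N n" for i
      proof -
        have ei: "integrable M (\<lambda>\<omega>. \<rho> n \<omega> * (e n i \<omega>)\<^sup>2)"
          using integrable_mult_bounded[OF EP(3)[OF i i], of "\<rho> n" 1] \<rho>1 i by (auto simp: mult.commute)
        have wi: "integrable M (\<lambda>\<omega>. \<rho> n \<omega> * (w n i \<omega>)\<^sup>2)"
          using integrable_mult_bounded[OF W(2)[OF i], of "\<rho> n" 1] \<rho>1 i by (auto simp: mult.commute)
        have "(\<integral>\<omega>. \<rho> n \<omega> * (w n i \<omega>)\<^sup>2 \<partial>M) \<le> (\<integral>\<omega>. 2 * (\<rho> n \<omega> * (e n i \<omega>)\<^sup>2) + 2 * (w n i \<omega> - e n i \<omega>)\<^sup>2 \<partial>M)"
        proof (rule integral_mono[OF wi])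
          fix \<omega>
          have "0 \<le> (w n i \<omega> - 2 * e n i \<omega>)\<^sup>2" by simp
          then have "(w n i \<omega>)\<^sup>2 \<le> 2 * (e n i \<omega>)\<^sup>2 + 2 * (w n i \<omega> - e n i \<omega>)\<^sup>2"
            by (simp add: power2_eq_square algebra_simps)
          then have "\<rho> n \<omega> * (w n i \<omega>)\<^sup>2 \<le> \<rho> n \<omega> * (2 * (e n i \<omega>)\<^sup>2 + 2 * (w n i \<omega> - e n i \<omega>)\<^sup>2)"
            using \<rho>1(1) by (rule mult_left_mono)
          also have "\<dots> \<le> 2 * (\<rho> n \<omega> * (e n i \<omega>)\<^sup>2) + 2 * (w n i \<omega> - e n i \<omega>)\<^sup>2"
            using mult_right_mono[OF \<rho>1(2)[of n \<omega>], of "2 * (w n i \<omega> - e n i \<omega>)\<^sup>2"] by (simp add: algebra_simps)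
          finally show "\<rho> n \<omega> * (w n i \<omega>)\<^sup>2 \<le> 2 * (\<rho> n \<omega> * (e n i \<omega>)\<^sup>2) + 2 * (w n i \<omega> - e n i \<omega>)\<^sup>2" .
        qed (use ei dint[OF i] in auto)
        also have "\<dots> = 2 * (\<integral>\<omega>. \<rho> n \<omega> * (e n i \<omega>)\<^sup>2 \<partial>M) + 2 * (\<integral>\<omega>. (w n i \<omega> - e n i \<omega>)\<^sup>2 \<partial>M)"
          using ei dint[OF i] by simp
        finally show ?thesis .
      qed
      then have "(\<Sum>i<N n. \<integral>\<omega>. \<rho> n \<omega> * (w n i \<omega>)\<^sup>2 \<partial>M)
         \<le> (\<Sum>i<N n. 2 * (\<integral>\<omega>. \<rho> n \<omega> * (e n i \<omega>)\<^sup>2 \<partial>M) + 2 * (\<integral>\<omega>. (w n i \<omega> - e n i \<omega>)\<^sup>2 \<partial>M))"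
        by (intro sum_mono) auto
      also have "\<dots> = 2 * (\<Sum>i<N n. \<integral>\<omega>. \<rho> n \<omega> * (e n i \<omega>)\<^sup>2 \<partial>M) + 2 * (\<Sum>i<N n. \<integral>\<omega>. (w n i \<omega> - e n i \<omega>)\<^sup>2 \<partial>M)"
        by (simp add: sum.distrib sum_distrib_left)
      also have "\<dots> \<le> 2 * (K * sqrt (\<integral>\<omega>. (\<rho> n \<omega>)\<^sup>2 \<partial>M)) + 2 * (\<epsilon> / 4)"
        by (intro add_mono mult_left_mono Ebound D) auto
      finally show ?thesis .
    qed
    have "(\<lambda>n. 2 * (K * sqrt (\<integral>\<omega>. (\<rho> n \<omega>)\<^sup>2 \<partial>M)) + 2 * (\<epsilon> / 4)) \<longlonglongrightarrow> 2 * (K * 0) + 2 * (\<epsilon> / 4)"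
      by (intro tendsto_intros \<rho>lim)
    moreover have "2 * (K * 0) + 2 * (\<epsilon> / 4) < \<epsilon>" using \<epsilon> by simp
    ultimately have "\<forall>\<^sub>F n in sequentially. 2 * (K * sqrt (\<integral>\<omega>. (\<rho> n \<omega>)\<^sup>2 \<partial>M)) + 2 * (\<epsilon> / 4) < \<epsilon>"
      by (rule order_tendstoD(2))
    then obtain n0 where "\<And>n. n \<ge> n0 \<Longrightarrow> 2 * (K * sqrt (\<integral>\<omega>. (\<rho> n \<omega>)\<^sup>2 \<partial>M)) + 2 * (\<epsilon> / 4) < \<epsilon>"
      by (auto simp: eventually_sequentially)
    then show "\<exists>n0. \<forall>n\<ge>n0. norm ((\<Sum>i<N n. \<integral>\<omega>. \<rho> n \<omega> * (w n i \<omega>)\<^sup>2 \<partial>M) - 0) < \<epsilon>"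
      using nonneg bound by (intro exI[of _ n0]) (auto intro: le_less_trans)
  qed
qed

end

section \<open>A convex function vanishing on the negative half-line\<close>

text \<open>The cube of the positive part has a Lipschitz second derivative but grows too fast.
  Subtracting its translate by 1 stops the second derivative at 2 and makes the growth quadratic.
  The digits in the names count derivatives.\<close>

definition pos_psi2 :: "real \<Rightarrow> real" where "pos_psi2 x = 2 * max x 0 - 2 * max (x - 1) 0"
definition pos_psi1 :: "real \<Rightarrow> real" where "pos_psi1 x = (max x 0)\<^sup>2 - (max (x - 1) 0)\<^sup>2"
definition pos_psi :: "real \<Rightarrow> real" where "pos_psi x = ((max x 0) ^ 3 - (max (x - 1) 0) ^ 3) / 3"

lemma DERIV_max_square: "((\<lambda>x::real. (max x 0)\<^sup>2) has_real_derivative 2 * max x 0) (at x)"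
proof (cases x "0::real" rule: linorder_cases)
  case less
  have "((\<lambda>x::real. (max x 0)\<^sup>2) has_real_derivative 0) (at x)"
    by (rule has_field_derivative_transform_within_open[where f="\<lambda>_. 0" and S="{..<0}"]) (use less in auto)
  then show ?thesis using less by simp
next
  case greater
  have "((\<lambda>x::real. (max x 0)\<^sup>2) has_real_derivative 2 * x) (at x)"
    by (rule has_field_derivative_transform_within_open[where f="\<lambda>x. x\<^sup>2" and S="{0<..}"])
       (use greater in \<open>auto intro!: derivative_eq_intros\<close>)
  then show ?thesis using greater by simp
next
  case equal
  \<comment> \<open>Neither one-sided formula is valid on a neighbourhood of 0, so the difference
    quotient is squeezed between 0 and the modulus of h.\<close>
  have "(\<lambda>h::real. (max h 0)\<^sup>2 / h) \<midarrow>0\<rightarrow> 0"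
  proof (rule tendsto_sandwich[where f="\<lambda>_. 0" and h="\<lambda>h. \<bar>h\<bar>"])
    show "\<forall>\<^sub>F h in at (0::real). 0 \<le> (max h 0)\<^sup>2 / h"
      by (intro always_eventually allI) (auto simp: max_def divide_nonneg_nonneg)
    show "\<forall>\<^sub>F h in at (0::real). (max h 0)\<^sup>2 / h \<le> \<bar>h\<bar>"
      by (intro always_eventually allI) (auto simp: max_def power2_eq_square)
    show "((\<lambda>h::real. \<bar>h\<bar>) \<longlongrightarrow> 0) (at 0)" by (rule tendsto_rabs_zero) (rule tendsto_ident_at)
  qed simp
  then show ?thesis unfolding equal by (simp add: DERIV_def)
qed

lemma DERIV_max_cube: "((\<lambda>x::real. (max x 0) ^ 3) has_real_derivative 3 * (max x 0)\<^sup>2) (at x)"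
proof -
  have eq: "(\<lambda>x::real. (max x 0) ^ 3) = (\<lambda>x. x * (max x 0)\<^sup>2)"
    by (auto simp: fun_eq_iff max_def power2_eq_square power3_eq_cube)
  show ?thesis unfolding eq
    by (rule derivative_eq_intros DERIV_max_square refl)+ (auto simp: max_def power2_eq_square)
qed

lemma DERIV_pos_psi1: "(pos_psi1 has_real_derivative pos_psi2 x) (at x)"
  unfolding pos_psi1_def[abs_def] pos_psi2_def
  by (intro DERIV_diff DERIV_max_square DERIV_chain2[OF DERIV_max_square, where Db=1, simplified])
     (auto intro!: derivative_eq_intros)

lemma DERIV_pos_psi: "(pos_psi has_real_derivative pos_psi1 x) (at x)"
proof -
  have "((\<lambda>x. (max x 0) ^ 3 - (max (x - 1) 0) ^ 3) has_real_derivative 3 * (max x 0)\<^sup>2 - 3 * (max (x - 1) 0)\<^sup>2) (at x)"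
    by (intro DERIV_diff DERIV_max_cube DERIV_chain2[OF DERIV_max_cube, where Db=1, simplified])
       (auto intro!: derivative_eq_intros)
  from DERIV_cdivide[OF this, of 3] show ?thesis
    unfolding pos_psi1_def pos_psi_def[abs_def] by (simp add: diff_divide_distrib)
qed

text \<open>The two points will be successive values of a path and may come in either order; of the
  intermediate point only its distance from y is kept.\<close>

lemma MVT_between:
  fixes f f' :: "real \<Rightarrow> real"
  assumes "\<And>z. (f has_real_derivative f' z) (at z)"
  obtains z where "\<bar>z - y\<bar> \<le> \<bar>x - y\<bar>" "f x - f y = f' z * (x - y)"
proof (cases x y rule: linorder_cases)
  case less
  from MVT2[OF less, of f f'] assms obtain z where "x < z" "z < y" "f y - f x = (y - x) * f' z" by auto
  then show ?thesis using that[of z] by (simp add: algebra_simps)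
next
  case greater
  from MVT2[OF greater, of f f'] assms obtain z where "y < z" "z < x" "f x - f y = (x - y) * f' z" by auto
  then show ?thesis using that[of z] by (simp add: algebra_simps)
qed (use that[of y] in auto)

lemma pos_psi2_bounds: "0 \<le> pos_psi2 x" "pos_psi2 x \<le> 2"
  by (auto simp: pos_psi2_def max_def)

text \<open>The Lipschitz bound and the bound by the range of values are merged into one
  \<open>min\<close>, which later becomes the bounded oscillation weight.\<close>

lemma pos_psi2_diff: "\<bar>pos_psi2 x - pos_psi2 y\<bar> \<le> 2 * min 1 \<bar>x - y\<bar>"
  by (auto simp: pos_psi2_def max_def min_def abs_if)

lemma pos_psi2_lipschitz: "\<bar>pos_psi2 x - pos_psi2 y\<bar> \<le> 2 * \<bar>x - y\<bar>"
  by (auto simp: pos_psi2_def max_def abs_if)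

lemma pos_psi1_nonneg: "0 \<le> pos_psi1 x"
  by (auto simp: pos_psi1_def max_def power2_eq_square algebra_simps)

lemma pos_psi1_diff: "\<bar>pos_psi1 x - pos_psi1 y\<bar> \<le> 2 * \<bar>x - y\<bar>"
proof -
  obtain z where "pos_psi1 x - pos_psi1 y = pos_psi2 z * (x - y)"
    using MVT_between[of pos_psi1 pos_psi2 y x] DERIV_pos_psi1 by blast
  then show ?thesis using pos_psi2_bounds[of z] by (simp add: abs_mult mult_right_mono)
qed

lemma pos_psi1_le: "pos_psi1 x \<le> 2 * max x 0"
proof (cases "x \<le> 0")
  case True
  then show ?thesis by (simp add: pos_psi1_def)
next
  case False
  then show ?thesis using pos_psi1_diff[of x 0] by (simp add: pos_psi1_def)
qed

lemma pos_psi_nonneg: "0 \<le> pos_psi x"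
  by (auto simp: pos_psi_def intro!: power_mono)

lemma pos_psi_eq_0: "pos_psi x = 0 \<longleftrightarrow> x \<le> 0"
proof
  assume *: "pos_psi x = 0"
  show "x \<le> 0"
  proof (rule ccontr)
    assume "\<not> x \<le> 0"
    then have "(max (x - 1) 0) ^ 3 < (max x 0) ^ 3" by (intro power_strict_mono) auto
    then show False using * by (simp add: pos_psi_def)
  qed
qed (auto simp: pos_psi_def)

lemma pos_psi_cases:
  assumes "0 < x"
  shows "x \<le> 1 \<Longrightarrow> pos_psi x = x ^ 3 / 3" "x \<le> 1 \<Longrightarrow> pos_psi1 x = x\<^sup>2" "x \<le> 1 \<Longrightarrow> pos_psi2 x = 2 * x"
    "1 \<le> x \<Longrightarrow> pos_psi x = x\<^sup>2 - x + 1 / 3" "1 \<le> x \<Longrightarrow> pos_psi1 x = 2 * x - 1" "1 \<le> x \<Longrightarrow> pos_psi2 x = 2"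
  using assms by (auto simp: pos_psi_def pos_psi1_def pos_psi2_def max_def power2_eq_square power3_eq_cube field_simps)

lemma sq_le_pos_psi: "1 \<le> x \<Longrightarrow> x\<^sup>2 \<le> 3 * pos_psi x"
  using mult_nonneg_nonneg[of "2 * x - 1" "x - 1"] by (simp add: pos_psi_cases power2_eq_square algebra_simps)

lemma pos_psi_le: "pos_psi x \<le> x\<^sup>2"
proof -
  obtain z where z: "\<bar>z\<bar> \<le> \<bar>x\<bar>" "pos_psi x = pos_psi1 z * x"
    using MVT_between[of pos_psi pos_psi1 0 x] DERIV_pos_psi pos_psi_eq_0[of 0] by auto
  show ?thesis
  proof (cases "0 < x \<and> x \<le> 1")
    case True
    then have "x ^ 3 \<le> x\<^sup>2" by (intro power_decreasing) auto
    moreover have "0 \<le> x\<^sup>2" by simp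
    ultimately show ?thesis using True pos_psi_cases(1)[of x] by linarith
  next
    case False
    then show ?thesis using pos_psi_eq_0[of x] pos_psi_cases(4)[of x] by fastforce
  qed
qed

text \<open>These bounds stand in for the homogeneity of the square. The first handles the
  dependence of the drift on X, the second that of g on X, and the third lets the dependence of the
  drift on Z be absorbed by the second-order term. The constant 6 is forced by the second bound, an
  equality on {0<..1}.\<close>

lemma pos_psi_growth:
  shows "\<bar>x\<bar> * pos_psi1 x \<le> 6 * pos_psi x" "pos_psi2 x * x\<^sup>2 \<le> 6 * pos_psi x" "(pos_psi1 x)\<^sup>2 \<le> 6 * pos_psi x * pos_psi2 x"
proof -
  have "\<bar>x\<bar> * pos_psi1 x \<le> 6 * pos_psi x \<and> pos_psi2 x * x\<^sup>2 \<le> 6 * pos_psi x \<and> (pos_psi1 x)\<^sup>2 \<le> 6 * pos_psi x * pos_psi2 x"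
  proof -
    consider "x \<le> 0" | "0 < x" "x \<le> 1" | "1 \<le> x" by linarith
    then show ?thesis
    proof cases
      case 1
      then show ?thesis by (simp add: pos_psi_def pos_psi1_def pos_psi2_def)
    next
      case 2
      then show ?thesis
        by (simp add: pos_psi_cases power2_eq_square power3_eq_cube mult_ac)
    next
      case 3
      have "x * (2 * x - 1) \<le> 2 * x\<^sup>2" using 3 by (simp add: power2_eq_square algebra_simps)
      moreover have "(2 * x - 1)\<^sup>2 \<le> 4 * x\<^sup>2" using 3 by (simp add: power2_eq_square algebra_simps)
      ultimately show ?thesis using 3 sq_le_pos_psi[OF 3] by (simp add: pos_psi_cases(5,6))
    qed
  qed
  then show "\<bar>x\<bar> * pos_psi1 x \<le> 6 * pos_psi x" "pos_psi2 x * x\<^sup>2 \<le> 6 * pos_psi x" "(pos_psi1 x)\<^sup>2 \<le> 6 * pos_psi x * pos_psi2 x"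
    by auto
qed

section \<open>Second-order expansion of the test function\<close>

lemma pos_psi1_taylor: "\<bar>pos_psi1 x - pos_psi1 y - pos_psi2 y * (x - y)\<bar> \<le> 2 * min 1 \<bar>x - y\<bar> * \<bar>x - y\<bar>"
proof -
  obtain z where z: "\<bar>z - y\<bar> \<le> \<bar>x - y\<bar>" "pos_psi1 x - pos_psi1 y = pos_psi2 z * (x - y)"
    using MVT_between[of pos_psi1 pos_psi2 y x] DERIV_pos_psi1 by blast
  have "pos_psi1 x - pos_psi1 y - pos_psi2 y * (x - y) = (pos_psi2 z - pos_psi2 y) * (x - y)"
    using z(2) by (simp add: algebra_simps)
  moreover have "\<bar>pos_psi2 z - pos_psi2 y\<bar> \<le> 2 * min 1 \<bar>x - y\<bar>"
  proof -
    have "min 1 \<bar>z - y\<bar> \<le> min 1 \<bar>x - y\<bar>" using z(1) by (rule min.mono[OF order_refl])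
    then show ?thesis using pos_psi2_diff[of z y] by linarith
  qed
  ultimately show ?thesis by (simp add: abs_mult mult_right_mono)
qed

text \<open>The derivative in x of the trapezoidal error is minus half the Taylor remainder of
  \<open>pos_psi1\<close>, so the mean value theorem gives an error of third order for small
  increments.\<close>

lemma pos_psi_trapezoid:
  "\<bar>pos_psi x - pos_psi y - (pos_psi1 x + pos_psi1 y) / 2 * (x - y)\<bar> \<le> min 1 \<bar>x - y\<bar> * (x - y)\<^sup>2"
proof -
  let ?F = "\<lambda>z. pos_psi z - pos_psi y - (pos_psi1 z + pos_psi1 y) / 2 * (z - y)"
  let ?F' = "\<lambda>z. - (pos_psi1 y - pos_psi1 z - pos_psi2 z * (y - z)) / 2"
  have "(?F has_real_derivative ?F' z) (at z)" for z
    by (rule DERIV_cong[OF DERIV_diff[OF DERIV_diff[OF DERIV_pos_psi DERIV_const]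
          DERIV_mult'[OF DERIV_cdivide[OF DERIV_add[OF DERIV_pos_psi1 DERIV_const]] DERIV_diff[OF DERIV_ident DERIV_const]]]])
       (simp add: field_simps)
  then obtain z where z: "\<bar>z - y\<bar> \<le> \<bar>x - y\<bar>" "?F x - ?F y = ?F' z * (x - y)"
    by (rule MVT_between)
  have "\<bar>?F' z\<bar> \<le> min 1 \<bar>y - z\<bar> * \<bar>y - z\<bar>" using pos_psi1_taylor[of y z] by simp
  also have "\<dots> \<le> min 1 \<bar>x - y\<bar> * \<bar>x - y\<bar>" using z(1) by (intro mult_mono) auto
  finally have "\<bar>?F' z\<bar> * \<bar>x - y\<bar> \<le> min 1 \<bar>x - y\<bar> * \<bar>x - y\<bar> * \<bar>x - y\<bar>" by (rule mult_right_mono) simp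
  then have "\<bar>?F' z * (x - y)\<bar> \<le> min 1 \<bar>x - y\<bar> * (x - y)\<^sup>2"
    unfolding abs_mult by (simp add: power2_eq_square mult.assoc abs_mult_self_eq)
  moreover have "?F x = ?F' z * (x - y)" using z(2) by simp
  ultimately show ?thesis by (simp only:)
qed

text \<open>The backward increment \<open>b\<close> is paired with the right end point \<open>y\<close> and the forward increment
  \<open>w\<close> with the left end point \<open>x\<close>, because this is where the respective integrands are
  measurable; the mixed terms \<open>b * w\<close> cancel.\<close>

lemma pos_psi_increment:
  fixes x y a b w :: real
  assumes D: "x - y = a + b - w"
  defines "\<rho> \<equiv> min 1 \<bar>x - y\<bar>"
  shows "pos_psi x - pos_psi y \<le> (pos_psi1 x + pos_psi1 y) / 2 * a + pos_psi1 y * b - pos_psi1 x * w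
    + pos_psi2 y * b\<^sup>2 / 2 - pos_psi2 x * w\<^sup>2 / 2 + 6 * \<rho> * (b\<^sup>2 + w\<^sup>2) + 3 * \<bar>a\<bar> * (\<bar>a\<bar> + \<bar>b\<bar> + \<bar>w\<bar>)"
proof -
  have \<rho>: "0 \<le> \<rho>" "\<rho> \<le> 1" by (auto simp: \<rho>_def)
  define r where "r = pos_psi1 x - pos_psi1 y - pos_psi2 y * (x - y)"
  have r: "\<bar>r\<bar> \<le> 2 * \<rho> * \<bar>x - y\<bar>" using pos_psi1_taylor[of x y] by (simp add: r_def \<rho>_def)
  have 1: "pos_psi x - pos_psi y \<le> (pos_psi1 x + pos_psi1 y) / 2 * (x - y) + \<rho> * (x - y)\<^sup>2"
    using pos_psi_trapezoid[of x y] by (simp add: \<rho>_def)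
  \<comment> \<open>As b and w enter x - y with opposite signs, moving b to its right-end
    coefficient and w to its left-end coefficient costs the same half difference of derivatives,
    multiplied by b + w.\<close>
  have 2: "(pos_psi1 x + pos_psi1 y) / 2 * (x - y) = (pos_psi1 x + pos_psi1 y) / 2 * a + pos_psi1 y * b - pos_psi1 x * w
     + (pos_psi1 x - pos_psi1 y) * (b + w) / 2"
    unfolding D by (simp add: field_simps)
  \<comment> \<open>To first order the difference of derivatives is proportional to b - w, which
    multiplies b + w: this leaves b^2 - w^2 and no mixed product.\<close>
  have 3: "(pos_psi1 x - pos_psi1 y) * (b + w) / 2 = pos_psi2 y * b\<^sup>2 / 2 - pos_psi2 y * w\<^sup>2 / 2
      + pos_psi2 y * (a * (b + w)) / 2 + r * (b + w) / 2"
  proof -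
    have "pos_psi1 x - pos_psi1 y = pos_psi2 y * (a + b - w) + r" by (simp add: r_def D)
    then show ?thesis by (simp only:) (simp add: field_simps power2_eq_square)
  qed
  \<comment> \<open>The coefficient of w^2 is moved to the left end, where the isometry of the
    forward integral is available.\<close>
  have 4: "- (pos_psi2 y * w\<^sup>2 / 2) \<le> - (pos_psi2 x * w\<^sup>2 / 2) + \<rho> * w\<^sup>2"
  proof -
    have "(pos_psi2 x - pos_psi2 y) * w\<^sup>2 \<le> 2 * \<rho> * w\<^sup>2"
      using pos_psi2_diff[of x y] by (intro mult_right_mono) (auto simp: \<rho>_def)
    then show ?thesis by (simp add: field_simps)
  qed
  have bw: "\<bar>b + w\<bar> \<le> \<bar>b\<bar> + \<bar>w\<bar>" by simp
  have 5: "pos_psi2 y * (a * (b + w)) / 2 \<le> \<bar>a\<bar> * (\<bar>b\<bar> + \<bar>w\<bar>)"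
  proof -
    have "pos_psi2 y * (a * (b + w)) \<le> \<bar>pos_psi2 y * (a * (b + w))\<bar>" by simp
    also have "\<dots> \<le> 2 * (\<bar>a\<bar> * (\<bar>b\<bar> + \<bar>w\<bar>))"
      unfolding abs_mult using pos_psi2_bounds[of y] bw by (intro mult_mono) auto
    finally show ?thesis by simp
  qed
  have sq: "(\<bar>b\<bar> + \<bar>w\<bar>) * (\<bar>b\<bar> + \<bar>w\<bar>) \<le> 2 * (b\<^sup>2 + w\<^sup>2)"
    using sum_squares_bound[of "\<bar>b\<bar>" "\<bar>w\<bar>"] by (simp add: power2_eq_square algebra_simps)
  have 6: "r * (b + w) / 2 \<le> \<bar>a\<bar> * (\<bar>b\<bar> + \<bar>w\<bar>) + 2 * \<rho> * (b\<^sup>2 + w\<^sup>2)"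
  proof -
    have "r * (b + w) \<le> \<bar>r\<bar> * \<bar>b + w\<bar>" by (simp add: abs_mult[symmetric])
    also have "\<dots> \<le> (2 * \<rho> * \<bar>x - y\<bar>) * (\<bar>b\<bar> + \<bar>w\<bar>)" using r bw by (intro mult_mono) auto
    also have "\<dots> \<le> (2 * \<rho> * (\<bar>a\<bar> + (\<bar>b\<bar> + \<bar>w\<bar>))) * (\<bar>b\<bar> + \<bar>w\<bar>)"
      using D \<rho> by (intro mult_right_mono mult_left_mono) auto
    also have "\<dots> = 2 * (\<rho> * (\<bar>a\<bar> * (\<bar>b\<bar> + \<bar>w\<bar>))) + 2 * (\<rho> * ((\<bar>b\<bar> + \<bar>w\<bar>) * (\<bar>b\<bar> + \<bar>w\<bar>)))"
      by (simp add: algebra_simps)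
    also have "\<dots> \<le> 2 * (1 * (\<bar>a\<bar> * (\<bar>b\<bar> + \<bar>w\<bar>))) + 2 * (\<rho> * (2 * (b\<^sup>2 + w\<^sup>2)))"
      using \<rho> sq by (intro add_mono mult_left_mono mult_right_mono) auto
    finally show ?thesis by (simp add: algebra_simps)
  qed
  have 7: "\<rho> * (x - y)\<^sup>2 \<le> 3 * a\<^sup>2 + 3 * \<rho> * (b\<^sup>2 + w\<^sup>2)"
  proof -
    have "0 \<le> (a - b)\<^sup>2 + (a + w)\<^sup>2 + (b + w)\<^sup>2" by simp
    then have "(x - y)\<^sup>2 \<le> 3 * (a\<^sup>2 + (b\<^sup>2 + w\<^sup>2))"
      unfolding D by (simp add: power2_eq_square algebra_simps)
    then have "\<rho> * (x - y)\<^sup>2 \<le> \<rho> * (3 * (a\<^sup>2 + (b\<^sup>2 + w\<^sup>2)))" using \<rho>(1) by (rule mult_left_mono)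
    also have "\<dots> = 3 * (\<rho> * a\<^sup>2) + 3 * \<rho> * (b\<^sup>2 + w\<^sup>2)" by (simp add: algebra_simps)
    also have "\<rho> * a\<^sup>2 \<le> a\<^sup>2" using \<rho> by (intro mult_left_le_one_le) auto
    finally show ?thesis by simp
  qed
  \<comment> \<open>Accounting of constants: the 6 covers 3 from the trapezoidal error, 2 from the
    Taylor remainder and 1, on w^2 only, from moving the second derivative. The factor 3 in front of
    the terms in a covers 3 a^2 and the two mixed contributions found above.\<close>
  have "3 * \<bar>a\<bar> * (\<bar>a\<bar> + \<bar>b\<bar> + \<bar>w\<bar>) = 3 * a\<^sup>2 + 3 * (\<bar>a\<bar> * (\<bar>b\<bar> + \<bar>w\<bar>))"
    by (simp add: algebra_simps power2_eq_square abs_mult_self_eq)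
  moreover have "0 \<le> \<bar>a\<bar> * (\<bar>b\<bar> + \<bar>w\<bar>)" "6 * \<rho> * (b\<^sup>2 + w\<^sup>2) = 3 * \<rho> * (b\<^sup>2 + w\<^sup>2) + 2 * \<rho> * (b\<^sup>2 + w\<^sup>2) + \<rho> * w\<^sup>2 + \<rho> * b\<^sup>2" "0 \<le> \<rho> * b\<^sup>2"
    using \<rho> by (auto simp: algebra_simps)
  ultimately show ?thesis using 1 2 3 4 5 6 7 by linarith
qed

text \<open>The square is completed in h. The third bound of \<open>pos_psi_growth\<close> converts
  the leftover quotient of the squared first by the second derivative into a multiple of
  \<open>pos_psi x\<close>; where the second derivative vanishes, so does the first. The share 1 -
  \<alpha> is what g leaves of the negative second-order term.\<close>

lemma pos_psi_amgm:
  assumes "0 \<le> C" "\<alpha> < 1"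
  shows "pos_psi1 x * C * h \<le> (1 - \<alpha>) / 2 * pos_psi2 x * h\<^sup>2 + 3 * C\<^sup>2 / (1 - \<alpha>) * pos_psi x"
proof -
  define \<beta> where "\<beta> = 1 - \<alpha>"
  have \<beta>: "0 < \<beta>" using assms by (simp add: \<beta>_def)
  show ?thesis
  proof (cases "pos_psi2 x = 0")
    case True
    then have "pos_psi1 x = 0" using pos_psi_growth(3)[of x] by simp
    then show ?thesis using True \<beta> pos_psi_nonneg[of x] by (simp add: \<beta>_def)
  next
    case False
    then have p: "0 < pos_psi2 x" using pos_psi2_bounds(1)[of x] by simp
    have "0 \<le> (\<beta> * pos_psi2 x * h - pos_psi1 x * C)\<^sup>2 / (2 * \<beta> * pos_psi2 x)"
      using p \<beta> by (intro divide_nonneg_pos) auto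
    also have "\<dots> = \<beta> / 2 * pos_psi2 x * h\<^sup>2 - pos_psi1 x * C * h + C\<^sup>2 * (pos_psi1 x)\<^sup>2 / (2 * \<beta> * pos_psi2 x)"
      using p \<beta> by (simp add: power2_diff field_simps power2_eq_square)
    also have "C\<^sup>2 * (pos_psi1 x)\<^sup>2 / (2 * \<beta> * pos_psi2 x) \<le> C\<^sup>2 * (6 * pos_psi x * pos_psi2 x) / (2 * \<beta> * pos_psi2 x)"
      using pos_psi_growth(3)[of x] p \<beta> by (intro divide_right_mono mult_left_mono) auto
    also have "\<dots> = 3 * C\<^sup>2 / \<beta> * pos_psi x" using p \<beta> by (simp add: field_simps)
    finally show ?thesis by (simp add: \<beta>_def)
  qed
qed

text \<open>All coefficients are frozen at the left end s, each exchange costing a multiple of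
  \<eta>. The terms in H^2 balance exactly: the drift takes the share (1 - \<alpha>) / 2 through
  \<open>pos_psi_amgm\<close>, G takes \<alpha> / 2, and the negative term supplies 1 / 2. What is
  left is proportional to \<open>pos_psi (X s)\<close>, with 6 C from the drift, 6 C from G and 3
  C^2 / (1 - \<alpha>) from the completed square.\<close>

lemma pathwise_interval_bound:
  fixes X \<phi> G H :: "real \<Rightarrow> real"
  assumes s: "s \<le> s'" and C: "0 \<le> C" and \<alpha>: "0 \<le> \<alpha>" "\<alpha> < 1"
    and osc: "\<And>u. u \<in> {s..s'} \<Longrightarrow> \<bar>X u - X s\<bar> \<le> \<eta>" and \<eta>: "\<eta> \<le> 1" and Bd: "\<bar>X s\<bar> \<le> Bd"
    and \<phi>: "integrable lborel (\<lambda>u. indicator {s<..s'} u * \<phi> u)"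
    and G: "integrable lborel (\<lambda>u. indicator {s<..s'} u * G u)"
    and H: "integrable lborel (\<lambda>u. indicator {s<..s'} u * (H u)\<^sup>2)" "H \<in> borel_measurable borel" "\<And>u. 0 \<le> H u"
    and \<phi>_le: "AE u in lborel. u \<in> {s<..s'} \<longrightarrow> \<bar>\<phi> u\<bar> \<le> C * (\<bar>X u\<bar> + H u)"
    and G_le: "AE u in lborel. u \<in> {s<..s'} \<longrightarrow> 0 \<le> G u \<and> G u \<le> C * (X u)\<^sup>2 + \<alpha> * (H u)\<^sup>2"
    and A: "0 \<le> dA" "0 < dA \<Longrightarrow> \<exists>u\<in>{s..s'}. X u \<le> 0" and V: "0 \<le> dV"
  shows "(pos_psi1 (X s) + pos_psi1 (X s')) / 2 * ((\<integral>u. indicator {s<..s'} u * \<phi> u \<partial>lborel) + dA - dV)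
    + pos_psi2 (X s') / 2 * (\<integral>u. indicator {s<..s'} u * G u \<partial>lborel)
    - pos_psi2 (X s) / 2 * (\<integral>u. indicator {s<..s'} u * (H u)\<^sup>2 \<partial>lborel)
    \<le> (12 * C + 3 * C\<^sup>2 / (1 - \<alpha>)) * pos_psi (X s) * (s' - s)
      + \<eta> * ((2 * Bd * C + 2 * C) * (s' - s) + (\<integral>u. indicator {s<..s'} u * \<bar>\<phi> u\<bar> \<partial>lborel) + 3 * dA
         + (\<integral>u. indicator {s<..s'} u * G u \<partial>lborel))"
proof -
  let ?i = "\<lambda>u. indicator {s<..s'} u :: real"
  define x where "x = X s"
  define y where "y = X s'"
  define p where "p = pos_psi1 x"
  define q where "q = pos_psi2 x"
  define IH where "IH = (\<integral>u. ?i u * H u \<partial>lborel)"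
  define IH2 where "IH2 = (\<integral>u. ?i u * (H u)\<^sup>2 \<partial>lborel)"
  define IG where "IG = (\<integral>u. ?i u * G u \<partial>lborel)"
  define IF where "IF = (\<integral>u. ?i u * \<bar>\<phi> u\<bar> \<partial>lborel)"
  define \<delta> where "\<delta> = s' - s"
  have \<delta>: "0 \<le> \<delta>" using s by (simp add: \<delta>_def)
  have \<eta>0: "0 \<le> \<eta>" using osc[of s] s by simp
  have xy: "\<bar>y - x\<bar> \<le> \<eta>" using osc[of s'] s by (simp add: x_def y_def)
  have p0: "0 \<le> p" and q0: "0 \<le> q" "q \<le> 2" using pos_psi1_nonneg pos_psi2_bounds by (auto simp: p_def q_def)
  have pB: "p \<le> 2 * Bd" using pos_psi1_le[of x] Bd by (auto simp: p_def x_def)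
  have py: "pos_psi1 y \<le> p + 2 * \<eta>" using order_trans[OF abs_le_D1[OF pos_psi1_diff[of y x]] mult_left_mono[OF xy]] by (simp add: p_def)
  have qy: "pos_psi2 y \<le> q + 2 * \<eta>" using order_trans[OF abs_le_D1[OF pos_psi2_lipschitz[of y x]] mult_left_mono[OF xy]] by (simp add: q_def)
  have ind: "integrable lborel ?i" "(\<integral>u. ?i u \<partial>lborel) = \<delta>" using s by (auto simp: \<delta>_def)
  note [measurable] = H(2)
  have Hint: "integrable lborel (\<lambda>u. ?i u * H u)"
  proof (rule Bochner_Integration.integrable_bound[where f="\<lambda>u. ?i u + ?i u * (H u)\<^sup>2"])
    have "z \<le> 1 + z\<^sup>2" for z :: real
      using zero_le_power2[of "z - 1 / 2"] by (simp add: power2_eq_square algebra_simps)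
    then show "AE u in lborel. norm (?i u * H u) \<le> norm (?i u + ?i u * (H u)\<^sup>2)"
      using H(3) by (auto simp: indicator_def)
  qed (use H ind in auto)
  have abs\<phi>: "integrable lborel (\<lambda>u. ?i u * \<bar>\<phi> u\<bar>)"
    using integrable_abs[OF \<phi>] by (simp add: abs_mult)
  have IF0: "0 \<le> IF" "IF \<le> C * ((\<bar>x\<bar> + \<eta>) * \<delta> + IH)"
  proof -
    show "0 \<le> IF" unfolding IF_def by (intro integral_nonneg_AE) auto
    have "IF \<le> (\<integral>u. C * ((\<bar>x\<bar> + \<eta>) * ?i u + ?i u * H u) \<partial>lborel)"
      unfolding IF_def
    proof (rule integral_mono_AE[OF abs\<phi>])
      show "AE u in lborel. ?i u * \<bar>\<phi> u\<bar> \<le> C * ((\<bar>x\<bar> + \<eta>) * ?i u + ?i u * H u)"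
        using \<phi>_le
      proof eventually_elim
        case (elim u)
        show ?case
        proof (cases "u \<in> {s<..s'}")
          case True
          then have "\<bar>X u\<bar> \<le> \<bar>x\<bar> + \<eta>" using osc[of u] by (auto simp: x_def)
          then have "C * (\<bar>X u\<bar> + H u) \<le> C * (\<bar>x\<bar> + \<eta> + H u)" using C by (intro mult_left_mono) auto
          then show ?thesis using elim True by auto
        qed auto
      qed
    qed (use ind Hint in auto)
    also have "\<dots> = C * ((\<bar>x\<bar> + \<eta>) * \<delta> + IH)" using ind Hint by (simp add: IH_def)
    finally show "IF \<le> C * ((\<bar>x\<bar> + \<eta>) * \<delta> + IH)" .
  qed
  have I\<phi>: "(\<integral>u. ?i u * \<phi> u \<partial>lborel) \<le> IF"
    unfolding IF_def by (rule integral_mono_AE[OF \<phi> abs\<phi>]) (auto simp: indicator_def)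
  have IG0: "0 \<le> IG"
    unfolding IG_def using G_le by (intro integral_nonneg_AE) (auto simp: indicator_def elim!: eventually_mono)
  have IG1: "IG \<le> C * ((2 * x\<^sup>2 + 2 * \<eta>) * \<delta>) + \<alpha> * IH2"
  proof -
    have "IG \<le> (\<integral>u. C * ((2 * x\<^sup>2 + 2 * \<eta>) * ?i u) + \<alpha> * (?i u * (H u)\<^sup>2) \<partial>lborel)"
      unfolding IG_def
    proof (rule integral_mono_AE[OF G])
      show "AE u in lborel. ?i u * G u \<le> C * ((2 * x\<^sup>2 + 2 * \<eta>) * ?i u) + \<alpha> * (?i u * (H u)\<^sup>2)"
        using G_le
      proof eventually_elim
        case (elim u)
        show ?case
        proof (cases "u \<in> {s<..s'}")
          case True
          then have "\<bar>X u - x\<bar> \<le> \<eta>" using osc[of u] by (auto simp: x_def)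
          then have "(X u - x)\<^sup>2 \<le> \<eta>\<^sup>2" using power_mono[of "\<bar>X u - x\<bar>" \<eta> 2] by simp
          also have "\<eta>\<^sup>2 \<le> \<eta>" using \<eta>0 \<eta> by (simp add: power2_eq_square mult_left_le)
          finally have "(X u)\<^sup>2 \<le> 2 * x\<^sup>2 + 2 * \<eta>"
            using zero_le_power2[of "X u - 2 * x"] by (simp add: power2_eq_square algebra_simps)
          then have "C * (X u)\<^sup>2 \<le> C * (2 * x\<^sup>2 + 2 * \<eta>)" using C by (rule mult_left_mono)
          then show ?thesis using elim True by auto
        qed auto
      qed
    qed (use ind H in auto)
    also have "\<dots> = C * ((2 * x\<^sup>2 + 2 * \<eta>) * \<delta>) + \<alpha> * IH2" using ind H by (simp add: IH2_def)
    finally show ?thesis .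
  qed
  have amgm: "p * C * IH \<le> (1 - \<alpha>) / 2 * q * IH2 + 3 * C\<^sup>2 / (1 - \<alpha>) * pos_psi x * \<delta>"
  proof -
    have "p * C * IH = (\<integral>u. p * C * (?i u * H u) \<partial>lborel)" by (simp add: IH_def)
    also have "\<dots> \<le> (\<integral>u. (1 - \<alpha>) / 2 * q * (?i u * (H u)\<^sup>2) + 3 * C\<^sup>2 / (1 - \<alpha>) * pos_psi x * ?i u \<partial>lborel)"
    proof (rule integral_mono)
      fix u
      show "p * C * (?i u * H u) \<le> (1 - \<alpha>) / 2 * q * (?i u * (H u)\<^sup>2) + 3 * C\<^sup>2 / (1 - \<alpha>) * pos_psi x * ?i u"
        using pos_psi_amgm[OF C \<alpha>(2), of x "H u"] by (auto simp: indicator_def p_def q_def)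
    qed (use ind H Hint in auto)
    also have "\<dots> = (1 - \<alpha>) / 2 * q * IH2 + 3 * C\<^sup>2 / (1 - \<alpha>) * pos_psi x * \<delta>"
      using ind H by (simp add: IH2_def)
    finally show ?thesis .
  qed
  have t1: "(p + pos_psi1 y) / 2 * (\<integral>u. ?i u * \<phi> u \<partial>lborel) \<le> 6 * C * pos_psi x * \<delta> + p * C * IH + \<eta> * (2 * Bd * C * \<delta>) + \<eta> * IF"
  proof -
    have "(p + pos_psi1 y) / 2 * (\<integral>u. ?i u * \<phi> u \<partial>lborel) \<le> (p + pos_psi1 y) / 2 * IF"
      using I\<phi> p0 pos_psi1_nonneg[of y] by (intro mult_left_mono) auto
    also have "\<dots> \<le> (p + \<eta>) * IF" using py IF0 by (intro mult_right_mono) auto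
    also have "\<dots> = p * IF + \<eta> * IF" by (simp add: algebra_simps)
    also have "p * IF \<le> p * (C * ((\<bar>x\<bar> + \<eta>) * \<delta> + IH))" using IF0 p0 by (intro mult_left_mono) auto
    also have "\<dots> = C * \<delta> * (\<bar>x\<bar> * p) + \<eta> * (p * C * \<delta>) + p * C * IH" by (simp add: algebra_simps)
    also have "C * \<delta> * (\<bar>x\<bar> * p) \<le> C * \<delta> * (6 * pos_psi x)"
      using pos_psi_growth(1)[of x] C \<delta> by (intro mult_left_mono) (auto simp: p_def)
    also have "\<eta> * (p * C * \<delta>) \<le> \<eta> * (2 * Bd * C * \<delta>)"
      using pB C \<delta> \<eta>0 by (intro mult_left_mono mult_right_mono) auto
    finally show ?thesis by (simp add: algebra_simps)
  qed
  \<comment> \<open>If the process A grows here, X is non-positive somewhere in the interval, hence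
    X s is at most \<eta>; the first derivative is then at most 2 \<eta> at the left and 4 \<eta> at
    the right end.\<close>
  have t2: "(p + pos_psi1 y) / 2 * dA \<le> 3 * \<eta> * dA"
  proof (cases "dA = 0")
    case False
    then obtain u where u: "u \<in> {s..s'}" "X u \<le> 0" using A by auto
    then have "x \<le> \<eta>" using osc[OF u(1)] by (simp add: x_def)
    then have "p \<le> 2 * \<eta>" using pos_psi1_le[of x] \<eta>0 by (auto simp: p_def)
    then show ?thesis using py A(1) by (intro mult_right_mono) auto
  qed simp
  have t3: "0 \<le> (p + pos_psi1 y) / 2 * dV" using p0 pos_psi1_nonneg[of y] V by auto
  have t4: "pos_psi2 y / 2 * IG \<le> 6 * C * pos_psi x * \<delta> + \<eta> * (2 * C * \<delta>) + \<alpha> / 2 * q * IH2 + \<eta> * IG"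
  proof -
    have "pos_psi2 y / 2 * IG \<le> (q / 2 + \<eta>) * IG" using qy IG0 by (intro mult_right_mono) auto
    also have "\<dots> = q / 2 * IG + \<eta> * IG" by (simp add: algebra_simps)
    also have "q / 2 * IG \<le> q / 2 * (C * ((2 * x\<^sup>2 + 2 * \<eta>) * \<delta>) + \<alpha> * IH2)"
      using IG1 q0 by (intro mult_left_mono) auto
    also have "\<dots> = C * \<delta> * (q * x\<^sup>2) + \<eta> * (q * C * \<delta>) + \<alpha> / 2 * q * IH2" by (simp add: algebra_simps)
    also have "C * \<delta> * (q * x\<^sup>2) \<le> C * \<delta> * (6 * pos_psi x)"
      using pos_psi_growth(2)[of x] C \<delta> by (intro mult_left_mono) (auto simp: q_def)
    also have "\<eta> * (q * C * \<delta>) \<le> \<eta> * (2 * C * \<delta>)"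
      using q0 C \<delta> \<eta>0 by (intro mult_left_mono mult_right_mono) auto
    finally show ?thesis by (simp add: algebra_simps)
  qed
  have e1: "(p + pos_psi1 y) / 2 * ((\<integral>u. ?i u * \<phi> u \<partial>lborel) + dA - dV)
     = (p + pos_psi1 y) / 2 * (\<integral>u. ?i u * \<phi> u \<partial>lborel) + (p + pos_psi1 y) / 2 * dA - (p + pos_psi1 y) / 2 * dV"
    by (simp add: algebra_simps)
  have e2: "(1 - \<alpha>) / 2 * q * IH2 + \<alpha> / 2 * q * IH2 = q / 2 * IH2" by (simp add: field_simps)
  have e3: "(12 * C + 3 * C\<^sup>2 / (1 - \<alpha>)) * pos_psi x * \<delta> = 6 * C * pos_psi x * \<delta> + 6 * C * pos_psi x * \<delta> + 3 * C\<^sup>2 / (1 - \<alpha>) * pos_psi x * \<delta>"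
    by (simp add: algebra_simps)
  have e4: "\<eta> * ((2 * Bd * C + 2 * C) * \<delta> + IF + 3 * dA + IG) = \<eta> * (2 * Bd * C * \<delta>) + \<eta> * (2 * C * \<delta>) + \<eta> * IF + 3 * \<eta> * dA + \<eta> * IG"
    by (simp add: algebra_simps)
  have "(p + pos_psi1 y) / 2 * ((\<integral>u. ?i u * \<phi> u \<partial>lborel) + dA - dV) + pos_psi2 y / 2 * IG - q / 2 * IH2
    \<le> (12 * C + 3 * C\<^sup>2 / (1 - \<alpha>)) * pos_psi x * \<delta> + \<eta> * ((2 * Bd * C + 2 * C) * \<delta> + IF + 3 * dA + IG)"
    unfolding e1 e3 e4 using t1 t2 t3 t4 amgm e2 by linarith
  then show ?thesis
    unfolding p_def q_def x_def y_def IH2_def IG_def IF_def \<delta>_def .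
qed

section \<open>Pathwise estimates along uniform partitions\<close>

text \<open>Half-open intervals make adjacent integrals additive without discussing end points, and
  they match the steps of elementary integrands.\<close>

definition ivl_integral :: "(real \<Rightarrow> real) \<Rightarrow> real \<Rightarrow> real \<Rightarrow> real" where
  "ivl_integral f s r = (\<integral>u. indicator {s<..r} u * f u \<partial>lborel)"

abbreviation ivl_integrable :: "(real \<Rightarrow> real) \<Rightarrow> real \<Rightarrow> real \<Rightarrow> bool" where
  "ivl_integrable f s r \<equiv> integrable lborel (\<lambda>u. indicator {s<..r} u * f u)"

lemma ivl_integrable_subset:
  assumes "ivl_integrable f t r" "t \<le> s" "s' \<le> r"
  shows "ivl_integrable f s s'"
proof -
  have "integrable lborel (\<lambda>u. indicator {t<..r} u * f u * indicator {s<..s'} u)"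
    by (rule integrable_real_mult_indicator[OF _ assms(1)]) simp
  moreover have "(\<lambda>u. indicator {t<..r} u * f u * indicator {s<..s'} u) = (\<lambda>u. indicator {s<..s'} u * f u)"
    using assms by (auto simp: indicator_def fun_eq_iff)
  ultimately show ?thesis by simp
qed

lemma ivl_integral_nonneg: "AE u in lborel. u \<in> {s<..r} \<longrightarrow> 0 \<le> f u \<Longrightarrow> 0 \<le> ivl_integral f s r"
  unfolding ivl_integral_def by (rule integral_nonneg_AE) (auto simp: indicator_def elim!: eventually_mono)

lemma ivl_integral_abs_le: "\<bar>ivl_integral f s r\<bar> \<le> ivl_integral (\<lambda>u. \<bar>f u\<bar>) s r"
  unfolding ivl_integral_def using integral_abs_bound[of lborel "\<lambda>u. indicator {s<..r} u * f u"]
  by (simp add: abs_mult)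

lemma ivl_integral_sum:
  assumes "ivl_integrable f (\<tau> 0) (\<tau> k)" and mono: "\<And>i. i < k \<Longrightarrow> \<tau> i \<le> \<tau> (Suc i)"
  shows "(\<Sum>i<k. ivl_integral f (\<tau> i) (\<tau> (Suc i))) = ivl_integral f (\<tau> 0) (\<tau> k)"
proof -
  have m: "\<tau> 0 \<le> \<tau> i" "\<tau> i \<le> \<tau> k" if "i \<le> k" for i
  proof -
    have "\<tau> i \<le> \<tau> j" if "i \<le> j" "j \<le> k" for i j
      using that by (induction rule: dec_induct) (use mono in \<open>auto intro: order_trans\<close>)
    then show "\<tau> 0 \<le> \<tau> i" "\<tau> i \<le> \<tau> k" using that by auto
  qed
  have "(\<Sum>i<k. ivl_integral f (\<tau> i) (\<tau> (Suc i))) = (\<integral>u. (\<Sum>i<k. indicator {\<tau> i<..\<tau> (Suc i)} u * f u) \<partial>lborel)"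
    unfolding ivl_integral_def
    by (rule Bochner_Integration.integral_sum[symmetric], rule ivl_integrable_subset[OF assms(1)]) (use m in auto)
  also have "\<dots> = ivl_integral f (\<tau> 0) (\<tau> k)"
    unfolding sum_distrib_right[symmetric] ivl_integral_def
    using sum_indicator_consecutive[of k \<tau>] mono by simp
  finally show ?thesis .
qed

lemma ivl_integral_split:
  assumes "ivl_integrable f a b" "a \<le> s" "s \<le> b"
  shows "ivl_integral f a b = ivl_integral f a s + ivl_integral f s b"
proof -
  have "ivl_integral f a s + ivl_integral f s b = (\<integral>u. indicator {a<..s} u * f u + indicator {s<..b} u * f u \<partial>lborel)"
    unfolding ivl_integral_def
    by (rule Bochner_Integration.integral_add[symmetric]; rule ivl_integrable_subset[OF assms(1)]) (use assms in auto)
  also have "\<dots> = ivl_integral f a b"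
    unfolding ivl_integral_def by (rule Bochner_Integration.integral_cong) (use assms in \<open>auto simp: indicator_def\<close>)
  finally show ?thesis by simp
qed

text \<open>The two integrands differ at the single point s, so they are measurable together; if
  they are not measurable, both integrals take the default value 0. The identity therefore holds for
  every f.\<close>

lemma ivl_integral_set: "set_lebesgue_integral lborel {s..r} f = ivl_integral f s r"
  unfolding set_lebesgue_integral_def ivl_integral_def real_scaleR_def
proof -
  let ?l = "\<lambda>u. indicator {s..r} u * f u" and ?m = "\<lambda>u. indicator {s<..r} u * f u"
  have ae: "AE u in lborel. ?l u = ?m u"
    using AE_lborel_singleton[of s] by eventually_elim (auto simp: indicator_def)
  have iff: "?l \<in> borel_measurable lborel \<longleftrightarrow> ?m \<in> borel_measurable lborel"
  proof
    assume l: "?l \<in> borel_measurable lborel"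
    have "?m = (\<lambda>u. indicator {s<..r} u * ?l u)" by (auto simp: indicator_def fun_eq_iff)
    then show "?m \<in> borel_measurable lborel" using l by (metis (no_types) borel_measurable_times borel_measurable_indicator greaterThanAtMost_borel sets_lborel)
  next
    assume m: "?m \<in> borel_measurable lborel"
    have "?l = (\<lambda>u. ?m u + indicator ({s} \<inter> {s..r}) u * f s)" by (auto simp: indicator_def fun_eq_iff)
    moreover have "(\<lambda>u. ?m u + indicator ({s} \<inter> {s..r}) u * f s) \<in> borel_measurable lborel" using m by auto
    ultimately show "?l \<in> borel_measurable lborel" by simp
  qed
  show "integral\<^sup>L lborel ?l = integral\<^sup>L lborel ?m"
  proof (cases "?l \<in> borel_measurable lborel")
    case True
    then show ?thesis using iff ae by (intro integral_cong_AE) auto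
  next
    case False
    then have "\<not> integrable lborel ?l" "\<not> integrable lborel ?m" using iff by (auto dest: borel_measurable_integrable)
    then show ?thesis by (simp add: not_integrable_integral_eq)
  qed
qed

text \<open>Continuity of an indefinite integral is imported from the gauge integral, with which the
  Lebesgue integral agrees on integrable functions.\<close>

lemma continuous_on_ivl_integral:
  assumes "ivl_integrable f t r"
  shows "continuous_on {t..r} (\<lambda>s. ivl_integral f t s)"
proof -
  let ?g = "\<lambda>u. indicator {t<..r} u * f u"
  have "?g absolutely_integrable_on UNIV"
    using assms by (simp add: set_integrable_def integrable_completion)
  then have "?g absolutely_integrable_on {t..r}" by (rule set_integrable_subset) auto
  then have hk: "?g integrable_on {t..r}" by (rule set_lebesgue_integral_eq_integral)
  have "ivl_integral f t s = integral {t..s} ?g" if "s \<in> {t..r}" for s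
  proof -
    have "?g absolutely_integrable_on {t..s}"
      using \<open>?g absolutely_integrable_on UNIV\<close> by (rule set_integrable_subset) auto
    have "set_integrable lborel {t..s} ?g"
      unfolding set_integrable_def using integrable_real_mult_indicator[OF _ assms, of "{t..s}"] by (simp add: mult.commute)
    then have "integral {t..s} ?g = set_lebesgue_integral lborel {t..s} ?g"
      by (simp add: set_borel_integral_eq_integral)
    also have "\<dots> = ivl_integral f t s"
      unfolding set_lebesgue_integral_def ivl_integral_def
      by (rule Bochner_Integration.integral_cong) (use that in \<open>auto simp: indicator_def\<close>)
    finally show ?thesis by simp
  qed
  then show ?thesis
    by (intro continuous_on_eq[OF indefinite_integral_continuous_1[OF hk]]) simp
qed

text \<open>There are n + 1 intervals, so every n gives a genuine partition and the mesh is never a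
  quotient by 0.\<close>

definition grid :: "real \<Rightarrow> real \<Rightarrow> nat \<Rightarrow> nat \<Rightarrow> real" where
  "grid t r n i = t + (r - t) * real i / real (Suc n)"

lemma grid_0 [simp]: "grid t r n 0 = t"
  and grid_end [simp]: "grid t r n (Suc n) = r"
  by (auto simp: grid_def)

lemma grid_step: "grid t r n (Suc i) - grid t r n i = (r - t) / real (Suc n)"
  by (simp add: grid_def diff_divide_distrib[symmetric] algebra_simps)

lemma grid_mono: "t \<le> r \<Longrightarrow> grid t r n i \<le> grid t r n (Suc i)"
  using grid_step[of t r n i] by (metis diff_ge_0_iff_ge divide_nonneg_nonneg of_nat_0_le_iff)

lemma grid_range:
  assumes "t \<le> r" "i \<le> Suc n"
  shows "t \<le> grid t r n i" "grid t r n i \<le> r"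
proof -
  show "t \<le> grid t r n i" using assms by (simp add: grid_def)
  have "(r - t) * (real i / real (Suc n)) \<le> (r - t) * 1"
    using assms by (intro mult_left_mono) (auto simp: divide_le_eq)
  then show "grid t r n i \<le> r" by (simp add: grid_def)
qed

lemma grid_osc:
  fixes f :: "real \<Rightarrow> real"
  assumes f: "continuous_on {t..r} f" and tr: "t \<le> r" and \<eta>: "0 < \<eta>"
  shows "\<forall>\<^sub>F n in sequentially. \<forall>i\<le>n. \<forall>u\<in>{grid t r n i..grid t r n (Suc i)}. \<bar>f u - f (grid t r n i)\<bar> \<le> \<eta>"
proof -
  have "uniformly_continuous_on {t..r} f" by (rule compact_uniformly_continuous[OF f]) simp
  then obtain d where d: "0 < d" "\<And>u v. u \<in> {t..r} \<Longrightarrow> v \<in> {t..r} \<Longrightarrow> dist u v < d \<Longrightarrow> dist (f u) (f v) < \<eta>"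
    using \<eta> unfolding uniformly_continuous_on_def by metis
  have "(\<lambda>n. (r - t) / real (Suc n)) \<longlonglongrightarrow> 0"
    using LIMSEQ_Suc[OF lim_const_over_n[of "r - t"]] by simp
  then have "\<forall>\<^sub>F n in sequentially. (r - t) / real (Suc n) < d" using d(1) by (rule order_tendstoD(2))
  then show ?thesis
  proof eventually_elim
    case (elim n)
    show ?case
    proof (intro allI impI ballI)
      fix i u assume i: "i \<le> n" and u: "u \<in> {grid t r n i..grid t r n (Suc i)}"
      have "dist u (grid t r n i) < d" using u grid_step[of t r n i] elim by (auto simp: dist_real_def)
      moreover have "u \<in> {t..r}" "grid t r n i \<in> {t..r}"
        using u grid_range[OF tr, of i n] grid_range[OF tr, of "Suc i" n] i by auto
      ultimately show "\<bar>f u - f (grid t r n i)\<bar> \<le> \<eta>" using d(2)[of u "grid t r n i"] by (simp add: dist_real_def)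
    qed
  qed
qed

text \<open>In each square one factor is bounded by the largest increment of the continuous P, which
  tends to 0, while the other sums to the total increase. Bounding the largest increment by the
  total one instead gives a majorant independent of n, for dominated convergence.\<close>

lemma grid_square_variation:
  fixes P :: "real \<Rightarrow> real"
  assumes tr: "t \<le> r" and P: "continuous_on {t..r} P" "mono_on {t..r} P"
    and a: "\<And>n i. i \<le> n \<Longrightarrow> \<bar>a n i\<bar> \<le> P (grid t r n (Suc i)) - P (grid t r n i)"
  shows "(\<lambda>n. \<Sum>i<Suc n. (a n i)\<^sup>2) \<longlonglongrightarrow> 0"
    and "(\<Sum>i<Suc n. (a n i)\<^sup>2) \<le> (P r - P t)\<^sup>2"
proof -
  have dP: "0 \<le> P (grid t r n (Suc i)) - P (grid t r n i)" if "i \<le> n" for n i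
    using a[OF that] by linarith
  have sum_dP: "(\<Sum>i<Suc n. P (grid t r n (Suc i)) - P (grid t r n i)) = P r - P t" for n
    using sum_lessThan_telescope[of "\<lambda>i. P (grid t r n i)" "Suc n"] by simp
  have tot: "0 \<le> P r - P t" using P(2) tr by (auto dest: mono_onD)
  have bound: "(\<Sum>i<Suc n. (a n i)\<^sup>2) \<le> \<eta> * (P r - P t)"
    if "\<And>i. i \<le> n \<Longrightarrow> P (grid t r n (Suc i)) - P (grid t r n i) \<le> \<eta>" for n \<eta>
  proof -
    have "(\<Sum>i<Suc n. (a n i)\<^sup>2) \<le> (\<Sum>i<Suc n. \<eta> * (P (grid t r n (Suc i)) - P (grid t r n i)))"
    proof (rule sum_mono)
      fix i assume "i \<in> {..<Suc n}"
      then have i: "i \<le> n" by auto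
      have "(a n i)\<^sup>2 = \<bar>a n i\<bar> * \<bar>a n i\<bar>" by (simp add: power2_eq_square)
      also have "\<dots> \<le> \<eta> * (P (grid t r n (Suc i)) - P (grid t r n i))"
        using a[OF i] that[OF i] dP[OF i] by (intro mult_mono) auto
      finally show "(a n i)\<^sup>2 \<le> \<eta> * (P (grid t r n (Suc i)) - P (grid t r n i))" .
    qed
    also have "\<dots> = \<eta> * (P r - P t)" unfolding sum_distrib_left[symmetric] sum_dP ..
    finally show ?thesis .
  qed
  show "(\<Sum>i<Suc n. (a n i)\<^sup>2) \<le> (P r - P t)\<^sup>2"
    unfolding power2_eq_square[of "P r - P t"]
  proof (rule bound)
    fix i assume i: "i \<le> n"
    have "P (grid t r n (Suc i)) - P (grid t r n i) \<le> (\<Sum>i<Suc n. P (grid t r n (Suc i)) - P (grid t r n i))"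
      by (rule member_le_sum) (use i dP in auto)
    then show "P (grid t r n (Suc i)) - P (grid t r n i) \<le> P r - P t" unfolding sum_dP .
  qed
  show "(\<lambda>n. \<Sum>i<Suc n. (a n i)\<^sup>2) \<longlonglongrightarrow> 0"
  proof (rule LIMSEQ_I)
    fix \<epsilon> :: real assume \<epsilon>: "0 < \<epsilon>"
    define \<eta> where "\<eta> = \<epsilon> / (P r - P t + 1)"
    have \<eta>: "0 < \<eta>" using \<epsilon> tot by (simp add: \<eta>_def)
    have small: "\<eta> * (P r - P t) < \<epsilon>" using \<epsilon> tot by (simp add: \<eta>_def field_simps)
    obtain n0 where n0: "\<And>n. n \<ge> n0 \<Longrightarrow> \<forall>i\<le>n. \<forall>u\<in>{grid t r n i..grid t r n (Suc i)}. \<bar>P u - P (grid t r n i)\<bar> \<le> \<eta>"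
      using grid_osc[OF P(1) tr \<eta>] by (auto simp: eventually_sequentially)
    show "\<exists>n0. \<forall>n\<ge>n0. norm ((\<Sum>i<Suc n. (a n i)\<^sup>2) - 0) < \<epsilon>"
    proof (intro exI allI impI)
      fix n assume "n \<ge> n0"
      then have "(\<Sum>i<Suc n. (a n i)\<^sup>2) \<le> \<eta> * (P r - P t)"
        using n0[of n] grid_mono[OF tr] by (intro bound) (fastforce simp: abs_le_iff)
      moreover have "0 \<le> (\<Sum>i<Suc n. (a n i)\<^sup>2)" by (intro sum_nonneg) auto
      ultimately show "norm ((\<Sum>i<Suc n. (a n i)\<^sup>2) - 0) < \<epsilon>" using small by simp
    qed
  qed
qed

definition ito_main :: "(real \<Rightarrow> real) \<Rightarrow> (real \<Rightarrow> real \<Rightarrow> real) \<Rightarrow> (real \<Rightarrow> real) \<Rightarrow> (real \<Rightarrow> real) \<Rightarrow> real \<Rightarrow> real \<Rightarrow> nat \<Rightarrow> real" where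
  "ito_main X a G H2 t r n = (\<Sum>i<Suc n.
     (pos_psi1 (X (grid t r n i)) + pos_psi1 (X (grid t r n (Suc i)))) / 2 * a (grid t r n i) (grid t r n (Suc i))
     + pos_psi2 (X (grid t r n (Suc i))) / 2 * ivl_integral G (grid t r n i) (grid t r n (Suc i))
     - pos_psi2 (X (grid t r n i)) / 2 * ivl_integral H2 (grid t r n i) (grid t r n (Suc i)))"

definition psi_riemann :: "(real \<Rightarrow> real) \<Rightarrow> real \<Rightarrow> real \<Rightarrow> nat \<Rightarrow> real" where
  "psi_riemann X t r n = (\<Sum>i<Suc n. pos_psi (X (grid t r n i)) * ((r - t) / real (Suc n)))"

text \<open>The first claim is the pathwise limit, the second the majorant that dominated
  convergence needs. Positive parts are taken because V can make the sum very negative, which does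
  no harm to an upper estimate but would spoil a two-sided bound.\<close>

lemma ito_main_bounds:
  fixes X \<phi> G H A V :: "real \<Rightarrow> real"
  assumes tr: "t \<le> r" and C: "0 \<le> C" and \<alpha>: "0 \<le> \<alpha>" "\<alpha> < 1"
    and X: "continuous_on {t..r} X" "\<And>u. u \<in> {t..r} \<Longrightarrow> \<bar>X u\<bar> \<le> Bd"
    and \<phi>: "ivl_integrable \<phi> t r" and G: "ivl_integrable G t r"
    and H: "ivl_integrable (\<lambda>u. (H u)\<^sup>2) t r" "H \<in> borel_measurable borel" "\<And>u. 0 \<le> H u"
    and \<phi>_le: "AE u in lborel. u \<in> {t<..r} \<longrightarrow> \<bar>\<phi> u\<bar> \<le> C * (\<bar>X u\<bar> + H u)"
    and G_le: "AE u in lborel. u \<in> {t<..r} \<longrightarrow> 0 \<le> G u \<and> G u \<le> C * (X u)\<^sup>2 + \<alpha> * (H u)\<^sup>2"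
    and A: "mono_on {t..r} A" "\<And>s s'. t \<le> s \<Longrightarrow> s \<le> s' \<Longrightarrow> s' \<le> r \<Longrightarrow> A s < A s' \<Longrightarrow> \<exists>u\<in>{s..s'}. X u \<le> 0"
    and V: "mono_on {t..r} V"
    and a: "\<And>s s'. a s s' = ivl_integral \<phi> s s' + (A s' - A s) - (V s' - V s)"
  shows "(\<lambda>n. max 0 (ito_main X a G (\<lambda>u. (H u)\<^sup>2) t r n - (12 * C + 3 * C\<^sup>2 / (1 - \<alpha>)) * psi_riemann X t r n)) \<longlonglongrightarrow> 0"
    and "max 0 (ito_main X a G (\<lambda>u. (H u)\<^sup>2) t r n - (12 * C + 3 * C\<^sup>2 / (1 - \<alpha>)) * psi_riemann X t r n)
      \<le> 2 * Bd * (ivl_integral (\<lambda>u. \<bar>\<phi> u\<bar>) t r + (A r - A t)) + ivl_integral G t r"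
proof -
  define k where "k = 12 * C + 3 * C\<^sup>2 / (1 - \<alpha>)"
  have k0: "0 \<le> k" using C \<alpha> by (simp add: k_def)
  let ?g = "grid t r"
  let ?IF = "ivl_integral (\<lambda>u. \<bar>\<phi> u\<bar>)"
  have abs\<phi>: "ivl_integrable (\<lambda>u. \<bar>\<phi> u\<bar>) t r" using integrable_abs[OF \<phi>] by (simp add: abs_mult)
  have Bd0: "0 \<le> Bd" using X(2)[of t] tr by force
  have sub: "t \<le> ?g n i" "?g n i \<le> ?g n (Suc i)" "?g n (Suc i) \<le> r" if "i < Suc n" for n i
    using that grid_range[OF tr, of i n] grid_range[OF tr, of "Suc i" n] grid_mono[OF tr, of n i] by auto
  have sum_IF: "(\<Sum>i<Suc n. ?IF (?g n i) (?g n (Suc i))) = ?IF t r" for n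
    using ivl_integral_sum[where f="\<lambda>u. \<bar>\<phi> u\<bar>" and \<tau>="?g n" and k="Suc n"] abs\<phi> grid_mono[OF tr] by simp
  have sum_IG: "(\<Sum>i<Suc n. ivl_integral G (?g n i) (?g n (Suc i))) = ivl_integral G t r" for n
    using ivl_integral_sum[where f=G and \<tau>="?g n" and k="Suc n"] G grid_mono[OF tr] by simp
  have sum_A: "(\<Sum>i<Suc n. A (?g n (Suc i)) - A (?g n i)) = A r - A t" for n
    using sum_lessThan_telescope[of "\<lambda>i. A (?g n i)" "Suc n"] by simp
  have dA: "0 \<le> A (?g n (Suc i)) - A (?g n i)" if "i < Suc n" for n i
    using mono_onD[OF A(1), of "?g n i" "?g n (Suc i)"] sub[OF that] by auto
  have dV: "0 \<le> V (?g n (Suc i)) - V (?g n i)" if "i < Suc n" for n i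
    using mono_onD[OF V, of "?g n i" "?g n (Suc i)"] sub[OF that] by auto
  have AE\<phi>: "AE u in lborel. u \<in> {?g n i<..?g n (Suc i)} \<longrightarrow> \<bar>\<phi> u\<bar> \<le> C * (\<bar>X u\<bar> + H u)" if "i < Suc n" for n i
    using \<phi>_le by eventually_elim (use sub[OF that] in auto)
  have AEG: "AE u in lborel. u \<in> {?g n i<..?g n (Suc i)} \<longrightarrow> 0 \<le> G u \<and> G u \<le> C * (X u)\<^sup>2 + \<alpha> * (H u)\<^sup>2" if "i < Suc n" for n i
    using G_le by eventually_elim (use sub[OF that] in auto)
  have G0: "0 \<le> ivl_integral G (?g n i) (?g n (Suc i))" if "i < Suc n" for n i
    by (rule ivl_integral_nonneg) (use AEG[OF that] in \<open>auto elim!: eventually_mono\<close>)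
  have G00: "0 \<le> ivl_integral G t r"
    by (rule ivl_integral_nonneg) (use G_le in \<open>auto elim!: eventually_mono\<close>)
  have IF0: "0 \<le> ?IF s s'" for s s' by (rule ivl_integral_nonneg) auto
  have A0: "0 \<le> A r - A t" using mono_onD[OF A(1), of t r] tr by auto
  have r0: "0 \<le> psi_riemann X t r n" for n
    unfolding psi_riemann_def using tr by (intro sum_nonneg mult_nonneg_nonneg pos_psi_nonneg) auto
  let ?D = "2 * Bd * (?IF t r + (A r - A t)) + ivl_integral G t r"
  have "ito_main X a G (\<lambda>u. (H u)\<^sup>2) t r n \<le> ?D" for n
  proof -
    have "ito_main X a G (\<lambda>u. (H u)\<^sup>2) t r n \<le> (\<Sum>i<Suc n. 2 * Bd * (?IF (?g n i) (?g n (Suc i)) + (A (?g n (Suc i)) - A (?g n i)))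
        + ivl_integral G (?g n i) (?g n (Suc i)))"
      unfolding ito_main_def
    proof (rule sum_mono)
      fix i assume "i \<in> {..<Suc n}"
      then have i: "i < Suc n" by simp
      let ?s = "?g n i" and ?s' = "?g n (Suc i)"
      have p: "0 \<le> (pos_psi1 (X ?s) + pos_psi1 (X ?s')) / 2" "(pos_psi1 (X ?s) + pos_psi1 (X ?s')) / 2 \<le> 2 * Bd"
        using pos_psi1_nonneg[of "X ?s"] pos_psi1_nonneg[of "X ?s'"] pos_psi1_le[of "X ?s"] pos_psi1_le[of "X ?s'"]
          X(2)[of ?s] X(2)[of ?s'] sub[OF i] by auto
      have "a ?s ?s' \<le> ?IF ?s ?s' + (A ?s' - A ?s)"
        using ivl_integral_abs_le[of \<phi> ?s ?s'] dV[OF i] unfolding a by linarith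
      then have "(pos_psi1 (X ?s) + pos_psi1 (X ?s')) / 2 * a ?s ?s' \<le> (pos_psi1 (X ?s) + pos_psi1 (X ?s')) / 2 * (?IF ?s ?s' + (A ?s' - A ?s))"
        using p by (intro mult_left_mono) auto
      also have "\<dots> \<le> 2 * Bd * (?IF ?s ?s' + (A ?s' - A ?s))"
        using p IF0[of ?s ?s'] dA[OF i] by (intro mult_right_mono) auto
      finally have 1: "(pos_psi1 (X ?s) + pos_psi1 (X ?s')) / 2 * a ?s ?s' \<le> 2 * Bd * (?IF ?s ?s' + (A ?s' - A ?s))" .
      have 2: "pos_psi2 (X ?s') / 2 * ivl_integral G ?s ?s' \<le> ivl_integral G ?s ?s'"
        using pos_psi2_bounds[of "X ?s'"] G0[OF i] by (intro mult_left_le_one_le) auto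
      have 3: "0 \<le> pos_psi2 (X ?s) / 2 * ivl_integral (\<lambda>u. (H u)\<^sup>2) ?s ?s'"
        using pos_psi2_bounds[of "X ?s"] by (intro mult_nonneg_nonneg ivl_integral_nonneg) auto
      show "(pos_psi1 (X ?s) + pos_psi1 (X ?s')) / 2 * a ?s ?s' + pos_psi2 (X ?s') / 2 * ivl_integral G ?s ?s'
        - pos_psi2 (X ?s) / 2 * ivl_integral (\<lambda>u. (H u)\<^sup>2) ?s ?s'
        \<le> 2 * Bd * (?IF ?s ?s' + (A ?s' - A ?s)) + ivl_integral G ?s ?s'"
        using 1 2 3 by linarith
    qed
    also have "\<dots> = ?D"
      by (simp only: sum.distrib sum_distrib_left[symmetric] sum_IF sum_IG sum_A)
    finally show ?thesis .
  qed
  moreover have "0 \<le> ?D" using Bd0 IF0[of t r] A0 G00 by auto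
  moreover have "0 \<le> k * psi_riemann X t r n" using k0 r0 by simp
  ultimately show "max 0 (ito_main X a G (\<lambda>u. (H u)\<^sup>2) t r n - (12 * C + 3 * C\<^sup>2 / (1 - \<alpha>)) * psi_riemann X t r n) \<le> ?D"
    unfolding k_def[symmetric] by (smt (verit))
  \<comment> \<open>The coefficient of \<eta> summed over the grid. Each contribution is additive
    over the intervals, so the total does not depend on n.\<close>
  define Kc where "Kc = (2 * Bd * C + 2 * C) * (r - t) + ?IF t r + 3 * (A r - A t) + ivl_integral G t r"
  have Kc0: "0 \<le> Kc" unfolding Kc_def using Bd0 C tr IF0[of t r] A0 G00 by auto
  have step: "ito_main X a G (\<lambda>u. (H u)\<^sup>2) t r n - k * psi_riemann X t r n \<le> \<eta> * Kc"
    if osc: "\<forall>i\<le>n. \<forall>u\<in>{?g n i..?g n (Suc i)}. \<bar>X u - X (?g n i)\<bar> \<le> \<eta>" and \<eta>: "\<eta> \<le> 1" for n \<eta>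
  proof -
    have "ito_main X a G (\<lambda>u. (H u)\<^sup>2) t r n \<le> (\<Sum>i<Suc n. k * pos_psi (X (?g n i)) * ((r - t) / real (Suc n))
      + \<eta> * ((2 * Bd * C + 2 * C) * ((r - t) / real (Suc n)) + ?IF (?g n i) (?g n (Suc i)) + 3 * (A (?g n (Suc i)) - A (?g n i))
         + ivl_integral G (?g n i) (?g n (Suc i))))"
      unfolding ito_main_def
    proof (rule sum_mono)
      fix i assume "i \<in> {..<Suc n}"
      then have i: "i < Suc n" by simp
      let ?s = "?g n i" and ?s' = "?g n (Suc i)"
      note S = sub[OF i]
      have "\<exists>u\<in>{?s..?s'}. X u \<le> 0" if "0 < A ?s' - A ?s" using A(2)[of ?s ?s'] S that by auto
      then show "(pos_psi1 (X ?s) + pos_psi1 (X ?s')) / 2 * a ?s ?s' + pos_psi2 (X ?s') / 2 * ivl_integral G ?s ?s'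
        - pos_psi2 (X ?s) / 2 * ivl_integral (\<lambda>u. (H u)\<^sup>2) ?s ?s'
        \<le> k * pos_psi (X ?s) * ((r - t) / real (Suc n))
         + \<eta> * ((2 * Bd * C + 2 * C) * ((r - t) / real (Suc n)) + ?IF ?s ?s' + 3 * (A ?s' - A ?s) + ivl_integral G ?s ?s')"
        unfolding a k_def ivl_integral_def grid_step[of t r n i, symmetric]
        by (intro pathwise_interval_bound S C \<alpha> \<eta> H(2,3) AE\<phi>[OF i] AEG[OF i] dA[OF i] dV[OF i]
               ivl_integrable_subset[OF \<phi>] ivl_integrable_subset[OF G] ivl_integrable_subset[OF H(1)])
           (use osc i X(2)[of ?s] S in auto)
    qed
    also have "\<dots> = k * psi_riemann X t r n + \<eta> * ((2 * Bd * C + 2 * C) * (\<Sum>i<Suc n. (r - t) / real (Suc n)) + ?IF t r + 3 * (A r - A t) + ivl_integral G t r)"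
      unfolding psi_riemann_def by (simp only: sum.distrib sum_distrib_left[symmetric] sum_IF sum_IG sum_A mult.assoc)
    also have "(\<Sum>i<Suc n. (r - t) / real (Suc n)) = r - t" by simp
    finally show ?thesis by (simp add: Kc_def)
  qed
  show "(\<lambda>n. max 0 (ito_main X a G (\<lambda>u. (H u)\<^sup>2) t r n - (12 * C + 3 * C\<^sup>2 / (1 - \<alpha>)) * psi_riemann X t r n)) \<longlonglongrightarrow> 0"
    unfolding k_def[symmetric]
  proof (rule LIMSEQ_I)
    fix \<epsilon> :: real assume \<epsilon>: "0 < \<epsilon>"
    define \<eta> where "\<eta> = min 1 (\<epsilon> / (Kc + 1))"
    have \<eta>: "0 < \<eta>" "\<eta> \<le> 1" using \<epsilon> Kc0 by (auto simp: \<eta>_def)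
    have "\<eta> * Kc \<le> \<epsilon> / (Kc + 1) * Kc" using Kc0 by (intro mult_right_mono) (auto simp: \<eta>_def)
    also have "\<dots> < \<epsilon>" using \<epsilon> Kc0 by (simp add: field_simps)
    finally have small: "\<eta> * Kc < \<epsilon>" .
    obtain n0 where n0: "\<And>n. n \<ge> n0 \<Longrightarrow> \<forall>i\<le>n. \<forall>u\<in>{?g n i..?g n (Suc i)}. \<bar>X u - X (?g n i)\<bar> \<le> \<eta>"
      using grid_osc[OF X(1) tr \<eta>(1)] by (auto simp: eventually_sequentially)
    show "\<exists>n0. \<forall>n\<ge>n0. norm (max 0 (ito_main X a G (\<lambda>u. (H u)\<^sup>2) t r n - k * psi_riemann X t r n) - 0) < \<epsilon>"
    proof (intro exI allI impI)
      fix n assume "n \<ge> n0"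
      then have "ito_main X a G (\<lambda>u. (H u)\<^sup>2) t r n - k * psi_riemann X t r n \<le> \<eta> * Kc"
        by (intro step n0 \<eta>)
      then show "norm (max 0 (ito_main X a G (\<lambda>u. (H u)\<^sup>2) t r n - k * psi_riemann X t r n) - 0) < \<epsilon>"
        using small \<epsilon> by auto
    qed
  qed
qed

section \<open>Square-integrable increments of stochastic integrals\<close>

lemma integrable_square_add:
  fixes u v :: "'a \<Rightarrow> real"
  assumes "u \<in> borel_measurable M" "integrable M (\<lambda>x. (u x)\<^sup>2)" "v \<in> borel_measurable M" "integrable M (\<lambda>x. (v x)\<^sup>2)"
  shows "integrable M (\<lambda>x. (u x + v x)\<^sup>2)"
  unfolding power2_sum using assms integrable_mult_square[OF assms(1,3,2,4)] by (auto simp: mult.assoc)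

lemma integrable_square_diff:
  fixes u v :: "'a \<Rightarrow> real"
  assumes "u \<in> borel_measurable M" "integrable M (\<lambda>x. (u x)\<^sup>2)" "v \<in> borel_measurable M" "integrable M (\<lambda>x. (v x)\<^sup>2)"
  shows "integrable M (\<lambda>x. (u x - v x)\<^sup>2)"
  unfolding power2_diff using assms integrable_mult_square[OF assms(1,3,2,4)] by (auto simp: mult.assoc)

lemma integrable_square_bound:
  fixes u v :: "'a \<Rightarrow> real"
  assumes "integrable M (\<lambda>x. (v x)\<^sup>2)" "u \<in> borel_measurable M" "AE x in M. \<bar>u x\<bar> \<le> v x"
  shows "integrable M (\<lambda>x. (u x)\<^sup>2)"
proof (rule Bochner_Integration.integrable_bound[OF assms(1)])
  show "AE x in M. norm ((u x)\<^sup>2) \<le> norm ((v x)\<^sup>2)"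
    using assms(3)
  proof eventually_elim
    case (elim x)
    then have "\<bar>u x\<bar>\<^sup>2 \<le> (v x)\<^sup>2" by (intro power_mono) auto
    then show ?case by simp
  qed
qed (use assms(2) in auto)

context simple_integration
begin

lemma ito_limit_diff:
  assumes "ito_limit s r \<phi> w" "ito_limit s r \<phi>' w'" and sr: "0 \<le> s" "s \<le> r" "r \<le> T"
    and [measurable]: "(\<lambda>x. \<phi> (snd x) (fst x)) \<in> borel_measurable (M \<Otimes>\<^sub>M lborel)"
      "(\<lambda>x. \<phi>' (snd x) (fst x)) \<in> borel_measurable (M \<Otimes>\<^sub>M lborel)"
  shows "ito_limit s r (\<lambda>u \<omega>. \<phi> u \<omega> - \<phi>' u \<omega>) (\<lambda>\<omega>. w \<omega> - w' \<omega>)"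
proof -
  let ?L = "M \<Otimes>\<^sub>M lborel"
  have pt: "(norm (x - y))\<^sup>2 \<le> 2 * (norm x)\<^sup>2 + 2 * (norm y)\<^sup>2" for x y :: "'z::real_normed_vector"
  proof -
    have "(norm (x - y))\<^sup>2 \<le> (norm x + norm y)\<^sup>2" using norm_triangle_ineq4 by (intro power_mono) auto
    also have "\<dots> \<le> 2 * (norm x)\<^sup>2 + 2 * (norm y)\<^sup>2"
      using sum_squares_bound[of "norm x" "norm y"] by (simp add: power2_sum)
    finally show ?thesis .
  qed
  have lim: "(\<lambda>k. \<integral>\<^sup>+x. ennreal ((norm (u k x - v k x))\<^sup>2) \<partial>N) \<longlonglongrightarrow> 0"
    if [measurable]: "\<And>k. u k \<in> borel_measurable N" "\<And>k. v k \<in> borel_measurable N"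
      and l: "(\<lambda>k::nat. \<integral>\<^sup>+x. ennreal ((norm (u k x))\<^sup>2) \<partial>N) \<longlonglongrightarrow> 0" "(\<lambda>k. \<integral>\<^sup>+x. ennreal ((norm (v k x))\<^sup>2) \<partial>N) \<longlonglongrightarrow> 0"
    for N :: "'y measure" and u v :: "nat \<Rightarrow> 'y \<Rightarrow> 'z::euclidean_space"
  proof (rule tendsto_0_nn_integral_le)
    have "(\<lambda>k. 2 * (\<integral>\<^sup>+x. ennreal ((norm (u k x))\<^sup>2) \<partial>N) + 2 * (\<integral>\<^sup>+x. ennreal ((norm (v k x))\<^sup>2) \<partial>N)) \<longlonglongrightarrow> 2 * 0 + 2 * 0"
      by (intro tendsto_add ennreal_tendsto_cmult l) auto
    then show "(\<lambda>k. 2 * (\<integral>\<^sup>+x. ennreal ((norm (u k x))\<^sup>2) \<partial>N) + 2 * (\<integral>\<^sup>+x. ennreal ((norm (v k x))\<^sup>2) \<partial>N)) \<longlonglongrightarrow> 0" by simp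
    fix k
    have "(\<integral>\<^sup>+x. ennreal ((norm (u k x - v k x))\<^sup>2) \<partial>N) \<le> (\<integral>\<^sup>+x. 2 * ennreal ((norm (u k x))\<^sup>2) + 2 * ennreal ((norm (v k x))\<^sup>2) \<partial>N)"
    proof (intro nn_integral_mono)
      fix x
      have "ennreal ((norm (u k x - v k x))\<^sup>2) \<le> ennreal (2 * (norm (u k x))\<^sup>2 + 2 * (norm (v k x))\<^sup>2)" by (rule ennreal_leI) (rule pt)
      then show "ennreal ((norm (u k x - v k x))\<^sup>2) \<le> 2 * ennreal ((norm (u k x))\<^sup>2) + 2 * ennreal ((norm (v k x))\<^sup>2)"
        by (simp add: ennreal_mult)
    qed
    also have "\<dots> = 2 * (\<integral>\<^sup>+x. ennreal ((norm (u k x))\<^sup>2) \<partial>N) + 2 * (\<integral>\<^sup>+x. ennreal ((norm (v k x))\<^sup>2) \<partial>N)"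
      by (subst nn_integral_add) (auto simp: nn_integral_cmult)
    finally show "(\<integral>\<^sup>+x. ennreal ((norm (u k x - v k x))\<^sup>2) \<partial>N) \<le> 2 * (\<integral>\<^sup>+x. ennreal ((norm (u k x))\<^sup>2) \<partial>N) + 2 * (\<integral>\<^sup>+x. ennreal ((norm (v k x))\<^sup>2) \<partial>N)" .
  qed
  obtain \<phi>k Ik where w[measurable]: "w \<in> borel_measurable M" and k: "\<And>k::nat. ito_simple s r (\<phi>k k) (Ik k)"
    and l1: "(\<lambda>k. \<integral>\<^sup>+x. ennreal ((norm (\<phi>k k (snd x) (fst x) - indicator {s<..r} (snd x) *\<^sub>R \<phi> (snd x) (fst x)))\<^sup>2) \<partial>?L) \<longlonglongrightarrow> 0"
    and l2: "(\<lambda>k. \<integral>\<^sup>+\<omega>. ennreal ((Ik k \<omega> - w \<omega>)\<^sup>2) \<partial>M) \<longlonglongrightarrow> 0"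
    using assms(1) unfolding ito_limit_def by auto
  obtain \<phi>k' Ik' where w'[measurable]: "w' \<in> borel_measurable M" and k': "\<And>k::nat. ito_simple s r (\<phi>k' k) (Ik' k)"
    and l1': "(\<lambda>k. \<integral>\<^sup>+x. ennreal ((norm (\<phi>k' k (snd x) (fst x) - indicator {s<..r} (snd x) *\<^sub>R \<phi>' (snd x) (fst x)))\<^sup>2) \<partial>?L) \<longlonglongrightarrow> 0"
    and l2': "(\<lambda>k. \<integral>\<^sup>+\<omega>. ennreal ((Ik' k \<omega> - w' \<omega>)\<^sup>2) \<partial>M) \<longlonglongrightarrow> 0"
    using assms(2) unfolding ito_limit_def by auto
  note [measurable] = ito_simple_props(2)[OF k sr] ito_simple_props(2)[OF k' sr]
  have [measurable]: "(\<lambda>x. \<phi>k k (snd x) (fst x)) \<in> borel_measurable ?L" "(\<lambda>x. \<phi>k' k (snd x) (fst x)) \<in> borel_measurable ?L" for k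
    using ito_simple_props(1)[OF k sr] ito_simple_props(1)[OF k' sr] by (simp_all add: split_beta')
  have "(\<lambda>k. \<integral>\<^sup>+x. ennreal ((norm ((\<phi>k k (snd x) (fst x) - indicator {s<..r} (snd x) *\<^sub>R \<phi> (snd x) (fst x))
     - (\<phi>k' k (snd x) (fst x) - indicator {s<..r} (snd x) *\<^sub>R \<phi>' (snd x) (fst x))))\<^sup>2) \<partial>?L) \<longlonglongrightarrow> 0"
    by (rule lim[OF _ _ l1 l1']) measurable
  moreover have "(\<lambda>k. \<integral>\<^sup>+\<omega>. ennreal ((norm ((Ik k \<omega> - w \<omega>) - (Ik' k \<omega> - w' \<omega>)))\<^sup>2) \<partial>M) \<longlonglongrightarrow> 0"
    by (rule lim) (use l2 l2' in auto)
  ultimately show ?thesis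
    unfolding ito_limit_def
    by (intro conjI exI[of _ "\<lambda>k u \<omega>. \<phi>k k u \<omega> - \<phi>k' k u \<omega>"] exI[of _ "\<lambda>k \<omega>. Ik k \<omega> - Ik' k \<omega>"])
       (auto intro!: ito_simple_diff k k' simp: algebra_simps)
qed

text \<open>What the comparison needs to know about a stochastic integral viewed as a function of
  the interval, in a form stable under differences. The clause on vanishing weights is part of it
  because a difference inherits it directly from its two parts, whereas a proof from scratch
  requires elementary approximations of the integrand.\<close>

definition ito_increments :: "(real \<Rightarrow> 'w \<Rightarrow> 'b) \<Rightarrow> (real \<Rightarrow> real \<Rightarrow> 'w \<Rightarrow> real) \<Rightarrow> bool" where
  "ito_increments \<phi> w \<longleftrightarrow>
     (\<lambda>x. \<phi> (snd x) (fst x)) \<in> borel_measurable (M \<Otimes>\<^sub>M lborel) \<and>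
     integrable (M \<Otimes>\<^sub>M lborel) (\<lambda>x. indicator {0<..T} (snd x) * (norm (\<phi> (snd x) (fst x)))\<^sup>2) \<and>
     (\<forall>s r. 0 \<le> s \<longrightarrow> s \<le> r \<longrightarrow> r \<le> T \<longrightarrow> ito_limit s r \<phi> (w s r)) \<and>
     (\<forall>t r \<rho>. 0 \<le> t \<longrightarrow> t \<le> r \<longrightarrow> r \<le> T \<longrightarrow> (\<forall>n. \<rho> n \<in> borel_measurable M) \<longrightarrow> (\<forall>n \<omega>. 0 \<le> \<rho> n \<omega> \<and> \<rho> n \<omega> \<le> 1) \<longrightarrow>
        (AE \<omega> in M. (\<lambda>n. \<rho> n \<omega>) \<longlonglongrightarrow> 0) \<longrightarrow>
        (\<lambda>n. \<Sum>i<Suc n. \<integral>\<omega>. \<rho> n \<omega> * (w (grid t r n i) (grid t r n (Suc i)) \<omega>)\<^sup>2 \<partial>M) \<longlonglongrightarrow> 0)"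

text \<open>The equation supplies only the integrals from t to the terminal time. The integral over
  {s..r} is taken to be the difference of two of them, and \<open>ito_limit_increment\<close>
  identifies it.\<close>

lemma ito_incrementsI:
  assumes lim: "\<And>t. 0 \<le> t \<Longrightarrow> t \<le> T \<Longrightarrow> L2_limit_of_elementary M adm X t T \<phi>0 (J t)"
    and adm: "\<And>n p h. adm n p h \<Longrightarrow> \<forall>i<n. h i \<in> borel_measurable (\<Phi> (p i) (p (Suc i)))"
    and \<phi>: "(\<lambda>x. \<phi> (snd x) (fst x)) \<in> borel_measurable (M \<Otimes>\<^sub>M lborel)"
    and int: "integrable (M \<Otimes>\<^sub>M lborel) (\<lambda>x. indicator {0<..T} (snd x) * (norm (\<phi> (snd x) (fst x)))\<^sup>2)"
    and eq: "AE \<omega> in M. \<forall>u\<in>{0..T}. \<phi>0 u \<omega> = \<phi> u \<omega>"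
  shows "ito_increments \<phi> (\<lambda>s r \<omega>. J s \<omega> - J r \<omega>)"
proof -
  have eq': "AE \<omega> in M. \<forall>u\<in>{t..T}. \<phi>0 u \<omega> = \<phi> u \<omega>" if "0 \<le> t" for t
    using eq by eventually_elim (use that in auto)
  have L: "ito_limit s r \<phi> (\<lambda>\<omega>. J s \<omega> - J r \<omega>)" if "0 \<le> s" "s \<le> r" "r \<le> T" for s r
  proof -
    have sT: "s \<le> T" "0 \<le> r" using that by auto
    show ?thesis
      by (rule ito_limit_increment[OF lim[OF that(1) sT(1)] lim[OF sT(2) that(3)] that order_refl adm \<phi> eq'[OF that(1)]]) assumption
  qed
  have "(\<lambda>n. \<Sum>i<Suc n. \<integral>\<omega>. \<rho> n \<omega> * (J (grid t r n i) \<omega> - J (grid t r n (Suc i)) \<omega>)\<^sup>2 \<partial>M) \<longlonglongrightarrow> 0"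
    if tr: "0 \<le> t" "t \<le> r" "r \<le> T" and \<rho>: "\<And>n. \<rho> n \<in> borel_measurable M" "\<And>n \<omega>. 0 \<le> \<rho> n \<omega>" "\<And>n \<omega>. \<rho> n \<omega> \<le> 1"
       "AE \<omega> in M. (\<lambda>n. \<rho> n \<omega>) \<longlonglongrightarrow> 0" for t r and \<rho> :: "nat \<Rightarrow> 'w \<Rightarrow> real"
  proof (rule ito_limit_sum_null[where a=t and b=T and \<tau>="grid t r" and N=Suc and \<phi>=\<phi> and w="\<lambda>n i \<omega>. J (grid t r n i) \<omega> - J (grid t r n (Suc i)) \<omega>"])
    show "0 \<le> t" "t \<le> T" "T \<le> T" using tr by auto
    fix \<epsilon> :: real assume \<epsilon>: "0 < \<epsilon>"
    have tT: "t \<le> T" using tr by simp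
    have "\<exists>n p h. (\<forall>k::nat. elementary_approx t T (n k) (p k) (h k)) \<and>
      (\<lambda>k. \<integral>\<^sup>+x. ennreal ((norm (step_process (n k) (p k) (h k) (snd x) (fst x) - \<phi> (snd x) (fst x)))\<^sup>2)
            * indicator {t<..T} (snd x) \<partial>(M \<Otimes>\<^sub>M lborel)) \<longlonglongrightarrow> 0"
    proof (rule L2_limit_of_elementaryE[OF lim[OF tr(1) tT] tr(1) tT order_refl _ \<phi> eq'[OF tr(1)]], goal_cases)
      case (1 n p h)
      then show ?case by (rule adm)
    next
      case (2 n p h)
      show ?case by (intro exI conjI allI) (rule 2(1), rule 2(2))
    qed
    then obtain n p h where E: "\<And>k::nat. elementary_approx t T (n k) (p k) (h k)"
      and B: "(\<lambda>k. \<integral>\<^sup>+x. ennreal ((norm (step_process (n k) (p k) (h k) (snd x) (fst x) - \<phi> (snd x) (fst x)))\<^sup>2)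
            * indicator {t<..T} (snd x) \<partial>(M \<Otimes>\<^sub>M lborel)) \<longlonglongrightarrow> 0"
      by auto
    have "\<forall>\<^sub>F k in sequentially. (\<integral>\<^sup>+x. ennreal ((norm (step_process (n k) (p k) (h k) (snd x) (fst x) - \<phi> (snd x) (fst x)))\<^sup>2)
            * indicator {t<..T} (snd x) \<partial>(M \<Otimes>\<^sub>M lborel)) < ennreal \<epsilon>"
      using \<epsilon> by (intro order_tendstoD(2)[OF B]) auto
    then obtain k where "(\<integral>\<^sup>+x. ennreal ((norm (step_process (n k) (p k) (h k) (snd x) (fst x) - \<phi> (snd x) (fst x)))\<^sup>2)
            * indicator {t<..T} (snd x) \<partial>(M \<Otimes>\<^sub>M lborel)) < ennreal \<epsilon>" by (auto simp: eventually_sequentially)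
    then show "\<exists>n p h. elementary_approx t T n p h \<and> (\<integral>\<^sup>+x. ennreal ((norm (step_process n p h (snd x) (fst x) - \<phi> (snd x) (fst x)))\<^sup>2)
            * indicator {t<..T} (snd x) \<partial>(M \<Otimes>\<^sub>M lborel)) < ennreal \<epsilon>"
      using E by blast
  next
    fix n i assume "i \<le> Suc n"
    then show "t \<le> grid t r n i \<and> grid t r n i \<le> T" using grid_range[OF tr(2), of i n] tr by auto
  next
    fix n i assume "i < Suc n"
    then show "ito_limit (grid t r n i) (grid t r n (Suc i)) \<phi> (\<lambda>\<omega>. J (grid t r n i) \<omega> - J (grid t r n (Suc i)) \<omega>)"
      using grid_range[OF tr(2), of i n] grid_range[OF tr(2), of "Suc i" n] grid_mono[OF tr(2)] tr by (intro L) auto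
  qed (use \<rho> \<phi> grid_mono[OF tr(2)] in auto)
  then show ?thesis unfolding ito_increments_def using \<phi> int L by blast
qed

lemma ito_increments_diff:
  assumes w: "ito_increments \<phi> w" and w': "ito_increments \<phi>' w'"
  shows "ito_increments (\<lambda>u \<omega>. \<phi> u \<omega> - \<phi>' u \<omega>) (\<lambda>s r \<omega>. w s r \<omega> - w' s r \<omega>)"
proof -
  let ?L = "M \<Otimes>\<^sub>M lborel"
  note m[measurable] = w[unfolded ito_increments_def, THEN conjunct1] w'[unfolded ito_increments_def, THEN conjunct1]
  have i: "integrable ?L (\<lambda>x. indicator {0<..T} (snd x) * (norm (\<phi> (snd x) (fst x)))\<^sup>2)"
    "integrable ?L (\<lambda>x. indicator {0<..T} (snd x) * (norm (\<phi>' (snd x) (fst x)))\<^sup>2)"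
    using w w' unfolding ito_increments_def by auto
  have l: "ito_limit s r \<phi> (w s r)" "ito_limit s r \<phi>' (w' s r)" if "0 \<le> s" "s \<le> r" "r \<le> T" for s r
    using w w' that unfolding ito_increments_def by auto
  have I: "integrable ?L (\<lambda>x. indicator {0<..T} (snd x) * (norm (\<phi> (snd x) (fst x) - \<phi>' (snd x) (fst x)))\<^sup>2)"
  proof (rule Bochner_Integration.integrable_bound)
    show "integrable ?L (\<lambda>x. 2 * (indicator {0<..T} (snd x) * (norm (\<phi> (snd x) (fst x)))\<^sup>2) + 2 * (indicator {0<..T} (snd x) * (norm (\<phi>' (snd x) (fst x)))\<^sup>2))"
      using i by auto
    have "(norm (x - y))\<^sup>2 \<le> 2 * (norm x)\<^sup>2 + 2 * (norm y)\<^sup>2" for x y :: 'b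
    proof -
      have "(norm (x - y))\<^sup>2 \<le> (norm x + norm y)\<^sup>2" using norm_triangle_ineq4 by (intro power_mono) auto
      also have "\<dots> \<le> 2 * (norm x)\<^sup>2 + 2 * (norm y)\<^sup>2"
        using sum_squares_bound[of "norm x" "norm y"] by (simp add: power2_sum)
      finally show ?thesis .
    qed
    then show "AE x in ?L. norm (indicator {0<..T} (snd x) * (norm (\<phi> (snd x) (fst x) - \<phi>' (snd x) (fst x)))\<^sup>2)
       \<le> norm (2 * (indicator {0<..T} (snd x) * (norm (\<phi> (snd x) (fst x)))\<^sup>2) + 2 * (indicator {0<..T} (snd x) * (norm (\<phi>' (snd x) (fst x)))\<^sup>2))"
      by (intro AE_I2) (auto simp: indicator_def)
  qed measurable
  have U: "(\<lambda>n. \<Sum>i<Suc n. \<integral>\<omega>. \<rho> n \<omega> * (w (grid t r n i) (grid t r n (Suc i)) \<omega> - w' (grid t r n i) (grid t r n (Suc i)) \<omega>)\<^sup>2 \<partial>M) \<longlonglongrightarrow> 0"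
    if tr: "0 \<le> t" "t \<le> r" "r \<le> T" and \<rho>: "\<And>n. \<rho> n \<in> borel_measurable M" "\<And>n \<omega>. 0 \<le> \<rho> n \<omega> \<and> \<rho> n \<omega> \<le> 1"
       "AE \<omega> in M. (\<lambda>n. \<rho> n \<omega>) \<longlonglongrightarrow> 0" for t r and \<rho> :: "nat \<Rightarrow> 'w \<Rightarrow> real"
  proof (rule tendsto_sandwich[OF _ _ tendsto_const])
    let ?s = "\<lambda>w n. \<Sum>i<Suc n. \<integral>\<omega>. \<rho> n \<omega> * (w (grid t r n i) (grid t r n (Suc i)) \<omega>)\<^sup>2 \<partial>M"
    have "?s w \<longlonglongrightarrow> 0" "?s w' \<longlonglongrightarrow> 0"
      using w w' tr \<rho> unfolding ito_increments_def by blast+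
    then have "(\<lambda>n. 2 * ?s w n + 2 * ?s w' n) \<longlonglongrightarrow> 2 * 0 + 2 * 0" by (intro tendsto_intros)
    then show "(\<lambda>n. 2 * ?s w n + 2 * ?s w' n) \<longlonglongrightarrow> 0" by simp
    show "\<forall>\<^sub>F n in sequentially. 0 \<le> (\<Sum>i<Suc n. \<integral>\<omega>. \<rho> n \<omega> * (w (grid t r n i) (grid t r n (Suc i)) \<omega> - w' (grid t r n i) (grid t r n (Suc i)) \<omega>)\<^sup>2 \<partial>M)"
      using \<rho> by (intro always_eventually allI sum_nonneg integral_nonneg_AE) auto
    show "\<forall>\<^sub>F n in sequentially. (\<Sum>i<Suc n. \<integral>\<omega>. \<rho> n \<omega> * (w (grid t r n i) (grid t r n (Suc i)) \<omega> - w' (grid t r n i) (grid t r n (Suc i)) \<omega>)\<^sup>2 \<partial>M)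
      \<le> 2 * ?s w n + 2 * ?s w' n"
    proof (intro always_eventually allI)
      fix n
      have "(\<integral>\<omega>. \<rho> n \<omega> * (w (grid t r n i) (grid t r n (Suc i)) \<omega> - w' (grid t r n i) (grid t r n (Suc i)) \<omega>)\<^sup>2 \<partial>M)
        \<le> 2 * (\<integral>\<omega>. \<rho> n \<omega> * (w (grid t r n i) (grid t r n (Suc i)) \<omega>)\<^sup>2 \<partial>M) + 2 * (\<integral>\<omega>. \<rho> n \<omega> * (w' (grid t r n i) (grid t r n (Suc i)) \<omega>)\<^sup>2 \<partial>M)"
        if i: "i < Suc n" for i
      proof -
        let ?w = "w (grid t r n i) (grid t r n (Suc i))" and ?w' = "w' (grid t r n i) (grid t r n (Suc i))"
        have g: "0 \<le> grid t r n i" "grid t r n i \<le> grid t r n (Suc i)" "grid t r n (Suc i) \<le> T"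
          using grid_range[OF tr(2), of i n] grid_range[OF tr(2), of "Suc i" n] grid_mono[OF tr(2)] tr i by auto
        note W = ito_limit_sq_integrable[OF l(1)[OF g] g] ito_limit_sq_integrable[OF l(2)[OF g] g]
        have r: "integrable M (\<lambda>\<omega>. \<rho> n \<omega> * (u \<omega>)\<^sup>2)" if "integrable M (\<lambda>\<omega>. (u \<omega>)\<^sup>2)" for u
          using integrable_mult_bounded[OF that, of "\<rho> n" 1] \<rho> by (auto simp: mult.commute)
        have "(\<integral>\<omega>. \<rho> n \<omega> * (?w \<omega> - ?w' \<omega>)\<^sup>2 \<partial>M) \<le> (\<integral>\<omega>. 2 * (\<rho> n \<omega> * (?w \<omega>)\<^sup>2) + 2 * (\<rho> n \<omega> * (?w' \<omega>)\<^sup>2) \<partial>M)"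
        proof (rule integral_mono)
          fix \<omega>
          have "(?w \<omega> - ?w' \<omega>)\<^sup>2 \<le> 2 * (?w \<omega>)\<^sup>2 + 2 * (?w' \<omega>)\<^sup>2"
            using zero_le_power2[of "?w \<omega> + ?w' \<omega>"] by (simp add: power2_eq_square algebra_simps)
          then have "\<rho> n \<omega> * (?w \<omega> - ?w' \<omega>)\<^sup>2 \<le> \<rho> n \<omega> * (2 * (?w \<omega>)\<^sup>2 + 2 * (?w' \<omega>)\<^sup>2)"
            using \<rho> by (intro mult_left_mono) auto
          then show "\<rho> n \<omega> * (?w \<omega> - ?w' \<omega>)\<^sup>2 \<le> 2 * (\<rho> n \<omega> * (?w \<omega>)\<^sup>2) + 2 * (\<rho> n \<omega> * (?w' \<omega>)\<^sup>2)" by (simp add: algebra_simps)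
        qed (use r integrable_square_diff[OF W] W in auto)
        also have "\<dots> = 2 * (\<integral>\<omega>. \<rho> n \<omega> * (?w \<omega>)\<^sup>2 \<partial>M) + 2 * (\<integral>\<omega>. \<rho> n \<omega> * (?w' \<omega>)\<^sup>2 \<partial>M)"
          using r W by simp
        finally show ?thesis .
      qed
      then show "(\<Sum>i<Suc n. \<integral>\<omega>. \<rho> n \<omega> * (w (grid t r n i) (grid t r n (Suc i)) \<omega> - w' (grid t r n i) (grid t r n (Suc i)) \<omega>)\<^sup>2 \<partial>M)
        \<le> 2 * ?s w n + 2 * ?s w' n"
        unfolding sum_distrib_left sum.distrib[symmetric] by (intro sum_mono) auto
    qed
  qed
  show ?thesis
    unfolding ito_increments_def
  proof (intro conjI allI impI)
    show "(\<lambda>x. \<phi> (snd x) (fst x) - \<phi>' (snd x) (fst x)) \<in> borel_measurable ?L" by measurable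
    show "integrable ?L (\<lambda>x. indicator {0<..T} (snd x) * (norm (\<phi> (snd x) (fst x) - \<phi>' (snd x) (fst x)))\<^sup>2)" by (rule I)
    show "ito_limit s r (\<lambda>u \<omega>. \<phi> u \<omega> - \<phi>' u \<omega>) (\<lambda>\<omega>. w s r \<omega> - w' s r \<omega>)" if "0 \<le> s" "s \<le> r" "r \<le> T" for s r
      by (rule ito_limit_diff[OF l(1)[OF that] l(2)[OF that] that m])
    show "(\<lambda>n. \<Sum>i<Suc n. \<integral>\<omega>. \<rho> n \<omega> * (w (grid t r n i) (grid t r n (Suc i)) \<omega> - w' (grid t r n i) (grid t r n (Suc i)) \<omega>)\<^sup>2 \<partial>M) \<longlonglongrightarrow> 0"
      if "0 \<le> t" "t \<le> r" "r \<le> T" "\<forall>n. \<rho> n \<in> borel_measurable M" "\<forall>n \<omega>. 0 \<le> \<rho> n \<omega> \<and> \<rho> n \<omega> \<le> 1"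
       "AE \<omega> in M. (\<lambda>n. \<rho> n \<omega>) \<longlonglongrightarrow> 0" for t r and \<rho> :: "nat \<Rightarrow> 'w \<Rightarrow> real"
      using U[OF that(1-3) spec[OF that(4)] spec[OF spec[OF that(5)]] that(6)] .
  qed
qed

lemma ito_incrementsD:
  assumes w: "ito_increments \<phi> w" and sr: "0 \<le> s" "s \<le> r" "r \<le> T"
  shows "w s r \<in> borel_measurable M" "integrable M (\<lambda>\<omega>. (w s r \<omega>)\<^sup>2)"
    and "\<And>\<eta>. \<eta> \<in> borel_measurable (\<Phi> s r) \<Longrightarrow> integrable M (\<lambda>\<omega>. (\<eta> \<omega>)\<^sup>2) \<Longrightarrow> (\<integral>\<omega>. \<eta> \<omega> * w s r \<omega> \<partial>M) = 0"
    and "\<And>\<theta>. \<theta> \<in> borel_measurable (\<Phi> s r) \<Longrightarrow> (\<And>\<omega>. 0 \<le> \<theta> \<omega> \<and> \<theta> \<omega> \<le> c) \<Longrightarrow>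
        (\<integral>\<omega>. \<theta> \<omega> * (w s r \<omega>)\<^sup>2 \<partial>M) = (\<integral>\<omega>. \<theta> \<omega> * ivl_integral (\<lambda>u. (norm (\<phi> u \<omega>))\<^sup>2) s r \<partial>M)"
    and "AE \<omega> in M. ivl_integrable (\<lambda>u. (norm (\<phi> u \<omega>))\<^sup>2) 0 T"
    and "(\<lambda>\<omega>. ivl_integral (\<lambda>u. (norm (\<phi> u \<omega>))\<^sup>2) s r) \<in> borel_measurable M"
    and "integrable M (\<lambda>\<omega>. ivl_integral (\<lambda>u. (norm (\<phi> u \<omega>))\<^sup>2) s r)"
proof -
  interpret pair_sigma_finite M lborel by (rule pair_sigma_finite_lborel)
  have lim: "ito_limit s r \<phi> (w s r)" and m[measurable]: "(\<lambda>x. \<phi> (snd x) (fst x)) \<in> borel_measurable (M \<Otimes>\<^sub>M lborel)"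
    and int: "integrable (M \<Otimes>\<^sub>M lborel) (\<lambda>x. indicator {0<..T} (snd x) * (norm (\<phi> (snd x) (fst x)))\<^sup>2)"
    using w sr by (auto simp: ito_increments_def)
  have int': "integrable (M \<Otimes>\<^sub>M lborel) (\<lambda>x. indicator {s<..r} (snd x) * (norm (\<phi> (snd x) (fst x)))\<^sup>2)"
    by (rule Bochner_Integration.integrable_bound[OF int]) (use sr in \<open>auto simp: indicator_def\<close>)
  show W: "w s r \<in> borel_measurable M" "integrable M (\<lambda>\<omega>. (w s r \<omega>)\<^sup>2)"
    using ito_limit_sq_integrable[OF lim sr] .
  show "(\<integral>\<omega>. \<eta> \<omega> * w s r \<omega> \<partial>M) = 0" if "\<eta> \<in> borel_measurable (\<Phi> s r)" "integrable M (\<lambda>\<omega>. (\<eta> \<omega>)\<^sup>2)" for \<eta>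
    by (rule ito_limit_mean[OF lim sr that])
  show "(\<integral>\<omega>. \<theta> \<omega> * (w s r \<omega>)\<^sup>2 \<partial>M) = (\<integral>\<omega>. \<theta> \<omega> * ivl_integral (\<lambda>u. (norm (\<phi> u \<omega>))\<^sup>2) s r \<partial>M)"
    if \<theta>: "\<theta> \<in> borel_measurable (\<Phi> s r)" "\<And>\<omega>. 0 \<le> \<theta> \<omega> \<and> \<theta> \<omega> \<le> c" for \<theta>
  proof -
    \<comment> \<open>The weighted isometry is formulated for squared weights; non-negativity of
      \<theta> permits the square root.\<close>
    have "bounded_measurable (\<Phi> s r) (\<lambda>\<omega>. sqrt (\<theta> \<omega>))"
      using \<theta> by (auto simp: bounded_measurable_def intro!: exI[of _ "sqrt c"])
    from ito_limit_weighted(1)[OF lim sr m int' this] show ?thesis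
      using \<theta>(2) by (simp add: ivl_integral_def)
  qed
  show "AE \<omega> in M. ivl_integrable (\<lambda>u. (norm (\<phi> u \<omega>))\<^sup>2) 0 T"
    using AE_integrable_fst'[OF int] by simp
  show "integrable M (\<lambda>\<omega>. ivl_integral (\<lambda>u. (norm (\<phi> u \<omega>))\<^sup>2) s r)"
    using integrable_fst'[OF int'] by (simp add: ivl_integral_def)
  then show "(\<lambda>\<omega>. ivl_integral (\<lambda>u. (norm (\<phi> u \<omega>))\<^sup>2) s r) \<in> borel_measurable M" by simp
qed

end

section \<open>The difference of two solutions\<close>

lemma pos_psi_measurable [measurable]:
  "pos_psi \<in> borel_measurable borel" "pos_psi1 \<in> borel_measurable borel" "pos_psi2 \<in> borel_measurable borel"
  unfolding pos_psi_def[abs_def] pos_psi1_def[abs_def] pos_psi2_def[abs_def] by measurable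

text \<open>The difference of two solutions in abstract form: X is the difference of the Y, H and G
  are those of the integrands, A is the increasing process that acts only near times with X
  non-positive, and V collects everything increasing that pushes X down. \<open>A_flat\<close> is
  the Skorohod condition in the form in which it is applied; square integrability of the increments
  of V is derived in \<open>V_diff_sq\<close>.\<close>

locale rbdsde_difference =
  fw: simple_integration M T \<kappa>W \<Phi>W W + bw: simple_integration M T \<kappa>B \<Phi>B B
  for M :: "'w measure" and T \<kappa>W :: real and \<Phi>W and W :: "real \<Rightarrow> 'w \<Rightarrow> 'b::euclidean_space"
    and \<kappa>B :: real and \<Phi>B and B :: "real \<Rightarrow> 'w \<Rightarrow> 'c::euclidean_space" +
  fixes X A V :: "real \<Rightarrow> 'w \<Rightarrow> real" and \<phi> :: "real \<Rightarrow> 'w \<Rightarrow> real" and H :: "real \<Rightarrow> 'w \<Rightarrow> 'b" and G :: "real \<Rightarrow> 'w \<Rightarrow> 'c"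
    and w b :: "real \<Rightarrow> real \<Rightarrow> 'w \<Rightarrow> real" and C \<alpha> :: real and Xs :: "'w \<Rightarrow> real"
  assumes T0: "0 \<le> T" and C0: "0 \<le> C" and \<alpha>: "0 \<le> \<alpha>" "\<alpha> < 1"
    and X_fw: "\<And>s r. 0 \<le> s \<Longrightarrow> s \<le> r \<Longrightarrow> r \<le> T \<Longrightarrow> X s \<in> borel_measurable (\<Phi>W s r)"
    and X_bw: "\<And>s r. 0 \<le> s \<Longrightarrow> s \<le> r \<Longrightarrow> r \<le> T \<Longrightarrow> X r \<in> borel_measurable (\<Phi>B s r)"
    and X_cont: "AE \<omega> in M. continuous_on {0..T} (\<lambda>t. X t \<omega>)"
    and Xs: "Xs \<in> borel_measurable M" "integrable M (\<lambda>\<omega>. (Xs \<omega>)\<^sup>2)"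
    and X_le: "AE \<omega> in M. \<forall>t\<in>{0..T}. \<bar>X t \<omega>\<bar> \<le> Xs \<omega>"
    and w: "fw.ito_increments H w" and b: "bw.ito_increments G b"
    and \<phi>_meas: "(\<lambda>x. \<phi> (snd x) (fst x)) \<in> borel_measurable (M \<Otimes>\<^sub>M lborel)"
    and \<phi>_int: "AE \<omega> in M. ivl_integrable (\<lambda>u. \<phi> u \<omega>) 0 T"
    and \<phi>_le: "AE \<omega> in M. AE u in lborel. u \<in> {0<..T} \<longrightarrow> \<bar>\<phi> u \<omega>\<bar> \<le> C * (\<bar>X u \<omega>\<bar> + norm (H u \<omega>))"
    and G_le: "AE \<omega> in M. AE u in lborel. u \<in> {0<..T} \<longrightarrow> (norm (G u \<omega>))\<^sup>2 \<le> C * (X u \<omega>)\<^sup>2 + \<alpha> * (norm (H u \<omega>))\<^sup>2"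
    and A_meas: "\<And>t. 0 \<le> t \<Longrightarrow> t \<le> T \<Longrightarrow> A t \<in> borel_measurable M"
    and A_cont: "AE \<omega> in M. continuous_on {0..T} (\<lambda>t. A t \<omega>)"
    and A_mono: "AE \<omega> in M. mono_on {0..T} (\<lambda>t. A t \<omega>)"
    and A_sq: "integrable M (\<lambda>\<omega>. (A T \<omega> - A 0 \<omega>)\<^sup>2)"
    and A_flat: "AE \<omega> in M. \<forall>s r. 0 \<le> s \<longrightarrow> s \<le> r \<longrightarrow> r \<le> T \<longrightarrow> A s \<omega> < A r \<omega> \<longrightarrow> (\<exists>u\<in>{s..r}. X u \<omega> \<le> 0)"
    and V_meas: "\<And>t. 0 \<le> t \<Longrightarrow> t \<le> T \<Longrightarrow> V t \<in> borel_measurable M"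
    and V_cont: "AE \<omega> in M. continuous_on {0..T} (\<lambda>t. V t \<omega>)"
    and V_mono: "AE \<omega> in M. mono_on {0..T} (\<lambda>t. V t \<omega>)"
    and equation: "\<And>s r. 0 \<le> s \<Longrightarrow> s \<le> r \<Longrightarrow> r \<le> T \<Longrightarrow> AE \<omega> in M.
       X s \<omega> - X r \<omega> = ivl_integral (\<lambda>u. \<phi> u \<omega>) s r + (A r \<omega> - A s \<omega>) - (V r \<omega> - V s \<omega>) + b s r \<omega> - w s r \<omega>"
begin

lemma X_meas [measurable (raw)]: "0 \<le> t \<Longrightarrow> t \<le> T \<Longrightarrow> X t \<in> borel_measurable M"
  using measurable_from_subalg[OF fw.sub[of t T] X_fw[of t T]] by simp

lemma X_sq: "0 \<le> t \<Longrightarrow> t \<le> T \<Longrightarrow> integrable M (\<lambda>\<omega>. (X t \<omega>)\<^sup>2)"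
  using X_le by (intro integrable_square_bound[OF Xs(2)]) (auto intro: X_meas elim!: eventually_mono)

definition a :: "real \<Rightarrow> real \<Rightarrow> 'w \<Rightarrow> real" where
  "a s r \<omega> = ivl_integral (\<lambda>u. \<phi> u \<omega>) s r + (A r \<omega> - A s \<omega>) - (V r \<omega> - V s \<omega>)"

abbreviation "IF s r \<omega> \<equiv> ivl_integral (\<lambda>u. \<bar>\<phi> u \<omega>\<bar>) s r"
abbreviation "IG s r \<omega> \<equiv> ivl_integral (\<lambda>u. (norm (G u \<omega>))\<^sup>2) s r"
abbreviation "IH s r \<omega> \<equiv> ivl_integral (\<lambda>u. (norm (H u \<omega>))\<^sup>2) s r"

lemma IF_meas [measurable]: "IF s r \<in> borel_measurable M" "(\<lambda>\<omega>. ivl_integral (\<lambda>u. \<phi> u \<omega>) s r) \<in> borel_measurable M"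
proof -
  note [measurable] = \<phi>_meas
  have "case_prod (\<lambda>\<omega> u. indicator {s<..r} u * \<bar>\<phi> u \<omega>\<bar>) \<in> borel_measurable (M \<Otimes>\<^sub>M lborel)"
    "case_prod (\<lambda>\<omega> u. indicator {s<..r} u * \<phi> u \<omega>) \<in> borel_measurable (M \<Otimes>\<^sub>M lborel)"
    unfolding split_beta' by measurable
  then show "IF s r \<in> borel_measurable M" "(\<lambda>\<omega>. ivl_integral (\<lambda>u. \<phi> u \<omega>) s r) \<in> borel_measurable M"
    unfolding ivl_integral_def by (auto intro: lborel.borel_measurable_lebesgue_integral)
qed

lemma a_meas: "0 \<le> s \<Longrightarrow> s \<le> r \<Longrightarrow> r \<le> T \<Longrightarrow> a s r \<in> borel_measurable M"
  unfolding a_def[abs_def] using A_meas[of s] A_meas[of r] V_meas[of s] V_meas[of r] by auto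

lemma equation_a:
  assumes "0 \<le> s" "s \<le> r" "r \<le> T"
  shows "AE \<omega> in M. X s \<omega> - X r \<omega> = a s r \<omega> + b s r \<omega> - w s r \<omega>"
  using equation[OF assms] by (simp add: a_def)

lemma w_sq: "0 \<le> s \<Longrightarrow> s \<le> r \<Longrightarrow> r \<le> T \<Longrightarrow> w s r \<in> borel_measurable M"
    "0 \<le> s \<Longrightarrow> s \<le> r \<Longrightarrow> r \<le> T \<Longrightarrow> integrable M (\<lambda>\<omega>. (w s r \<omega>)\<^sup>2)"
  and b_sq: "0 \<le> s \<Longrightarrow> s \<le> r \<Longrightarrow> r \<le> T \<Longrightarrow> b s r \<in> borel_measurable M"
    "0 \<le> s \<Longrightarrow> s \<le> r \<Longrightarrow> r \<le> T \<Longrightarrow> integrable M (\<lambda>\<omega>. (b s r \<omega>)\<^sup>2)"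
  using fw.ito_incrementsD(1,2)[OF w] bw.ito_incrementsD(1,2)[OF b] by auto

text \<open>The equation expresses a as the increment of X corrected by the two stochastic
  integrals, all of which are in L^2.\<close>

lemma a_sq:
  assumes sr: "0 \<le> s" "s \<le> r" "r \<le> T"
  shows "integrable M (\<lambda>\<omega>. (a s r \<omega>)\<^sup>2)"
proof -
  have T: "0 \<le> r" "s \<le> T" using sr by auto
  have m: "(\<lambda>\<omega>. X s \<omega> - X r \<omega>) \<in> borel_measurable M" "(\<lambda>\<omega>. w s r \<omega> - b s r \<omega>) \<in> borel_measurable M"
    using X_meas[of s] X_meas[of r] sr T w_sq[OF sr] b_sq[OF sr] by auto
  have "integrable M (\<lambda>\<omega>. (X s \<omega> - X r \<omega> + (w s r \<omega> - b s r \<omega>))\<^sup>2)"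
    using sr T
    by (intro integrable_square_add integrable_square_diff X_sq w_sq[OF sr] b_sq[OF sr] X_meas m)
  moreover have "AE \<omega> in M. (X s \<omega> - X r \<omega> + (w s r \<omega> - b s r \<omega>))\<^sup>2 = (a s r \<omega>)\<^sup>2"
    using equation_a[OF sr] by eventually_elim (simp add: algebra_simps)
  ultimately show ?thesis
    using a_meas[OF sr] m by (subst integrable_cong_AE[symmetric]) auto
qed

text \<open>The Lipschitz bound on the drift and Cauchy-Schwarz in time give the majorant C (T Xs +
  sqrt T sqrt (IH s r)), which is in L^2.\<close>

lemma IF_sq:
  assumes sr: "0 \<le> s" "s \<le> r" "r \<le> T"
  shows "integrable M (\<lambda>\<omega>. (IF s r \<omega>)\<^sup>2)"
proof -
  note IH = fw.ito_incrementsD[OF w sr]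
  define B where "B \<omega> = C * (T * Xs \<omega> + sqrt T * sqrt (IH s r \<omega>))" for \<omega>
  have [measurable]: "B \<in> borel_measurable M" unfolding B_def[abs_def] using Xs(1) IH(6) by measurable
  have IH0: "0 \<le> IH s r \<omega>" for \<omega> by (rule ivl_integral_nonneg) auto
  have "integrable M (\<lambda>\<omega>. (T * Xs \<omega> + sqrt T * sqrt (IH s r \<omega>))\<^sup>2)"
    by (rule integrable_square_add) (use Xs IH IH0 in \<open>auto simp: power_mult_distrib\<close>)
  then have "integrable M (\<lambda>\<omega>. (B \<omega>)\<^sup>2)" unfolding B_def power_mult_distrib[of C] by simp
  then show ?thesis
  proof (rule integrable_square_bound)
    show "AE \<omega> in M. \<bar>IF s r \<omega>\<bar> \<le> B \<omega>"
      using \<phi>_le \<phi>_int X_le IH(5) AE_space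
    proof eventually_elim
      case (elim \<omega>)
      have Hm: "(\<lambda>u. norm (H u \<omega>)) \<in> borel_measurable borel"
        using measurable_compose_Pair1[OF elim(5) w[unfolded fw.ito_increments_def, THEN conjunct1]] by simp
      have ih: "ivl_integrable (\<lambda>u. (norm (H u \<omega>))\<^sup>2) s r" by (rule ivl_integrable_subset[OF elim(4)]) (use sr in auto)
      have f: "ivl_integrable (\<lambda>u. \<bar>\<phi> u \<omega>\<bar>) s r"
        using integrable_abs[OF ivl_integrable_subset[OF elim(2), of s r]] sr by (simp add: abs_mult)
      have i1: "integrable lborel (\<lambda>u. indicator {s<..r} u :: real)" "(\<integral>u. indicator {s<..r} u \<partial>lborel) = r - s"
        using sr by auto
      have sq: "(indicator {s<..r} u * norm (H u \<omega>))\<^sup>2 = indicator {s<..r} u * (norm (H u \<omega>))\<^sup>2"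
        "(indicator {s<..r} u :: real)\<^sup>2 = indicator {s<..r} u" for u
        by (auto simp: indicator_def)
      \<comment> \<open>The indicator is written twice so that both factors are square integrable
        over the line.\<close>
      have CS: "(\<integral>u. \<bar>indicator {s<..r} u * (indicator {s<..r} u * norm (H u \<omega>))\<bar> \<partial>lborel)
         \<le> sqrt (\<integral>u. (indicator {s<..r} u)\<^sup>2 \<partial>lborel) * sqrt (\<integral>u. (indicator {s<..r} u * norm (H u \<omega>))\<^sup>2 \<partial>lborel)"
        by (rule integral_Cauchy_Schwarz) (use Hm ih i1 in \<open>auto simp: sq\<close>)
      have e: "\<bar>indicator {s<..r} u * (indicator {s<..r} u * norm (H u \<omega>))\<bar> = indicator {s<..r} u * norm (H u \<omega>)" for u
        by (auto simp: indicator_def)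
      have h1: "(\<integral>u. indicator {s<..r} u * norm (H u \<omega>) \<partial>lborel) \<le> sqrt (r - s) * sqrt (IH s r \<omega>)"
        using CS unfolding e sq i1(2) ivl_integral_def .
      have hi: "integrable lborel (\<lambda>u. indicator {s<..r} u * norm (H u \<omega>))"
        using integrable_mult_square[of "\<lambda>u. indicator {s<..r} u" lborel "\<lambda>u. indicator {s<..r} u * norm (H u \<omega>)"] Hm ih i1
        by (auto simp: sq mult.assoc[symmetric] power2_eq_square[symmetric])
      have "IF s r \<omega> \<le> (\<integral>u. C * (Xs \<omega> * indicator {s<..r} u + indicator {s<..r} u * norm (H u \<omega>)) \<partial>lborel)"
        unfolding ivl_integral_def
      proof (rule integral_mono_AE[OF f])
        show "AE u in lborel. indicator {s<..r} u * \<bar>\<phi> u \<omega>\<bar> \<le> C * (Xs \<omega> * indicator {s<..r} u + indicator {s<..r} u * norm (H u \<omega>))"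
          using elim(1)
        proof eventually_elim
          case (elim u)
          show ?case
          proof (cases "u \<in> {s<..r}")
            case True
            then have "\<bar>\<phi> u \<omega>\<bar> \<le> C * (\<bar>X u \<omega>\<bar> + norm (H u \<omega>))" using elim sr by auto
            also have "\<dots> \<le> C * (Xs \<omega> + norm (H u \<omega>))"
              using C0 \<open>\<forall>t\<in>{0..T}. \<bar>X t \<omega>\<bar> \<le> Xs \<omega>\<close> True sr by (intro mult_left_mono) auto
            finally show ?thesis using True by simp
          qed simp
        qed
      qed (use i1 hi in auto)
      also have "\<dots> = C * (Xs \<omega> * (r - s) + (\<integral>u. indicator {s<..r} u * norm (H u \<omega>) \<partial>lborel))" using i1 hi by simp
      also have "\<dots> \<le> C * (T * Xs \<omega> + sqrt T * sqrt (IH s r \<omega>))"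
      proof -
        have "0 \<le> Xs \<omega>" using elim(3) T0 by (meson abs_ge_zero atLeastAtMost_iff order_refl order_trans)
        then have "Xs \<omega> * (r - s) \<le> Xs \<omega> * T" using sr by (intro mult_left_mono) auto
        moreover have "sqrt (r - s) * sqrt (IH s r \<omega>) \<le> sqrt T * sqrt (IH s r \<omega>)" using sr IH0 by (intro mult_right_mono) auto
        ultimately show ?thesis using h1 C0 by (intro mult_left_mono) (auto simp: mult.commute)
      qed
      finally have "IF s r \<omega> \<le> B \<omega>" by (simp add: B_def)
      moreover have "0 \<le> IF s r \<omega>" by (rule ivl_integral_nonneg) auto
      ultimately show ?case by simp
    qed
  qed measurable
qed

lemma A_diff_sq:
  assumes sr: "0 \<le> s" "s \<le> r" "r \<le> T"
  shows "integrable M (\<lambda>\<omega>. (A r \<omega> - A s \<omega>)\<^sup>2)"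
proof (rule integrable_square_bound[OF A_sq])
  show "(\<lambda>\<omega>. A r \<omega> - A s \<omega>) \<in> borel_measurable M" using A_meas[of s] A_meas[of r] sr by auto
  show "AE \<omega> in M. \<bar>A r \<omega> - A s \<omega>\<bar> \<le> A T \<omega> - A 0 \<omega>"
    using A_mono
  proof eventually_elim
    case (elim \<omega>)
    have "A 0 \<omega> \<le> A s \<omega>" "A s \<omega> \<le> A r \<omega>" "A r \<omega> \<le> A T \<omega>" using sr by (auto intro!: mono_onD[OF elim])
    then show ?case by simp
  qed
qed

text \<open>V is the one remaining term in the definition of \<open>a\<close>, all others being in
  L^2. In this way the increments of V, which will contain the part of the drift outside the
  Lipschitz generator, become square integrable.\<close>

lemma V_diff_sq:
  assumes sr: "0 \<le> s" "s \<le> r" "r \<le> T"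
  shows "integrable M (\<lambda>\<omega>. (V r \<omega> - V s \<omega>)\<^sup>2)"
proof -
  have m: "(\<lambda>\<omega>. ivl_integral (\<lambda>u. \<phi> u \<omega>) s r + (A r \<omega> - A s \<omega>)) \<in> borel_measurable M" "(\<lambda>\<omega>. A r \<omega> - A s \<omega>) \<in> borel_measurable M"
    using A_meas[of s] A_meas[of r] sr by auto
  have "integrable M (\<lambda>\<omega>. (ivl_integral (\<lambda>u. \<phi> u \<omega>) s r)\<^sup>2)"
    by (rule integrable_square_bound[OF IF_sq[OF sr]]) (auto intro!: AE_I2 ivl_integral_abs_le)
  then have "integrable M (\<lambda>\<omega>. ((ivl_integral (\<lambda>u. \<phi> u \<omega>) s r + (A r \<omega> - A s \<omega>)) - a s r \<omega>)\<^sup>2)"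
    by (intro integrable_square_diff integrable_square_add A_diff_sq[OF sr] a_sq[OF sr] a_meas[OF sr] m IF_meas)
  then show ?thesis by (simp add: a_def algebra_simps)
qed

lemma psi_integrable: "0 \<le> t \<Longrightarrow> t \<le> T \<Longrightarrow> integrable M (\<lambda>\<omega>. pos_psi (X t \<omega>))"
  by (rule Bochner_Integration.integrable_bound[OF X_sq[of t]])
     (auto intro!: X_meas measurable_compose[OF X_meas pos_psi_measurable(1)] AE_I2 simp: pos_psi_nonneg pos_psi_le)

lemma psi1_sq: 
  assumes "0 \<le> t" "t \<le> T"
  shows "integrable M (\<lambda>\<omega>. (pos_psi1 (X t \<omega>))\<^sup>2)"
proof (rule integrable_square_bound[where v="\<lambda>\<omega>. 2 * \<bar>X t \<omega>\<bar>"])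
  show "AE \<omega> in M. \<bar>pos_psi1 (X t \<omega>)\<bar> \<le> 2 * \<bar>X t \<omega>\<bar>"
  proof (rule AE_I2)
    fix \<omega> show "\<bar>pos_psi1 (X t \<omega>)\<bar> \<le> 2 * \<bar>X t \<omega>\<bar>"
      using pos_psi1_le[of "X t \<omega>"] pos_psi1_nonneg[of "X t \<omega>"] by auto
  qed
qed (use X_sq[OF assms] X_meas[OF assms] in \<open>auto simp: power_mult_distrib\<close>)

definition main_term :: "real \<Rightarrow> real \<Rightarrow> 'w \<Rightarrow> real" where
  "main_term s r \<omega> = (pos_psi1 (X s \<omega>) + pos_psi1 (X r \<omega>)) / 2 * a s r \<omega> + pos_psi2 (X r \<omega>) / 2 * IG s r \<omega>
     - pos_psi2 (X s \<omega>) / 2 * IH s r \<omega>"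

lemma main_term_integrable:
  assumes sr: "0 \<le> s" "s \<le> r" "r \<le> T"
  shows "integrable M (\<lambda>\<omega>. (pos_psi1 (X s \<omega>) + pos_psi1 (X r \<omega>)) / 2 * a s r \<omega>)"
    "integrable M (\<lambda>\<omega>. pos_psi2 (X r \<omega>) / 2 * IG s r \<omega>)"
    "integrable M (\<lambda>\<omega>. pos_psi2 (X s \<omega>) / 2 * IH s r \<omega>)" "integrable M (main_term s r)"
proof -
  have T: "0 \<le> r" "s \<le> T" using sr by auto
  note [measurable] = X_meas[OF sr(1) T(2)] X_meas[OF T(1) sr(3)] a_meas[OF sr]
  have "integrable M (\<lambda>\<omega>. (pos_psi1 (X s \<omega>) + pos_psi1 (X r \<omega>)) * a s r \<omega>)"
    by (intro integrable_mult_square a_sq[OF sr] integrable_square_add psi1_sq sr T) measurable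
  from integrable_divide[OF this, of 2] show 1: "integrable M (\<lambda>\<omega>. (pos_psi1 (X s \<omega>) + pos_psi1 (X r \<omega>)) / 2 * a s r \<omega>)" by simp
  have *: "\<bar>pos_psi2 x / 2\<bar> \<le> 1" for x using pos_psi2_bounds[of x] by auto
  show 2: "integrable M (\<lambda>\<omega>. pos_psi2 (X r \<omega>) / 2 * IG s r \<omega>)"
    using integrable_mult_bounded[OF bw.ito_incrementsD(7)[OF b sr], of "\<lambda>\<omega>. pos_psi2 (X r \<omega>) / 2" 1] * by (auto simp: mult.commute)
  show 3: "integrable M (\<lambda>\<omega>. pos_psi2 (X s \<omega>) / 2 * IH s r \<omega>)"
    using integrable_mult_bounded[OF fw.ito_incrementsD(7)[OF w sr], of "\<lambda>\<omega>. pos_psi2 (X s \<omega>) / 2" 1] * by (auto simp: mult.commute)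
  show "integrable M (main_term s r)" unfolding main_term_def[abs_def] using 1 2 3 by auto
qed

text \<open>Under the expectation the first-order terms of \<open>pos_psi_increment\<close> in b and
  w vanish and the second-order ones turn into time integrals by the weighted isometry. \<rho> only
  has to majorise the oscillation, so that one weight can serve all intervals of a grid. The
  parameter \<gamma> distributes the products of a with b and w between the squares of a, which
  vanish in the limit, and a small multiple of the bounded squares of b and w.\<close>

lemma interval_estimate:
  assumes sr: "0 \<le> s" "s \<le> r" "r \<le> T" and \<gamma>: "0 < \<gamma>"
    and \<rho>[measurable]: "\<rho> \<in> borel_measurable M" and \<rho>1: "\<And>\<omega>. 0 \<le> \<rho> \<omega>" "\<And>\<omega>. \<rho> \<omega> \<le> (1::real)"
    and \<rho>X: "\<And>\<omega>. min 1 \<bar>X s \<omega> - X r \<omega>\<bar> \<le> \<rho> \<omega>"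
  shows "(\<integral>\<omega>. pos_psi (X s \<omega>) \<partial>M) - (\<integral>\<omega>. pos_psi (X r \<omega>) \<partial>M) \<le>
    (\<integral>\<omega>. main_term s r \<omega> \<partial>M) + 6 * ((\<integral>\<omega>. \<rho> \<omega> * (b s r \<omega>)\<^sup>2 \<partial>M) + (\<integral>\<omega>. \<rho> \<omega> * (w s r \<omega>)\<^sup>2 \<partial>M))
    + 3 * (1 + 2 / \<gamma>) * (\<integral>\<omega>. (a s r \<omega>)\<^sup>2 \<partial>M) + 3 * \<gamma> * ((\<integral>\<omega>. IG s r \<omega> \<partial>M) + (\<integral>\<omega>. IH s r \<omega> \<partial>M))"
proof -
  have T: "0 \<le> r" "s \<le> T" using sr by auto
  note [measurable] = X_meas[OF sr(1) T(2)] X_meas[OF T(1) sr(3)] a_meas[OF sr] w_sq(1)[OF sr] b_sq(1)[OF sr]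
  note BD = bw.ito_incrementsD[OF b sr] and WD = fw.ito_incrementsD[OF w sr]
  have Xr: "X r \<in> borel_measurable (\<Phi>B s r)" and Xs': "X s \<in> borel_measurable (\<Phi>W s r)" using X_fw X_bw sr by auto
  have z1: "(\<integral>\<omega>. pos_psi1 (X r \<omega>) * b s r \<omega> \<partial>M) = 0"
    by (rule BD(3)) (use measurable_compose[OF Xr pos_psi_measurable(2)] psi1_sq[of r] T sr in auto)
  have z2: "(\<integral>\<omega>. pos_psi1 (X s \<omega>) * w s r \<omega> \<partial>M) = 0"
    by (rule WD(3)) (use measurable_compose[OF Xs' pos_psi_measurable(2)] psi1_sq[of s] T sr in auto)
  \<comment> \<open>Half of the second derivative takes values in {0..1}, hence the bound 1; taken
    at the right end point r it is admissible for the backward isometry.\<close>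
  have i1: "(\<integral>\<omega>. pos_psi2 (X r \<omega>) / 2 * (b s r \<omega>)\<^sup>2 \<partial>M) = (\<integral>\<omega>. pos_psi2 (X r \<omega>) / 2 * IG s r \<omega> \<partial>M)"
    by (rule BD(4)[where c=1]) (use measurable_compose[OF Xr pos_psi_measurable(3)] pos_psi2_bounds in \<open>auto simp: field_simps\<close>)
  have i2: "(\<integral>\<omega>. pos_psi2 (X s \<omega>) / 2 * (w s r \<omega>)\<^sup>2 \<partial>M) = (\<integral>\<omega>. pos_psi2 (X s \<omega>) / 2 * IH s r \<omega> \<partial>M)"
    by (rule WD(4)[where c=1]) (use measurable_compose[OF Xs' pos_psi_measurable(3)] pos_psi2_bounds in \<open>auto simp: field_simps\<close>)
  have eb: "(\<integral>\<omega>. (b s r \<omega>)\<^sup>2 \<partial>M) = (\<integral>\<omega>. IG s r \<omega> \<partial>M)" using BD(4)[of "\<lambda>_. 1" 1] by simp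
  have ew: "(\<integral>\<omega>. (w s r \<omega>)\<^sup>2 \<partial>M) = (\<integral>\<omega>. IH s r \<omega> \<partial>M)" using WD(4)[of "\<lambda>_. 1" 1] by simp
  have *: "\<bar>pos_psi2 x / 2\<bar> \<le> 1" for x using pos_psi2_bounds[of x] by auto
  have bnd: "integrable M (\<lambda>\<omega>. \<theta> \<omega> * u \<omega>)" if "integrable M u" "\<theta> \<in> borel_measurable M" "\<And>\<omega>. \<bar>\<theta> \<omega>\<bar> \<le> 1" for \<theta> u :: "'w \<Rightarrow> real"
    using integrable_mult_bounded[OF that(1,2), of 1] that(3) by (simp add: mult.commute)
  define t1 where "t1 \<omega> = (pos_psi1 (X s \<omega>) + pos_psi1 (X r \<omega>)) / 2 * a s r \<omega>" for \<omega>
  define t2 where "t2 \<omega> = pos_psi1 (X r \<omega>) * b s r \<omega>" for \<omega>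
  define t3 where "t3 \<omega> = pos_psi1 (X s \<omega>) * w s r \<omega>" for \<omega>
  define t4 where "t4 \<omega> = pos_psi2 (X r \<omega>) / 2 * (b s r \<omega>)\<^sup>2" for \<omega>
  define t5 where "t5 \<omega> = pos_psi2 (X s \<omega>) / 2 * (w s r \<omega>)\<^sup>2" for \<omega>
  define t6 where "t6 \<omega> = \<rho> \<omega> * (b s r \<omega>)\<^sup>2" for \<omega>
  define t7 where "t7 \<omega> = \<rho> \<omega> * (w s r \<omega>)\<^sup>2" for \<omega>
  have "integrable M t1" unfolding t1_def[abs_def] by (rule main_term_integrable(1)[OF sr])
  moreover have "integrable M t2" "integrable M t3" unfolding t2_def[abs_def] t3_def[abs_def]
    by (intro integrable_mult_square psi1_sq b_sq(2)[OF sr] w_sq(2)[OF sr] sr T; measurable)+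
  moreover have "integrable M t4" "integrable M t5" unfolding t4_def[abs_def] t5_def[abs_def]
    by (intro bnd b_sq(2)[OF sr] w_sq(2)[OF sr] *; measurable)+
  moreover have "integrable M t6" "integrable M t7" unfolding t6_def[abs_def] t7_def[abs_def]
    by (intro bnd b_sq(2)[OF sr] w_sq(2)[OF sr] \<rho>; use \<rho>1 in simp)+
  ultimately have int: "integrable M t1" "integrable M t2" "integrable M t3" "integrable M t4" "integrable M t5"
    "integrable M t6" "integrable M t7" by auto
  have "(\<integral>\<omega>. pos_psi (X s \<omega>) \<partial>M) - (\<integral>\<omega>. pos_psi (X r \<omega>) \<partial>M) = (\<integral>\<omega>. pos_psi (X s \<omega>) - pos_psi (X r \<omega>) \<partial>M)"
    using psi_integrable sr T by simp
  also have "\<dots> \<le> (\<integral>\<omega>. t1 \<omega> + t2 \<omega> - t3 \<omega> + t4 \<omega> - t5 \<omega> + 6 * (t6 \<omega> + t7 \<omega>)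
      + (3 * (1 + 2 / \<gamma>) * (a s r \<omega>)\<^sup>2 + 3 * \<gamma> * ((b s r \<omega>)\<^sup>2 + (w s r \<omega>)\<^sup>2)) \<partial>M)"
  proof (rule integral_mono_AE)
    show "AE \<omega> in M. pos_psi (X s \<omega>) - pos_psi (X r \<omega>) \<le> t1 \<omega> + t2 \<omega> - t3 \<omega> + t4 \<omega> - t5 \<omega> + 6 * (t6 \<omega> + t7 \<omega>)
      + (3 * (1 + 2 / \<gamma>) * (a s r \<omega>)\<^sup>2 + 3 * \<gamma> * ((b s r \<omega>)\<^sup>2 + (w s r \<omega>)\<^sup>2))"
      using equation_a[OF sr]
    proof eventually_elim
      case (elim \<omega>)
      let ?a = "a s r \<omega>" and ?b = "b s r \<omega>" and ?w = "w s r \<omega>"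
      have am: "\<bar>?a\<bar> * \<bar>z\<bar> \<le> ?a\<^sup>2 / \<gamma> + \<gamma> * z\<^sup>2" for z
      proof -
        have "0 \<le> (\<bar>?a\<bar> - \<gamma> * \<bar>z\<bar>)\<^sup>2 / \<gamma>" using \<gamma> by simp
        also have "\<dots> = ?a\<^sup>2 / \<gamma> + \<gamma> * z\<^sup>2 - 2 * (\<bar>?a\<bar> * \<bar>z\<bar>)"
          using \<gamma> by (simp add: power2_diff power_mult_distrib field_simps) (simp add: power2_eq_square)
        finally have "2 * (\<bar>?a\<bar> * \<bar>z\<bar>) \<le> ?a\<^sup>2 / \<gamma> + \<gamma> * z\<^sup>2" by simp
        moreover have "0 \<le> \<bar>?a\<bar> * \<bar>z\<bar>" by simp
        ultimately show ?thesis by linarith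
      qed
      have e: "\<bar>?a\<bar> * (\<bar>?a\<bar> + \<bar>?b\<bar> + \<bar>?w\<bar>) = ?a\<^sup>2 + \<bar>?a\<bar> * \<bar>?b\<bar> + \<bar>?a\<bar> * \<bar>?w\<bar>"
        by (simp add: algebra_simps power2_eq_square)
      have "\<bar>?a\<bar> * (\<bar>?a\<bar> + \<bar>?b\<bar> + \<bar>?w\<bar>) \<le> (1 + 2 / \<gamma>) * ?a\<^sup>2 + \<gamma> * (?b\<^sup>2 + ?w\<^sup>2)"
        unfolding e using am[of ?b] am[of ?w] by (simp add: algebra_simps)
      then have E1: "3 * \<bar>?a\<bar> * (\<bar>?a\<bar> + \<bar>?b\<bar> + \<bar>?w\<bar>) \<le> 3 * (1 + 2 / \<gamma>) * ?a\<^sup>2 + 3 * \<gamma> * (?b\<^sup>2 + ?w\<^sup>2)"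
        by (simp add: algebra_simps)
      have E2: "6 * min 1 \<bar>X s \<omega> - X r \<omega>\<bar> * (?b\<^sup>2 + ?w\<^sup>2) \<le> 6 * (t6 \<omega> + t7 \<omega>)"
        using mult_right_mono[OF \<rho>X[of \<omega>], of "?b\<^sup>2 + ?w\<^sup>2"] by (simp add: t6_def t7_def algebra_simps)
      show ?case
        using pos_psi_increment[OF elim] E1 E2 unfolding t1_def t2_def t3_def t4_def t5_def by simp
    qed
  qed (use psi_integrable sr T int a_sq[OF sr] b_sq(2)[OF sr] w_sq(2)[OF sr] in auto)
  also have "\<dots> = (\<integral>\<omega>. t1 \<omega> \<partial>M) + (\<integral>\<omega>. t2 \<omega> \<partial>M) - (\<integral>\<omega>. t3 \<omega> \<partial>M) + (\<integral>\<omega>. t4 \<omega> \<partial>M) - (\<integral>\<omega>. t5 \<omega> \<partial>M)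
      + 6 * ((\<integral>\<omega>. t6 \<omega> \<partial>M) + (\<integral>\<omega>. t7 \<omega> \<partial>M))
      + (3 * (1 + 2 / \<gamma>) * (\<integral>\<omega>. (a s r \<omega>)\<^sup>2 \<partial>M) + 3 * \<gamma> * ((\<integral>\<omega>. (b s r \<omega>)\<^sup>2 \<partial>M) + (\<integral>\<omega>. (w s r \<omega>)\<^sup>2 \<partial>M)))"
    using int a_sq[OF sr] b_sq(2)[OF sr] w_sq(2)[OF sr] by simp
  also have "(\<integral>\<omega>. t1 \<omega> \<partial>M) + (\<integral>\<omega>. t2 \<omega> \<partial>M) - (\<integral>\<omega>. t3 \<omega> \<partial>M) + (\<integral>\<omega>. t4 \<omega> \<partial>M) - (\<integral>\<omega>. t5 \<omega> \<partial>M) = (\<integral>\<omega>. main_term s r \<omega> \<partial>M)"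
    unfolding main_term_def using main_term_integrable(1-3)[OF sr] z1 z2 i1 i2
    by (simp add: t1_def t2_def t3_def t4_def t5_def)
  finally show ?thesis unfolding eb ew by (simp add: t6_def t7_def)
qed

section \<open>Limits along the grid and the growth inequality\<close>

definition growth :: real where "growth = 12 * C + 3 * C\<^sup>2 / (1 - \<alpha>)"

text \<open>The positive part makes this non-negative, so that the upper bound of
  \<open>ito_main_bounds\<close> alone suffices for dominated convergence.\<close>

definition excess :: "real \<Rightarrow> real \<Rightarrow> nat \<Rightarrow> 'w \<Rightarrow> real" where
  "excess t r n \<omega> = max 0 (ito_main (\<lambda>u. X u \<omega>) (\<lambda>s s'. a s s' \<omega>) (\<lambda>u. (norm (G u \<omega>))\<^sup>2) (\<lambda>u. (norm (H u \<omega>))\<^sup>2) t r n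
     - growth * psi_riemann (\<lambda>u. X u \<omega>) t r n)"

lemma growth_nonneg: "0 \<le> growth"
  using C0 \<alpha> by (simp add: growth_def)

lemma grid_times:
  assumes "0 \<le> t" "t \<le> r" "r \<le> T" "i < Suc n"
  shows "0 \<le> grid t r n i" "grid t r n i \<le> grid t r n (Suc i)" "grid t r n (Suc i) \<le> T"
    "grid t r n i \<le> T" "0 \<le> grid t r n (Suc i)" "t \<le> grid t r n i" "grid t r n (Suc i) \<le> r"
  using grid_range[OF assms(2), of i n] grid_range[OF assms(2), of "Suc i" n] grid_mono[OF assms(2), of n i] assms by auto

lemma ito_main_eq:
  "ito_main (\<lambda>u. X u \<omega>) (\<lambda>s s'. a s s' \<omega>) (\<lambda>u. (norm (G u \<omega>))\<^sup>2) (\<lambda>u. (norm (H u \<omega>))\<^sup>2) t r n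
    = (\<Sum>i<Suc n. main_term (grid t r n i) (grid t r n (Suc i)) \<omega>)"
  by (simp only: ito_main_def main_term_def)

lemma ito_main_integrable:
  assumes tr: "0 \<le> t" "t \<le> r" "r \<le> T"
  shows "integrable M (\<lambda>\<omega>. ito_main (\<lambda>u. X u \<omega>) (\<lambda>s s'. a s s' \<omega>) (\<lambda>u. (norm (G u \<omega>))\<^sup>2) (\<lambda>u. (norm (H u \<omega>))\<^sup>2) t r n)"
  unfolding ito_main_eq
  by (intro Bochner_Integration.integrable_sum main_term_integrable(4)) (use grid_times[OF tr] in auto)

lemma psi_riemann_integrable:
  assumes tr: "0 \<le> t" "t \<le> r" "r \<le> T"
  shows "integrable M (\<lambda>\<omega>. psi_riemann (\<lambda>u. X u \<omega>) t r n)"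
  unfolding psi_riemann_def
  by (intro Bochner_Integration.integrable_sum integrable_mult_left psi_integrable) (use grid_times[OF tr] in auto)

lemma excess_integrable:
  assumes tr: "0 \<le> t" "t \<le> r" "r \<le> T"
  shows "integrable M (excess t r n)"
  unfolding excess_def[abs_def]
  by (intro Bochner_Integration.integrable_max Bochner_Integration.integrable_diff integrable_mult_right
       ito_main_integrable[OF tr] psi_riemann_integrable[OF tr]) simp_all

lemma good_path:
  assumes tr: "0 \<le> t" "t \<le> r" "r \<le> T"
  shows "AE \<omega> in M. (\<lambda>n. excess t r n \<omega>) \<longlonglongrightarrow> 0 \<and>
     (\<forall>n. excess t r n \<omega> \<le> 2 * Xs \<omega> * (IF t r \<omega> + (A r \<omega> - A t \<omega>)) + IG t r \<omega>)"
    and "AE \<omega> in M. (\<lambda>n. \<Sum>i<Suc n. (a (grid t r n i) (grid t r n (Suc i)) \<omega>)\<^sup>2) \<longlonglongrightarrow> 0 \<and>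
     (\<forall>n. (\<Sum>i<Suc n. (a (grid t r n i) (grid t r n (Suc i)) \<omega>)\<^sup>2) \<le> (IF t r \<omega> + (A r \<omega> - A t \<omega>) + (V r \<omega> - V t \<omega>))\<^sup>2)"
proof -
  note HD = fw.ito_incrementsD[OF w tr] and GD = bw.ito_incrementsD[OF b tr]
  have sub: "{t..r} \<subseteq> {0..T}" using tr by auto
  show "AE \<omega> in M. (\<lambda>n. excess t r n \<omega>) \<longlonglongrightarrow> 0 \<and>
     (\<forall>n. excess t r n \<omega> \<le> 2 * Xs \<omega> * (IF t r \<omega> + (A r \<omega> - A t \<omega>)) + IG t r \<omega>)"
    using X_cont X_le \<phi>_int \<phi>_le G_le A_mono A_flat V_mono HD(5) GD(5) AE_space
  proof eventually_elim
    case (elim \<omega>)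
    have Hm: "(\<lambda>u. norm (H u \<omega>)) \<in> borel_measurable borel"
      using measurable_compose_Pair1[OF elim(11) w[unfolded fw.ito_increments_def, THEN conjunct1]] by simp
    have c: "continuous_on {t..r} (\<lambda>u. X u \<omega>)" by (rule continuous_on_subset[OF elim(1) sub])
    have 1: "\<And>u. u \<in> {t..r} \<Longrightarrow> \<bar>X u \<omega>\<bar> \<le> Xs \<omega>" using elim(2) sub by auto
    have 2: "ivl_integrable (\<lambda>u. \<phi> u \<omega>) t r" "ivl_integrable (\<lambda>u. (norm (G u \<omega>))\<^sup>2) t r" "ivl_integrable (\<lambda>u. (norm (H u \<omega>))\<^sup>2) t r"
      using ivl_integrable_subset[OF elim(3), of t r] ivl_integrable_subset[OF elim(10), of t r] ivl_integrable_subset[OF elim(9), of t r] tr by auto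
    have 3: "AE u in lborel. u \<in> {t<..r} \<longrightarrow> \<bar>\<phi> u \<omega>\<bar> \<le> C * (\<bar>X u \<omega>\<bar> + norm (H u \<omega>))"
      using elim(4) by eventually_elim (use tr in auto)
    have 4: "AE u in lborel. u \<in> {t<..r} \<longrightarrow> 0 \<le> (norm (G u \<omega>))\<^sup>2 \<and> (norm (G u \<omega>))\<^sup>2 \<le> C * (X u \<omega>)\<^sup>2 + \<alpha> * (norm (H u \<omega>))\<^sup>2"
      using elim(5) by eventually_elim (use tr in auto)
    have 5: "mono_on {t..r} (\<lambda>u. A u \<omega>)" "mono_on {t..r} (\<lambda>u. V u \<omega>)"
      using mono_on_subset[OF elim(6) sub] mono_on_subset[OF elim(8) sub] .
    have 6: "\<exists>u\<in>{s..s'}. X u \<omega> \<le> 0" if "t \<le> s" "s \<le> s'" "s' \<le> r" "A s \<omega> < A s' \<omega>" for s s'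
      using elim(7) that tr by auto
    note bnds = ito_main_bounds[OF tr(2) C0 \<alpha> c 1 2(1,2,3) Hm norm_ge_zero 3 4 5(1) 6 5(2) a_def]
    show ?case
      unfolding excess_def growth_def using bnds by blast
  qed
  show "AE \<omega> in M. (\<lambda>n. \<Sum>i<Suc n. (a (grid t r n i) (grid t r n (Suc i)) \<omega>)\<^sup>2) \<longlonglongrightarrow> 0 \<and>
     (\<forall>n. (\<Sum>i<Suc n. (a (grid t r n i) (grid t r n (Suc i)) \<omega>)\<^sup>2) \<le> (IF t r \<omega> + (A r \<omega> - A t \<omega>) + (V r \<omega> - V t \<omega>))\<^sup>2)"
    using \<phi>_int A_mono A_cont V_mono V_cont
  proof eventually_elim
    case (elim \<omega>)
    \<comment> \<open>A continuous non-decreasing path that dominates every increment of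
      \<open>a\<close>: the accumulated modulus of the drift plus both increasing processes.\<close>
    define P where "P u = IF t u \<omega> + A u \<omega> + V u \<omega>" for u
    have f: "ivl_integrable (\<lambda>u. \<bar>\<phi> u \<omega>\<bar>) t r"
      using integrable_abs[OF ivl_integrable_subset[OF elim(1), of t r]] tr by (simp add: abs_mult)
    have split: "IF t s' \<omega> = IF t s \<omega> + IF s s' \<omega>" if "t \<le> s" "s \<le> s'" "s' \<le> r" for s s'
      by (rule ivl_integral_split[OF ivl_integrable_subset[OF f]]) (use that in auto)
    have IF0: "0 \<le> IF s s' \<omega>" for s s' by (rule ivl_integral_nonneg) auto
    have m: "A s \<omega> \<le> A s' \<omega>" "V s \<omega> \<le> V s' \<omega>" if "t \<le> s" "s \<le> s'" "s' \<le> r" for s s'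
      using mono_onD[OF elim(2), of s s'] mono_onD[OF elim(4), of s s'] that tr by auto
    have Pc: "continuous_on {t..r} P"
      unfolding P_def[abs_def]
      by (intro continuous_intros continuous_on_ivl_integral f continuous_on_subset[OF elim(3) sub] continuous_on_subset[OF elim(5) sub])
    have dP: "\<bar>a s s' \<omega>\<bar> \<le> P s' - P s" if "t \<le> s" "s \<le> s'" "s' \<le> r" for s s'
      using ivl_integral_abs_le[of "\<lambda>u. \<phi> u \<omega>" s s'] split[OF that] m[OF that] unfolding a_def P_def by linarith
    have Pm: "mono_on {t..r} P"
    proof (rule mono_onI)
      fix s s' assume "s \<in> {t..r}" "s' \<in> {t..r}" "s \<le> s'"
      then show "P s \<le> P s'" using dP[of s s'] by auto
    qed
    have ai: "\<bar>a (grid t r n i) (grid t r n (Suc i)) \<omega>\<bar> \<le> P (grid t r n (Suc i)) - P (grid t r n i)" if "i \<le> n" for n i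
      using grid_times[OF tr, of i n] that by (intro dP) auto
    have "ivl_integral (\<lambda>u. \<bar>\<phi> u \<omega>\<bar>) t t = 0" by (simp add: ivl_integral_def)
    then have "P r - P t = IF t r \<omega> + (A r \<omega> - A t \<omega>) + (V r \<omega> - V t \<omega>)" by (simp add: P_def)
    then show ?case
      using grid_square_variation[OF tr(2) Pc Pm, of "\<lambda>n i. a (grid t r n i) (grid t r n (Suc i)) \<omega>", OF ai] by simp
  qed
qed

lemma excess_null:
  assumes tr: "0 \<le> t" "t \<le> r" "r \<le> T"
  shows "(\<lambda>n. \<integral>\<omega>. excess t r n \<omega> \<partial>M) \<longlonglongrightarrow> 0"
proof -
  have Am: "(\<lambda>\<omega>. A r \<omega> - A t \<omega>) \<in> borel_measurable M" using A_meas[of t] A_meas[of r] tr by auto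
  have "(\<lambda>n. \<integral>\<omega>. excess t r n \<omega> \<partial>M) \<longlonglongrightarrow> (\<integral>\<omega>. 0 \<partial>M)"
  proof (rule integral_dominated_convergence[where w="\<lambda>\<omega>. 2 * Xs \<omega> * (IF t r \<omega> + (A r \<omega> - A t \<omega>)) + IG t r \<omega>"])
    have "integrable M (\<lambda>\<omega>. Xs \<omega> * (IF t r \<omega> + (A r \<omega> - A t \<omega>)))"
      by (intro integrable_mult_square Xs integrable_square_add IF_sq[OF tr] A_diff_sq[OF tr] Am borel_measurable_add IF_meas)
    then show "integrable M (\<lambda>\<omega>. 2 * Xs \<omega> * (IF t r \<omega> + (A r \<omega> - A t \<omega>)) + IG t r \<omega>)"
      using bw.ito_incrementsD(7)[OF b tr] by (simp add: mult.assoc)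
    show "AE \<omega> in M. (\<lambda>n. excess t r n \<omega>) \<longlonglongrightarrow> 0" using good_path(1)[OF tr] by eventually_elim auto
    show "AE \<omega> in M. norm (excess t r n \<omega>) \<le> 2 * Xs \<omega> * (IF t r \<omega> + (A r \<omega> - A t \<omega>)) + IG t r \<omega>" for n
      using good_path(1)[OF tr] by eventually_elim (auto simp: excess_def)
  qed (use excess_integrable[OF tr] in auto)
  then show ?thesis by simp
qed

lemma a_squares_null:
  assumes tr: "0 \<le> t" "t \<le> r" "r \<le> T"
  shows "(\<lambda>n. \<Sum>i<Suc n. \<integral>\<omega>. (a (grid t r n i) (grid t r n (Suc i)) \<omega>)\<^sup>2 \<partial>M) \<longlonglongrightarrow> 0"
proof -
  have Am: "(\<lambda>\<omega>. A r \<omega> - A t \<omega>) \<in> borel_measurable M" "(\<lambda>\<omega>. V r \<omega> - V t \<omega>) \<in> borel_measurable M"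
    using A_meas[of t] A_meas[of r] V_meas[of t] V_meas[of r] tr by auto
  have i: "integrable M (\<lambda>\<omega>. (a (grid t r n i) (grid t r n (Suc i)) \<omega>)\<^sup>2)" if "i < Suc n" for n i
    by (rule a_sq) (use grid_times[OF tr that] in auto)
  have "(\<lambda>n. \<integral>\<omega>. (\<Sum>i<Suc n. (a (grid t r n i) (grid t r n (Suc i)) \<omega>)\<^sup>2) \<partial>M) \<longlonglongrightarrow> (\<integral>\<omega>. 0 \<partial>M)"
  proof (rule integral_dominated_convergence[where w="\<lambda>\<omega>. (IF t r \<omega> + (A r \<omega> - A t \<omega>) + (V r \<omega> - V t \<omega>))\<^sup>2"])
    show "integrable M (\<lambda>\<omega>. (IF t r \<omega> + (A r \<omega> - A t \<omega>) + (V r \<omega> - V t \<omega>))\<^sup>2)"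
      by (intro integrable_square_add IF_sq[OF tr] A_diff_sq[OF tr] V_diff_sq[OF tr] Am borel_measurable_add IF_meas)
    show "AE \<omega> in M. (\<lambda>n. \<Sum>i<Suc n. (a (grid t r n i) (grid t r n (Suc i)) \<omega>)\<^sup>2) \<longlonglongrightarrow> 0"
      using good_path(2)[OF tr] by eventually_elim auto
    show "AE \<omega> in M. norm (\<Sum>i<Suc n. (a (grid t r n i) (grid t r n (Suc i)) \<omega>)\<^sup>2) \<le> (IF t r \<omega> + (A r \<omega> - A t \<omega>) + (V r \<omega> - V t \<omega>))\<^sup>2" for n
      using good_path(2)[OF tr] by eventually_elim (auto simp: abs_of_nonneg sum_nonneg simp del: sum.lessThan_Suc)
    show "(\<lambda>\<omega>. \<Sum>i<Suc n. (a (grid t r n i) (grid t r n (Suc i)) \<omega>)\<^sup>2) \<in> borel_measurable M" for n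
      using i by (intro borel_measurable_sum borel_measurable_integrable) auto
  qed simp
  moreover have "(\<integral>\<omega>. (\<Sum>i<Suc n. (a (grid t r n i) (grid t r n (Suc i)) \<omega>)\<^sup>2) \<partial>M) = (\<Sum>i<Suc n. \<integral>\<omega>. (a (grid t r n i) (grid t r n (Suc i)) \<omega>)\<^sup>2 \<partial>M)" for n
    by (rule Bochner_Integration.integral_sum) (use i in auto)
  ultimately show ?thesis by simp
qed

text \<open>A single weight for the whole grid, as \<open>ito_limit_sum_null\<close> demands, cut at
  1 to match the \<open>min\<close> in the expansion. It involves X at all grid points, before and
  after any given interval, and is thus out of reach of a conditional isometry.\<close>

definition osc :: "real \<Rightarrow> real \<Rightarrow> nat \<Rightarrow> 'w \<Rightarrow> real" where
  "osc t r n \<omega> = min 1 (Max ((\<lambda>i. \<bar>X (grid t r n i) \<omega> - X (grid t r n (Suc i)) \<omega>\<bar>) ` {..n}))"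

lemma osc_props:
  assumes tr: "0 \<le> t" "t \<le> r" "r \<le> T"
  shows "osc t r n \<in> borel_measurable M" "0 \<le> osc t r n \<omega>" "osc t r n \<omega> \<le> 1"
    and "i < Suc n \<Longrightarrow> min 1 \<bar>X (grid t r n i) \<omega> - X (grid t r n (Suc i)) \<omega>\<bar> \<le> osc t r n \<omega>"
    and "AE \<omega> in M. (\<lambda>n. osc t r n \<omega>) \<longlonglongrightarrow> 0"
proof -
  have Xm: "(\<lambda>\<omega>. \<bar>X (grid t r n i) \<omega> - X (grid t r n (Suc i)) \<omega>\<bar>) \<in> borel_measurable M" if "i \<le> n" for n i
    using X_meas[of "grid t r n i"] X_meas[of "grid t r n (Suc i)"] grid_times[OF tr, of i n] that by auto
  have "(\<lambda>\<omega>. Max ((\<lambda>i. \<bar>X (grid t r n i) \<omega> - X (grid t r n (Suc i)) \<omega>\<bar>) ` {..n})) \<in> borel_measurable M"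
    by (rule borel_measurable_Max) (use Xm in auto)
  then show "osc t r n \<in> borel_measurable M" unfolding osc_def[abs_def] by measurable
  have "0 \<le> \<bar>X (grid t r n 0) \<omega> - X (grid t r n (Suc 0)) \<omega>\<bar>" by simp
  also have "\<dots> \<le> Max ((\<lambda>i. \<bar>X (grid t r n i) \<omega> - X (grid t r n (Suc i)) \<omega>\<bar>) ` {..n})"
    by (rule Max_ge) (simp, rule image_eqI[of _ _ 0], simp_all)
  finally show nn: "0 \<le> osc t r n \<omega>" by (simp add: osc_def)
  show "osc t r n \<omega> \<le> 1" by (simp add: osc_def)
  show "min 1 \<bar>X (grid t r n i) \<omega> - X (grid t r n (Suc i)) \<omega>\<bar> \<le> osc t r n \<omega>" if "i < Suc n"
    unfolding osc_def by (intro min.mono order_refl Max_ge) (use that in auto)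
  show "AE \<omega> in M. (\<lambda>n. osc t r n \<omega>) \<longlonglongrightarrow> 0"
    using X_cont
  proof eventually_elim
    case (elim \<omega>)
    have c: "continuous_on {t..r} (\<lambda>u. X u \<omega>)" by (rule continuous_on_subset[OF elim]) (use tr in auto)
    show ?case
    proof (rule LIMSEQ_I)
      fix \<epsilon> :: real assume "0 < \<epsilon>"
      then have e: "0 < \<epsilon> / 2" by simp
      obtain n0 where n0: "\<And>n. n \<ge> n0 \<Longrightarrow> \<forall>i\<le>n. \<forall>u\<in>{grid t r n i..grid t r n (Suc i)}. \<bar>X u \<omega> - X (grid t r n i) \<omega>\<bar> \<le> \<epsilon> / 2"
        using grid_osc[OF c tr(2) e] by (auto simp: eventually_sequentially)
      show "\<exists>n0. \<forall>n\<ge>n0. norm (osc t r n \<omega> - 0) < \<epsilon>"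
      proof (intro exI allI impI)
        fix n assume n: "n \<ge> n0"
        have "\<bar>X (grid t r n i) \<omega> - X (grid t r n (Suc i)) \<omega>\<bar> \<le> \<epsilon> / 2" if "i \<le> n" for i
        proof -
          have "grid t r n (Suc i) \<in> {grid t r n i..grid t r n (Suc i)}" using grid_mono[OF tr(2)] by simp
          then show ?thesis using n0[OF n] that by (subst abs_minus_commute) blast
        qed
        then have "Max ((\<lambda>i. \<bar>X (grid t r n i) \<omega> - X (grid t r n (Suc i)) \<omega>\<bar>) ` {..n}) \<le> \<epsilon> / 2"
          by (subst Max_le_iff) auto
        then have "osc t r n \<omega> < \<epsilon>" using e by (simp add: osc_def)
        moreover have "0 \<le> osc t r n \<omega>"
        proof -
          have "0 \<le> \<bar>X (grid t r n 0) \<omega> - X (grid t r n (Suc 0)) \<omega>\<bar>" by simp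
          also have "\<dots> \<le> Max ((\<lambda>i. \<bar>X (grid t r n i) \<omega> - X (grid t r n (Suc i)) \<omega>\<bar>) ` {..n})"
    by (rule Max_ge) (simp, rule image_eqI[of _ _ 0], simp_all)
          finally show ?thesis by (simp add: osc_def)
        qed
        ultimately show "norm (osc t r n \<omega> - 0) < \<epsilon>" by simp
      qed
    qed
  qed
qed

text \<open>Summing \<open>interval_estimate\<close> over the grid telescopes the left side. For
  fixed \<gamma> the refinement removes the weighted squares, the squares of a and the excess. Only
  afterwards may \<gamma> tend to 0 to remove 3 * \<gamma> * c0, because the squares of a carry the
  coefficient 3 * (1 + 2 / \<gamma>).\<close>

lemma expectation_step:
  assumes tr: "0 \<le> t" "t \<le> r" "r \<le> T" and L: "\<And>s. t \<le> s \<Longrightarrow> s \<le> r \<Longrightarrow> (\<integral>\<omega>. pos_psi (X s \<omega>) \<partial>M) \<le> L"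
  shows "(\<integral>\<omega>. pos_psi (X t \<omega>) \<partial>M) \<le> (\<integral>\<omega>. pos_psi (X r \<omega>) \<partial>M) + growth * (r - t) * L"
proof -
  let ?g = "grid t r"
  define c0 where "c0 = (\<integral>\<omega>. IG t r \<omega> \<partial>M) + (\<integral>\<omega>. IH t r \<omega> \<partial>M)"
  define Rb where "Rb n = (\<Sum>i<Suc n. \<integral>\<omega>. osc t r n \<omega> * (b (?g n i) (?g n (Suc i)) \<omega>)\<^sup>2 \<partial>M)" for n
  define Rw where "Rw n = (\<Sum>i<Suc n. \<integral>\<omega>. osc t r n \<omega> * (w (?g n i) (?g n (Suc i)) \<omega>)\<^sup>2 \<partial>M)" for n
  define Sa where "Sa n = (\<Sum>i<Suc n. \<integral>\<omega>. (a (?g n i) (?g n (Suc i)) \<omega>)\<^sup>2 \<partial>M)" for n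
  define E where "E n = (\<integral>\<omega>. excess t r n \<omega> \<partial>M)" for n
  note op = osc_props[OF tr]
  have lims: "Rb \<longlonglongrightarrow> 0" "Rw \<longlonglongrightarrow> 0" "Sa \<longlonglongrightarrow> 0" "E \<longlonglongrightarrow> 0"
  proof -
    show "Rb \<longlonglongrightarrow> 0" unfolding Rb_def[abs_def]
      using b[unfolded bw.ito_increments_def] tr op by blast
    show "Rw \<longlonglongrightarrow> 0" unfolding Rw_def[abs_def]
      using w[unfolded fw.ito_increments_def] tr op by blast
    show "Sa \<longlonglongrightarrow> 0" unfolding Sa_def[abs_def] by (rule a_squares_null[OF tr])
    show "E \<longlonglongrightarrow> 0" unfolding E_def[abs_def] by (rule excess_null[OF tr])
  qed
  have sumI: "(\<Sum>i<Suc n. \<integral>\<omega>. IG (?g n i) (?g n (Suc i)) \<omega> \<partial>M) = (\<integral>\<omega>. IG t r \<omega> \<partial>M)"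
    "(\<Sum>i<Suc n. \<integral>\<omega>. IH (?g n i) (?g n (Suc i)) \<omega> \<partial>M) = (\<integral>\<omega>. IH t r \<omega> \<partial>M)" for n
  proof -
    have sumivl: "(\<Sum>i<Suc n. ivl_integral f (?g n i) (?g n (Suc i))) = ivl_integral f t r" if "ivl_integrable f 0 T" for f
      using ivl_integral_sum[where f=f and \<tau>="?g n" and k="Suc n"] ivl_integrable_subset[OF that, of t r] tr grid_mono[OF tr(2)] by simp
    have i: "integrable M (IG (?g n i) (?g n (Suc i)))" "integrable M (IH (?g n i) (?g n (Suc i)))" if "i < Suc n" for i
      using bw.ito_incrementsD(7)[OF b] fw.ito_incrementsD(7)[OF w] grid_times[OF tr that] by auto
    have "(\<Sum>i<Suc n. \<integral>\<omega>. IG (?g n i) (?g n (Suc i)) \<omega> \<partial>M) = (\<integral>\<omega>. (\<Sum>i<Suc n. IG (?g n i) (?g n (Suc i)) \<omega>) \<partial>M)"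
      by (rule Bochner_Integration.integral_sum[symmetric]) (use i in auto)
    also have "\<dots> = (\<integral>\<omega>. IG t r \<omega> \<partial>M)"
    proof (rule integral_cong_AE)
      show "AE \<omega> in M. (\<Sum>i<Suc n. IG (?g n i) (?g n (Suc i)) \<omega>) = IG t r \<omega>"
        using bw.ito_incrementsD(5)[OF b tr] by eventually_elim (rule sumivl)
      show "(\<lambda>\<omega>. \<Sum>i<Suc n. IG (?g n i) (?g n (Suc i)) \<omega>) \<in> borel_measurable M"
        using i by (intro borel_measurable_sum borel_measurable_integrable) auto
    qed (rule bw.ito_incrementsD(6)[OF b tr])
    finally show "(\<Sum>i<Suc n. \<integral>\<omega>. IG (?g n i) (?g n (Suc i)) \<omega> \<partial>M) = (\<integral>\<omega>. IG t r \<omega> \<partial>M)" .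
    have "(\<Sum>i<Suc n. \<integral>\<omega>. IH (?g n i) (?g n (Suc i)) \<omega> \<partial>M) = (\<integral>\<omega>. (\<Sum>i<Suc n. IH (?g n i) (?g n (Suc i)) \<omega>) \<partial>M)"
      by (rule Bochner_Integration.integral_sum[symmetric]) (use i in auto)
    also have "\<dots> = (\<integral>\<omega>. IH t r \<omega> \<partial>M)"
    proof (rule integral_cong_AE)
      show "AE \<omega> in M. (\<Sum>i<Suc n. IH (?g n i) (?g n (Suc i)) \<omega>) = IH t r \<omega>"
        using fw.ito_incrementsD(5)[OF w tr] by eventually_elim (rule sumivl)
      show "(\<lambda>\<omega>. \<Sum>i<Suc n. IH (?g n i) (?g n (Suc i)) \<omega>) \<in> borel_measurable M"
        using i by (intro borel_measurable_sum borel_measurable_integrable) auto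
    qed (rule fw.ito_incrementsD(6)[OF w tr])
    finally show "(\<Sum>i<Suc n. \<integral>\<omega>. IH (?g n i) (?g n (Suc i)) \<omega> \<partial>M) = (\<integral>\<omega>. IH t r \<omega> \<partial>M)" .
  qed
  have main: "(\<Sum>i<Suc n. \<integral>\<omega>. main_term (?g n i) (?g n (Suc i)) \<omega> \<partial>M) \<le> E n + growth * (r - t) * L" for n
  proof -
    have "(\<integral>\<omega>. psi_riemann (\<lambda>u. X u \<omega>) t r n \<partial>M) = (\<Sum>i<Suc n. (\<integral>\<omega>. pos_psi (X (?g n i) \<omega>) \<partial>M) * ((r - t) / real (Suc n)))"
    proof -
      have "integrable M (\<lambda>\<omega>. pos_psi (X (?g n i) \<omega>))" if "i < Suc n" for i
        using grid_times[OF tr that] by (intro psi_integrable) auto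
      then show ?thesis unfolding psi_riemann_def
        by (subst Bochner_Integration.integral_sum) (auto simp del: sum.lessThan_Suc intro!: integrable_divide sum.cong)
    qed
    also have "\<dots> \<le> (\<Sum>i<Suc n. L * ((r - t) / real (Suc n)))"
      using tr grid_range[OF tr(2), of _ n]
      by (intro sum_mono mult_right_mono L) auto
    also have "\<dots> = L * (r - t)" by (simp add: field_simps)
    finally have riemann: "growth * (\<integral>\<omega>. psi_riemann (\<lambda>u. X u \<omega>) t r n \<partial>M) \<le> growth * (L * (r - t))"
      using growth_nonneg by (rule mult_left_mono)
    have "(\<Sum>i<Suc n. \<integral>\<omega>. main_term (?g n i) (?g n (Suc i)) \<omega> \<partial>M)
      = (\<integral>\<omega>. ito_main (\<lambda>u. X u \<omega>) (\<lambda>s s'. a s s' \<omega>) (\<lambda>u. (norm (G u \<omega>))\<^sup>2) (\<lambda>u. (norm (H u \<omega>))\<^sup>2) t r n \<partial>M)"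
      unfolding ito_main_eq
      by (rule Bochner_Integration.integral_sum[symmetric], rule main_term_integrable(4)) (use grid_times[OF tr] in auto)
    also have "\<dots> \<le> (\<integral>\<omega>. excess t r n \<omega> + growth * psi_riemann (\<lambda>u. X u \<omega>) t r n \<partial>M)"
      by (rule integral_mono) (use ito_main_integrable[OF tr] excess_integrable[OF tr] psi_riemann_integrable[OF tr] in \<open>auto simp: excess_def\<close>)
    also have "\<dots> = E n + growth * (\<integral>\<omega>. psi_riemann (\<lambda>u. X u \<omega>) t r n \<partial>M)"
      using excess_integrable[OF tr] psi_riemann_integrable[OF tr] by (simp add: E_def)
    finally show ?thesis using riemann by (simp add: mult_ac del: sum.lessThan_Suc)
  qed
  have bound: "(\<integral>\<omega>. pos_psi (X t \<omega>) \<partial>M) - (\<integral>\<omega>. pos_psi (X r \<omega>) \<partial>M)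
    \<le> (E n + growth * (r - t) * L) + 6 * (Rb n + Rw n) + 3 * (1 + 2 / \<gamma>) * Sa n + 3 * \<gamma> * c0" if \<gamma>: "0 < \<gamma>" for n \<gamma>
  proof -
    let ?e = "\<lambda>u. \<integral>\<omega>. pos_psi (X u \<omega>) \<partial>M"
    have "?e t - ?e r = (\<Sum>i<Suc n. ?e (?g n i) - ?e (?g n (Suc i)))"
      using sum_lessThan_telescope'[of "\<lambda>i. ?e (?g n i)" "Suc n"] by simp
    also have "\<dots> \<le> (\<Sum>i<Suc n. (\<integral>\<omega>. main_term (?g n i) (?g n (Suc i)) \<omega> \<partial>M)
        + 6 * ((\<integral>\<omega>. osc t r n \<omega> * (b (?g n i) (?g n (Suc i)) \<omega>)\<^sup>2 \<partial>M) + (\<integral>\<omega>. osc t r n \<omega> * (w (?g n i) (?g n (Suc i)) \<omega>)\<^sup>2 \<partial>M))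
        + 3 * (1 + 2 / \<gamma>) * (\<integral>\<omega>. (a (?g n i) (?g n (Suc i)) \<omega>)\<^sup>2 \<partial>M)
        + 3 * \<gamma> * ((\<integral>\<omega>. IG (?g n i) (?g n (Suc i)) \<omega> \<partial>M) + (\<integral>\<omega>. IH (?g n i) (?g n (Suc i)) \<omega> \<partial>M)))"
      by (rule sum_mono, rule interval_estimate[OF _ _ _ \<gamma> op(1-3) op(4)]) (use grid_times[OF tr] in auto)
    also have "\<dots> = (\<Sum>i<Suc n. \<integral>\<omega>. main_term (?g n i) (?g n (Suc i)) \<omega> \<partial>M) + 6 * (Rb n + Rw n) + 3 * (1 + 2 / \<gamma>) * Sa n + 3 * \<gamma> * c0"
      by (simp only: sum.distrib sum_distrib_left[symmetric] sumI Rb_def Rw_def Sa_def c0_def)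
    finally show ?thesis using main[of n] by linarith
  qed
  have fin: "(\<integral>\<omega>. pos_psi (X t \<omega>) \<partial>M) - (\<integral>\<omega>. pos_psi (X r \<omega>) \<partial>M) \<le> growth * (r - t) * L + 3 * \<gamma> * c0" if \<gamma>: "0 < \<gamma>" for \<gamma>
  proof (rule LIMSEQ_le_const)
    have "(\<lambda>n. (E n + growth * (r - t) * L) + 6 * (Rb n + Rw n) + 3 * (1 + 2 / \<gamma>) * Sa n + 3 * \<gamma> * c0)
      \<longlonglongrightarrow> (0 + growth * (r - t) * L) + 6 * (0 + 0) + 3 * (1 + 2 / \<gamma>) * 0 + 3 * \<gamma> * c0"
      by (intro tendsto_intros lims)
    then show "(\<lambda>n. (E n + growth * (r - t) * L) + 6 * (Rb n + Rw n) + 3 * (1 + 2 / \<gamma>) * Sa n + 3 * \<gamma> * c0)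
      \<longlonglongrightarrow> growth * (r - t) * L + 3 * \<gamma> * c0" by simp
  qed (use bound[OF \<gamma>] in auto)
  have "((\<lambda>\<gamma>. growth * (r - t) * L + 3 * \<gamma> * c0) \<longlongrightarrow> growth * (r - t) * L + 3 * 0 * c0) (at_right 0)"
    by (intro tendsto_intros)
  moreover have "\<forall>\<^sub>F \<gamma> in at_right 0. (\<integral>\<omega>. pos_psi (X t \<omega>) \<partial>M) - (\<integral>\<omega>. pos_psi (X r \<omega>) \<partial>M) \<le> growth * (r - t) * L + 3 * \<gamma> * c0"
    using fin by (auto simp: eventually_at_right_field intro!: exI[of _ 1])
  ultimately have "(\<integral>\<omega>. pos_psi (X t \<omega>) \<partial>M) - (\<integral>\<omega>. pos_psi (X r \<omega>) \<partial>M) \<le> growth * (r - t) * L + 3 * 0 * c0"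
    by (rule tendsto_lowerbound) simp
  then show ?thesis by simp
qed

text \<open>\<open>E (pos_psi (X t))\<close> vanishes on successive intervals of
  length \<open>\<delta>\<close> counted backward from \<open>T\<close>, because on each its supremum is at most half of itself.\<close>

theorem nonpositive:
  assumes XT: "AE \<omega> in M. X T \<omega> \<le> 0" and t: "0 \<le> t" "t \<le> T"
  shows "AE \<omega> in M. X t \<omega> \<le> 0"
proof -
  define m where "m s = (\<integral>\<omega>. pos_psi (X s \<omega>) \<partial>M)" for s
  have m0: "0 \<le> m s" for s unfolding m_def by (intro integral_nonneg_AE AE_I2 pos_psi_nonneg)
  \<comment> \<open>Short enough for growth * \<delta> \<le> 1 / 2; the added 1 keeps the quotient
    meaningful when the growth constant is 0.\<close>
  define \<delta> where "\<delta> = 1 / (2 * (growth + 1))"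
  have \<delta>: "0 < \<delta>" "growth * \<delta> \<le> 1 / 2" using growth_nonneg by (auto simp: \<delta>_def field_simps)
  have mT: "m T = 0"
  proof -
    have "(\<integral>\<omega>. pos_psi (X T \<omega>) \<partial>M) = (\<integral>\<omega>. 0 \<partial>M)"
      using XT by (intro integral_cong_AE measurable_compose[OF X_meas pos_psi_measurable(1)])
        (auto simp: pos_psi_eq_0 T0 elim!: eventually_mono)
    then show ?thesis by (simp add: m_def)
  qed
  \<comment> \<open>A finite supremum is needed before L \<le> L / 2 can be read as L \<le>
    0.\<close>
  have upper: "m s \<le> (\<integral>\<omega>. (Xs \<omega>)\<^sup>2 \<partial>M)" if "0 \<le> s" "s \<le> T" for s
    unfolding m_def
  proof (rule integral_mono_AE[OF psi_integrable[OF that] Xs(2)])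
    show "AE \<omega> in M. pos_psi (X s \<omega>) \<le> (Xs \<omega>)\<^sup>2"
      using X_le
    proof eventually_elim
      case (elim \<omega>)
      then have "\<bar>X s \<omega>\<bar>\<^sup>2 \<le> (Xs \<omega>)\<^sup>2" using that by (intro power_mono) auto
      then show ?case using pos_psi_le[of "X s \<omega>"] by simp
    qed
  qed
  have step_back: "m s = 0" if r: "0 \<le> r" "r \<le> T" "m r = 0" and s: "max 0 (r - \<delta>) \<le> s" "s \<le> r" for r s
  proof -
    define K where "K = {max 0 (r - \<delta>)..r}"
    define L where "L = (SUP u\<in>K. m u)"
    have bdd: "bdd_above (m ` K)"
      by (rule bdd_aboveI2[where M="\<integral>\<omega>. (Xs \<omega>)\<^sup>2 \<partial>M"]) (use upper r in \<open>auto simp: K_def\<close>)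
    have leL: "m u \<le> L" if "u \<in> K" for u unfolding L_def by (rule cSUP_upper[OF that bdd])
    have sK: "s \<in> K" "r \<in> K" using s \<delta>(1) r by (auto simp: K_def)
    have L0: "0 \<le> L" using leL[OF sK(1)] m0[of s] by linarith
    have "m u \<le> L / 2" if u: "u \<in> K" for u
    proof -
      have "m u \<le> m r + growth * (r - u) * L"
        unfolding m_def by (rule expectation_step) (use u r leL in \<open>auto simp: K_def m_def\<close>)
      also have "growth * (r - u) * L \<le> growth * \<delta> * L"
        using u growth_nonneg L0 by (intro mult_right_mono mult_left_mono) (auto simp: K_def)
      also have "\<dots> \<le> 1 / 2 * L" using \<delta>(2) L0 by (rule mult_right_mono)
      finally show ?thesis using r(3) by simp
    qed
    then have "L \<le> L / 2" unfolding L_def using sK by (intro cSUP_least) auto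
    then show ?thesis using leL[OF sK(1)] m0[of s] by linarith
  qed
  have "\<forall>s. max 0 (T - real k * \<delta>) \<le> s \<and> s \<le> T \<longrightarrow> m s = 0" for k
  proof (induction k)
    case 0
    then show ?case using mT T0 by auto
  next
    case (Suc k)
    show ?case
    proof (intro allI impI)
      fix s assume s: "max 0 (T - real (Suc k) * \<delta>) \<le> s \<and> s \<le> T"
      define r where "r = max 0 (T - real k * \<delta>)"
      have rT: "0 \<le> r" "r \<le> T" using T0 \<delta>(1) by (auto simp: r_def)
      then have mr: "m r = 0" using Suc.IH by (auto simp: r_def)
      show "m s = 0"
      proof (cases "r \<le> s")
        case True
        then show ?thesis using Suc.IH s by (auto simp: r_def)
      next
        case False
        have "max 0 (r - \<delta>) \<le> s" using s False by (auto simp: r_def algebra_simps split: if_splits)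
        then show ?thesis using step_back[OF rT mr] False by auto
      qed
    qed
  qed
  moreover obtain k :: nat where "T / \<delta> \<le> real k" using real_arch_simple by blast
  then have "T - real k * \<delta> \<le> 0" using \<delta>(1) by (simp add: field_simps)
  ultimately have "m t = 0" using t by (metis max.absorb1)
  then have "AE \<omega> in M. pos_psi (X t \<omega>) = 0"
    unfolding m_def using integral_nonneg_eq_0_iff_AE[OF psi_integrable[OF t]] pos_psi_nonneg by auto
  then show ?thesis by (simp add: pos_psi_eq_0)
qed

end

section \<open>The two filtrations and measurable versions of the processes\<close>

lemma (in prob_space) indep_set_commute: "indep_set A B \<Longrightarrow> indep_set B A"
proof (rule indep_setI)
  assume AB: "indep_set A B"
  show "B \<subseteq> events" by (rule indep_setD_ev2[OF AB])
  show "A \<subseteq> events" by (rule indep_setD_ev1[OF AB])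
  show "prob (b \<inter> a) = prob b * prob a" if "b \<in> B" "a \<in> A" for a b
    using indep_setD[OF AB that(2,1)] by (simp add: Int_commute mult.commute)
qed

lemma (in prob_space) standard_BM_measurable:
  "standard_BM M T X \<Longrightarrow> 0 \<le> t \<Longrightarrow> t \<le> T \<Longrightarrow> X t \<in> borel_measurable M"
  by (simp add: standard_BM_def)

text \<open>D is first placed next to A, where independence of X from \<G> separates both from
  \<Gamma>. Disjointness of the increments then separates A from D, and independence from \<G> is
  used once more to reunite A with \<Gamma>.\<close>

lemma (in prob_space) standard_BM_indep_joint:
  fixes X :: "real \<Rightarrow> 'a \<Rightarrow> real ^ 'n"
  assumes BM: "standard_BM M T X" and Y: "indep_set (sets (sigma_incr M X 0 T)) \<G>"
    and ab: "0 \<le> a" "a \<le> b" "b \<le> T" and st: "0 \<le> s" "s \<le> t" "t \<le> T" and disj: "b \<le> s \<or> t \<le> a"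
    and A: "A \<in> sets (sigma_incr M X a b)" and \<Gamma>: "\<Gamma> \<in> \<G>" and D: "D \<in> vimages M (\<lambda>\<omega>. X t \<omega> - X s \<omega>)"
  shows "prob (A \<inter> \<Gamma> \<inter> D) = prob (A \<inter> \<Gamma>) * prob D"
proof -
  have A': "A \<in> sets (sigma_incr M X 0 T)" using A sigma_incr_mono[of 0 a b T M X] ab by auto
  have D': "D \<in> sets (sigma_incr M X 0 T)"
  proof -
    obtain E where E: "D = (\<lambda>\<omega>. X t \<omega> - X s \<omega>) -` E \<inter> space M" "E \<in> sets borel" using D by (auto simp: vimages_def)
    have "(\<lambda>\<omega>. X t \<omega> - X s \<omega>) \<in> borel_measurable (sigma_incr M X 0 T)"
      using st by (intro measurable_increment2) auto
    from measurable_sets[OF this E(2)] show ?thesis by (simp add: E(1))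
  qed
  have "prob (A \<inter> \<Gamma> \<inter> D) = prob ((A \<inter> D) \<inter> \<Gamma>)" by (simp add: Int_ac)
  also have "\<dots> = prob (A \<inter> D) * prob \<Gamma>" using A' D' \<Gamma> by (intro indep_setD[OF Y]) auto
  also have "prob (A \<inter> D) = prob A * prob D"
    using indep_setD[OF standard_BM_indep_set[OF BM ab st disj] A] D by (auto intro: sigma_sets.Basic)
  also have "prob A * prob D * prob \<Gamma> = (prob A * prob \<Gamma>) * prob D" by simp
  also have "prob A * prob \<Gamma> = prob (A \<inter> \<Gamma>)" using indep_setD[OF Y A' \<Gamma>] by simp
  finally show ?thesis .
qed

text \<open>The disjunction in \<open>adapted\<close> covers both directions of time: of two
  successive intervals, either the earlier step is known to the later sigma-algebra (forward) or the
  later one to the earlier (backward). In both cases the known step plays the role of \<eta> in the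
  centring property.\<close>

lemma (in prob_space) simple_integrationI:
  fixes X :: "real \<Rightarrow> 'a \<Rightarrow> real ^ 'n"
  assumes BM: "standard_BM M T X"
    and sub: "\<And>s t. 0 \<le> s \<Longrightarrow> s \<le> t \<Longrightarrow> t \<le> T \<Longrightarrow> subalgebra M (\<Phi> s t)"
    and mono: "\<And>s s' t t'. 0 \<le> s \<Longrightarrow> s \<le> s' \<Longrightarrow> s' \<le> t' \<Longrightarrow> t' \<le> t \<Longrightarrow> t \<le> T \<Longrightarrow> sets (\<Phi> s t) \<subseteq> sets (\<Phi> s' t')"
    and indep: "\<And>s t. 0 \<le> s \<Longrightarrow> s \<le> t \<Longrightarrow> t \<le> T \<Longrightarrow> indep_set (sets (\<Phi> s t)) (sigma_sets (space M) (vimages M (\<lambda>\<omega>. X t \<omega> - X s \<omega>)))"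
    and adapted: "\<And>a b c d. 0 \<le> a \<Longrightarrow> a \<le> b \<Longrightarrow> b \<le> c \<Longrightarrow> c \<le> d \<Longrightarrow> d \<le> T \<Longrightarrow>
      (sets (\<Phi> a b) \<subseteq> sets (\<Phi> c d) \<and> (\<lambda>\<omega>. X b \<omega> - X a \<omega>) \<in> borel_measurable (\<Phi> c d)) \<or>
      (sets (\<Phi> c d) \<subseteq> sets (\<Phi> a b) \<and> (\<lambda>\<omega>. X d \<omega> - X c \<omega>) \<in> borel_measurable (\<Phi> a b))"
  shows "simple_integration M T (3 * (real CARD('n))\<^sup>2) \<Phi> X"
proof -
  note Xm = standard_BM_measurable[OF BM]
  note mom = standard_BM_increment_moments[OF BM]
  have dm: "(\<lambda>\<omega>. X t \<omega> - X s \<omega>) \<in> borel_measurable M" if "0 \<le> s" "s \<le> t" "t \<le> T" for s t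
    using Xm[of s] Xm[of t] that by auto
  have zero: "bounded_measurable F (\<lambda>_. 0 :: real ^ 'n)" for F :: "'a measure" by (auto simp: bounded_measurable_def)
  have mean: "(\<integral>\<omega>. \<eta> \<omega> * (h \<omega> \<bullet> (X t \<omega> - X s \<omega>)) \<partial>M) = 0"
    if st: "0 \<le> s" "s \<le> t" "t \<le> T" and h: "bounded_measurable (\<Phi> s t) h" and \<eta>: "\<eta> \<in> borel_measurable (\<Phi> s t)" "integrable M (\<lambda>\<omega>. (\<eta> \<omega>)\<^sup>2)"
    for s t h \<eta>
    by (rule indep_increment_moments(1)[OF sub[OF st] dm[OF st] indep[OF st] mom(1-3)[OF st] h zero \<eta>])
  have sq: "integrable M (\<lambda>\<omega>. (h \<omega> \<bullet> (X t \<omega> - X s \<omega>))\<^sup>2)" if st: "0 \<le> s" "s \<le> t" "t \<le> T" and h: "bounded_measurable F h" and F: "subalgebra M F" for s t h F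
  proof -
    obtain c where c: "\<And>\<omega>. \<omega> \<in> space M \<Longrightarrow> norm (h \<omega>) \<le> c"
      using h F by (auto simp: bounded_measurable_def subalgebra_def)
    have hm: "h \<in> borel_measurable M" using h measurable_from_subalg[OF F] by (auto simp: bounded_measurable_def)
    have i: "integrable M (\<lambda>\<omega>. (\<Sum>j\<in>Basis. ((X t \<omega> - X s \<omega>) \<bullet> j)\<^sup>2))" using mom(1)[OF st] by auto
    show ?thesis
    proof (rule Bochner_Integration.integrable_bound)
      show "integrable M (\<lambda>\<omega>. c\<^sup>2 * (\<Sum>j\<in>Basis. ((X t \<omega> - X s \<omega>) \<bullet> j)\<^sup>2))" using i by simp
      show "(\<lambda>\<omega>. (h \<omega> \<bullet> (X t \<omega> - X s \<omega>))\<^sup>2) \<in> borel_measurable M" using hm dm[OF st] by auto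
      show "AE \<omega> in M. norm ((h \<omega> \<bullet> (X t \<omega> - X s \<omega>))\<^sup>2) \<le> norm (c\<^sup>2 * (\<Sum>j\<in>Basis. ((X t \<omega> - X s \<omega>) \<bullet> j)\<^sup>2))"
      proof (rule AE_I2)
        fix \<omega> assume "\<omega> \<in> space M"
        have "\<bar>h \<omega> \<bullet> (X t \<omega> - X s \<omega>)\<bar> \<le> c * norm (X t \<omega> - X s \<omega>)"
          using Cauchy_Schwarz_ineq2[of "h \<omega>" "X t \<omega> - X s \<omega>"] mult_right_mono[OF c[OF \<open>\<omega> \<in> space M\<close>] norm_ge_zero[of "X t \<omega> - X s \<omega>"]] by linarith
        then have "\<bar>h \<omega> \<bullet> (X t \<omega> - X s \<omega>)\<bar>\<^sup>2 \<le> (c * norm (X t \<omega> - X s \<omega>))\<^sup>2" by (intro power_mono) auto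
        also have "\<dots> = c\<^sup>2 * (\<Sum>j\<in>Basis. ((X t \<omega> - X s \<omega>) \<bullet> j)\<^sup>2)"
          unfolding power_mult_distrib power2_norm_eq_inner
          by (subst euclidean_inner[of "X t \<omega> - X s \<omega>" "X t \<omega> - X s \<omega>"]) (simp add: power2_eq_square)
        finally show "norm ((h \<omega> \<bullet> (X t \<omega> - X s \<omega>))\<^sup>2) \<le> norm (c\<^sup>2 * (\<Sum>j\<in>Basis. ((X t \<omega> - X s \<omega>) \<bullet> j)\<^sup>2))"
          by (simp add: abs_of_nonneg sum_nonneg)
      qed
    qed
  qed
  show ?thesis
  proof (intro simple_integration.intro prob_space_axioms simple_integration_axioms.intro)
    fix s t assume st: "0 \<le> s" "s \<le> t" "t \<le> T"
    show "subalgebra M (\<Phi> s t)" by (rule sub[OF st])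
    show "(\<integral>\<omega>. \<eta> \<omega> * (h \<omega> \<bullet> (X t \<omega> - X s \<omega>)) \<partial>M) = 0"
      if "bounded_measurable (\<Phi> s t) h" "\<eta> \<in> borel_measurable (\<Phi> s t)" "integrable M (\<lambda>\<omega>. (\<eta> \<omega>)\<^sup>2)" for h \<eta>
      by (rule mean[OF st that])
    show "(\<integral>\<omega>. (h \<omega> \<bullet> (X t \<omega> - X s \<omega>)) * (k \<omega> \<bullet> (X t \<omega> - X s \<omega>)) \<partial>M) = (t - s) * (\<integral>\<omega>. h \<omega> \<bullet> k \<omega> \<partial>M)"
      if "bounded_measurable (\<Phi> s t) h" "bounded_measurable (\<Phi> s t) k" for h k
      by (rule indep_increment_moments(2)[OF sub[OF st] dm[OF st] indep[OF st] mom(1-3)[OF st] that, of "\<lambda>_. 0"]) auto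
    show "integrable M (\<lambda>\<omega>. norm (X t \<omega> - X s \<omega>) ^ 4)" "(\<integral>\<omega>. norm (X t \<omega> - X s \<omega>) ^ 4 \<partial>M) \<le> 3 * (real CARD('n))\<^sup>2 * (t - s)\<^sup>2"
      using mom(4,5)[OF st] .
  next
    fix s s' t t' assume "0 \<le> s" "s \<le> s'" "s' \<le> t'" "t' \<le> t" "t \<le> T"
    then show "sets (\<Phi> s t) \<subseteq> sets (\<Phi> s' t')" by (rule mono)
  next
    fix t assume "0 \<le> t" "t \<le> T" then show "X t \<in> borel_measurable M" by (rule Xm)
  next
    fix a b c d and h k :: "'a \<Rightarrow> real ^ 'n"
    assume o: "0 \<le> a" "a \<le> b" "b \<le> c" "c \<le> d" "d \<le> T"
      and h: "bounded_measurable (\<Phi> a b) h" and k: "bounded_measurable (\<Phi> c d) k"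
    have ab: "0 \<le> a" "a \<le> b" "b \<le> T" and cd: "0 \<le> c" "c \<le> d" "d \<le> T" using o by auto
    have lift: "h' \<in> borel_measurable F'" if "h' \<in> borel_measurable F" "subalgebra M F" "subalgebra M F'" "sets F \<subseteq> sets F'"
      for F F' :: "'a measure" and h' :: "'a \<Rightarrow> real ^ 'n"
    proof -
      have "subalgebra F' F" using that(2-4) by (simp add: subalgebra_def)
      then show ?thesis by (rule measurable_from_subalg) (rule that(1))
    qed
    from adapted[OF o] show "(\<integral>\<omega>. (h \<omega> \<bullet> (X b \<omega> - X a \<omega>)) * (k \<omega> \<bullet> (X d \<omega> - X c \<omega>)) \<partial>M) = 0"
    proof
      assume *: "sets (\<Phi> a b) \<subseteq> sets (\<Phi> c d) \<and> (\<lambda>\<omega>. X b \<omega> - X a \<omega>) \<in> borel_measurable (\<Phi> c d)"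
      have "h \<in> borel_measurable (\<Phi> c d)"
        using h * by (intro lift[OF _ sub[OF ab] sub[OF cd]]) (simp_all add: bounded_measurable_def)
      then have "(\<lambda>\<omega>. h \<omega> \<bullet> (X b \<omega> - X a \<omega>)) \<in> borel_measurable (\<Phi> c d)" using * by auto
      from mean[OF cd k this sq[OF ab h sub[OF ab]]] show ?thesis .
    next
      assume *: "sets (\<Phi> c d) \<subseteq> sets (\<Phi> a b) \<and> (\<lambda>\<omega>. X d \<omega> - X c \<omega>) \<in> borel_measurable (\<Phi> a b)"
      have "k \<in> borel_measurable (\<Phi> a b)"
        using k * by (intro lift[OF _ sub[OF cd] sub[OF ab]]) (simp_all add: bounded_measurable_def)
      then have "(\<lambda>\<omega>. k \<omega> \<bullet> (X d \<omega> - X c \<omega>)) \<in> borel_measurable (\<Phi> a b)" using * by auto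
      from mean[OF ab h this sq[OF cd k sub[OF cd]]] show ?thesis by (simp add: mult.commute)
    qed
  qed simp
qed

section \<open>The forward and backward families as instances\<close>

lemma subalgebra_sigma_join:
  assumes "subalgebra M F" "subalgebra M G"
  shows "subalgebra M (sigma_join F G)"
  using assms sets_sigma_join_least[of F M G] by (auto simp: subalgebra_def)

lemma measurable_sigma_join:
  assumes "space F = space G" "f \<in> borel_measurable F \<or> f \<in> borel_measurable G"
  shows "f \<in> borel_measurable (sigma_join F G)"
proof -
  have "subalgebra (sigma_join F G) F" "subalgebra (sigma_join F G) G"
    using assms(1) sets_subset_sigma_join[OF assms(1)] by (auto simp: subalgebra_def)
  then show ?thesis using assms(2) measurable_from_subalg by blast
qed

locale BM_pair_space = prob_space M for M :: "'w measure" +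
  fixes T :: real and W :: "real \<Rightarrow> 'w \<Rightarrow> real ^ 'd" and B :: "real \<Rightarrow> 'w \<Rightarrow> real ^ 'l"
  assumes T_pos: "0 < T" and BM: "BM_pair M T W B"
begin

lemma BMW: "standard_BM M T W" and BMB: "standard_BM M T B"
  and indep_WB: "indep_set (sets (sigma_incr M W 0 T)) (sets (sigma_incr M B 0 T))"
  using BM by (auto simp: BM_pair_def)

lemma subalgebra_W: "0 \<le> s \<Longrightarrow> t \<le> T \<Longrightarrow> subalgebra M (sigma_incr M W s t)"
  and subalgebra_B: "0 \<le> s \<Longrightarrow> t \<le> T \<Longrightarrow> subalgebra M (sigma_incr M B s t)"
  using standard_BM_measurable[OF BMW] standard_BM_measurable[OF BMB] by (auto intro!: subalgebra_sigma_incr)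

lemma subalgebra_Ft: "0 \<le> t \<Longrightarrow> t \<le> T \<Longrightarrow> subalgebra M (Ft M T W B t)"
  and subalgebra_Gt: "0 \<le> t \<Longrightarrow> t \<le> T \<Longrightarrow> subalgebra M (Gt M T W B t)"
  and subalgebra_Ht: "0 \<le> t \<Longrightarrow> t \<le> T \<Longrightarrow> subalgebra M (Ht M T W B t)"
  unfolding Ft_def Gt_def Ht_def by (auto intro!: subalgebra_sigma_join subalgebra_W subalgebra_B)

text \<open>This is why the solution processes can meet both integrals: the value at the left end is
  admissible forward, the value at the right end backward.\<close>

lemma Ft_Gt: "0 \<le> t \<Longrightarrow> t \<le> T \<Longrightarrow> subalgebra (Gt M T W B t) (Ft M T W B t)"
  and Ft_Ht: "0 \<le> t \<Longrightarrow> t \<le> T \<Longrightarrow> subalgebra (Ht M T W B t) (Ft M T W B t)"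
  unfolding Ft_def Gt_def Ht_def subalgebra_def by (auto intro!: sigma_join_mono sigma_incr_mono del: subsetI)

lemma null_sets_Ft: "null_sets M \<subseteq> sets (Ft M T W B t)"
  using null_sets_subset_sigma_incr[of M W 0 t] sets_subset_sigma_join(1)[of "sigma_incr M W 0 t" "sigma_incr M B t T"]
  by (auto simp: Ft_def)

text \<open>At time s the forward family knows all of B and the past of W. An increment of W after s
  is independent of the latter by the Brownian property and of B by \<open>indep_WB\<close>;
  \<open>standard_BM_indep_joint\<close> makes the two independences joint.\<close>

lemma simple_integration_W: "simple_integration M T (3 * (real CARD('d))\<^sup>2) (\<lambda>s t. Gt M T W B s) W"
proof (rule simple_integrationI[OF BMW])
  fix s t assume st: "0 \<le> s" "s \<le> t" "t \<le> T"
  show "subalgebra M (Gt M T W B s)" using st by (intro subalgebra_Gt) auto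
  show "indep_set (sets (Gt M T W B s)) (sigma_sets (space M) (vimages M (\<lambda>\<omega>. W t \<omega> - W s \<omega>)))"
    unfolding Gt_def
  proof (rule indep_set_sigma_join)
    show "vimages M (\<lambda>\<omega>. W t \<omega> - W s \<omega>) \<subseteq> events"
      using standard_BM_measurable[OF BMW, of s] standard_BM_measurable[OF BMW, of t] st by (intro vimages_subset) auto
    fix A \<Gamma> D assume "A \<in> sets (sigma_incr M W 0 s)" "\<Gamma> \<in> sets (sigma_incr M B 0 T)" "D \<in> vimages M (\<lambda>\<omega>. W t \<omega> - W s \<omega>)"
    then show "prob (A \<inter> \<Gamma> \<inter> D) = prob (A \<inter> \<Gamma>) * prob D"
      using st by (intro standard_BM_indep_joint[OF BMW indep_WB, of 0 s s t]) auto
  qed (use st Int_stable_vimages subalgebra_W subalgebra_B in auto)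
next
  fix s s' t t' :: real assume "0 \<le> s" "s \<le> s'" "s' \<le> t'" "t' \<le> t" "t \<le> T"
  then show "sets (Gt M T W B s) \<subseteq> sets (Gt M T W B s')"
    unfolding Gt_def by (intro sigma_join_mono sigma_incr_mono) auto
next
  fix a b c d :: real assume o: "0 \<le> a" "a \<le> b" "b \<le> c" "c \<le> d" "d \<le> T"
  have "sets (Gt M T W B a) \<subseteq> sets (Gt M T W B c)"
    unfolding Gt_def using o by (intro sigma_join_mono sigma_incr_mono) auto
  moreover have "(\<lambda>\<omega>. W b \<omega> - W a \<omega>) \<in> borel_measurable (Gt M T W B c)"
    unfolding Gt_def by (rule measurable_sigma_join) (use o in \<open>auto intro!: measurable_increment2\<close>)
  ultimately show "(sets (Gt M T W B a) \<subseteq> sets (Gt M T W B c) \<and> (\<lambda>\<omega>. W b \<omega> - W a \<omega>) \<in> borel_measurable (Gt M T W B c)) \<or>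
      (sets (Gt M T W B c) \<subseteq> sets (Gt M T W B a) \<and> (\<lambda>\<omega>. W d \<omega> - W c \<omega>) \<in> borel_measurable (Gt M T W B a))" by blast
qed

text \<open>The mirror image: the backward family at t knows all of W and the increments of B after
  t, so the increment of B up to t is independent of it, and of two successive increments the later
  one is known.\<close>

lemma simple_integration_B: "simple_integration M T (3 * (real CARD('l))\<^sup>2) (\<lambda>s t. Ht M T W B t) B"
proof (rule simple_integrationI[OF BMB])
  fix s t assume st: "0 \<le> s" "s \<le> t" "t \<le> T"
  show "subalgebra M (Ht M T W B t)" using st by (intro subalgebra_Ht) auto
  show "indep_set (sets (Ht M T W B t)) (sigma_sets (space M) (vimages M (\<lambda>\<omega>. B t \<omega> - B s \<omega>)))"
    unfolding Ht_def
  proof (rule indep_set_sigma_join)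
    show "vimages M (\<lambda>\<omega>. B t \<omega> - B s \<omega>) \<subseteq> events"
      using standard_BM_measurable[OF BMB, of s] standard_BM_measurable[OF BMB, of t] st by (intro vimages_subset) auto
    fix \<Gamma> A D assume "\<Gamma> \<in> sets (sigma_incr M W 0 T)" "A \<in> sets (sigma_incr M B t T)" "D \<in> vimages M (\<lambda>\<omega>. B t \<omega> - B s \<omega>)"
    then show "prob (\<Gamma> \<inter> A \<inter> D) = prob (\<Gamma> \<inter> A) * prob D"
      using st standard_BM_indep_joint[OF BMB indep_set_commute[OF indep_WB], of t T s t A \<Gamma> D] by (simp add: Int_commute)
  qed (use st Int_stable_vimages subalgebra_W subalgebra_B in auto)
next
  fix s s' t t' :: real assume "0 \<le> s" "s \<le> s'" "s' \<le> t'" "t' \<le> t" "t \<le> T"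
  then show "sets (Ht M T W B t) \<subseteq> sets (Ht M T W B t')"
    unfolding Ht_def by (intro sigma_join_mono sigma_incr_mono) auto
next
  fix a b c d :: real assume o: "0 \<le> a" "a \<le> b" "b \<le> c" "c \<le> d" "d \<le> T"
  have "sets (Ht M T W B d) \<subseteq> sets (Ht M T W B b)"
    unfolding Ht_def using o by (intro sigma_join_mono sigma_incr_mono) auto
  moreover have "(\<lambda>\<omega>. B d \<omega> - B c \<omega>) \<in> borel_measurable (Ht M T W B b)"
    unfolding Ht_def by (rule measurable_sigma_join) (use o in \<open>auto intro!: measurable_increment2\<close>)
  ultimately show "(sets (Ht M T W B b) \<subseteq> sets (Ht M T W B d) \<and> (\<lambda>\<omega>. B b \<omega> - B a \<omega>) \<in> borel_measurable (Ht M T W B d)) \<or>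
      (sets (Ht M T W B d) \<subseteq> sets (Ht M T W B b) \<and> (\<lambda>\<omega>. B d \<omega> - B c \<omega>) \<in> borel_measurable (Ht M T W B b))" by blast
qed

end

section \<open>Countable time nets and jointly measurable processes\<close>

definition approx_time :: "real \<Rightarrow> nat \<Rightarrow> real \<Rightarrow> real" where
  "approx_time T n t = min T (real (nat \<lfloor>real (Suc n) * t\<rfloor>) / real (Suc n))"

definition time_net :: "real \<Rightarrow> real set" where
  "time_net T = (\<lambda>(j, n). min T (real j / real (Suc n))) ` (UNIV :: (nat \<times> nat) set)"

lemma countable_time_net: "countable (time_net T)"
  unfolding time_net_def by (rule countable_image) simp

lemma time_net_subset: "0 \<le> T \<Longrightarrow> time_net T \<subseteq> {0..T}"
  by (auto simp: time_net_def)

lemma approx_time_in_net: "approx_time T n t \<in> time_net T"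
  unfolding approx_time_def time_net_def by auto

lemma approx_time_tendsto:
  assumes "t \<in> {0..T}"
  shows "(\<lambda>n. approx_time T n t) \<longlonglongrightarrow> t"
proof (rule tendsto_sandwich[where f="\<lambda>n. t - 1 / real (Suc n)" and h="\<lambda>_. t"])
  have fl: "real (nat \<lfloor>real (Suc n) * t\<rfloor>) \<le> real (Suc n) * t" "real (Suc n) * t - 1 \<le> real (nat \<lfloor>real (Suc n) * t\<rfloor>)" for n
    using assms by (auto simp: of_nat_nat)
  show "\<forall>\<^sub>F n in sequentially. approx_time T n t \<le> t"
  proof (intro always_eventually allI)
    fix n
    have "real (nat \<lfloor>real (Suc n) * t\<rfloor>) / real (Suc n) \<le> t" using fl(1)[of n] by (simp add: field_simps)
    then show "approx_time T n t \<le> t" by (simp add: approx_time_def)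
  qed
  show "\<forall>\<^sub>F n in sequentially. t - 1 / real (Suc n) \<le> approx_time T n t"
  proof (intro always_eventually allI)
    fix n
    have "t - 1 / real (Suc n) = (real (Suc n) * t - 1) / real (Suc n)" by (simp add: field_simps)
    also have "\<dots> \<le> real (nat \<lfloor>real (Suc n) * t\<rfloor>) / real (Suc n)" by (rule divide_right_mono[OF fl(2)]) simp
    finally have "t - 1 / real (Suc n) \<le> real (nat \<lfloor>real (Suc n) * t\<rfloor>) / real (Suc n)" .
    moreover have "t - 1 / real (Suc n) \<le> T" using assms by (simp add: algebra_simps add_increasing2)
    ultimately show "t - 1 / real (Suc n) \<le> approx_time T n t" by (simp add: approx_time_def)
  qed
  have "(\<lambda>n. t - 1 / real (Suc n)) \<longlonglongrightarrow> t - 0" by (intro tendsto_intros LIMSEQ_Suc[OF lim_1_over_n])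
  then show "(\<lambda>n. t - 1 / real (Suc n)) \<longlonglongrightarrow> t" by simp
qed simp

lemma approx_time_continuous:
  assumes "continuous_on {0..T} f" "t \<in> {0..T}"
  shows "(\<lambda>n. f (approx_time T n t)) \<longlonglongrightarrow> f t"
proof -
  have "0 \<le> T" using assms(2) by auto
  then have "approx_time T n t \<in> {0..T}" for n using approx_time_in_net time_net_subset by blast
  then show ?thesis
    using assms approx_time_tendsto[OF assms(2)] unfolding continuous_on_sequentially comp_def by auto
qed

lemma le_from_time_net:
  fixes f :: "real \<Rightarrow> real"
  assumes "continuous_on {0..T} f" "\<And>q. q \<in> time_net T \<Longrightarrow> f q \<le> c" "t \<in> {0..T}"
  shows "f t \<le> c"
  by (rule LIMSEQ_le_const2[OF approx_time_continuous[OF assms(1,3)]]) (use assms(2) approx_time_in_net in auto)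

text \<open>Rounding time down to a countable net gives a jointly measurable process, and continuity
  of the paths passes this to the limit.\<close>

lemma measurable_continuous_process:
  fixes Y :: "real \<Rightarrow> 'w \<Rightarrow> real"
  assumes Y: "\<And>t. t \<in> {0..T} \<Longrightarrow> Y t \<in> borel_measurable M" and c: "\<And>\<omega>. \<omega> \<in> space M \<Longrightarrow> continuous_on {0..T} (\<lambda>t. Y t \<omega>)"
    and T: "0 \<le> T"
  shows "(\<lambda>x. indicator {0..T} (snd x) * Y (snd x) (fst x)) \<in> borel_measurable (M \<Otimes>\<^sub>M lborel)"
proof (rule borel_measurable_LIMSEQ_real)
  fix n
  have 1: "(\<lambda>x. Y (min T (real j / real (Suc n))) (fst x)) \<in> borel_measurable (M \<Otimes>\<^sub>M lborel)" for j
    using Y[of "min T (real j / real (Suc n))"] T by (intro measurable_compose[OF measurable_fst]) auto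
  have 2: "(\<lambda>x. nat \<lfloor>real (Suc n) * snd x\<rfloor>) \<in> M \<Otimes>\<^sub>M lborel \<rightarrow>\<^sub>M count_space UNIV" by measurable
  have "(\<lambda>x. Y (min T (real (nat \<lfloor>real (Suc n) * snd x\<rfloor>) / real (Suc n))) (fst x)) \<in> borel_measurable (M \<Otimes>\<^sub>M lborel)"
    by (rule measurable_compose_countable[OF 1 2])
  then show "(\<lambda>x. indicator {0..T} (snd x) * Y (approx_time T n (snd x)) (fst x)) \<in> borel_measurable (M \<Otimes>\<^sub>M lborel)"
    unfolding approx_time_def by simp
next
  fix x :: "'w \<times> real" assume "x \<in> space (M \<Otimes>\<^sub>M lborel)"
  then have "fst x \<in> space M" by (auto simp: space_pair_measure)
  then show "(\<lambda>n. indicator {0..T} (snd x) * Y (approx_time T n (snd x)) (fst x)) \<longlonglongrightarrow> indicator {0..T} (snd x) * Y (snd x) (fst x)"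
    using approx_time_continuous[OF c] by (cases "snd x \<in> {0..T}") (auto intro!: tendsto_intros)
qed

text \<open>Joint measurability is given over {0..T} only. Composing with the projection of the line
  onto that interval extends it, and the indicator hides the artificial values outside.\<close>

lemma measurable_process_extend:
  fixes Z :: "real \<Rightarrow> 'w \<Rightarrow> 'b::euclidean_space"
  assumes Z: "(\<lambda>(\<omega>, t). Z t \<omega>) \<in> borel_measurable (M \<Otimes>\<^sub>M restrict_space borel {0..T})" and T: "0 \<le> T"
  shows "(\<lambda>x. indicator {0..T} (snd x) *\<^sub>R Z (snd x) (fst x)) \<in> borel_measurable (M \<Otimes>\<^sub>M lborel)"
proof -
  have "(\<lambda>x. max 0 (min T (snd x))) \<in> M \<Otimes>\<^sub>M lborel \<rightarrow>\<^sub>M restrict_space borel {0..T}"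
    by (rule measurable_restrict_space2) (use T in auto)
  then have "(\<lambda>x. (fst x, max 0 (min T (snd x)))) \<in> M \<Otimes>\<^sub>M lborel \<rightarrow>\<^sub>M M \<Otimes>\<^sub>M restrict_space borel {0..T}" by measurable
  from measurable_compose[OF this Z]
  have [measurable]: "(\<lambda>x. Z (max 0 (min T (snd x))) (fst x)) \<in> borel_measurable (M \<Otimes>\<^sub>M lborel)" by simp
  have "(\<lambda>x. indicator {0..T} (snd x) *\<^sub>R Z (max 0 (min T (snd x))) (fst x)) \<in> borel_measurable (M \<Otimes>\<^sub>M lborel)" by measurable
  moreover have "(\<lambda>x. indicator {0..T} (snd x) *\<^sub>R Z (max 0 (min T (snd x))) (fst x)) = (\<lambda>x. indicator {0..T} (snd x) *\<^sub>R Z (snd x) (fst x))"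
    by (auto simp: fun_eq_iff indicator_def max_def min_def)
  ultimately show ?thesis by simp
qed

lemma measurable_field_compose:
  fixes f :: "'w \<Rightarrow> real \<Rightarrow> real \<Rightarrow> real ^ 'd \<Rightarrow> 'a::euclidean_space"
  assumes f: "jointly_measurable M T f" and T: "0 \<le> T"
    and Y: "(\<lambda>x. Y (snd x) (fst x)) \<in> borel_measurable (M \<Otimes>\<^sub>M lborel)"
    and Z: "(\<lambda>x. Z (snd x) (fst x)) \<in> borel_measurable (M \<Otimes>\<^sub>M lborel)"
  shows "(\<lambda>x. indicator {0..T} (snd x) *\<^sub>R f (fst x) (snd x) (Y (snd x) (fst x)) (Z (snd x) (fst x))) \<in> borel_measurable (M \<Otimes>\<^sub>M lborel)"
proof -
  note [measurable] = Y Z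
  have [measurable]: "(\<lambda>x. max 0 (min T (snd x))) \<in> M \<Otimes>\<^sub>M lborel \<rightarrow>\<^sub>M restrict_space borel {0..T}"
    by (rule measurable_restrict_space2) (use T in auto)
  have "(\<lambda>x. (fst x, max 0 (min T (snd x)), Y (snd x) (fst x), Z (snd x) (fst x)))
    \<in> M \<Otimes>\<^sub>M lborel \<rightarrow>\<^sub>M M \<Otimes>\<^sub>M restrict_space borel {0..T} \<Otimes>\<^sub>M borel \<Otimes>\<^sub>M borel"
    by (intro measurable_Pair) measurable
  from measurable_compose[OF this f[unfolded jointly_measurable_def]]
  have [measurable]: "(\<lambda>x. f (fst x) (max 0 (min T (snd x))) (Y (snd x) (fst x)) (Z (snd x) (fst x))) \<in> borel_measurable (M \<Otimes>\<^sub>M lborel)" by simp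
  have "(\<lambda>x. indicator {0..T} (snd x) *\<^sub>R f (fst x) (max 0 (min T (snd x))) (Y (snd x) (fst x)) (Z (snd x) (fst x))) \<in> borel_measurable (M \<Otimes>\<^sub>M lborel)" by measurable
  moreover have "(\<lambda>x. indicator {0..T} (snd x) *\<^sub>R f (fst x) (max 0 (min T (snd x))) (Y (snd x) (fst x)) (Z (snd x) (fst x)))
    = (\<lambda>x. indicator {0..T} (snd x) *\<^sub>R f (fst x) (snd x) (Y (snd x) (fst x)) (Z (snd x) (fst x)))"
    by (auto simp: fun_eq_iff indicator_def max_def min_def)
  ultimately show ?thesis by simp
qed

context BM_pair_space
begin

text \<open>The supremum over all of {0..T} need not be measurable. The supremum over the countable
  net is, it is no larger, and by continuity it bounds almost every path at all times.\<close>

lemma S2_space_sup: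
  assumes Y: "Y \<in> S2_space M T W B"
  obtains Ys :: "'w \<Rightarrow> real" where "Ys \<in> borel_measurable M" "integrable M (\<lambda>\<omega>. (Ys \<omega>)\<^sup>2)" "AE \<omega> in M. \<forall>t\<in>{0..T}. \<bar>Y t \<omega>\<bar> \<le> Ys \<omega>"
proof -
  have c: "AE \<omega> in M. continuous_on {0..T} (\<lambda>t. Y t \<omega>)" and fin: "(\<integral>\<^sup>+\<omega>. (SUP t\<in>{0..T}. ennreal ((norm (Y t \<omega>))\<^sup>2)) \<partial>M) < \<infinity>"
    and m: "\<And>t. t \<in> {0..T} \<Longrightarrow> Y t \<in> borel_measurable (Ft M T W B t)" using Y by (auto simp: S2_space_def)
  have T: "0 \<le> T" using T_pos by simp
  have mM: "Y t \<in> borel_measurable M" if "t \<in> {0..T}" for t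
    using measurable_from_subalg[OF subalgebra_Ft m[OF that]] that by auto
  define D where "D \<omega> = (SUP t\<in>time_net T. ennreal ((norm (Y t \<omega>))\<^sup>2))" for \<omega>
  have [measurable]: "D \<in> borel_measurable M"
    unfolding D_def[abs_def] by (rule borel_measurable_SUP[OF countable_time_net]) (use mM time_net_subset[OF T] in auto)
  have "(\<integral>\<^sup>+\<omega>. D \<omega> \<partial>M) \<le> (\<integral>\<^sup>+\<omega>. (SUP t\<in>{0..T}. ennreal ((norm (Y t \<omega>))\<^sup>2)) \<partial>M)"
    unfolding D_def by (intro nn_integral_mono SUP_subset_mono time_net_subset[OF T]) auto
  then have Dfin: "(\<integral>\<^sup>+\<omega>. D \<omega> \<partial>M) < \<infinity>" using fin by (rule le_less_trans)
  then have DAE: "AE \<omega> in M. D \<omega> \<noteq> \<infinity>" by (intro nn_integral_PInf_AE) auto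
  define Ys where "Ys \<omega> = sqrt (enn2real (D \<omega>))" for \<omega>
  have Ysm: "Ys \<in> borel_measurable M" unfolding Ys_def[abs_def] by measurable
  have "integrable M (\<lambda>\<omega>. (Ys \<omega>)\<^sup>2)"
  proof (subst nn_integral_square_finite_iff[OF Ysm])
    have "(\<integral>\<^sup>+\<omega>. ennreal ((Ys \<omega>)\<^sup>2) \<partial>M) \<le> (\<integral>\<^sup>+\<omega>. D \<omega> \<partial>M)"
    proof (rule nn_integral_mono)
      fix \<omega> show "ennreal ((Ys \<omega>)\<^sup>2) \<le> D \<omega>"
        unfolding Ys_def by (cases "D \<omega>") auto
    qed
    then show "(\<integral>\<^sup>+\<omega>. ennreal ((Ys \<omega>)\<^sup>2) \<partial>M) < \<infinity>" using Dfin by (rule le_less_trans)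
  qed
  moreover have "AE \<omega> in M. \<forall>t\<in>{0..T}. \<bar>Y t \<omega>\<bar> \<le> Ys \<omega>"
    using c DAE
  proof eventually_elim
    case (elim \<omega>)
    have "\<bar>Y q \<omega>\<bar> \<le> Ys \<omega>" if "q \<in> time_net T" for q
    proof -
      have "ennreal ((norm (Y q \<omega>))\<^sup>2) \<le> D \<omega>" unfolding D_def by (rule SUP_upper[OF that])
      also have "D \<omega> = ennreal (enn2real (D \<omega>))" using elim(2) by (simp add: less_top)
      finally have "(Y q \<omega>)\<^sup>2 \<le> enn2real (D \<omega>)" by (subst (asm) ennreal_le_iff) auto
      then show ?thesis unfolding Ys_def by (simp add: real_le_rsqrt)
    qed
    then show ?case
      using le_from_time_net[where f="\<lambda>t. \<bar>Y t \<omega>\<bar>", OF continuous_on_rabs[OF elim(1)]] by blast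
  qed
  ultimately show thesis by (rule that[OF Ysm])
qed

text \<open>The obstacles will be compared at random contact times, so the exceptional null set must
  not depend on t; continuity reduces all times to a countable net.\<close>

lemma AE_all_times_le:
  fixes S S' :: "real \<Rightarrow> 'w \<Rightarrow> real"
  assumes "AE \<omega> in M. continuous_on {0..T} (\<lambda>t. S t \<omega>)" "AE \<omega> in M. continuous_on {0..T} (\<lambda>t. S' t \<omega>)"
    and "\<forall>t\<in>{0..T}. AE \<omega> in M. S t \<omega> \<le> S' t \<omega>"
  shows "AE \<omega> in M. \<forall>t\<in>{0..T}. S t \<omega> \<le> S' t \<omega>"
proof -
  have "AE \<omega> in M. \<forall>t\<in>time_net T. S t \<omega> \<le> S' t \<omega>"
    using assms(3) time_net_subset[of T] T_pos by (intro AE_ball_countable' countable_time_net) auto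
  with assms(1,2) show ?thesis
  proof eventually_elim
    case (elim \<omega>)
    show ?case
    proof
      fix t assume t: "t \<in> {0..T}"
      have "S t \<omega> - S' t \<omega> \<le> 0"
        by (rule le_from_time_net[where f="\<lambda>t. S t \<omega> - S' t \<omega>" and T=T, OF continuous_on_diff[OF elim(1,2)] _ t]) (use elim(3) in auto)
      then show "S t \<omega> \<le> S' t \<omega>" by simp
    qed
  qed
qed

end

text \<open>If D were positive on all of {s..r}, the vanishing integral of the non-negative D would
  give {s<..r} measure 0, which means that K does not grow there.\<close>

lemma dpath_flat:
  fixes K :: "real \<Rightarrow> 'w \<Rightarrow> real" and D :: "real \<Rightarrow> real"
  assumes T: "0 \<le> T" and K: "continuous_on {0..T} (\<lambda>t. K t \<omega>)" "mono_on {0..T} (\<lambda>t. K t \<omega>)"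
    and D: "continuous_on {0..T} D" "\<And>t. t \<in> {0..T} \<Longrightarrow> 0 \<le> D t"
    and z: "(LINT t:{0..T}|dpath T K \<omega>. D t) = 0"
    and sr: "0 \<le> s" "s \<le> r" "r \<le> T" "K s \<omega> < K r \<omega>"
  shows "\<exists>u\<in>{s..r}. D u = 0"
proof (rule ccontr)
  assume "\<not> ?thesis"
  then have pos: "0 < D u" if "u \<in> {s..r}" for u using D(2)[of u] that sr by force
  define F where "F t = K (max 0 (min T t)) \<omega>" for t
  have Fm: "F x \<le> F y" if "x \<le> y" for x y
    unfolding F_def using T that by (intro mono_onD[OF K(2)]) auto
  have "continuous_on UNIV F"
    unfolding F_def by (rule continuous_on_compose2[OF K(1)]) (use T in \<open>auto intro!: continuous_intros\<close>)
  then have "isCont F x" for x by (simp add: continuous_on_eq_continuous_at)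
  then have Fc: "continuous (at_right x) F" for x by (rule continuous_at_imp_continuous_at_within)
  let ?\<mu> = "interval_measure F"
  have \<mu>: "dpath T K \<omega> = ?\<mu>" by (simp add: dpath_def F_def[abs_def])
  have em: "emeasure ?\<mu> {x<..y} = ennreal (F y - F x)" if "x \<le> y" for x y
    by (rule emeasure_interval_measure_Ioc[OF that Fm Fc])
  \<comment> \<open>The measure is known on half-open intervals, so {0..T} is enlarged to {-1<..T};
    the path is frozen before 0, so the enlargement adds no mass.\<close>
  have fin: "emeasure ?\<mu> {0..T} < \<infinity>"
  proof -
    have "emeasure ?\<mu> {0..T} \<le> emeasure ?\<mu> {-1<..T}" by (rule emeasure_mono) auto
    then show ?thesis using em[of "-1" T] T by (simp add: le_less_trans)
  qed
  have meas: "(\<lambda>t. indicator {0..T} t * D t) \<in> borel_measurable ?\<mu>"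
    using borel_measurable_continuous_on_indicator[OF _ D(1)] by simp
  have "\<exists>c. \<forall>t\<in>{0..T}. \<bar>D t\<bar> \<le> c"
    using compact_imp_bounded[OF compact_continuous_image[OF D(1)]] by (auto simp: bounded_iff)
  then obtain c where c: "\<And>t. t \<in> {0..T} \<Longrightarrow> \<bar>D t\<bar> \<le> c" by blast
  have int: "integrable ?\<mu> (\<lambda>t. indicator {0..T} t * D t)"
    by (rule integrableI_bounded_set[where A="{0..T}" and B=c]) (use meas fin c in \<open>auto simp: indicator_def\<close>)
  have "(\<integral>t. indicator {0..T} t * D t \<partial>?\<mu>) = 0"
    using z unfolding \<mu> set_lebesgue_integral_def by simp
  then have "AE t in ?\<mu>. indicator {0..T} t * D t = 0"
    by (subst (asm) integral_nonneg_eq_0_iff_AE[OF int]) (use D(2) in \<open>auto simp: indicator_def\<close>)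
  then have "AE t in ?\<mu>. t \<notin> {s<..r}"
  proof eventually_elim
    case (elim t)
    show ?case
    proof
      assume "t \<in> {s<..r}"
      then have "0 < D t" "t \<in> {0..T}" using pos[of t] sr by auto
      then show False using elim by simp
    qed
  qed
  then have "emeasure ?\<mu> {s<..r} = 0"
    by (subst (asm) AE_iff_measurable[where N="{s<..r}"]) auto
  moreover have "F r - F s = K r \<omega> - K s \<omega>" using sr by (simp add: F_def)
  ultimately show False using em[OF sr(2)] sr(4) by simp
qed

section \<open>The comparison theorem\<close>

text \<open>Over a degenerate interval every elementary integral is 0. This fixes the terminal value
  of a solution, for which the definition only provides some pair of integrals.\<close>

lemma L2_limit_of_elementary_trivial:
  assumes "L2_limit_of_elementary M adm X a a \<phi> I"
  shows "AE \<omega> in M. I \<omega> = 0"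
proof -
  obtain n p h where p: "\<And>k::nat. partition_of a a (n k) (p k)" and I: "I \<in> borel_measurable M"
    and C: "(\<lambda>k. \<integral>\<^sup>+\<omega>. ennreal ((elementary_integral X (n k) (p k) (h k) \<omega> - I \<omega>)\<^sup>2) \<partial>M) \<longlonglongrightarrow> 0"
    using assms unfolding L2_limit_of_elementary_def by blast
  have "elementary_integral X (n k) (p k) (h k) \<omega> = 0" for k \<omega>
    unfolding elementary_integral_def
  proof (rule sum.neutral, intro ballI)
    fix i assume "i \<in> {..<n k}"
    then have "p k i = a" "p k (Suc i) = a"
      using partition_of_range[OF p, of i k] partition_of_range[OF p, of "Suc i" k] by auto
    then show "h k i \<omega> \<bullet> (X (p k (Suc i)) \<omega> - X (p k i) \<omega>) = 0" by simp
  qed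
  with C have "(\<lambda>k::nat. \<integral>\<^sup>+\<omega>. ennreal ((I \<omega>)\<^sup>2) \<partial>M) \<longlonglongrightarrow> 0" by simp
  then have "(\<integral>\<^sup>+\<omega>. ennreal ((I \<omega>)\<^sup>2) \<partial>M) = 0" using LIMSEQ_unique tendsto_const by blast
  then show ?thesis using I by (subst (asm) nn_integral_0_iff_AE) auto
qed

section \<open>From solutions to the abstract difference\<close>

context BM_pair_space
begin

sublocale fw: simple_integration M T "3 * (real CARD('d))\<^sup>2" "\<lambda>s t. Gt M T W B s" W
  by (rule simple_integration_W)

sublocale bw: simple_integration M T "3 * (real CARD('l))\<^sup>2" "\<lambda>s t. Ht M T W B t" B
  by (rule simple_integration_B)

lemma integrable_pair_indicator:
  fixes h :: "'w \<Rightarrow> real"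
  assumes h: "integrable M h"
  shows "integrable (M \<Otimes>\<^sub>M lborel) (\<lambda>x. indicator {0<..T} (snd x) * h (fst x))"
proof -
  interpret pair_sigma_finite M lborel by (rule pair_sigma_finite_lborel)
  have [measurable]: "h \<in> borel_measurable M" using h by simp
  show ?thesis
  proof (rule Fubini_integrable)
    have "(\<lambda>x. \<integral>y. norm (indicator {0<..T} (snd (x, y)) * h (fst (x, y))) \<partial>lborel) = (\<lambda>x. T * \<bar>h x\<bar>)"
      using T_pos by (auto simp: abs_mult fun_eq_iff)
    then show "integrable M (\<lambda>x. \<integral>y. norm (indicator {0<..T} (snd (x, y)) * h (fst (x, y))) \<partial>lborel)"
      using h by simp
    show "AE x in M. integrable lborel (\<lambda>y. indicator {0<..T} (snd (x, y)) * h (fst (x, y)))" using T_pos by simp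
  qed measurable
qed

text \<open>Paths in a null set containing the discontinuous ones are replaced by 0. Since every
  \<open>Ft\<close> contains the null sets, the change preserves adaptedness, and continuity of all
  paths then yields joint measurability.\<close>

lemma S2_space_version:
  fixes Y :: "real \<Rightarrow> 'w \<Rightarrow> real"
  assumes Y: "Y \<in> S2_space M T W B"
  obtains Yh where "\<And>t. t \<in> {0..T} \<Longrightarrow> Yh t \<in> borel_measurable (Ft M T W B t)"
    "\<And>\<omega>. \<omega> \<in> space M \<Longrightarrow> continuous_on {0..T} (\<lambda>t. Yh t \<omega>)"
    "AE \<omega> in M. \<forall>t\<in>{0..T}. Yh t \<omega> = Y t \<omega>"
    "(\<lambda>x. Yh (snd x) (fst x)) \<in> borel_measurable (M \<Otimes>\<^sub>M lborel)"
proof -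
  have c: "AE \<omega> in M. continuous_on {0..T} (\<lambda>t. Y t \<omega>)" and m: "\<And>t. t \<in> {0..T} \<Longrightarrow> Y t \<in> borel_measurable (Ft M T W B t)"
    using Y by (auto simp: S2_space_def)
  obtain N where N: "{\<omega> \<in> space M. \<not> continuous_on {0..T} (\<lambda>t. Y t \<omega>)} \<subseteq> N" "N \<in> null_sets M"
    using AE_E[OF c] by (auto simp: null_sets_def)
  define Yh where "Yh t \<omega> = (if t \<in> {0..T} then if \<omega> \<in> N then 0 else Y t \<omega> else 0)" for t \<omega>
  have 1: "Yh t \<in> borel_measurable (Ft M T W B t)" if t: "t \<in> {0..T}" for t
  proof -
    have "N \<in> sets (Ft M T W B t)" using N(2) null_sets_Ft by auto
    then have "N \<inter> space (Ft M T W B t) \<in> sets (Ft M T W B t)" by auto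
    then have "(\<lambda>\<omega>. if \<omega> \<in> N then 0 else Y t \<omega>) \<in> borel_measurable (Ft M T W B t)"
      by (intro measurable_If_set m[OF t]) auto
    then show ?thesis using t by (simp add: Yh_def[abs_def])
  qed
  have 2: "continuous_on {0..T} (\<lambda>t. Yh t \<omega>)" if "\<omega> \<in> space M" for \<omega>
  proof (cases "\<omega> \<in> N")
    case False
    then have "continuous_on {0..T} (\<lambda>t. Y t \<omega>)" using N(1) that by auto
    then show ?thesis by (rule continuous_on_eq) (simp add: Yh_def False)
  next
    case True
    show ?thesis by (rule continuous_on_eq[OF continuous_on_const[of _ 0]]) (simp add: Yh_def True)
  qed
  have 3: "AE \<omega> in M. \<forall>t\<in>{0..T}. Yh t \<omega> = Y t \<omega>"
    using AE_not_in[OF N(2)] by eventually_elim (auto simp: Yh_def)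
  have "(\<lambda>x. indicator {0..T} (snd x) * Yh (snd x) (fst x)) \<in> borel_measurable (M \<Otimes>\<^sub>M lborel)"
  proof (rule measurable_continuous_process[OF _ 2])
    show "Yh t \<in> borel_measurable M" if "t \<in> {0..T}" for t
      using measurable_from_subalg[OF subalgebra_Ft 1[OF that]] that by simp
  qed (use T_pos in auto)
  moreover have "(\<lambda>x. indicator {0..T} (snd x) * Yh (snd x) (fst x)) = (\<lambda>x. Yh (snd x) (fst x))"
    by (auto simp: fun_eq_iff Yh_def)
  ultimately show thesis using that[OF 1 2 3] by simp
qed

lemma M2_space_version:
  fixes Z :: "real \<Rightarrow> 'w \<Rightarrow> 'b::euclidean_space"
  assumes Z: "Z \<in> M2_space M T W B"
  shows "(\<lambda>x. indicator {0..T} (snd x) *\<^sub>R Z (snd x) (fst x)) \<in> borel_measurable (M \<Otimes>\<^sub>M lborel)"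
    and "integrable (M \<Otimes>\<^sub>M lborel) (\<lambda>x. indicator {0<..T} (snd x) * (norm (indicator {0..T} (snd x) *\<^sub>R Z (snd x) (fst x)))\<^sup>2)"
proof -
  have m: "(\<lambda>(\<omega>, t). Z t \<omega>) \<in> borel_measurable (M \<Otimes>\<^sub>M restrict_space borel {0..T})"
    and fin: "(\<integral>\<^sup>+\<omega>. (\<integral>\<^sup>+t\<in>{0..T}. ennreal ((norm (Z t \<omega>))\<^sup>2) \<partial>lborel) \<partial>M) < \<infinity>"
    using Z by (auto simp: M2_space_def)
  show M[measurable]: "(\<lambda>x. indicator {0..T} (snd x) *\<^sub>R Z (snd x) (fst x)) \<in> borel_measurable (M \<Otimes>\<^sub>M lborel)"
    by (rule measurable_process_extend[OF m]) (use T_pos in simp)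
  let ?F = "\<lambda>x. indicator {0<..T} (snd x) * (norm (indicator {0..T} (snd x) *\<^sub>R Z (snd x) (fst x)))\<^sup>2"
  show "integrable (M \<Otimes>\<^sub>M lborel) ?F"
  proof (rule integrableI_bounded)
    have "(\<integral>\<^sup>+x. ennreal (norm (?F x)) \<partial>(M \<Otimes>\<^sub>M lborel)) = (\<integral>\<^sup>+\<omega>. (\<integral>\<^sup>+t. ennreal (norm (?F (\<omega>, t))) \<partial>lborel) \<partial>M)"
      by (rule lborel.nn_integral_fst[symmetric]) measurable
    also have "\<dots> \<le> (\<integral>\<^sup>+\<omega>. (\<integral>\<^sup>+t\<in>{0..T}. ennreal ((norm (Z t \<omega>))\<^sup>2) \<partial>lborel) \<partial>M)"
      by (intro nn_integral_mono) (auto simp: indicator_def)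
    finally show "(\<integral>\<^sup>+x. ennreal (norm (?F x)) \<partial>(M \<Otimes>\<^sub>M lborel)) < \<infinity>" using fin by (rule le_less_trans)
  qed measurable
qed

text \<open>Translates a solution into the vocabulary of \<open>rbdsde_difference\<close>: versions
  measurable on the product space, an L^2 majorant of the path, and the equation on every
  subinterval, obtained by subtracting it at two times. The vanishing of g at (0, 0) and its
  Lipschitz bound put its composition with the solution into L^2.\<close>

lemma solution_data:
  fixes f :: "'w \<Rightarrow> real \<Rightarrow> real \<Rightarrow> real ^ 'd \<Rightarrow> real" and g :: "'w \<Rightarrow> real \<Rightarrow> real \<Rightarrow> real ^ 'd \<Rightarrow> real ^ 'l"
  assumes jg: "jointly_measurable M T g" and g0: "AE \<omega> in M. \<forall>t\<in>{0..T}. g \<omega> t 0 0 = 0"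
    and gL: "AE \<omega> in M. \<forall>t\<in>{0..T}. \<forall>y1 y2 z1 z2.
           (norm (g \<omega> t y1 z1 - g \<omega> t y2 z2))\<^sup>2 \<le> C * \<bar>y1 - y2\<bar>\<^sup>2 + \<alpha> * (norm (z1 - z2))\<^sup>2"
    and C: "0 \<le> C" "0 \<le> \<alpha>" and sol: "rbdsde_solution M T W B f g \<xi> S Y Z K"
    and Zh_def: "\<And>t \<omega>. Zh t \<omega> = indicator {0..T} t *\<^sub>R Z t \<omega>"
  obtains Yh Ys I J where
    "\<And>t. t \<in> {0..T} \<Longrightarrow> Yh t \<in> borel_measurable (Ft M T W B t)"
    "\<And>\<omega>. \<omega> \<in> space M \<Longrightarrow> continuous_on {0..T} (\<lambda>t. Yh t \<omega>)"
    "AE \<omega> in M. \<forall>t\<in>{0..T}. Yh t \<omega> = Y t \<omega>"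
    "(\<lambda>x. Yh (snd x) (fst x)) \<in> borel_measurable (M \<Otimes>\<^sub>M lborel)"
    "Ys \<in> borel_measurable M" "integrable M (\<lambda>\<omega>. (Ys \<omega>)\<^sup>2)" "AE \<omega> in M. \<forall>t\<in>{0..T}. \<bar>Yh t \<omega>\<bar> \<le> Ys \<omega>"
    "fw.ito_increments Zh (\<lambda>s r \<omega>. J s \<omega> - J r \<omega>)"
    "bw.ito_increments (\<lambda>u \<omega>. indicator {0..T} u *\<^sub>R g \<omega> u (Yh u \<omega>) (Zh u \<omega>)) (\<lambda>s r \<omega>. I s \<omega> - I r \<omega>)"
    "AE \<omega> in M. ivl_integrable (\<lambda>u. f \<omega> u (Yh u \<omega>) (Zh u \<omega>)) 0 T"
    "\<And>s r. 0 \<le> s \<Longrightarrow> s \<le> r \<Longrightarrow> r \<le> T \<Longrightarrow> AE \<omega> in M. Yh s \<omega> - Yh r \<omega> =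
       ivl_integral (\<lambda>u. f \<omega> u (Yh u \<omega>) (Zh u \<omega>)) s r + (I s \<omega> - I r \<omega>) + (K r \<omega> - K s \<omega>) - (J s \<omega> - J r \<omega>)"
    "AE \<omega> in M. Yh T \<omega> = \<xi> \<omega>"
proof -
  have Y: "Y \<in> S2_space M T W B" and Z: "Z \<in> M2_space M T W B"
    and fint: "AE \<omega> in M. set_integrable lborel {0..T} (\<lambda>s. f \<omega> s (Y s \<omega>) (Z s \<omega>))"
    and ex: "\<forall>t\<in>{0..T}. \<exists>I J.
        has_backward_ito_integral M (Ht M T W B) B t T (\<lambda>s \<omega>. g \<omega> s (Y s \<omega>) (Z s \<omega>)) I \<and>
        has_forward_ito_integral M (Gt M T W B) W t T Z J \<and>
        (AE \<omega> in M. Y t \<omega> = \<xi> \<omega> + (LINT s:{t..T}|lborel. f \<omega> s (Y s \<omega>) (Z s \<omega>)) + I \<omega> + K T \<omega> - K t \<omega> - J \<omega>)"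
    using sol by (simp_all add: rbdsde_solution_def)
  obtain Yh where Yh: "\<And>t. t \<in> {0..T} \<Longrightarrow> Yh t \<in> borel_measurable (Ft M T W B t)"
    "\<And>\<omega>. \<omega> \<in> space M \<Longrightarrow> continuous_on {0..T} (\<lambda>t. Yh t \<omega>)"
    and YhY: "AE \<omega> in M. \<forall>t\<in>{0..T}. Yh t \<omega> = Y t \<omega>"
    and Yhm[measurable]: "(\<lambda>x. Yh (snd x) (fst x)) \<in> borel_measurable (M \<Otimes>\<^sub>M lborel)"
    by (rule S2_space_version[OF Y]) blast
  obtain Ys where Ys: "Ys \<in> borel_measurable M" "integrable M (\<lambda>\<omega>. (Ys \<omega>)\<^sup>2)" and Ysb: "AE \<omega> in M. \<forall>t\<in>{0..T}. \<bar>Y t \<omega>\<bar> \<le> Ys \<omega>"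
    by (rule S2_space_sup[OF Y]) blast
  have Ysh: "AE \<omega> in M. \<forall>t\<in>{0..T}. \<bar>Yh t \<omega>\<bar> \<le> Ys \<omega>" using YhY Ysb by eventually_elim auto
  have Zhm[measurable]: "(\<lambda>x. Zh (snd x) (fst x)) \<in> borel_measurable (M \<Otimes>\<^sub>M lborel)"
    and Zhi: "integrable (M \<Otimes>\<^sub>M lborel) (\<lambda>x. indicator {0<..T} (snd x) * (norm (Zh (snd x) (fst x)))\<^sup>2)"
    using M2_space_version[OF Z] by (simp_all add: Zh_def)
  have ZhZ: "Zh t \<omega> = Z t \<omega>" if "t \<in> {0..T}" for t \<omega> using that by (simp add: Zh_def)
  define Gh where "Gh u \<omega> = indicator {0..T} u *\<^sub>R g \<omega> u (Yh u \<omega>) (Zh u \<omega>)" for u \<omega>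
  have Ghm[measurable]: "(\<lambda>x. Gh (snd x) (fst x)) \<in> borel_measurable (M \<Otimes>\<^sub>M lborel)"
    unfolding Gh_def by (rule measurable_field_compose[OF jg _ Yhm Zhm]) (use T_pos in simp)
  have Ghi: "integrable (M \<Otimes>\<^sub>M lborel) (\<lambda>x. indicator {0<..T} (snd x) * (norm (Gh (snd x) (fst x)))\<^sup>2)"
  proof (rule Bochner_Integration.integrable_bound)
    show "integrable (M \<Otimes>\<^sub>M lborel) (\<lambda>x. C * (indicator {0<..T} (snd x) * (Ys (fst x))\<^sup>2) + \<alpha> * (indicator {0<..T} (snd x) * (norm (Zh (snd x) (fst x)))\<^sup>2))"
      using integrable_pair_indicator[OF Ys(2)] Zhi by auto
    have "AE \<omega> in M. \<forall>u\<in>{0<..T}. (norm (Gh u \<omega>))\<^sup>2 \<le> C * (Ys \<omega>)\<^sup>2 + \<alpha> * (norm (Zh u \<omega>))\<^sup>2"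
      using g0 gL Ysh
    proof eventually_elim
      case (elim \<omega>)
      show ?case
      proof
        fix u assume u: "u \<in> {0<..T}"
        then have u': "u \<in> {0..T}" by auto
        have "(norm (g \<omega> u (Yh u \<omega>) (Zh u \<omega>) - g \<omega> u 0 0))\<^sup>2 \<le> C * \<bar>Yh u \<omega> - 0\<bar>\<^sup>2 + \<alpha> * (norm (Zh u \<omega> - 0))\<^sup>2"
          using elim(2) u' by blast
        then have "(norm (Gh u \<omega>))\<^sup>2 \<le> C * \<bar>Yh u \<omega>\<bar>\<^sup>2 + \<alpha> * (norm (Zh u \<omega>))\<^sup>2"
          using elim(1) u' by (simp add: Gh_def)
        moreover have "\<bar>Yh u \<omega>\<bar>\<^sup>2 \<le> (Ys \<omega>)\<^sup>2" using elim(3) u' by (intro power_mono) auto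
        ultimately show "(norm (Gh u \<omega>))\<^sup>2 \<le> C * (Ys \<omega>)\<^sup>2 + \<alpha> * (norm (Zh u \<omega>))\<^sup>2"
          using mult_left_mono[OF _ C(1)] by fastforce
      qed
    qed
    from lborel.AE_pair_fst[OF this]
    show "AE x in M \<Otimes>\<^sub>M lborel. norm (indicator {0<..T} (snd x) * (norm (Gh (snd x) (fst x)))\<^sup>2)
       \<le> norm (C * (indicator {0<..T} (snd x) * (Ys (fst x))\<^sup>2) + \<alpha> * (indicator {0<..T} (snd x) * (norm (Zh (snd x) (fst x)))\<^sup>2))"
      by eventually_elim (use C in \<open>auto simp: indicator_def\<close>)
  qed measurable
  obtain I J where IJ: "\<And>t. t \<in> {0..T} \<Longrightarrow> has_backward_ito_integral M (Ht M T W B) B t T (\<lambda>s \<omega>. g \<omega> s (Y s \<omega>) (Z s \<omega>)) (I t)"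
     "\<And>t. t \<in> {0..T} \<Longrightarrow> has_forward_ito_integral M (Gt M T W B) W t T Z (J t)"
     "\<And>t. t \<in> {0..T} \<Longrightarrow> AE \<omega> in M. Y t \<omega> = \<xi> \<omega> + (LINT s:{t..T}|lborel. f \<omega> s (Y s \<omega>) (Z s \<omega>)) + I t \<omega> + K T \<omega> - K t \<omega> - J t \<omega>"
  proof -
    \<comment> \<open>The integrals exist for each t separately; a choice fixes one family, from
      which the increments are formed.\<close>
    from bchoice[OF ex] obtain I where I: "\<forall>t\<in>{0..T}. \<exists>J.
        has_backward_ito_integral M (Ht M T W B) B t T (\<lambda>s \<omega>. g \<omega> s (Y s \<omega>) (Z s \<omega>)) (I t) \<and>
        has_forward_ito_integral M (Gt M T W B) W t T Z J \<and>
        (AE \<omega> in M. Y t \<omega> = \<xi> \<omega> + (LINT s:{t..T}|lborel. f \<omega> s (Y s \<omega>) (Z s \<omega>)) + I t \<omega> + K T \<omega> - K t \<omega> - J \<omega>)"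
      by (elim exE)
    from bchoice[OF I] obtain J where J: "\<forall>t\<in>{0..T}.
        has_backward_ito_integral M (Ht M T W B) B t T (\<lambda>s \<omega>. g \<omega> s (Y s \<omega>) (Z s \<omega>)) (I t) \<and>
        has_forward_ito_integral M (Gt M T W B) W t T Z (J t) \<and>
        (AE \<omega> in M. Y t \<omega> = \<xi> \<omega> + (LINT s:{t..T}|lborel. f \<omega> s (Y s \<omega>) (Z s \<omega>)) + I t \<omega> + K T \<omega> - K t \<omega> - J t \<omega>)"
      by (elim exE)
    show thesis
      by (rule that[of I J]; drule bspec[OF J]; elim conjE; assumption)
  qed
  have incJ: "fw.ito_increments Zh (\<lambda>s r \<omega>. J s \<omega> - J r \<omega>)"
    by (rule fw.ito_incrementsI[OF IJ(2)[unfolded has_forward_ito_integral_def] _ Zhm Zhi]) (use ZhZ in auto)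
  have incI: "bw.ito_increments Gh (\<lambda>s r \<omega>. I s \<omega> - I r \<omega>)"
  proof (rule bw.ito_incrementsI[OF IJ(1)[unfolded has_backward_ito_integral_def] _ Ghm Ghi])
    show "AE \<omega> in M. \<forall>u\<in>{0..T}. g \<omega> u (Y u \<omega>) (Z u \<omega>) = Gh u \<omega>"
      using YhY by eventually_elim (simp add: Gh_def ZhZ)
  qed auto
  have fi: "AE \<omega> in M. ivl_integrable (\<lambda>u. f \<omega> u (Yh u \<omega>) (Zh u \<omega>)) 0 T"
    using fint YhY
  proof eventually_elim
    case (elim \<omega>)
    have "integrable lborel (\<lambda>u. indicator {0..T} u * f \<omega> u (Y u \<omega>) (Z u \<omega>) * indicator {0<..T} u)"
      using elim(1) by (intro integrable_real_mult_indicator) (auto simp: set_integrable_def)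
    moreover have "(\<lambda>u. indicator {0..T} u * f \<omega> u (Y u \<omega>) (Z u \<omega>) * indicator {0<..T} u)
      = (\<lambda>u. indicator {0<..T} u * f \<omega> u (Yh u \<omega>) (Zh u \<omega>))"
      using elim(2) ZhZ by (auto simp: fun_eq_iff indicator_def)
    ultimately show ?case by simp
  qed
  have lint: "AE \<omega> in M. \<forall>t\<in>{0..T}. (LINT s:{t..T}|lborel. f \<omega> s (Y s \<omega>) (Z s \<omega>)) = ivl_integral (\<lambda>u. f \<omega> u (Yh u \<omega>) (Zh u \<omega>)) t T"
    using YhY
  proof eventually_elim
    case (elim \<omega>)
    show ?case
    proof
      fix t assume t: "t \<in> {0..T}"
      have "(LINT s:{t..T}|lborel. f \<omega> s (Y s \<omega>) (Z s \<omega>)) = (LINT s:{t..T}|lborel. f \<omega> s (Yh s \<omega>) (Zh s \<omega>))"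
        unfolding set_lebesgue_integral_def
        by (rule Bochner_Integration.integral_cong) (use elim ZhZ t in \<open>auto simp: indicator_def\<close>)
      then show "(LINT s:{t..T}|lborel. f \<omega> s (Y s \<omega>) (Z s \<omega>)) = ivl_integral (\<lambda>u. f \<omega> u (Yh u \<omega>) (Zh u \<omega>)) t T"
        by (simp add: ivl_integral_set)
    qed
  qed
  have eq: "AE \<omega> in M. Yh t \<omega> = \<xi> \<omega> + ivl_integral (\<lambda>u. f \<omega> u (Yh u \<omega>) (Zh u \<omega>)) t T + I t \<omega> + K T \<omega> - K t \<omega> - J t \<omega>"
    if "t \<in> {0..T}" for t
    using IJ(3)[OF that] lint YhY by eventually_elim (use that in auto)
  have eqd: "AE \<omega> in M. Yh s \<omega> - Yh r \<omega> =
       ivl_integral (\<lambda>u. f \<omega> u (Yh u \<omega>) (Zh u \<omega>)) s r + (I s \<omega> - I r \<omega>) + (K r \<omega> - K s \<omega>) - (J s \<omega> - J r \<omega>)"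
    if sr: "0 \<le> s" "s \<le> r" "r \<le> T" for s r
  proof -
    have "s \<in> {0..T}" "r \<in> {0..T}" using sr by auto
    from eq[OF this(1)] eq[OF this(2)] fi show ?thesis
    proof eventually_elim
      case (elim \<omega>)
      have "ivl_integral (\<lambda>u. f \<omega> u (Yh u \<omega>) (Zh u \<omega>)) s T = ivl_integral (\<lambda>u. f \<omega> u (Yh u \<omega>) (Zh u \<omega>)) s r + ivl_integral (\<lambda>u. f \<omega> u (Yh u \<omega>) (Zh u \<omega>)) r T"
        by (rule ivl_integral_split[OF ivl_integrable_subset[OF elim(3)]]) (use sr in auto)
      then show ?case using elim(1,2) by simp
    qed
  qed
  have TT: "T \<in> {0..T}" using T_pos by simp
  have "AE \<omega> in M. I T \<omega> = 0" "AE \<omega> in M. J T \<omega> = 0"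
    using L2_limit_of_elementary_trivial[OF IJ(1)[OF TT, unfolded has_backward_ito_integral_def]]
      L2_limit_of_elementary_trivial[OF IJ(2)[OF TT, unfolded has_forward_ito_integral_def]] by auto
  with eq[OF TT] have terminal: "AE \<omega> in M. Yh T \<omega> = \<xi> \<omega>"
    by eventually_elim (simp add: ivl_integral_def)
  show thesis by (rule that[OF Yh YhY Yhm Ys Ysh incJ incI[unfolded Gh_def] fi eqd terminal])
qed

text \<open>The hypothesis quantifies over times first and outcomes second, while the pathwise
  estimates need the opposite order. Fubini exchanges the two for jointly measurable functions,
  which is why versions of Y and Z take the place of the originals.\<close>

lemma AE_time_outcome_swap:
  fixes f1 f2 :: "'w \<Rightarrow> real \<Rightarrow> real \<Rightarrow> real ^ 'd \<Rightarrow> real"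
  assumes jf: "jointly_measurable M T f1" "jointly_measurable M T f2"
    and Y: "Y \<in> S2_space M T W B" and Z: "Z \<in> M2_space M T W B"
    and le: "AE t in lborel. t \<in> {0..T} \<longrightarrow> (AE \<omega> in M. f1 \<omega> t (Y t \<omega>) (Z t \<omega>) \<le> f2 \<omega> t (Y t \<omega>) (Z t \<omega>))"
  shows "AE \<omega> in M. AE t in lborel. t \<in> {0..T} \<longrightarrow> f1 \<omega> t (Y t \<omega>) (Z t \<omega>) \<le> f2 \<omega> t (Y t \<omega>) (Z t \<omega>)"
proof -
  interpret pair_sigma_finite M lborel by (rule pair_sigma_finite_lborel)
  obtain Yh where YhY: "AE \<omega> in M. \<forall>t\<in>{0..T}. Yh t \<omega> = Y t \<omega>"
    and Yhm: "(\<lambda>x. Yh (snd x) (fst x)) \<in> borel_measurable (M \<Otimes>\<^sub>M lborel)"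
    by (rule S2_space_version[OF Y]) blast
  define Zh where "Zh t \<omega> = indicator {0..T} t *\<^sub>R Z t \<omega>" for t \<omega>
  have Zhm: "(\<lambda>x. Zh (snd x) (fst x)) \<in> borel_measurable (M \<Otimes>\<^sub>M lborel)" using M2_space_version[OF Z] by (simp add: Zh_def)
  let ?F = "\<lambda>f x. indicator {0..T} (snd x) *\<^sub>R f (fst x) (snd x) (Yh (snd x) (fst x)) (Zh (snd x) (fst x)) :: real"
  have [measurable]: "?F f1 \<in> borel_measurable (M \<Otimes>\<^sub>M lborel)" "?F f2 \<in> borel_measurable (M \<Otimes>\<^sub>M lborel)"
    by (rule measurable_field_compose[OF jf(1) less_imp_le[OF T_pos] Yhm Zhm],
        rule measurable_field_compose[OF jf(2) less_imp_le[OF T_pos] Yhm Zhm])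
  have "{x \<in> space (M \<Otimes>\<^sub>M lborel). ?F f1 x \<le> ?F f2 x} \<in> sets (M \<Otimes>\<^sub>M lborel)" by measurable
  then have "{x \<in> space (M \<Otimes>\<^sub>M lborel). ?F f1 (fst x, snd x) \<le> ?F f2 (fst x, snd x)} \<in> sets (M \<Otimes>\<^sub>M lborel)" by simp
  from AE_commute[OF this]
  have sw: "(AE \<omega> in M. AE t in lborel. ?F f1 (\<omega>, t) \<le> ?F f2 (\<omega>, t)) \<longleftrightarrow> (AE t in lborel. AE \<omega> in M. ?F f1 (\<omega>, t) \<le> ?F f2 (\<omega>, t))" .
  have "AE t in lborel. AE \<omega> in M. ?F f1 (\<omega>, t) \<le> ?F f2 (\<omega>, t)"
    using le
  proof eventually_elim
    case (elim t)
    show ?case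
    proof (cases "t \<in> {0..T}")
      case True
      with elim have "AE \<omega> in M. f1 \<omega> t (Y t \<omega>) (Z t \<omega>) \<le> f2 \<omega> t (Y t \<omega>) (Z t \<omega>)" by simp
      with YhY show ?thesis by eventually_elim (use True in \<open>simp add: Zh_def\<close>)
    qed simp
  qed
  with sw have "AE \<omega> in M. AE t in lborel. ?F f1 (\<omega>, t) \<le> ?F f2 (\<omega>, t)" by simp
  with YhY show ?thesis
  proof eventually_elim
    case (elim \<omega>)
    from elim(2) show ?case by eventually_elim (use elim(1) in \<open>auto simp: Zh_def\<close>)
  qed
qed

text \<open>Both alternatives of hypothesis (iii) are instances of this comparison: the Lipschitz generator
  \<open>e\<close> is \<open>f1\<close> in the first and \<open>f2\<close> in the second. Writing the difference of the drifts as
  \<open>e(Y1,Z1) - e(Y2,Z2)\<close> minus a non-negative remainder, the remainder is absorbed together with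
  \<open>K2\<close> in one increasing process.\<close>

lemma comparison:
  fixes f1 f2 e :: "'w \<Rightarrow> real \<Rightarrow> real \<Rightarrow> real ^ 'd \<Rightarrow> real" and g :: "'w \<Rightarrow> real \<Rightarrow> real \<Rightarrow> real ^ 'd \<Rightarrow> real ^ 'l"
  assumes jf: "jointly_measurable M T f1" "jointly_measurable M T f2" "jointly_measurable M T e" "jointly_measurable M T g"
    and S: "S1 \<in> S2_space M T W B" "S2 \<in> S2_space M T W B" "\<forall>t\<in>{0..T}. AE \<omega> in M. S1 t \<omega> \<le> S2 t \<omega>"
    and g0: "AE \<omega> in M. \<forall>t\<in>{0..T}. g \<omega> t 0 0 = 0"
    and C: "0 < C" "0 < \<alpha>" "\<alpha> < 1"
    and gL: "AE \<omega> in M. \<forall>t\<in>{0..T}. \<forall>y1 y2 z1 z2.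
           (norm (g \<omega> t y1 z1 - g \<omega> t y2 z2))\<^sup>2 \<le> C * \<bar>y1 - y2\<bar>\<^sup>2 + \<alpha> * (norm (z1 - z2))\<^sup>2"
    and sol: "rbdsde_solution M T W B f1 g \<xi>1 S1 Y1 Z1 K1" "rbdsde_solution M T W B f2 g \<xi>2 S2 Y2 Z2 K2"
    and \<xi>: "AE \<omega> in M. \<xi>1 \<omega> \<le> \<xi>2 \<omega>"
    and Ce: "0 < Ce" and eL: "AE \<omega> in M. \<forall>t\<in>{0..T}. \<forall>y1 y2 z1 z2.
        \<bar>e \<omega> t y1 z1 - e \<omega> t y2 z2\<bar> \<le> Ce * (\<bar>y1 - y2\<bar> + norm (z1 - z2))"
    and drift: "AE \<omega> in M. AE t in lborel. t \<in> {0..T} \<longrightarrow>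
        f1 \<omega> t (Y1 t \<omega>) (Z1 t \<omega>) - f2 \<omega> t (Y2 t \<omega>) (Z2 t \<omega>) \<le> e \<omega> t (Y1 t \<omega>) (Z1 t \<omega>) - e \<omega> t (Y2 t \<omega>) (Z2 t \<omega>)"
  shows "\<forall>t\<in>{0..T}. AE \<omega> in M. Y1 t \<omega> \<le> Y2 t \<omega>"
proof -
  have T0: "0 \<le> T" using T_pos by simp
  have C0: "0 \<le> C" "0 \<le> \<alpha>" using C by auto
  define Zh1 where "Zh1 t \<omega> = indicator {0..T} t *\<^sub>R Z1 t \<omega>" for t \<omega>
  define Zh2 where "Zh2 t \<omega> = indicator {0..T} t *\<^sub>R Z2 t \<omega>" for t \<omega>
  obtain Yh1 Ys1 I1 J1 where Y1: "\<And>t. t \<in> {0..T} \<Longrightarrow> Yh1 t \<in> borel_measurable (Ft M T W B t)"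
    "\<And>\<omega>. \<omega> \<in> space M \<Longrightarrow> continuous_on {0..T} (\<lambda>t. Yh1 t \<omega>)"
    "AE \<omega> in M. \<forall>t\<in>{0..T}. Yh1 t \<omega> = Y1 t \<omega>"
    "(\<lambda>x. Yh1 (snd x) (fst x)) \<in> borel_measurable (M \<Otimes>\<^sub>M lborel)"
    and Ys1: "Ys1 \<in> borel_measurable M" "integrable M (\<lambda>\<omega>. (Ys1 \<omega>)\<^sup>2)" "AE \<omega> in M. \<forall>t\<in>{0..T}. \<bar>Yh1 t \<omega>\<bar> \<le> Ys1 \<omega>"
    and inc1: "fw.ito_increments Zh1 (\<lambda>s r \<omega>. J1 s \<omega> - J1 r \<omega>)"
    "bw.ito_increments (\<lambda>u \<omega>. indicator {0..T} u *\<^sub>R g \<omega> u (Yh1 u \<omega>) (Zh1 u \<omega>)) (\<lambda>s r \<omega>. I1 s \<omega> - I1 r \<omega>)"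
    and fi1: "AE \<omega> in M. ivl_integrable (\<lambda>u. f1 \<omega> u (Yh1 u \<omega>) (Zh1 u \<omega>)) 0 T"
    and eq1: "\<And>s r. 0 \<le> s \<Longrightarrow> s \<le> r \<Longrightarrow> r \<le> T \<Longrightarrow> AE \<omega> in M. Yh1 s \<omega> - Yh1 r \<omega> =
       ivl_integral (\<lambda>u. f1 \<omega> u (Yh1 u \<omega>) (Zh1 u \<omega>)) s r + (I1 s \<omega> - I1 r \<omega>) + (K1 r \<omega> - K1 s \<omega>) - (J1 s \<omega> - J1 r \<omega>)"
    and end1: "AE \<omega> in M. Yh1 T \<omega> = \<xi>1 \<omega>"
  proof (rule solution_data[OF jf(4) g0 gL C0 sol(1) Zh1_def], goal_cases)
    case (1 Yh Ys I J)
    show ?case by (rule that[of Yh Ys J I]) (fact 1)+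
  qed
  obtain Yh2 Ys2 I2 J2 where Y2: "\<And>t. t \<in> {0..T} \<Longrightarrow> Yh2 t \<in> borel_measurable (Ft M T W B t)"
    "\<And>\<omega>. \<omega> \<in> space M \<Longrightarrow> continuous_on {0..T} (\<lambda>t. Yh2 t \<omega>)"
    "AE \<omega> in M. \<forall>t\<in>{0..T}. Yh2 t \<omega> = Y2 t \<omega>"
    "(\<lambda>x. Yh2 (snd x) (fst x)) \<in> borel_measurable (M \<Otimes>\<^sub>M lborel)"
    and Ys2: "Ys2 \<in> borel_measurable M" "integrable M (\<lambda>\<omega>. (Ys2 \<omega>)\<^sup>2)" "AE \<omega> in M. \<forall>t\<in>{0..T}. \<bar>Yh2 t \<omega>\<bar> \<le> Ys2 \<omega>"
    and inc2: "fw.ito_increments Zh2 (\<lambda>s r \<omega>. J2 s \<omega> - J2 r \<omega>)"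
    "bw.ito_increments (\<lambda>u \<omega>. indicator {0..T} u *\<^sub>R g \<omega> u (Yh2 u \<omega>) (Zh2 u \<omega>)) (\<lambda>s r \<omega>. I2 s \<omega> - I2 r \<omega>)"
    and fi2: "AE \<omega> in M. ivl_integrable (\<lambda>u. f2 \<omega> u (Yh2 u \<omega>) (Zh2 u \<omega>)) 0 T"
    and eq2: "\<And>s r. 0 \<le> s \<Longrightarrow> s \<le> r \<Longrightarrow> r \<le> T \<Longrightarrow> AE \<omega> in M. Yh2 s \<omega> - Yh2 r \<omega> =
       ivl_integral (\<lambda>u. f2 \<omega> u (Yh2 u \<omega>) (Zh2 u \<omega>)) s r + (I2 s \<omega> - I2 r \<omega>) + (K2 r \<omega> - K2 s \<omega>) - (J2 s \<omega> - J2 r \<omega>)"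
    and end2: "AE \<omega> in M. Yh2 T \<omega> = \<xi>2 \<omega>"
  proof (rule solution_data[OF jf(4) g0 gL C0 sol(2) Zh2_def], goal_cases)
    case (1 Yh Ys I J)
    show ?case by (rule that[of Yh Ys J I]) (fact 1)+
  qed
  have Zhm: "(\<lambda>x. Zh1 (snd x) (fst x)) \<in> borel_measurable (M \<Otimes>\<^sub>M lborel)" "(\<lambda>x. Zh2 (snd x) (fst x)) \<in> borel_measurable (M \<Otimes>\<^sub>M lborel)"
    using inc1(1) inc2(1) by (simp_all add: fw.ito_increments_def)
  have K1: "\<And>t. t \<in> {0..T} \<Longrightarrow> K1 t \<in> borel_measurable M" "\<And>t. t \<in> {0..T} \<Longrightarrow> integrable M (\<lambda>\<omega>. (K1 t \<omega>)\<^sup>2)"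
    and S1Y1: "AE \<omega> in M. \<forall>t\<in>{0..T}. S1 t \<omega> \<le> Y1 t \<omega>"
    and K1p: "AE \<omega> in M. continuous_on {0..T} (\<lambda>t. K1 t \<omega>) \<and> mono_on {0..T} (\<lambda>t. K1 t \<omega>) \<and> K1 0 \<omega> = 0 \<and>
        (LINT t:{0..T}|dpath T K1 \<omega>. Y1 t \<omega> - S1 t \<omega>) = 0"
    using sol(1) by (simp_all add: rbdsde_solution_def)
  have K2: "\<And>t. t \<in> {0..T} \<Longrightarrow> K2 t \<in> borel_measurable M" and S2Y2: "AE \<omega> in M. \<forall>t\<in>{0..T}. S2 t \<omega> \<le> Y2 t \<omega>"
    and K2p: "AE \<omega> in M. continuous_on {0..T} (\<lambda>t. K2 t \<omega>) \<and> mono_on {0..T} (\<lambda>t. K2 t \<omega>)"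
    using sol(2) by (auto simp: rbdsde_solution_def elim: eventually_mono)
  have S1c: "AE \<omega> in M. continuous_on {0..T} (\<lambda>t. S1 t \<omega>)" and S2c: "AE \<omega> in M. continuous_on {0..T} (\<lambda>t. S2 t \<omega>)"
    using S by (auto simp: S2_space_def)
  have S12: "AE \<omega> in M. \<forall>t\<in>{0..T}. S1 t \<omega> \<le> S2 t \<omega>" by (rule AE_all_times_le[OF S1c S2c S(3)])
  define X where "X t \<omega> = Yh1 t \<omega> - Yh2 t \<omega>" for t \<omega>
  define eh where "eh u \<omega> = indicator {0..T} u *\<^sub>R e \<omega> u (Yh1 u \<omega>) (Zh1 u \<omega>) - indicator {0..T} u *\<^sub>R e \<omega> u (Yh2 u \<omega>) (Zh2 u \<omega>)" for u \<omega>
  define fh1 where "fh1 u \<omega> = indicator {0..T} u *\<^sub>R f1 \<omega> u (Yh1 u \<omega>) (Zh1 u \<omega>)" for u \<omega>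
  define fh2 where "fh2 u \<omega> = indicator {0..T} u *\<^sub>R f2 \<omega> u (Yh2 u \<omega>) (Zh2 u \<omega>)" for u \<omega>
  define R where "R u \<omega> = eh u \<omega> - (fh1 u \<omega> - fh2 u \<omega>)" for u \<omega>
  define V where "V t \<omega> = K2 t \<omega> + ivl_integral (\<lambda>u. R u \<omega>) 0 t" for t \<omega>
  define H where "H u \<omega> = Zh1 u \<omega> - Zh2 u \<omega>" for u \<omega>
  define G where "G u \<omega> = indicator {0..T} u *\<^sub>R g \<omega> u (Yh1 u \<omega>) (Zh1 u \<omega>) - indicator {0..T} u *\<^sub>R g \<omega> u (Yh2 u \<omega>) (Zh2 u \<omega>)" for u \<omega>
  \<comment> \<open>\<open>rbdsde_difference\<close> has a single constant, which must serve both
    the drift and g.\<close>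
  define C' where "C' = max C Ce"
  have incH: "fw.ito_increments H (\<lambda>s r \<omega>. (J1 s \<omega> - J1 r \<omega>) - (J2 s \<omega> - J2 r \<omega>))"
    unfolding H_def[abs_def] by (rule fw.ito_increments_diff[OF inc1(1) inc2(1)])
  have incG: "bw.ito_increments G (\<lambda>s r \<omega>. (I1 s \<omega> - I1 r \<omega>) - (I2 s \<omega> - I2 r \<omega>))"
    unfolding G_def[abs_def] by (rule bw.ito_increments_diff[OF inc1(2) inc2(2)])
  have ehm[measurable]: "(\<lambda>x. eh (snd x) (fst x)) \<in> borel_measurable (M \<Otimes>\<^sub>M lborel)"
    unfolding eh_def by (intro borel_measurable_diff measurable_field_compose jf T0 Y1(4) Y2(4) Zhm)
  have [measurable]: "(\<lambda>x. fh1 (snd x) (fst x)) \<in> borel_measurable (M \<Otimes>\<^sub>M lborel)" "(\<lambda>x. fh2 (snd x) (fst x)) \<in> borel_measurable (M \<Otimes>\<^sub>M lborel)"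
    unfolding fh1_def fh2_def by (intro measurable_field_compose jf T0 Y1(4) Y2(4) Zhm)+
  have Rm: "(\<lambda>x. R (snd x) (fst x)) \<in> borel_measurable (M \<Otimes>\<^sub>M lborel)" unfolding R_def by measurable
  have eh_le: "AE \<omega> in M. AE u in lborel. u \<in> {0<..T} \<longrightarrow> \<bar>eh u \<omega>\<bar> \<le> C' * (\<bar>X u \<omega>\<bar> + norm (H u \<omega>))"
    using eL
  proof eventually_elim
    case (elim \<omega>)
    show ?case
    proof (intro AE_I2 impI)
      fix u assume "u \<in> {0<..T}"
      then have u: "u \<in> {0..T}" by auto
      then have "\<bar>eh u \<omega>\<bar> \<le> Ce * (\<bar>X u \<omega>\<bar> + norm (H u \<omega>))" using elim by (simp add: eh_def X_def H_def)
      also have "\<dots> \<le> C' * (\<bar>X u \<omega>\<bar> + norm (H u \<omega>))" by (intro mult_right_mono) (auto simp: C'_def)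
      finally show "\<bar>eh u \<omega>\<bar> \<le> C' * (\<bar>X u \<omega>\<bar> + norm (H u \<omega>))" .
    qed
  qed
  have G_le: "AE \<omega> in M. AE u in lborel. u \<in> {0<..T} \<longrightarrow> (norm (G u \<omega>))\<^sup>2 \<le> C' * (X u \<omega>)\<^sup>2 + \<alpha> * (norm (H u \<omega>))\<^sup>2"
    using gL
  proof eventually_elim
    case (elim \<omega>)
    show ?case
    proof (intro AE_I2 impI)
      fix u assume "u \<in> {0<..T}"
      then have u: "u \<in> {0..T}" by auto
      have "(norm (g \<omega> u (Yh1 u \<omega>) (Zh1 u \<omega>) - g \<omega> u (Yh2 u \<omega>) (Zh2 u \<omega>)))\<^sup>2 \<le> C * \<bar>Yh1 u \<omega> - Yh2 u \<omega>\<bar>\<^sup>2 + \<alpha> * (norm (Zh1 u \<omega> - Zh2 u \<omega>))\<^sup>2"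
        using elim u by blast
      then have "(norm (G u \<omega>))\<^sup>2 \<le> C * (X u \<omega>)\<^sup>2 + \<alpha> * (norm (H u \<omega>))\<^sup>2" using u by (simp add: G_def X_def H_def)
      also have "\<dots> \<le> C' * (X u \<omega>)\<^sup>2 + \<alpha> * (norm (H u \<omega>))\<^sup>2" by (intro add_right_mono mult_right_mono) (auto simp: C'_def)
      finally show "(norm (G u \<omega>))\<^sup>2 \<le> C' * (X u \<omega>)\<^sup>2 + \<alpha> * (norm (H u \<omega>))\<^sup>2" .
    qed
  qed
  have Hm: "(\<lambda>x. H (snd x) (fst x)) \<in> borel_measurable (M \<Otimes>\<^sub>M lborel)" using incH by (simp add: fw.ito_increments_def)
  \<comment> \<open>Along a path X is bounded, and norm H is at most 1 plus its square, whose time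
    integral is finite.\<close>
  have eh_int: "AE \<omega> in M. ivl_integrable (\<lambda>u. eh u \<omega>) 0 T"
    using eh_le fw.ito_incrementsD(5)[OF incH order_refl T0 order_refl] Ys1(3) Ys2(3) AE_space
  proof eventually_elim
    case (elim \<omega>)
    have [measurable]: "(\<lambda>u. eh u \<omega>) \<in> borel_measurable borel"
      using measurable_compose_Pair1[OF elim(5) ehm] by simp
    show ?case
    proof (rule Bochner_Integration.integrable_bound)
      have "integrable lborel (\<lambda>u. indicator {0<..T} u * 1 :: real)" using T0 by simp
      then show "integrable lborel (\<lambda>u. C' * (Ys1 \<omega> + Ys2 \<omega> + 1) * (indicator {0<..T} u * 1) + C' * (indicator {0<..T} u * (norm (H u \<omega>))\<^sup>2))"
        using elim(2) by (intro Bochner_Integration.integrable_add integrable_mult_right) auto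
      show "AE u in lborel. norm (indicator {0<..T} u * eh u \<omega>) \<le> norm (C' * (Ys1 \<omega> + Ys2 \<omega> + 1) * (indicator {0<..T} u * 1) + C' * (indicator {0<..T} u * (norm (H u \<omega>))\<^sup>2))"
        using elim(1)
      proof eventually_elim
        case (elim u)
        show ?case
        proof (cases "u \<in> {0<..T}")
          case True
          then have u: "u \<in> {0..T}" by auto
          have "\<bar>X u \<omega>\<bar> \<le> Ys1 \<omega> + Ys2 \<omega>"
            using bspec[OF \<open>\<forall>t\<in>{0..T}. \<bar>Yh1 t \<omega>\<bar> \<le> Ys1 \<omega>\<close> u] bspec[OF \<open>\<forall>t\<in>{0..T}. \<bar>Yh2 t \<omega>\<bar> \<le> Ys2 \<omega>\<close> u] by (simp add: X_def)
          moreover have "norm (H u \<omega>) \<le> 1 + (norm (H u \<omega>))\<^sup>2"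
            using zero_le_power2[of "norm (H u \<omega>) - 1 / 2"] by (simp add: power2_eq_square algebra_simps)
          ultimately have "C' * (\<bar>X u \<omega>\<bar> + norm (H u \<omega>)) \<le> C' * ((Ys1 \<omega> + Ys2 \<omega> + 1) + (norm (H u \<omega>))\<^sup>2)"
            using C(1) by (intro mult_left_mono) (auto simp: C'_def)
          with elim True show ?thesis by (simp add: algebra_simps)
        qed simp
      qed
    qed measurable
  qed
  have R_int: "AE \<omega> in M. ivl_integrable (\<lambda>u. R u \<omega>) 0 T \<and> ivl_integrable (\<lambda>u. fh1 u \<omega>) 0 T \<and> ivl_integrable (\<lambda>u. fh2 u \<omega>) 0 T"
    using eh_int fi1 fi2
  proof eventually_elim
    case (elim \<omega>)
    have i: "ivl_integrable (\<lambda>u. fh1 u \<omega>) 0 T" "ivl_integrable (\<lambda>u. fh2 u \<omega>) 0 T"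
    proof -
      have "(\<lambda>u. indicator {0<..T} u * fh1 u \<omega>) = (\<lambda>u. indicator {0<..T} u * f1 \<omega> u (Yh1 u \<omega>) (Zh1 u \<omega>))"
        "(\<lambda>u. indicator {0<..T} u * fh2 u \<omega>) = (\<lambda>u. indicator {0<..T} u * f2 \<omega> u (Yh2 u \<omega>) (Zh2 u \<omega>))"
        by (auto simp: fun_eq_iff indicator_def fh1_def fh2_def)
      then show "ivl_integrable (\<lambda>u. fh1 u \<omega>) 0 T" "ivl_integrable (\<lambda>u. fh2 u \<omega>) 0 T" using elim(2,3) by simp_all
    qed
    have "integrable lborel (\<lambda>u. indicator {0<..T} u * eh u \<omega> - (indicator {0<..T} u * fh1 u \<omega> - indicator {0<..T} u * fh2 u \<omega>))"
      using elim(1) i by auto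
    then show ?case using i by (simp add: R_def right_diff_distrib)
  qed
  have R_nonneg: "AE \<omega> in M. AE u in lborel. u \<in> {0<..T} \<longrightarrow> 0 \<le> R u \<omega>"
    using drift Y1(3) Y2(3)
  proof eventually_elim
    case (elim \<omega>)
    from elim(1) show ?case
    proof eventually_elim
      case (elim u)
      then show ?case
        using \<open>\<forall>t\<in>{0..T}. Yh1 t \<omega> = Y1 t \<omega>\<close> \<open>\<forall>t\<in>{0..T}. Yh2 t \<omega> = Y2 t \<omega>\<close>
        by (auto simp: R_def eh_def fh1_def fh2_def Zh1_def Zh2_def)
    qed
  qed
  have core: "rbdsde_difference M T (3 * (real CARD('d))\<^sup>2) (\<lambda>s t. Gt M T W B s) W (3 * (real CARD('l))\<^sup>2) (\<lambda>s t. Ht M T W B t) B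
     X K1 V eh H G (\<lambda>s r \<omega>. (J1 s \<omega> - J1 r \<omega>) - (J2 s \<omega> - J2 r \<omega>)) (\<lambda>s r \<omega>. (I1 s \<omega> - I1 r \<omega>) - (I2 s \<omega> - I2 r \<omega>)) C' \<alpha>
     (\<lambda>\<omega>. Ys1 \<omega> + Ys2 \<omega>)"
  proof (intro rbdsde_difference.intro rbdsde_difference_axioms.intro fw.simple_integration_axioms bw.simple_integration_axioms)
    show "0 \<le> T" "0 \<le> \<alpha>" "\<alpha> < 1" "0 \<le> C'" using T0 C by (auto simp: C'_def)
    show "X s \<in> borel_measurable (Gt M T W B s)" if "0 \<le> s" "s \<le> r" "r \<le> T" for s r
      unfolding X_def[abs_def] using Y1(1)[of s] Y2(1)[of s] that
      by (intro borel_measurable_diff measurable_from_subalg[OF Ft_Gt]) auto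
    show "X r \<in> borel_measurable (Ht M T W B r)" if "0 \<le> s" "s \<le> r" "r \<le> T" for s r
      unfolding X_def[abs_def] using Y1(1)[of r] Y2(1)[of r] that
      by (intro borel_measurable_diff measurable_from_subalg[OF Ft_Ht]) auto
    show "AE \<omega> in M. continuous_on {0..T} (\<lambda>t. X t \<omega>)"
      unfolding X_def by (intro AE_I2 continuous_on_diff Y1(2) Y2(2))
    show "(\<lambda>\<omega>. Ys1 \<omega> + Ys2 \<omega>) \<in> borel_measurable M" using Ys1 Ys2 by auto
    show "integrable M (\<lambda>\<omega>. (Ys1 \<omega> + Ys2 \<omega>)\<^sup>2)" by (intro integrable_square_add Ys1 Ys2)
    show "AE \<omega> in M. \<forall>t\<in>{0..T}. \<bar>X t \<omega>\<bar> \<le> Ys1 \<omega> + Ys2 \<omega>"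
      using Ys1(3) Ys2(3) 
    proof eventually_elim
      case (elim \<omega>)
      show ?case
      proof
        fix t assume t: "t \<in> {0..T}"
        show "\<bar>X t \<omega>\<bar> \<le> Ys1 \<omega> + Ys2 \<omega>" using bspec[OF elim(1) t] bspec[OF elim(2) t] by (simp add: X_def)
      qed
    qed
    show "AE \<omega> in M. \<forall>s r. 0 \<le> s \<longrightarrow> s \<le> r \<longrightarrow> r \<le> T \<longrightarrow> K1 s \<omega> < K1 r \<omega> \<longrightarrow> (\<exists>u\<in>{s..r}. X u \<omega> \<le> 0)"
      using K1p S1Y1 S1c S12 S2Y2 Y1(3) Y2(3) AE_space
    proof eventually_elim
      case (elim \<omega>)
      have Yc: "continuous_on {0..T} (\<lambda>t. Y1 t \<omega>)"
        by (rule continuous_on_eq[OF Y1(2)[OF elim(8)]]) (use elim(6) in auto)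
      show ?case
      proof (intro allI impI)
        fix s r assume sr: "0 \<le> s" "s \<le> r" "r \<le> T" "K1 s \<omega> < K1 r \<omega>"
        have "\<exists>u\<in>{s..r}. Y1 u \<omega> - S1 u \<omega> = 0"
          using elim(1,2) 
          by (intro dpath_flat[where K=K1 and \<omega>=\<omega> and D="\<lambda>u. Y1 u \<omega> - S1 u \<omega>", OF T0 _ _ continuous_on_diff[OF Yc elim(3)] _ _ sr]) auto
        then obtain u where u: "u \<in> {s..r}" "Y1 u \<omega> = S1 u \<omega>" by auto
        then have uT: "u \<in> {0..T}" using sr by auto
        have "X u \<omega> \<le> 0"
          using bspec[OF elim(4) uT] bspec[OF elim(5) uT] bspec[OF elim(6) uT] bspec[OF elim(7) uT] u(2) by (simp add: X_def)
        then show "\<exists>u\<in>{s..r}. X u \<omega> \<le> 0" using u(1) by blast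
      qed
    qed
    show "AE \<omega> in M. continuous_on {0..T} (\<lambda>t. K1 t \<omega>)" "AE \<omega> in M. mono_on {0..T} (\<lambda>t. K1 t \<omega>)"
      using K1p by (auto elim: eventually_mono)
    show "integrable M (\<lambda>\<omega>. (K1 T \<omega> - K1 0 \<omega>)\<^sup>2)" by (intro integrable_square_diff K1) (use T0 in auto)
    show "K1 t \<in> borel_measurable M" if "0 \<le> t" "t \<le> T" for t using K1 that by auto
    show "V t \<in> borel_measurable M" if t: "0 \<le> t" "t \<le> T" for t
    proof -
      note [measurable] = Rm
      have "case_prod (\<lambda>\<omega> u. indicator {0<..t} u * R u \<omega>) \<in> borel_measurable (M \<Otimes>\<^sub>M lborel)" unfolding split_beta' by measurable
      then have "(\<lambda>\<omega>. ivl_integral (\<lambda>u. R u \<omega>) 0 t) \<in> borel_measurable M"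
        unfolding ivl_integral_def by (rule lborel.borel_measurable_lebesgue_integral)
      then show ?thesis unfolding V_def[abs_def] using K2[of t] t by auto
    qed
    show "AE \<omega> in M. continuous_on {0..T} (\<lambda>t. V t \<omega>)"
      using K2p R_int unfolding V_def by eventually_elim (intro continuous_on_add continuous_on_ivl_integral; simp)
    show "AE \<omega> in M. mono_on {0..T} (\<lambda>t. V t \<omega>)"
      using K2p R_int R_nonneg
    proof eventually_elim
      case (elim \<omega>)
      show ?case
      proof (rule mono_onI)
        fix s r assume sr: "s \<in> {0..T}" "r \<in> {0..T}" "s \<le> r"
        have "ivl_integral (\<lambda>u. R u \<omega>) 0 r = ivl_integral (\<lambda>u. R u \<omega>) 0 s + ivl_integral (\<lambda>u. R u \<omega>) s r"
          by (rule ivl_integral_split[OF ivl_integrable_subset[OF conjunct1[OF elim(2)]]]) (use sr in auto)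
        moreover have "0 \<le> ivl_integral (\<lambda>u. R u \<omega>) s r"
          by (rule ivl_integral_nonneg, use elim(3) in eventually_elim) (use sr in auto)
        moreover have "K2 s \<omega> \<le> K2 r \<omega>" by (rule mono_onD[OF conjunct2[OF elim(1)] sr])
        ultimately show "V s \<omega> \<le> V r \<omega>" by (simp add: V_def)
      qed
    qed
    show "AE \<omega> in M. X s \<omega> - X r \<omega> = ivl_integral (\<lambda>u. eh u \<omega>) s r + (K1 r \<omega> - K1 s \<omega>) - (V r \<omega> - V s \<omega>)
        + ((I1 s \<omega> - I1 r \<omega>) - (I2 s \<omega> - I2 r \<omega>)) - ((J1 s \<omega> - J1 r \<omega>) - (J2 s \<omega> - J2 r \<omega>))" if sr: "0 \<le> s" "s \<le> r" "r \<le> T" for s r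
      using eq1[OF sr] eq2[OF sr] R_int
    proof eventually_elim
      case (elim \<omega>)
      \<comment> \<open>The original drift difference fh1 - fh2 is eh - R, and the integral of R
        over {s..r} is the increment of the second part of \<open>V\<close>.\<close>
      have spl: "ivl_integral (\<lambda>u. R u \<omega>) 0 r = ivl_integral (\<lambda>u. R u \<omega>) 0 s + ivl_integral (\<lambda>u. R u \<omega>) s r"
        by (rule ivl_integral_split[OF ivl_integrable_subset[OF conjunct1[OF elim(3)]]]) (use sr in auto)
      have c: "ivl_integral (\<lambda>u. f1 \<omega> u (Yh1 u \<omega>) (Zh1 u \<omega>)) s r = ivl_integral (\<lambda>u. fh1 u \<omega>) s r"
        "ivl_integral (\<lambda>u. f2 \<omega> u (Yh2 u \<omega>) (Zh2 u \<omega>)) s r = ivl_integral (\<lambda>u. fh2 u \<omega>) s r"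
        unfolding ivl_integral_def fh1_def fh2_def
        by (rule Bochner_Integration.integral_cong; use sr in \<open>auto simp: indicator_def\<close>)+
      have i: "ivl_integrable (\<lambda>u. R u \<omega>) s r" "ivl_integrable (\<lambda>u. fh1 u \<omega>) s r" "ivl_integrable (\<lambda>u. fh2 u \<omega>) s r"
        using elim(3) sr by (auto intro: ivl_integrable_subset[where t=0 and r=T])
      have "ivl_integral (\<lambda>u. eh u \<omega>) s r = (\<integral>u. indicator {s<..r} u * R u \<omega> + (indicator {s<..r} u * fh1 u \<omega> - indicator {s<..r} u * fh2 u \<omega>) \<partial>lborel)"
        unfolding ivl_integral_def by (rule Bochner_Integration.integral_cong) (auto simp: R_def algebra_simps)
      also have "\<dots> = ivl_integral (\<lambda>u. R u \<omega>) s r + (ivl_integral (\<lambda>u. fh1 u \<omega>) s r - ivl_integral (\<lambda>u. fh2 u \<omega>) s r)"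
        using i by (simp add: ivl_integral_def)
      finally show ?case using elim(1,2) spl c by (simp add: X_def V_def)
    qed
  qed (fact incH incG ehm eh_int eh_le G_le)+
  have "AE \<omega> in M. X T \<omega> \<le> 0" using end1 end2 \<xi> by eventually_elim (simp add: X_def)
  from rbdsde_difference.nonpositive[OF core this]
  have X: "AE \<omega> in M. X t \<omega> \<le> 0" if "t \<in> {0..T}" for t using that by auto
  show ?thesis
  proof
    fix t assume t: "t \<in> {0..T}"
    from X[OF t] Y1(3) Y2(3) show "AE \<omega> in M. Y1 t \<omega> \<le> Y2 t \<omega>"
      by eventually_elim (use t in \<open>auto simp: X_def\<close>)
  qed
qed

end

theorem theorem3p2:
  fixes M :: "'w measure" and T C \<alpha> :: real
    and W :: "real \<Rightarrow> 'w \<Rightarrow> real ^ 'd" and B :: "real \<Rightarrow> 'w \<Rightarrow> real ^ 'l"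
    and f1 f2 :: "'w \<Rightarrow> real \<Rightarrow> real \<Rightarrow> real ^ 'd \<Rightarrow> real"
    and g :: "'w \<Rightarrow> real \<Rightarrow> real \<Rightarrow> real ^ 'd \<Rightarrow> real ^ 'l"
    and \<xi>1 \<xi>2 :: "'w \<Rightarrow> real"
    and S1 S2 Y1 Y2 K1 K2 :: "real \<Rightarrow> 'w \<Rightarrow> real"
    and Z1 Z2 :: "real \<Rightarrow> 'w \<Rightarrow> real ^ 'd"
  assumes "prob_space M" and "T > 0" and "BM_pair M T W B"
    and "jointly_measurable M T f1" and "jointly_measurable M T f2" and "jointly_measurable M T g"
    and "\<And>t y z. t \<in> {0..T} \<Longrightarrow> (\<lambda>\<omega>. g \<omega> t y z) \<in> borel_measurable (Ft M T W B t)"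
    and "\<xi>1 \<in> borel_measurable (Ft M T W B T)" and "integrable M (\<lambda>\<omega>. (\<xi>1 \<omega>)\<^sup>2)"
    and "\<xi>2 \<in> borel_measurable (Ft M T W B T)" and "integrable M (\<lambda>\<omega>. (\<xi>2 \<omega>)\<^sup>2)"
    and "S1 \<in> S2_space M T W B" and "S2 \<in> S2_space M T W B"
    and "AE \<omega> in M. S1 T \<omega> \<le> \<xi>1 \<omega>" and "AE \<omega> in M. S2 T \<omega> \<le> \<xi>2 \<omega>"
    and "AE \<omega> in M. \<forall>t\<in>{0..T}. g \<omega> t 0 0 = 0"
    and "C > 0" and "0 < \<alpha>" and "\<alpha> < 1"
    and "AE \<omega> in M. \<forall>t\<in>{0..T}. \<forall>y1 y2 z1 z2.
           (norm (g \<omega> t y1 z1 - g \<omega> t y2 z2))\<^sup>2 \<le> C * \<bar>y1 - y2\<bar>\<^sup>2 + \<alpha> * (norm (z1 - z2))\<^sup>2"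
    and "rbdsde_solution M T W B f1 g \<xi>1 S1 Y1 Z1 K1"
    and "rbdsde_solution M T W B f2 g \<xi>2 S2 Y2 Z2 K2"
    and "AE \<omega> in M. \<xi>1 \<omega> \<le> \<xi>2 \<omega>"
    and "\<forall>t\<in>{0..T}. AE \<omega> in M. S1 t \<omega> \<le> S2 t \<omega>"
    and "(lipschitz_L M T W B f1 \<and>
           (AE t in lborel. t \<in> {0..T} \<longrightarrow>
              (AE \<omega> in M. f1 \<omega> t (Y2 t \<omega>) (Z2 t \<omega>) \<le> f2 \<omega> t (Y2 t \<omega>) (Z2 t \<omega>)))) \<or>
         (lipschitz_L M T W B f2 \<and>
           (AE t in lborel. t \<in> {0..T} \<longrightarrow>
              (AE \<omega> in M. f1 \<omega> t (Y1 t \<omega>) (Z1 t \<omega>) \<le> f2 \<omega> t (Y1 t \<omega>) (Z1 t \<omega>))))"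
  shows "\<forall>t\<in>{0..T}. AE \<omega> in M. Y1 t \<omega> \<le> Y2 t \<omega>"
proof -
  interpret prob_space M by fact
  interpret BM_pair_space M T W B
    by unfold_locales fact+
  have Y1: "Y1 \<in> S2_space M T W B" "Z1 \<in> M2_space M T W B" and Y2: "Y2 \<in> S2_space M T W B" "Z2 \<in> M2_space M T W B"
    using assms(21,22) by (simp_all add: rbdsde_solution_def)
  note comp = comparison[OF assms(4,5) _ assms(6,12,13,24,16-23)]
  from assms(25) show ?thesis
  proof
    assume L: "lipschitz_L M T W B f1 \<and> (AE t in lborel. t \<in> {0..T} \<longrightarrow>
              (AE \<omega> in M. f1 \<omega> t (Y2 t \<omega>) (Z2 t \<omega>) \<le> f2 \<omega> t (Y2 t \<omega>) (Z2 t \<omega>)))"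
    then obtain Ce where Ce: "0 < Ce" "AE \<omega> in M. \<forall>t\<in>{0..T}. \<forall>y1 y2 z1 z2.
        \<bar>f1 \<omega> t y1 z1 - f1 \<omega> t y2 z2\<bar> \<le> Ce * (\<bar>y1 - y2\<bar> + norm (z1 - z2))"
      by (auto simp: lipschitz_L_def)
    have le: "AE \<omega> in M. AE t in lborel. t \<in> {0..T} \<longrightarrow> f1 \<omega> t (Y2 t \<omega>) (Z2 t \<omega>) \<le> f2 \<omega> t (Y2 t \<omega>) (Z2 t \<omega>)"
      by (rule AE_time_outcome_swap[OF assms(4,5) Y2 conjunct2[OF L]])
    show ?thesis
    proof (rule comp[OF assms(4) Ce])
      \<comment> \<open>The terms at (Y1, Z1) cancel, leaving the assumed inequality at (Y2,
        Z2).\<close>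
      show "AE \<omega> in M. AE t in lborel. t \<in> {0..T} \<longrightarrow>
        f1 \<omega> t (Y1 t \<omega>) (Z1 t \<omega>) - f2 \<omega> t (Y2 t \<omega>) (Z2 t \<omega>) \<le> f1 \<omega> t (Y1 t \<omega>) (Z1 t \<omega>) - f1 \<omega> t (Y2 t \<omega>) (Z2 t \<omega>)"
        using le by eventually_elim (auto elim: eventually_mono)
    qed
  next
    assume L: "lipschitz_L M T W B f2 \<and> (AE t in lborel. t \<in> {0..T} \<longrightarrow>
              (AE \<omega> in M. f1 \<omega> t (Y1 t \<omega>) (Z1 t \<omega>) \<le> f2 \<omega> t (Y1 t \<omega>) (Z1 t \<omega>)))"
    then obtain Ce where Ce: "0 < Ce" "AE \<omega> in M. \<forall>t\<in>{0..T}. \<forall>y1 y2 z1 z2.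
        \<bar>f2 \<omega> t y1 z1 - f2 \<omega> t y2 z2\<bar> \<le> Ce * (\<bar>y1 - y2\<bar> + norm (z1 - z2))"
      by (auto simp: lipschitz_L_def)
    have le: "AE \<omega> in M. AE t in lborel. t \<in> {0..T} \<longrightarrow> f1 \<omega> t (Y1 t \<omega>) (Z1 t \<omega>) \<le> f2 \<omega> t (Y1 t \<omega>) (Z1 t \<omega>)"
      by (rule AE_time_outcome_swap[OF assms(4,5) Y1 conjunct2[OF L]])
    show ?thesis
    proof (rule comp[OF assms(5) Ce])
      \<comment> \<open>Here the terms at (Y2, Z2) cancel, leaving the assumed inequality at (Y1,
        Z1).\<close>
      show "AE \<omega> in M. AE t in lborel. t \<in> {0..T} \<longrightarrow>
        f1 \<omega> t (Y1 t \<omega>) (Z1 t \<omega>) - f2 \<omega> t (Y2 t \<omega>) (Z2 t \<omega>) \<le> f2 \<omega> t (Y1 t \<omega>) (Z1 t \<omega>) - f2 \<omega> t (Y2 t \<omega>) (Z2 t \<omega>)"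
        using le by eventually_elim (auto elim: eventually_mono)
    qed
  qed
qed

end
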